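(* Let $n\ge 2$ be an even integer, $\lambda$ a positive even integer, $c>0$, $m=1+\frac{\lambda}{2}$, and let $h:\mathbb{R}^n\to\mathbb{R}$ be the shifted surface spline $$h(x)=(-1)^m(|x|^2+c^2)^{\lambda/2}\log\big((|x|^2+c^2)^{1/2}\big).$$ Let $l(\lambda,n)$, $\alpha_n$, $\gamma_n$, $\rho$, $\Delta_0$, the space $\mathcal{C}_{h,m}$, its semi-norm $\|\cdot\|_h$, and the notion of $h$ spline interpolant be as defined in the context. Given a positive number $b_0$, put $$\rho'=\frac{\rho}{c},\qquad C=\max\left\{2\rho'\sqrt{n}\,e^{2n\gamma_n},\ \frac{2}{3b_0}\right\},\qquad \delta_0=\frac{1}{3C\gamma_n(m+1)},\qquad \omega=\left(\frac{2}{3}\right)^{\frac{1}{3C\gamma_n}},$$ so that $\delta_0>0$ and $0<\omega<1$. Then the following is true: if $f\in\mathcal{C}_{h,m}$ and $s$ is the $h$ spline that interpolates $f$ on a subset $X$ of $\mathbb{R}^n$, then $$|f(x)-s(x)|\le \sqrt{l(\lambda,n)}\cdot\left(\frac{\pi}{2}\right)^{1/4}\cdot\sqrt{n\,\alpha_n}\cdot c^{\lambda/2}\cdot\sqrt{\Delta_0}\cdot\omega^{1/\delta}\cdot\|f\|_h$$ holds for all $x$ in a cube $E\subset\mathbb{R}^n$, provided that (a) $E$ has side $b$ and $b\ge b_0$; (b) $0<\delta\le\delta_0$; and (c) every subcube of $E$ of side $\delta$ contains a point of $X$.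
   Context: Notation. $|x|$ is the Euclidean norm; $P_{m-1}$ is the space of polynomials on $\mathbb{R}^n$ of degree $\le m-1$; $\alpha_n$ is the volume of the unit ball in $\mathbb{R}^n$; $\lceil t\rceil$ is the smallest integer $\ge t$. The numbers $\gamma_n$ are defined by $\gamma_1=2$ and $\gamma_n=2n(1+\gamma_{n-1})$ for $n>1$. Function space. $\mathcal{D}$ is the space of complex-valued, compactly supported, infinitely differentiable functions on $\mathbb{R}^n$, with Fourier transform $\hat\phi(\xi)=\int e^{-i\langle x,\xi\rangle}\phi(x)\,dx$, and $\mathcal{D}_m=\{\phi\in\mathcal{D}:\int x^\alpha\phi(x)\,dx=0 \text{ for all } |\alpha|<m\}$. The function $h$ is conditionally positive definite of order $m$. $\mathcal{C}_{h,m}$ is the class of continuous functions $f$ on $\mathbb{R}^n$ for which there is a constant $c(f)$ with $$\left|\int f(x)\phi(x)\,dx\right|\le c(f)\left\{\iint h(x-y)\phi(x)\overline{\phi(y)}\,dx\,dy\right\}^{1/2}\quad\text{for all }\phi\in\mathcal{D}_m,$$ and $\|f\|_h$ denotes the smallest such constant $c(f)$. Interpolant. For a finite set $X=\{x_1,\dots,x_N\}\subset\mathbb{R}^n$, the $h$ spline interpolating $f$ on $X$ is the function $s(x)=p(x)+\sum_{j=1}^N c_jh(x-x_j)$ with $p\in P_{m-1}$ and coefficients $c_j$ such that $\sum_{j=1}^N c_jq(x_j)=0$ for all $q\in P_{m-1}$ and $s(x_i)=f(x_i)$ for $i=1,\dots,N$. (It is uniquely determined when $X$ is a determining set for $P_{m-1}$,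 i.e. when the only $p\in P_{m-1}$ vanishing on $X$ is $0$.) The constant $l(\lambda,n)$. It is the positive constant, depending on $\lambda$ and $n$, in the formula for the (generalized) Fourier transform of $h$ (away from the origin): $$\hat h(\theta)=l(\lambda,n)\,|\theta|^{-\lambda-n}\,\tilde{\mathcal K}_{\frac{n+\lambda}{2}}(c|\theta|),\qquad \tilde{\mathcal K}_\nu(t)=t^\nu\mathcal{K}_\nu(t),$$ where $\mathcal{K}_\nu$ is the modified Bessel function of the second kind. The constants $\rho$ and $\Delta_0$. (a) If $n-\lambda>3$, let $s_0=\lceil\frac{n-\lambda-3}{2}\rceil$; then $\rho=1+\frac{s_0}{2m+3}$ and $\Delta_0=\dfrac{(2m+2+s_0)(2m+1+s_0)\cdots(2m+3)}{\rho^{2m+2}}$. (b) If $n-\lambda\le 1$, let $s_0=-\lceil\frac{n-\lambda-3}{2}\rceil$; then $\rho=1$ and $\Delta_0=\dfrac{1}{(2m+2)(2m+1)\cdots(2m-s_0+3)}$. (c) If $1<n-\lambda\le 3$, then $\rho=1$ and $\Delta_0=1$. *)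

theory Defs
  imports "HOL-Analysis.Analysis"
begin

section \<open>Test functions\<close>

text \<open>\<open>C\<^sup>k\<close> on the whole space; as in the AFP entry Smooth Manifolds, the derivative of \<open>f\<close> is
  differentiated again direction by direction.\<close>

primrec C_k :: "nat \<Rightarrow> ('a::euclidean_space \<Rightarrow> complex) \<Rightarrow> bool" where
  "C_k 0 f \<longleftrightarrow> continuous_on UNIV f"
| "C_k (Suc k) f \<longleftrightarrow>
     (\<forall>x. f differentiable (at x)) \<and> (\<forall>v. C_k k (\<lambda>x. frechet_derivative f (at x) v))"

definition test_functions :: "('a::euclidean_space \<Rightarrow> complex) set" where
  "test_functions = {\<phi>. (\<forall>k. C_k k \<phi>) \<and> compact (closure {x. \<phi> x \<noteq> 0})}"

definition fourier :: "('a::euclidean_space \<Rightarrow> complex) \<Rightarrow> 'a \<Rightarrow> complex" where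
  "fourier \<phi> \<xi> = (LINT x|lborel. exp (- \<i> * complex_of_real (x \<bullet> \<xi>)) * \<phi> x)"

text \<open>Multi-indices are functions \<open>'n \<Rightarrow> nat\<close>.\<close>

definition multi_degree :: "('n::finite \<Rightarrow> nat) \<Rightarrow> nat" where
  "multi_degree \<alpha> = (\<Sum>i\<in>UNIV. \<alpha> i)"

definition monomial :: "('n::finite \<Rightarrow> nat) \<Rightarrow> real ^ 'n \<Rightarrow> real" where
  "monomial \<alpha> x = (\<Prod>i\<in>UNIV. (x $ i) ^ \<alpha> i)"

definition test_functions_vanishing :: "nat \<Rightarrow> (real ^ 'n::finite \<Rightarrow> complex) set" where
  "test_functions_vanishing m = {\<phi> \<in> test_functions.
     \<forall>\<alpha>. multi_degree \<alpha> < m \<longrightarrow> (LINT x|lborel. complex_of_real (monomial \<alpha> x) * \<phi> x) = 0}"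


section \<open>The function space and its semi-norm\<close>

text \<open>The double integral is real and non-negative when \<open>h\<close> is real-valued, even and conditionally
  positive definite of order \<open>m\<close>, so that taking its real part changes nothing.\<close>

definition native_bound ::
    "(real ^ 'n::finite \<Rightarrow> real) \<Rightarrow> nat \<Rightarrow> (real ^ 'n \<Rightarrow> complex) \<Rightarrow> real \<Rightarrow> bool" where
  "native_bound h m f K \<longleftrightarrow> (\<forall>\<phi> \<in> test_functions_vanishing m.
     norm (LINT x|lborel. f x * \<phi> x) \<le>
       K * sqrt (Re (LINT x|lborel. LINT y|lborel. complex_of_real (h (x - y)) * \<phi> x * cnj (\<phi> y))))"

definition native_space ::
    "(real ^ 'n::finite \<Rightarrow> real) \<Rightarrow> nat \<Rightarrow> (real ^ 'n \<Rightarrow> complex) set" where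
  "native_space h m = {f. continuous_on UNIV f \<and> (\<exists>K\<ge>0. native_bound h m f K)}"

text \<open>The condition on \<open>K\<close> is closed, so for \<open>f\<close> in the space the infimum is attained and is the
  smallest admissible constant.\<close>

definition native_seminorm ::
    "(real ^ 'n::finite \<Rightarrow> real) \<Rightarrow> nat \<Rightarrow> (real ^ 'n \<Rightarrow> complex) \<Rightarrow> real" where
  "native_seminorm h m f = Inf {K. 0 \<le> K \<and> native_bound h m f K}"


section \<open>Spline interpolants\<close>

lemma finite_multi_degree_le: "finite {\<alpha>::'n::finite \<Rightarrow> nat. multi_degree \<alpha> \<le> k}"
proof (rule finite_subset)
  have "\<alpha> i \<le> multi_degree \<alpha>" for \<alpha> :: "'n \<Rightarrow> nat" and i
    unfolding multi_degree_def by (rule member_le_sum) auto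
  then show "{\<alpha>::'n \<Rightarrow> nat. multi_degree \<alpha> \<le> k} \<subseteq> PiE UNIV (\<lambda>_. {..k})"
    by (auto simp: PiE_UNIV_domain) (meson le_trans)
  show "finite (PiE (UNIV::'n set) (\<lambda>_. {..k}))"
    by (rule finite_PiE) auto
qed

definition poly_space :: "nat \<Rightarrow> (real ^ 'n::finite \<Rightarrow> complex) set" where
  "poly_space k = {p. \<exists>a. p = (\<lambda>x. \<Sum>\<alpha> | multi_degree \<alpha> \<le> k. a \<alpha> * complex_of_real (monomial \<alpha> x))}"

definition is_h_spline_interpolant ::
    "(real ^ 'n::finite \<Rightarrow> real) \<Rightarrow> nat \<Rightarrow> (real ^ 'n) set \<Rightarrow>
      (real ^ 'n \<Rightarrow> complex) \<Rightarrow> (real ^ 'n \<Rightarrow> complex) \<Rightarrow> bool" where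
  "is_h_spline_interpolant h m X f s \<longleftrightarrow> finite X \<and>
     (\<exists>p \<in> poly_space (m - 1). \<exists>a.
        (\<forall>x. s x = p x + (\<Sum>y\<in>X. a y * complex_of_real (h (x - y)))) \<and>
        (\<forall>q \<in> poly_space (m - 1). (\<Sum>y\<in>X. a y * q y) = 0)) \<and>
     (\<forall>x\<in>X. s x = f x)"


section \<open>The shifted surface spline and its generalized Fourier transform\<close>

definition shifted_surface_spline :: "nat \<Rightarrow> real \<Rightarrow> real ^ 'n::finite \<Rightarrow> real" where
  "shifted_surface_spline lam c x =
     (-1) ^ (1 + lam div 2) * ((norm x)\<^sup>2 + c\<^sup>2) powr (real lam / 2) * ln (sqrt ((norm x)\<^sup>2 + c\<^sup>2))"

text \<open>The modified Bessel function of the second kind, for positive argument.\<close>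

definition Bessel_K :: "real \<Rightarrow> real \<Rightarrow> real" where
  "Bessel_K \<nu> t = (LINT u:{0..}|lborel. exp (- t * cosh u) * cosh (\<nu> * u))"

definition Bessel_K_tilde :: "real \<Rightarrow> real \<Rightarrow> real" where
  "Bessel_K_tilde \<nu> t = t powr \<nu> * Bessel_K \<nu> t"

text \<open>\<open>g\<close> is the generalized (distributional) Fourier transform of \<open>h\<close> on the complement of the
  origin: \<open>\<langle>g, \<phi>\<rangle> = \<langle>h, fourier \<phi>\<rangle>\<close> for all test functions supported away from \<open>0\<close>.\<close>

definition fourier_away_from_origin ::
    "('a::euclidean_space \<Rightarrow> real) \<Rightarrow> ('a \<Rightarrow> real) \<Rightarrow> bool" where
  "fourier_away_from_origin h g \<longleftrightarrow>
     (\<forall>\<phi> \<in> test_functions. 0 \<notin> closure {x. \<phi> x \<noteq> 0} \<longrightarrow>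
        (LINT x|lborel. complex_of_real (h x) * fourier \<phi> x) =
        (LINT \<theta>|lborel. complex_of_real (g \<theta>) * \<phi> \<theta>))"

text \<open>The constant \<open>l(\<lambda>,n)\<close> for \<open>n = CARD('n)\<close>. The same constant serves for every shift \<open>c\<close>.\<close>

definition surface_spline_l :: "'n::finite itself \<Rightarrow> nat \<Rightarrow> real" where
  "surface_spline_l (_ :: 'n itself) lam = (THE l. l > 0 \<and>
     (\<forall>c>0. fourier_away_from_origin (shifted_surface_spline lam c :: real ^ 'n \<Rightarrow> real)
        (\<lambda>\<theta>. l * norm \<theta> powr (- real lam - real CARD('n))
              * Bessel_K_tilde ((real CARD('n) + real lam) / 2) (c * norm \<theta>))))"


section \<open>The numerical constants\<close>

text \<open>The value at \<open>0\<close> is a dummy.\<close>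

fun gamma_seq :: "nat \<Rightarrow> real" where
  "gamma_seq 0 = 0"
| "gamma_seq (Suc 0) = 2"
| "gamma_seq (Suc (Suc n)) = 2 * real (Suc (Suc n)) * (1 + gamma_seq (Suc n))"

definition spline_s0 :: "nat \<Rightarrow> nat \<Rightarrow> int" where
  "spline_s0 n lam =
     (if real n - real lam > 3 then \<lceil>(real n - real lam - 3) / 2\<rceil>
      else - \<lceil>(real n - real lam - 3) / 2\<rceil>)"

definition spline_rho :: "nat \<Rightarrow> nat \<Rightarrow> nat \<Rightarrow> real" where
  "spline_rho n lam m =
     (if real n - real lam > 3 then 1 + real_of_int (spline_s0 n lam) / (2 * real m + 3) else 1)"

text \<open>The products range over integer intervals: \<open>s\<^sub>0\<close> consecutive factors in both cases.\<close>

definition spline_Delta0 :: "nat \<Rightarrow> nat \<Rightarrow> nat \<Rightarrow> real" where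
  "spline_Delta0 n lam m =
     (if real n - real lam > 3 then
        (\<Prod>i \<in> {2 * int m + 3 .. 2 * int m + 2 + spline_s0 n lam}. real_of_int i)
          / spline_rho n lam m ^ (2 * m + 2)
      else if real n - real lam \<le> 1 then
        1 / (\<Prod>i \<in> {2 * int m - spline_s0 n lam + 3 .. 2 * int m + 2}. real_of_int i)
      else 1)"


section \<open>Cubes\<close>

text \<open>The closed cube of side \<open>b\<close> with vertex \<open>a\<close> and orientation given by the orthogonal map \<open>U\<close>;
  two such cubes with the same \<open>U\<close> are parallel.\<close>

definition cube :: "(real ^ 'n \<Rightarrow> real ^ 'n) \<Rightarrow> real ^ 'n::finite \<Rightarrow> real \<Rightarrow> (real ^ 'n) set" where
  "cube U a b = (\<lambda>y. a + U y) ` {y. \<forall>i. 0 \<le> y $ i \<and> y $ i \<le> b}"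

end

theory Submission
  imports Defs
    "HOL-Computational_Algebra.Fundamental_Theorem_Algebra"
    "HOL-Complex_Analysis.Conformal_Mappings"
    "HOL-Probability.Sinc_Integral"
    "HOL-Probability.Characteristic_Functions"
    "HOL-Real_Asymp.Real_Asymp"
begin

text \<open>
Write \<open>\<lambda> = 2 a\<close>, so that \<open>m = a + 1\<close>, and for coefficients \<open>u\<close> on a finite set put
\<open>Q(u) = \<Sum>\<Sum> u\<^sub>z cnj(u\<^sub>w) h(z - w)\<close>. If \<open>u\<close> annihilates \<open>P\<^sub>m\<^sub>-\<^sub>1\<close>, smearing its point masses with a
mollifier gives test functions in \<open>D\<^sub>m\<close>, so that \<open>|\<Sum> u\<^sub>z f(z)| \<le> \<parallel>f\<parallel> sqrt (Q(u))\<close>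
(\<open>native_bound_point_evaluations\<close>). Let \<open>x\<close> be a point of the cube \<open>E\<close> and let
\<open>L = \<delta>\<^sub>x - \<Sum> \<sigma>\<^sub>y \<delta>\<^sub>y\<close> annihilate \<open>P\<^sub>m\<^sub>-\<^sub>1\<close>, where the \<open>y\<close> are points of \<open>X\<close>. Subtracting from \<open>L\<close> a
suitable multiple of the conjugated coefficients of the spline \<open>s\<close> does not increase \<open>Q\<close> and changes
the value at \<open>f\<close> into \<open>f(x) - s(x)\<close>. Hence \<open>|f(x) - s(x)| \<le> \<parallel>f\<parallel> sqrt (Q(L))\<close> for every such choice
of weights \<open>\<sigma>\<close> (\<open>spline_error_functional_bound\<close>). The freedom in \<open>\<sigma>\<close> is used to let \<open>L\<close> annihilate
all polynomials of degree below \<open>\<kappa>\<close>, where \<open>\<kappa>\<close> is of the order \<open>1 / \<delta>\<close>; then \<open>Q(L)\<close> is exponentially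
small in \<open>\<kappa>\<close>.

For the weights, a cube of side \<open>2 \<gamma>\<^sub>n \<kappa> \<delta>\<close> inside \<open>E\<close> and containing \<open>x\<close> consists of \<open>(2 \<gamma>\<^sub>n \<kappa>)\<^sup>n\<close> cells, each with a point of
\<open>X\<close>. Bernstein's inequality along chords, applied to a polynomial times a power of a quadratic weight
that vanishes on the boundary of a ball, shows that these points determine polynomials of degree below \<open>\<kappa>\<close>
with a constant exponential in \<open>\<kappa>\<close> (\<open>norming_mesh\<close>). By duality there are weights that reproduce such
polynomials at \<open>x\<close> and whose sum of absolute values is at most exponential in \<open>\<kappa>\<close>
(\<open>local_polynomial_reproduction\<close>).

As to the quadratic form, up to a polynomial in \<open>s\<close> of degree \<open>a\<close>, the function \<open>(-1)\<^sup>a\<^sup>+\<^sup>1 s\<^sup>a ln s\<close> is the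
mixture of the exponentials \<open>exp (- t s)\<close> with density \<open>a! t\<^sup>-\<^sup>a\<^sup>-\<^sup>1\<close> (\<open>log_kernel_representation\<close>). With
\<open>s = |z - w|\<^sup>2 + c\<^sup>2\<close> this makes \<open>Q\<close> an integral of Gaussian forms, which are weighted square norms of the
exponential sum \<open>\<Sum> u\<^sub>z exp (- i \<langle>\<xi>, z\<rangle>)\<close>. If \<open>u\<close> annihilates polynomials of degree below \<open>\<kappa>\<close> and sits
within distance \<open>D\<close> of a point, that sum is of the order \<open>(D |\<xi>|)\<^sup>\<kappa> / \<kappa>!\<close>, and \<open>Q(u)\<close> is bounded by
\<open>(D / c)\<^sup>2\<^sup>\<kappa>\<close> up to a factor exponential in \<open>\<kappa>\<close> (\<open>surface_spline_form\<close>).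

The constant \<open>C\<close> is chosen such that \<open>D / c \<le> exp (- 2 n \<gamma>\<^sub>n) / (3 \<rho>)\<close>. The factor
\<open>exp (- 4 n \<gamma>\<^sub>n \<kappa>)\<close> absorbs all other constants (\<open>error_constant_bound\<close>) and leaves room for
\<open>(2/3)\<^sup>\<kappa>\<^sup>+\<^sup>1 \<le> \<omega>\<close> to the power \<open>1 / \<delta>\<close>. The constant \<open>l(\<lambda>,n)\<close> is found from the same mixture identity, with the
Fourier transform of a test function in place of point masses: the integral over \<open>t\<close> is then a Bessel
integral, and \<open>l = a! \<pi>\<^sup>N 2\<^sup>a\<^sup>+\<^sup>N\<close> for \<open>n = 2 N\<close> (\<open>surface_spline_l_eq\<close>).
\<close>

section \<open>Bernstein's inequality and the growth of polynomials\<close>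

lemma poly_eq_sum_le:
  fixes p :: "'a::comm_semiring_1 poly"
  assumes "degree p \<le> n"
  shows "poly p x = (\<Sum>i\<le>n. coeff p i * x ^ i)"
  unfolding poly_altdef
  by (rule sum.mono_neutral_left) (use assms in \<open>auto simp: coeff_eq_0\<close>)

text \<open>The maximum principle for the reflected polynomial \<open>w\<^sup>N F(1/w)\<close>, which obeys the same bound on the
  unit circle as \<open>F\<close>.\<close>

lemma norm_poly_outside_disc_le:
  fixes F :: "complex poly"
  assumes deg: "degree F \<le> N" and bound: "\<And>z. norm z = 1 \<Longrightarrow> norm (poly F z) \<le> M"
    and z: "norm z \<ge> 1"
  shows "norm (poly F z) \<le> M * norm z ^ N"
proof -
  define R where "R = (\<Sum>i\<le>N. monom (coeff F (N - i)) i)"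
  have R: "poly R w = w ^ N * poly F (1 / w)" if "w \<noteq> 0" for w
  proof -
    have "poly R w = (\<Sum>i\<le>N. coeff F (N - i) * w ^ i)"
      by (simp add: R_def poly_sum poly_monom)
    also have "\<dots> = (\<Sum>i\<le>N. coeff F i * w ^ (N - i))"
      by (rule sum.reindex_bij_witness[of _ "\<lambda>i. N - i" "\<lambda>i. N - i"]) auto
    also have "\<dots> = (\<Sum>i\<le>N. w ^ N * (coeff F i * (1 / w) ^ i))"
      using that by (intro sum.cong) (auto simp: power_diff power_one_over field_simps)
    also have "\<dots> = w ^ N * poly F (1 / w)"
      using deg by (simp add: poly_eq_sum_le sum_distrib_left)
    finally show ?thesis .
  qed
  have z0: "z \<noteq> 0" using z by auto
  have "norm (poly R (1 / z)) \<le> M"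
  proof (rule maximum_modulus_frontier[of "poly R" "cball 0 1"])
    show "poly R holomorphic_on interior (cball 0 1)"
      by (intro holomorphic_intros)
    show "continuous_on (closure (cball 0 1)) (poly R)"
      by (intro continuous_intros)
    show "bounded (cball (0::complex) 1)" by simp
    show "1 / z \<in> cball 0 1" using z z0 by (simp add: norm_divide)
    show "norm (poly R w) \<le> M" if "w \<in> frontier (cball 0 1)" for w
    proof -
      have w: "norm w = 1" using that by simp
      then show ?thesis using R[of w] bound[of "1 / w"]
        by (cases "w = 0") (auto simp: norm_mult norm_power norm_divide)
    qed
  qed
  then have "norm ((1 / z) ^ N * poly F z) \<le> M"
    using R[of "1 / z"] z0 by simp
  then show ?thesis
    using z z0 by (simp add: norm_mult norm_power norm_divide field_simps)
qed

text \<open>The logarithmic derivative is the sum of the terms \<open>z / (z - a)\<close>, and each of them has real part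
  above \<open>1/2\<close> because \<open>|a| < |z| = 1\<close>.\<close>

lemma Re_logarithmic_derivative_gt:
  assumes "\<And>a. a \<in># A \<Longrightarrow> norm a < 1" and "norm z = 1" and "A \<noteq> {#}"
  defines "H \<equiv> (\<Prod>x\<in>#A. [:- x, 1:])"
  shows "poly H z \<noteq> 0 \<and> Re (z * poly (pderiv H) z / poly H z) > real (size A) / 2"
  using assms(1,3) unfolding H_def
proof (induction A)
  case empty
  then show ?case by simp
next
  case (add a A)
  let ?H = "(\<Prod>x\<in>#A. [:- x, 1:])"
  have a: "norm a < 1" using add.prems by simp
  have za: "z - a \<noteq> 0" using a assms(2) by auto
  have half: "Re (z / (z - a)) > 1 / 2"
  proof -
    have "norm (z - a) ^ 2 = norm z ^ 2 - 2 * Re (z * cnj a) + norm a ^ 2"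
      unfolding cmod_power2 by (simp add: power2_eq_square algebra_simps)
    then have eq: "norm (z - a) ^ 2 = 1 - 2 * Re (z * cnj a) + norm a ^ 2"
      using assms(2) by simp
    have "Re (z / (z - a)) = Re (z * cnj (z - a)) / norm (z - a) ^ 2"
      by (subst complex_div_cnj) (simp add: cmod_power2)
    also have "Re (z * cnj (z - a)) = 1 - Re (z * cnj a)"
    proof -
      have "z * cnj z = 1" using assms(2) by (simp add: complex_norm_square[symmetric])
      then show ?thesis by (simp add: right_diff_distrib)
    qed
    finally have "Re (z / (z - a)) = (1 - Re (z * cnj a)) / norm (z - a) ^ 2" .
    moreover have "norm (z - a) ^ 2 > 0" using za by simp
    moreover have "norm a ^ 2 < 1" using a by (simp add: power_less_one_iff abs_square_less_1)
    moreover have "1 / 2 < (1 - x) / y" if "y > 0" "b < 1" "y = 1 - 2 * x + b" for x y b :: real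
      using that by (simp add: field_simps)
    ultimately show ?thesis using eq by metis
  qed
  have pd: "poly (pderiv ([:- a, 1:] * ?H)) z = poly ?H z + (z - a) * poly (pderiv ?H) z"
    by (simp only: pderiv_mult poly_add poly_mult) (simp add: pderiv_pCons)
  have pm: "(\<Prod>x\<in>#add_mset a A. [:- x, 1:]) = [:- a, 1:] * ?H" by simp
  show ?case
    unfolding pm
  proof (cases "A = {#}")
    case True
    then show "poly ([:- a, 1:] * ?H) z \<noteq> 0
        \<and> real (size (add_mset a A)) / 2 < Re (z * poly (pderiv ([:- a, 1:] * ?H)) z / poly ([:- a, 1:] * ?H) z)"
      using half za by (simp add: pderiv_pCons)
  next
    case False
    then have IH: "poly ?H z \<noteq> 0" "Re (z * poly (pderiv ?H) z / poly ?H z) > real (size A) / 2"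
      using add by auto
    have "z * (poly ?H z + (z - a) * poly (pderiv ?H) z) / ((z - a) * poly ?H z)
        = z / (z - a) + z * poly (pderiv ?H) z / poly ?H z"
      using za IH(1) by (simp add: field_simps)
    moreover have "poly ([:- a, 1:] * ?H) z = (z - a) * poly ?H z"
      by (simp add: algebra_simps)
    ultimately have "z * poly (pderiv ([:- a, 1:] * ?H)) z / poly ([:- a, 1:] * ?H) z
        = z / (z - a) + z * poly (pderiv ?H) z / poly ?H z"
      by (simp only: pd)
    moreover have "poly ([:- a, 1:] * ?H) z \<noteq> 0"
      using za IH(1) by (simp add: algebra_simps)
    ultimately show "poly ([:- a, 1:] * ?H) z \<noteq> 0
        \<and> real (size (add_mset a A)) / 2 < Re (z * poly (pderiv ([:- a, 1:] * ?H)) z / poly ([:- a, 1:] * ?H) z)"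
      using half IH(2) by simp
  qed
qed

text \<open>Bernstein's inequality on the circle. If it failed at \<open>z\<close>, some \<open>\<mu>\<close> with \<open>|\<mu>| > 1\<close> would make
  \<open>z H'(z) = D H(z)\<close> for \<open>H = F - \<mu> z\<^sup>2\<^sup>D\<close>. All zeros of this \<open>H\<close> lie inside the disc, because
  \<open>|F(w)| \<le> |w|\<^sup>2\<^sup>D < |\<mu> w\<^sup>2\<^sup>D|\<close> for \<open>|w| \<ge> 1\<close>, so the real part of \<open>z H'(z) / H(z)\<close> exceeds \<open>D\<close>.\<close>

lemma polar_derivative_bound:
  fixes F :: "complex poly"
  assumes deg: "degree F \<le> 2 * D" and bound: "\<And>z. norm z = 1 \<Longrightarrow> norm (poly F z) \<le> 1"
    and z: "norm z = 1"
  shows "norm (z * poly (pderiv F) z - of_nat D * poly F z) \<le> real D"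
proof (cases "D = 0")
  case True
  then show ?thesis using deg by (auto elim!: degree_eq_zeroE)
next
  case False
  show ?thesis
  proof (rule ccontr)
    assume "\<not> ?thesis"
    then have gt: "norm (z * poly (pderiv F) z - of_nat D * poly F z) > real D" by simp
    define N where "N = 2 * D"
    \<comment> \<open>This choice gives \<open>z H'(z) = D H(z)\<close>.\<close>
    define \<mu> where "\<mu> = (z * poly (pderiv F) z - of_nat D * poly F z) / (of_nat D * z ^ N)"
    have z0: "z \<noteq> 0" using z by auto
    have \<mu>1: "norm \<mu> > 1"
      using gt False z by (simp add: \<mu>_def norm_divide norm_mult norm_power)
    define H where "H = F - monom \<mu> N"
    have Hne: "poly H w \<noteq> 0" if "norm w \<ge> 1" for w
    proof
      assume "poly H w = 0"
      then have "poly F w = \<mu> * w ^ N" by (simp add: H_def poly_monom)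
      moreover have "norm (poly F w) \<le> 1 * norm w ^ N"
        by (rule norm_poly_outside_disc_le) (use deg bound that N_def in auto)
      ultimately have "norm \<mu> * norm w ^ N \<le> 1 * norm w ^ N" by (simp add: norm_mult norm_power)
      moreover have "norm w ^ N > 0"
        using that less_le_trans[of 0 1 "norm w"] by (intro zero_less_power) simp
      ultimately show False using \<mu>1 by simp
    qed
    have lead: "coeff H N \<noteq> 0"
    proof
      assume c: "coeff H N = 0"
      \<comment> \<open>The top coefficient of \<open>H\<close> vanishes only if \<open>F\<close> has top coefficient \<open>\<mu>\<close>; evaluating the
         reflected polynomial at the origin shows that this coefficient has norm at most one.\<close>
      have "\<mu> = coeff F N" using c by (simp add: H_def)
      have lim: "((\<lambda>r::real. norm (\<Sum>i\<le>N. coeff F i * of_real r ^ (N - i))) \<longlongrightarrow>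
          norm (\<Sum>i\<le>N. coeff F i * of_real 0 ^ (N - i))) (at_right 0)"
        by (intro tendsto_intros)
      have z0: "(\<Sum>i\<le>N. coeff F i * of_real 0 ^ (N - i)) = coeff F N"
      proof -
        have "(\<Sum>i\<le>N. coeff F i * of_real 0 ^ (N - i)) = (\<Sum>i\<in>{N}. coeff F i * of_real 0 ^ (N - i))"
          by (rule sum.mono_neutral_right) auto
        then show ?thesis by simp
      qed
      have "norm (coeff F N) \<le> 1"
      proof (rule tendsto_upperbound[OF lim[unfolded z0]])
        show "\<forall>\<^sub>F r in at_right 0. norm (\<Sum>i\<le>N. coeff F i * of_real r ^ (N - i)) \<le> 1"
          unfolding eventually_at_right_field
        proof (intro exI[of _ 1] conjI allI impI)
          fix r :: real assume r: "0 < r" "r < 1"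
          have "(\<Sum>i\<le>N. coeff F i * of_real r ^ (N - i)) = of_real r ^ N * poly F (1 / of_real r)"
          proof -
            have "poly F (1 / of_real r) = (\<Sum>i\<le>N. coeff F i * (1 / of_real r) ^ i)"
              using deg by (simp add: poly_eq_sum_le N_def)
            then show ?thesis using r
              by (auto simp: sum_distrib_left power_diff power_one_over field_simps intro!: sum.cong)
          qed
          moreover have "norm (poly F (1 / of_real r)) \<le> 1 * norm (1 / of_real r :: complex) ^ N"
            by (rule norm_poly_outside_disc_le) (use deg bound r N_def in \<open>auto simp: norm_divide\<close>)
          ultimately show "norm (\<Sum>i\<le>N. coeff F i * of_real r ^ (N - i)) \<le> 1"
            using r by (simp add: norm_mult norm_power norm_divide field_simps)
        qed simp
      qed simp
      then show False using \<mu>1 \<open>\<mu> = coeff F N\<close> by simp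
    qed
    have "degree H \<le> N"
      unfolding H_def by (rule degree_diff_le) (use deg N_def degree_monom_le in auto)
    then have degH: "degree H = N" using lead le_degree[of H N] by simp
    have "H \<noteq> 0" using lead by auto
    then obtain A where A: "size A = degree H" "H = smult (lead_coeff H) (\<Prod>x\<in>#A. [:-x, 1:])"
      using alg_closed_imp_factorization[OF \<open>H \<noteq> 0\<close>] by metis
    define P where "P = (\<Prod>x\<in>#A. [:-x, 1:])"
    define lc where "lc = lead_coeff H"
    have lc: "lc \<noteq> 0" using \<open>H \<noteq> 0\<close> by (simp add: lc_def)
    have HP: "H = smult lc P" using A(2) unfolding lc_def P_def .
    have A1: "norm a < 1" if "a \<in># A" for a
    proof -
      have "[:-a, 1:] dvd P" unfolding P_def
        by (rule dvd_prod_mset) (use that in auto)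
      then have "poly P a = 0" by (simp add: poly_eq_0_iff_dvd)
      then have "poly H a = 0" by (simp add: HP)
      then show ?thesis using Hne[of a] by force
    qed
    have "A \<noteq> {#}" using A(1) degH False N_def by auto
    from Re_logarithmic_derivative_gt[OF A1 z this]
    have P: "poly P z \<noteq> 0" "Re (z * poly (pderiv P) z / poly P z) > real (size A) / 2"
      unfolding P_def by auto
    have "z * poly (pderiv H) z / poly H z = z * poly (pderiv P) z / poly P z"
      using lc by (simp add: HP pderiv_smult)
    moreover have "real (size A) / 2 = real D" using A(1) degH N_def by simp
    ultimately have "Re (z * poly (pderiv H) z / poly H z) > real D"
      using P(2) by simp
    moreover have "z * poly (pderiv H) z = of_nat D * poly H z"
    proof -
      have "z * poly (pderiv H) z - of_nat D * poly H z
         = (z * poly (pderiv F) z - of_nat D * poly F z) - \<mu> * (of_nat D * z ^ N)"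
      proof -
        have "z * (of_nat N * \<mu> * z ^ (N - 1)) = of_nat N * \<mu> * z ^ N"
          by (cases N) auto
        then have "z * (of_nat N * \<mu> * z ^ (N - 1)) = 2 * of_nat D * \<mu> * z ^ N"
          by (simp only:) (simp add: N_def)
        then show ?thesis
          unfolding H_def by (simp add: pderiv_diff pderiv_monom poly_monom) (auto simp: algebra_simps)
      qed
      also have "\<dots> = 0" using z0 False by (simp add: \<mu>_def)
      finally show ?thesis by simp
    qed
    ultimately show False using Hne[of z] z by simp
  qed
qed

text \<open>Clearing denominators in \<open>g ((z + 1/z) / 2)\<close>.\<close>

lemma joukowski_polynomial:
  fixes g :: "complex poly"
  assumes "degree g \<le> D"
  obtains F where "degree F \<le> 2 * D"
    and "\<And>z. z \<noteq> 0 \<Longrightarrow> poly F z = z ^ D * poly g ((z + 1 / z) / 2)"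
proof
  define F where "F = (\<Sum>i\<le>D. smult (coeff g i / 2 ^ i) ([:1, 0, 1:] ^ i * monom 1 (D - i)))"
  show "degree F \<le> 2 * D"
    unfolding F_def
  proof (rule degree_sum_le)
    fix i assume i: "i \<in> {..D}"
    have "degree ([:1, 0, 1:] ^ i * monom 1 (D - i) :: complex poly) \<le> 2 * i + (D - i)"
      by (rule order.trans[OF degree_mult_le])
        (use degree_power_le[of "[:1, 0, 1::complex:]" i] in \<open>auto simp: degree_monom_eq\<close>)
    also have "\<dots> \<le> 2 * D" using i by simp
    finally show "degree (smult (coeff g i / 2 ^ i) ([:1, 0, 1:] ^ i * monom 1 (D - i))) \<le> 2 * D"
      using degree_smult_le order.trans by blast
  qed simp
  fix z :: complex assume z: "z \<noteq> 0"
  have "poly F z = (\<Sum>i\<le>D. coeff g i / 2 ^ i * ((1 + z * z) ^ i * z ^ (D - i)))"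
    by (simp add: F_def poly_sum poly_monom)
  also have "\<dots> = (\<Sum>i\<le>D. z ^ D * (coeff g i * ((z + 1 / z) / 2) ^ i))"
  proof (rule sum.cong)
    fix i assume "i \<in> {..D}"
    then have "z ^ D = z ^ i * z ^ (D - i)" by (simp add: power_add[symmetric])
    moreover have "((z + 1 / z) / 2) ^ i = (1 + z * z) ^ i / (2 ^ i * z ^ i)"
    proof -
      have "(z + 1 / z) / 2 = (1 + z * z) / (2 * z)" using z by (simp add: field_simps)
      then show ?thesis by (simp only: power_divide power_mult_distrib)
    qed
    ultimately show "coeff g i / 2 ^ i * ((1 + z * z) ^ i * z ^ (D - i))
        = z ^ D * (coeff g i * ((z + 1 / z) / 2) ^ i)"
      using z by simp
  qed simp
  also have "\<dots> = z ^ D * poly g ((z + 1 / z) / 2)"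
    using assms by (simp add: poly_eq_sum_le sum_distrib_left)
  finally show "poly F z = z ^ D * poly g ((z + 1 / z) / 2)" .
qed

text \<open>For \<open>z = exp (i \<theta>)\<close> the point \<open>(z + 1/z) / 2\<close> is \<open>cos \<theta>\<close>, so bounds for \<open>g\<close> on the interval with
  centre \<open>mid\<close> and half-length \<open>half\<close> become bounds for \<open>F\<close> on the unit circle, while real \<open>z > 1\<close> describe
  points beyond the interval.\<close>

lemma circle_lift:
  fixes g :: "real poly" and mid half :: real
  assumes "degree g \<le> D"
  obtains F G :: "complex poly" where "degree F \<le> 2 * D"
    and "\<And>z. z \<noteq> 0 \<Longrightarrow> poly F z = z ^ D * poly G ((z + 1 / z) / 2)"
    and "\<And>x. poly G (of_real x) = of_real (poly g (mid + half * x))"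
    and "\<And>x. poly (pderiv G) (of_real x) = of_real (half * poly (pderiv g) (mid + half * x))"
proof -
  define p where "p = pcompose g [:mid, half:]"
  define G where "G = map_poly complex_of_real p"
  have "degree p \<le> D"
    using degree_pcompose_le[of g "[:mid, half:]"] assms
    by (auto simp: p_def intro: order.trans)
  then have "degree G \<le> D"
    unfolding G_def by (intro degree_le) (auto simp: coeff_map_poly coeff_eq_0)
  then obtain F where F: "degree F \<le> 2 * D"
      "\<And>z. z \<noteq> 0 \<Longrightarrow> poly F z = z ^ D * poly G ((z + 1 / z) / 2)"
    using joukowski_polynomial by blast
  have lift: "poly (map_poly complex_of_real q) (of_real x) = of_real (poly q x)" for q x
    by (induction q) (auto simp: map_poly_pCons)
  have "pderiv G = map_poly complex_of_real (pderiv p)"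
    by (rule poly_eqI) (simp add: G_def coeff_pderiv coeff_map_poly)
  then show thesis
    by (intro that[OF F]) (auto simp: G_def lift p_def poly_pcompose pderiv_pcompose pderiv_pCons mult.commute)
qed

text \<open>At \<open>z = exp (i \<theta>)\<close> the lifted polynomial satisfies \<open>z F' - D F = i z\<^sup>D sin \<theta> G'(cos \<theta>)\<close>, so this is the
  inequality on the circle; \<open>half * sin \<theta>\<close> is the square root of \<open>(t - \<alpha>) (\<beta> - t)\<close>.\<close>

lemma bernstein_interval:
  fixes g :: "real poly"
  assumes deg: "degree g \<le> D" and M: "M > 0"
    and bound: "\<And>t. \<alpha> \<le> t \<Longrightarrow> t \<le> \<beta> \<Longrightarrow> \<bar>poly g t\<bar> \<le> M"
    and t: "\<alpha> < t" "t < \<beta>"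
  shows "\<bar>poly (pderiv g) t\<bar> * sqrt ((t - \<alpha>) * (\<beta> - t)) \<le> real D * M"
proof -
  define mid half where "mid = (\<alpha> + \<beta>) / 2" and "half = (\<beta> - \<alpha>) / 2"
  have half: "half > 0" using t by (simp add: half_def)
  obtain F G :: "complex poly" where F: "degree F \<le> 2 * D"
      "\<And>z. z \<noteq> 0 \<Longrightarrow> poly F z = z ^ D * poly G ((z + 1 / z) / 2)"
    and G: "\<And>x. poly G (of_real x) = of_real (poly g (mid + half * x))"
    and G': "\<And>x. poly (pderiv G) (of_real x) = of_real (half * poly (pderiv g) (mid + half * x))"
    using circle_lift[OF deg] by metis
  have circle: "(z + 1 / z) / 2 = of_real (Re z)" "(z - 1 / z) / 2 = \<i> * of_real (Im z)"
    if "norm z = 1" for z :: complex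
  proof -
    have "1 / z = cnj z"
      using that by (simp add: complex_div_cnj[of 1 z])
    then show "(z + 1 / z) / 2 = of_real (Re z)" "(z - 1 / z) / 2 = \<i> * of_real (Im z)"
      by (simp_all add: complex_eq_iff)
  qed
  have FM: "norm (poly (smult (of_real (1 / M)) F) z) \<le> 1" if z: "norm z = 1" for z
  proof -
    have "\<bar>Re z\<bar> \<le> 1" using abs_Re_le_cmod[of z] z by simp
    then have "\<alpha> \<le> mid + half * Re z" "mid + half * Re z \<le> \<beta>"
      using mult_left_mono[of "Re z" 1 half] mult_left_mono[of "-1" "Re z" half] half
      by (auto simp: mid_def half_def field_simps abs_le_iff)
    then have "\<bar>poly g (mid + half * Re z)\<bar> \<le> M" by (rule bound)
    moreover have "z \<noteq> 0" using z by auto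
    ultimately show ?thesis
      using M z by (simp add: F(2) circle G norm_mult norm_power norm_divide)
  qed
  define x where "x = (t - mid) / half"
  have t_eq: "mid + half * x = t" using half by (simp add: x_def)
  have x2: "half\<^sup>2 * (1 - x\<^sup>2) = (t - \<alpha>) * (\<beta> - t)"
  proof -
    have "half\<^sup>2 * (1 - x\<^sup>2) = half\<^sup>2 - (half * x)\<^sup>2" by (simp add: algebra_simps power_mult_distrib)
    also have "half * x = t - mid" using t_eq by simp
    finally show ?thesis
      by (simp add: mid_def half_def power2_eq_square field_simps)
  qed
  have "(t - \<alpha>) * (\<beta> - t) > 0" using t by simp
  then have "half\<^sup>2 * (1 - x\<^sup>2) > 0" using x2 by simp
  then have x1: "x\<^sup>2 < 1" using half by (simp add: zero_less_mult_iff)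
  \<comment> \<open>The point of the upper half circle above \<open>t\<close>.\<close>
  define z where "z = Complex x (sqrt (1 - x\<^sup>2))"
  have z: "norm z = 1" using x1 by (simp add: z_def cmod_def)
  then have z0: "z \<noteq> 0" by auto
  have d1: "(poly F has_field_derivative poly (pderiv F) z) (at z)" by (rule poly_DERIV)
  have "((\<lambda>w. w ^ D * poly G ((w + 1 / w) / 2)) has_field_derivative
      of_nat D * z ^ (D - 1) * poly G ((z + 1 / z) / 2)
      + z ^ D * (poly (pderiv G) ((z + 1 / z) / 2) * ((1 - 1 / z\<^sup>2) / 2))) (at z)"
  proof -
    have "((\<lambda>w. (w + 1 / w) / 2) has_field_derivative (1 - 1 / z\<^sup>2) / 2) (at z)"
      using z0 by (auto intro!: derivative_eq_intros simp: power2_eq_square field_simps)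
    from DERIV_mult[OF DERIV_power[OF DERIV_ident, of D z UNIV] DERIV_chain2[OF poly_DERIV this, of G]]
    show ?thesis by (rule DERIV_cong) (simp only: mult_1_right mult_1_left One_nat_def mult.commute[of "z ^ D"])
  qed
  then have d2: "(poly F has_field_derivative
      of_nat D * z ^ (D - 1) * poly G ((z + 1 / z) / 2)
      + z ^ D * (poly (pderiv G) ((z + 1 / z) / 2) * ((1 - 1 / z\<^sup>2) / 2))) (at z)"
    by (rule has_field_derivative_transform_within_open[of _ _ _ "- {0}"]) (use z0 F(2) in auto)
  have pF: "poly (pderiv F) z = of_nat D * z ^ (D - 1) * poly G ((z + 1 / z) / 2)
      + z ^ D * (poly (pderiv G) ((z + 1 / z) / 2) * ((1 - 1 / z\<^sup>2) / 2))"
    by (rule DERIV_unique[OF d1 d2])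
  have "z * poly (pderiv F) z - of_nat D * poly F z
      = z ^ D * poly (pderiv G) ((z + 1 / z) / 2) * ((z - 1 / z) / 2)"
  proof -
    have "z * (of_nat D * z ^ (D - 1)) = of_nat D * z ^ D" by (cases D) auto
    moreover have "z * ((1 - 1 / z\<^sup>2) / 2) = (z - 1 / z) / 2"
      using z0 by (simp add: power2_eq_square field_simps)
    moreover have "z * (dA * u + zD * (u' * e)) - d * (zD * u) = zD * u' * k"
      if "z * dA = d * zD" "z * e = k" for dA u zD u' e d k :: complex
    proof -
      have "z * (dA * u + zD * (u' * e)) = (z * dA) * u + zD * u' * (z * e)"
        by (simp add: algebra_simps)
      then show ?thesis unfolding that by (simp add: algebra_simps)
    qed
    ultimately show ?thesis unfolding pF F(2)[OF z0] by metis
  qed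
  then have "norm (z * poly (pderiv F) z - of_nat D * poly F z)
      = \<bar>poly (pderiv g) t\<bar> * (half * sqrt (1 - x\<^sup>2))"
    using z x1 half by (simp add: circle norm_mult norm_power G' abs_mult)
      (simp add: z_def t_eq)
  also have "half * sqrt (1 - x\<^sup>2) = sqrt ((t - \<alpha>) * (\<beta> - t))"
    using half by (simp add: x2[symmetric] real_sqrt_mult)
  finally have eq: "norm (z * poly (pderiv F) z - of_nat D * poly F z)
      = \<bar>poly (pderiv g) t\<bar> * sqrt ((t - \<alpha>) * (\<beta> - t))" .
  have "norm (z * poly (pderiv (smult (of_real (1 / M)) F)) z
      - of_nat D * poly (smult (of_real (1 / M)) F) z) \<le> real D"
    by (rule polar_derivative_bound) (use F(1) FM z order.trans[OF degree_smult_le] in auto)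
  also have "z * poly (pderiv (smult (of_real (1 / M)) F)) z
      - of_nat D * poly (smult (of_real (1 / M)) F) z
      = of_real (1 / M) * (z * poly (pderiv F) z - of_nat D * poly F z)"
    by (simp add: pderiv_smult algebra_simps)
  finally show ?thesis
    using M by (simp add: norm_mult norm_divide eq field_simps)
qed

text \<open>With \<open>v = u / r\<close>, the real number \<open>\<zeta> = v + sqrt (v\<^sup>2 - 1) \<le> 2 v\<close> satisfies \<open>(\<zeta> + 1/\<zeta>) / 2 = v\<close>, and the lifted
  polynomial grows at most like \<open>\<zeta>\<^sup>2\<^sup>D\<close> outside the disc.\<close>

lemma chebyshev_growth:
  fixes g :: "real poly"
  assumes deg: "degree g \<le> D" and r: "r > 0"
    and bound: "\<And>t. \<bar>t\<bar> \<le> r \<Longrightarrow> \<bar>poly g t\<bar> \<le> M" and u: "u \<ge> r"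
  shows "\<bar>poly g u\<bar> \<le> M * (2 * u / r) ^ D"
proof -
  obtain F G :: "complex poly" where F: "degree F \<le> 2 * D"
      "\<And>z. z \<noteq> 0 \<Longrightarrow> poly F z = z ^ D * poly G ((z + 1 / z) / 2)"
    and G: "\<And>x. poly G (of_real x) = of_real (poly g (0 + r * x))"
    using circle_lift[OF deg] by metis
  have M: "M \<ge> 0" using bound[of 0] r by linarith
  have FM: "norm (poly F z) \<le> M" if z: "norm z = 1" for z
  proof -
    have "1 / z = cnj z" using z by (simp add: complex_div_cnj[of 1 z])
    then have "(z + 1 / z) / 2 = of_real (Re z)" by (simp add: complex_eq_iff)
    moreover have "\<bar>r * Re z\<bar> \<le> r"
      using abs_Re_le_cmod[of z] z r by (simp add: abs_mult)
    moreover have "z \<noteq> 0" using z by auto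
    ultimately show ?thesis using bound z by (simp add: F(2) G norm_mult norm_power)
  qed
  define v where "v = u / r"
  have v: "v \<ge> 1" using u r by (simp add: v_def)
  define \<zeta> where "\<zeta> = v + sqrt (v\<^sup>2 - 1)"
  have v2: "v\<^sup>2 \<ge> 1" using v by (simp add: one_le_power)
  have z1: "\<zeta> \<ge> 1" using v v2 by (simp add: \<zeta>_def add_increasing2)
  have z2: "\<zeta> \<le> 2 * v"
    using v real_sqrt_le_mono[of "v\<^sup>2 - 1" "v\<^sup>2"] by (simp add: \<zeta>_def)
  have "\<zeta> * (v - sqrt (v\<^sup>2 - 1)) = 1"
    using v2 by (simp add: \<zeta>_def algebra_simps power2_eq_square[symmetric])
  then have inv: "1 / \<zeta> = v - sqrt (v\<^sup>2 - 1)" using z1 by (simp add: field_simps)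
  have "(of_real \<zeta> + 1 / of_real \<zeta> :: complex) / 2 = of_real ((\<zeta> + 1 / \<zeta>) / 2)" by simp
  also have "(\<zeta> + 1 / \<zeta>) / 2 = v" unfolding inv by (simp add: \<zeta>_def)
  finally have J: "(of_real \<zeta> + 1 / of_real \<zeta> :: complex) / 2 = of_real v" .
  have Gv: "poly G (of_real v) = of_real (poly g u)"
    using r by (subst G) (simp add: v_def)
  have "norm (poly F (of_real \<zeta>)) \<le> M * norm (of_real \<zeta> :: complex) ^ (2 * D)"
    by (rule norm_poly_outside_disc_le[OF F(1) FM]) (use z1 in auto)
  moreover have "norm (poly F (of_real \<zeta>)) = \<zeta> ^ D * \<bar>poly g u\<bar>"
    using z1 by (subst F(2)) (auto simp: J Gv norm_mult norm_power)
  ultimately have "\<zeta> ^ D * \<bar>poly g u\<bar> \<le> \<zeta> ^ D * (M * \<zeta> ^ D)"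
    using z1 by (simp add: power_add[symmetric] mult_2_right mult_ac)
  moreover have "\<zeta> ^ D > 0" using z1 by simp
  ultimately have "\<bar>poly g u\<bar> \<le> M * \<zeta> ^ D" by simp
  also have "\<dots> \<le> M * (2 * v) ^ D"
    using M z1 z2 by (intro mult_left_mono power_mono) auto
  finally show ?thesis by (simp add: v_def)
qed

section \<open>Norming sets for polynomials\<close>

text \<open>Only restrictions to lines enter the estimates, and this notion reduces them to univariate
  polynomials.\<close>

definition line_polynomial :: "nat \<Rightarrow> ('a::real_vector \<Rightarrow> real) \<Rightarrow> bool" where
  "line_polynomial d p \<longleftrightarrow>
     (\<forall>u v. \<exists>g :: real poly. degree g \<le> d \<and> (\<forall>t. p (u + t *\<^sub>R v) = poly g t))"

text \<open>The arithmetic behind \<open>norming_mesh\<close>, rescaled to a ball of radius one: \<open>r\<close> is the distance of the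
  weighted maximum from the centre, \<open>e\<close> the mesh width and \<open>k\<close> the degree plus one.\<close>

lemma mesh_inequality:
  fixes e k r :: real
  assumes "k \<ge> 2" "e \<ge> 0" "e * k \<le> 118 / 1000" "r \<ge> 0" "r\<^sup>2 \<le> 13 / 16"
  shows "(3 * (k - 1) * e)\<^sup>2 \<le> 3 / 4 * (1 - (r + e)\<^sup>2)" "(r + e)\<^sup>2 < 1"
proof -
  have e: "e \<le> 59 / 1000"
    using assms mult_left_mono[of 2 k e] by linarith
  have r: "r \<le> 91 / 100"
    by (rule power2_le_imp_le) (use assms in \<open>auto simp: power2_eq_square\<close>)
  have "0 \<le> (k - 1) * e" using assms by simp
  moreover have "(k - 1) * e \<le> 118 / 1000 - e" using assms by (simp add: algebra_simps)
  ultimately have 1: "((k - 1) * e)\<^sup>2 \<le> (118 / 1000 - e)\<^sup>2" by (intro power_mono) auto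
  have 2: "r * e \<le> 91 / 100 * e" using r assms by (intro mult_right_mono) auto
  have 3: "e * e \<le> 59 / 1000 * e" using e assms by (intro mult_right_mono) auto
  have 4: "(3 * (k - 1) * e)\<^sup>2 = 9 * ((k - 1) * e)\<^sup>2" by (simp only: mult.assoc power_mult_distrib) simp
  show "(3 * (k - 1) * e)\<^sup>2 \<le> 3 / 4 * (1 - (r + e)\<^sup>2)"
    unfolding 4 using 1 2 3 e assms(2,5) by (simp add: power2_eq_square algebra_simps)
  show "(r + e)\<^sup>2 < 1"
    using 2 3 e assms(2,5) by (simp add: power2_eq_square algebra_simps)
qed

text \<open>Along the chord through \<open>x\<^sub>0\<close> and \<open>y\<close> the weight \<open>R\<^sup>2 - |x - c|\<^sup>2\<close> vanishes exactly at the two ends, so it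
  is the factor that Bernstein's inequality carries. The weighted polynomial has degree at most \<open>3 d\<close> there,
  and the condition on \<open>\<epsilon>\<close> keeps its derivative below \<open>7/8 M\<close> between \<open>x\<^sub>0\<close> and \<open>y\<close>.\<close>

lemma weighted_maximum_stable:
  fixes p :: "'a::euclidean_space \<Rightarrow> real" and c :: 'a
  assumes lp: "line_polynomial d p" and R: "R > 0"
    and max: "\<And>x. x \<in> cball c R \<Longrightarrow> \<bar>p x * (R\<^sup>2 - (norm (x - c))\<^sup>2) ^ d\<bar> \<le> M" and M: "M > 0"
    and x0: "\<bar>p x\<^sub>0 * (R\<^sup>2 - (norm (x\<^sub>0 - c))\<^sup>2) ^ d\<bar> = M"
    and y: "norm (y - x\<^sub>0) \<le> \<epsilon>" and out: "norm (x\<^sub>0 - c) + \<epsilon> < R"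
    and small: "(3 * real d * \<epsilon>)\<^sup>2 \<le> 3 / 4 * (R\<^sup>2 - (norm (x\<^sub>0 - c) + \<epsilon>)\<^sup>2)"
  shows "M / 8 \<le> \<bar>p y * (R\<^sup>2 - (norm (y - c))\<^sup>2) ^ d\<bar>"
proof (cases "y = x\<^sub>0")
  case True
  then show ?thesis using x0 M by simp
next
  case False
  define v where "v = y - x\<^sub>0"
  have v: "norm v > 0" "norm v \<le> \<epsilon>" using False y by (auto simp: v_def)
  have \<epsilon>: "\<epsilon> \<ge> 0" using v by linarith
  define V where "V = (norm v)\<^sup>2"
  have V: "V > 0" using v by (simp add: V_def)
  define b where "b = (x\<^sub>0 - c) \<bullet> v"
  define w\<^sub>0 where "w\<^sub>0 = R\<^sup>2 - (norm (x\<^sub>0 - c))\<^sup>2"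
  define wmin where "wmin = R\<^sup>2 - (norm (x\<^sub>0 - c) + \<epsilon>)\<^sup>2"
  have wmin: "wmin > 0"
    unfolding wmin_def using out \<epsilon> R by (simp add: power_strict_mono)
  have w\<^sub>0: "w\<^sub>0 > 0"
    unfolding w\<^sub>0_def using out \<epsilon> R by (simp add: power_strict_mono)
  define W where "W = [:w\<^sub>0, - 2 * b, - V:]"
  have W: "poly W t = R\<^sup>2 - (norm (x\<^sub>0 + t *\<^sub>R v - c))\<^sup>2" for t
    unfolding W_def w\<^sub>0_def V_def b_def power2_norm_eq_inner
    by (simp add: inner_add inner_diff inner_commute algebra_simps)
  obtain g :: "real poly" where g: "degree g \<le> d" "\<And>t. p (x\<^sub>0 + t *\<^sub>R v) = poly g t"
    using lp unfolding line_polynomial_def by blast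
  define G where "G = g * W ^ d"
  have G: "poly G t = p (x\<^sub>0 + t *\<^sub>R v) * (R\<^sup>2 - (norm (x\<^sub>0 + t *\<^sub>R v - c))\<^sup>2) ^ d" for t
    by (simp add: G_def g W[symmetric])
  have degG: "degree G \<le> 3 * d"
  proof -
    have "degree W \<le> 2" by (simp add: W_def)
    then have "degree (W ^ d) \<le> 2 * d"
      using degree_power_le[of W d] by (meson le_trans mult_le_mono1)
    then show ?thesis
      unfolding G_def using degree_mult_le[of g "W ^ d"] g(1) by linarith
  qed
  \<comment> \<open>The chord through \<open>x\<^sub>0\<close> and \<open>y\<close> leaves the ball at the two roots of \<open>W\<close>.\<close>
  define s where "s = sqrt (b\<^sup>2 + V * w\<^sub>0)"
  have s2: "s * s = b\<^sup>2 + V * w\<^sub>0" using V w\<^sub>0 by (simp add: s_def)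
  define \<alpha> \<beta> where "\<alpha> = (- b - s) / V" and "\<beta> = (- b + s) / V"
  have fac: "poly W t = V * ((t - \<alpha>) * (\<beta> - t))" for t
  proof -
    have "V * ((t - \<alpha>) * (\<beta> - t)) = ((V * t + b + s) * (s - b - V * t)) / V"
      using V by (simp add: \<alpha>_def \<beta>_def field_simps)
    also have "(V * t + b + s) * (s - b - V * t) = V * (w\<^sub>0 - 2 * b * t - V * t * t)"
      using s2 by (simp add: algebra_simps power2_eq_square)
    finally show ?thesis using V by (simp add: W_def) (simp add: algebra_simps)
  qed
  have "s > 0" using V w\<^sub>0 by (simp add: s_def add_nonneg_pos)
  then have \<alpha>\<beta>: "\<alpha> < \<beta>" using V by (simp add: \<alpha>_def \<beta>_def divide_strict_right_mono)
  have Wmin: "poly W t \<ge> wmin" if "0 \<le> t" "t \<le> 1" for t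
  proof -
    have "norm (x\<^sub>0 + t *\<^sub>R v - c) \<le> norm (x\<^sub>0 - c) + norm (t *\<^sub>R v)"
      using norm_triangle_ineq[of "x\<^sub>0 - c" "t *\<^sub>R v"] by (simp add: algebra_simps)
    also have "norm (t *\<^sub>R v) \<le> \<epsilon>"
      using mult_mono[of t 1 "norm v" \<epsilon>] that v by simp
    finally have "norm (x\<^sub>0 + t *\<^sub>R v - c) \<le> norm (x\<^sub>0 - c) + \<epsilon>" by simp
    then show ?thesis unfolding W wmin_def by (simp add: power_mono)
  qed
  obtain t where t: "0 < t" "t < 1" "poly G 1 - poly G 0 = (1 - 0) * poly (pderiv G) t"
    using poly_MVT[of 0 1 G] by auto
  have "poly W t > 0" using Wmin[of t] t wmin by simp
  then have "(t - \<alpha>) * (\<beta> - t) > 0" using V by (simp add: fac zero_less_mult_iff)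
  then have tab: "\<alpha> < t" "t < \<beta>" using \<alpha>\<beta> by (auto simp: zero_less_mult_iff)
  have GM: "\<bar>poly G r\<bar> \<le> M" if "\<alpha> \<le> r" "r \<le> \<beta>" for r
  proof -
    have "poly W r \<ge> 0" using that V by (simp add: fac)
    then have "(norm (x\<^sub>0 + r *\<^sub>R v - c))\<^sup>2 \<le> R\<^sup>2" by (simp add: W)
    then have "norm (x\<^sub>0 + r *\<^sub>R v - c) \<le> R" using R by (simp add: power2_le_iff_abs_le)
    then show ?thesis unfolding G by (intro max) (simp add: dist_norm norm_minus_commute)
  qed
  have "\<bar>poly (pderiv G) t\<bar> * sqrt ((t - \<alpha>) * (\<beta> - t)) \<le> real (3 * d) * M"
    by (rule bernstein_interval[OF degG M GM tab])
  then have "\<bar>poly (pderiv G) t\<bar> * sqrt ((t - \<alpha>) * (\<beta> - t)) * norm v \<le> real (3 * d) * M * norm v"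
    by (rule mult_right_mono) simp
  moreover have "sqrt (poly W t) = sqrt ((t - \<alpha>) * (\<beta> - t)) * norm v"
    unfolding fac by (simp only: real_sqrt_mult V_def real_sqrt_abs abs_norm_cancel mult.commute)
  ultimately have "\<bar>poly (pderiv G) t\<bar> * sqrt (poly W t) \<le> real (3 * d) * M * norm v"
    by (simp only: mult.assoc)
  moreover have "\<bar>poly (pderiv G) t\<bar> * sqrt wmin \<le> \<bar>poly (pderiv G) t\<bar> * sqrt (poly W t)"
    using Wmin[of t] t by (intro mult_left_mono) auto
  moreover have "real (3 * d) * M * norm v \<le> real (3 * d) * M * \<epsilon>"
    using v M by (intro mult_left_mono) auto
  moreover have "real (3 * d) * M * \<epsilon> = M * (3 * real d * \<epsilon>)" by simp
  ultimately have A: "\<bar>poly (pderiv G) t\<bar> * sqrt wmin \<le> M * (3 * real d * \<epsilon>)"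
    by linarith
  have B: "3 * real d * \<epsilon> \<le> 7 / 8 * sqrt wmin"
  proof (rule power2_le_imp_le)
    have "(3 * real d * \<epsilon>)\<^sup>2 \<le> 3 / 4 * wmin" using small by (simp add: wmin_def)
    also have "\<dots> \<le> (7 / 8 * sqrt wmin)\<^sup>2" using wmin by (simp add: power_mult_distrib power_divide)
    finally show "(3 * real d * \<epsilon>)\<^sup>2 \<le> (7 / 8 * sqrt wmin)\<^sup>2" .
  qed (use wmin in auto)
  have "M * (3 * real d * \<epsilon>) \<le> M * (7 / 8 * sqrt wmin)"
    using M B by (intro mult_left_mono) auto
  with A have "\<bar>poly (pderiv G) t\<bar> * sqrt wmin \<le> (7 / 8 * M) * sqrt wmin"
    by (simp only: mult.assoc mult.left_commute[of M])
  then have "\<bar>poly (pderiv G) t\<bar> \<le> 7 / 8 * M" using wmin by (simp only: mult_le_cancel_right) auto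
  then have "\<bar>poly G 1 - poly G 0\<bar> \<le> 7 / 8 * M" using t by simp
  moreover have "\<bar>poly G 0\<bar> = M" using x0 by (simp add: G)
  ultimately have "M / 8 \<le> \<bar>poly G 1\<bar>" by linarith
  then show ?thesis by (simp add: G v_def)
qed

text \<open>Let \<open>x\<^sub>0\<close> maximize \<open>|p w\<^sup>d|\<close> on the ball, \<open>w = R\<^sup>2 - |x - c|\<^sup>2\<close>. The maximum controls \<open>p\<close> on the ball of half
  the radius, hence by growth along rays everywhere; at \<open>x\<^sub>0\<close> itself this is only consistent with
  \<open>w(x\<^sub>0) \<ge> 3/16 R\<^sup>2\<close>. So \<open>x\<^sub>0\<close> keeps a distance from the sphere, a mesh point near \<open>x\<^sub>0\<close> sees an eighth of the
  maximum, and the maximum is bounded by the values of \<open>p\<close> on the mesh.\<close>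

lemma norming_mesh:
  fixes p :: "'a::euclidean_space \<Rightarrow> real" and c :: 'a
  assumes cont: "continuous_on UNIV p" and lp: "line_polynomial d p" and d: "d \<ge> 1"
    and R: "R > 0" and \<epsilon>: "\<epsilon> \<ge> 0" "\<epsilon> * (real d + 1) \<le> 118 / 1000 * R"
    and mesh: "\<And>x. x \<in> cball c R \<Longrightarrow> \<exists>y\<in>Y. norm (y - x) \<le> \<epsilon>"
    and \<eta>: "\<And>y. y \<in> Y \<Longrightarrow> \<bar>p y\<bar> \<le> \<eta>"
    and \<sigma>: "\<sigma> \<ge> 1" and x: "norm (x - c) \<le> \<sigma> * R"
  shows "\<bar>p x\<bar> \<le> 8 * (16 / 3 * \<sigma>) ^ d * \<eta>"
proof -
  define w where "w z = R\<^sup>2 - (norm (z - c))\<^sup>2" for z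
  define P where "P z = \<bar>p z * w z ^ d\<bar>" for z
  have "compact (cball c R)" "cball c R \<noteq> {}" using R by auto
  moreover have "continuous_on (cball c R) P"
    unfolding P_def w_def
    by (intro continuous_intros continuous_on_subset[OF cont]) auto
  ultimately obtain x\<^sub>0 where x\<^sub>0: "x\<^sub>0 \<in> cball c R" "\<And>z. z \<in> cball c R \<Longrightarrow> P z \<le> P x\<^sub>0"
    using continuous_attains_sup by metis
  have \<eta>0: "\<eta> \<ge> 0" using mesh[OF x\<^sub>0(1)] \<eta> abs_ge_zero order.trans by blast
  define B where "B = P x\<^sub>0 / (3 / 4 * R\<^sup>2) ^ d"
  have B0: "B \<ge> 0" using R by (simp add: B_def P_def)
  have inner: "\<bar>p z\<bar> \<le> B" if z: "norm (z - c) \<le> R / 2" for z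
  proof -
    have "(norm (z - c))\<^sup>2 \<le> (R / 2)\<^sup>2" using z by (intro power_mono) auto
    then have "3 / 4 * R\<^sup>2 \<le> w z" by (simp add: w_def power_divide)
    then have "\<bar>p z\<bar> * (3 / 4 * R\<^sup>2) ^ d \<le> \<bar>p z\<bar> * w z ^ d"
      using R by (intro mult_left_mono power_mono) auto
    also have "\<dots> \<le> P z" unfolding P_def abs_mult by (intro mult_left_mono) auto
    also have "\<dots> \<le> P x\<^sub>0" using z R by (intro x\<^sub>0) (simp add: dist_norm norm_minus_commute)
    finally show ?thesis using R by (simp add: B_def field_simps)
  qed
  have outer: "\<bar>p z\<bar> \<le> B * (4 * norm (z - c) / R) ^ d" if z: "norm (z - c) \<ge> R / 2" for z
  proof -
    define v where "v = (1 / norm (z - c)) *\<^sub>R (z - c)"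
    have zc: "norm (z - c) > 0" using z R by linarith
    then have nv: "norm v = 1" by (simp add: v_def)
    obtain g :: "real poly" where g: "degree g \<le> d" "\<And>t. p (c + t *\<^sub>R v) = poly g t"
      using lp unfolding line_polynomial_def by blast
    have "\<bar>poly g (norm (z - c))\<bar> \<le> B * (2 * norm (z - c) / (R / 2)) ^ d"
    proof (rule chebyshev_growth[OF g(1)])
      show "\<bar>poly g t\<bar> \<le> B" if "\<bar>t\<bar> \<le> R / 2" for t
        unfolding g(2)[symmetric] by (rule inner) (use that nv in simp)
    qed (use R z in auto)
    moreover have "c + norm (z - c) *\<^sub>R v = z" using zc by (simp add: v_def)
    ultimately show ?thesis by (simp flip: g(2))
  qed
  have all: "\<bar>p x\<bar> \<le> B * (4 * \<sigma>) ^ d"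
  proof (cases "norm (x - c) \<ge> R / 2")
    case True
    have "B * (4 * norm (x - c) / R) ^ d \<le> B * (4 * \<sigma>) ^ d"
      using x R B0 by (intro mult_left_mono power_mono) (auto simp: field_simps)
    then show ?thesis using outer[OF True] by simp
  next
    case False
    have "B * 1 \<le> B * (4 * \<sigma>) ^ d" using \<sigma> B0 by (intro mult_left_mono one_le_power) auto
    then show ?thesis using inner[of x] False by simp
  qed
  have "P x\<^sub>0 \<le> 8 * \<eta> * R ^ (2 * d)"
  proof (cases "P x\<^sub>0 = 0")
    case True
    then show ?thesis using \<eta>0 R by simp
  next
    case False
    then have P0: "P x\<^sub>0 > 0" by (simp add: P_def)
    have wx: "w x\<^sub>0 \<ge> 3 / 16 * R\<^sup>2"
    proof (cases "norm (x\<^sub>0 - c) \<ge> R / 2")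
      case True
      have nx: "norm (x\<^sub>0 - c) \<le> R" using x\<^sub>0(1) by (simp add: dist_norm norm_minus_commute)
      then have wn: "w x\<^sub>0 \<ge> 0" by (simp add: w_def power_mono)
      have px: "\<bar>p x\<^sub>0\<bar> > 0" using P0 by (auto simp: P_def)
      have "\<bar>p x\<^sub>0\<bar> \<le> B * (4 * norm (x\<^sub>0 - c) / R) ^ d" by (rule outer[OF True])
      also have "\<dots> \<le> B * 4 ^ d"
        using nx R B0 by (intro mult_left_mono power_mono) (auto simp: field_simps)
      also have "\<dots> = \<bar>p x\<^sub>0\<bar> * (16 * w x\<^sub>0 / (3 * R\<^sup>2)) ^ d"
      proof -
        have "(16 * w x\<^sub>0 / (3 * R\<^sup>2)) = w x\<^sub>0 * 4 / (3 / 4 * R\<^sup>2)" using R by (simp add: field_simps)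
        then have "(16 * w x\<^sub>0 / (3 * R\<^sup>2)) ^ d = w x\<^sub>0 ^ d * 4 ^ d / (3 / 4 * R\<^sup>2) ^ d"
          by (simp only: power_divide power_mult_distrib)
        then show ?thesis using wn by (simp add: B_def P_def abs_mult)
      qed
      finally have "1 \<le> (16 * w x\<^sub>0 / (3 * R\<^sup>2)) ^ d" using px by simp
      then have "1 \<le> 16 * w x\<^sub>0 / (3 * R\<^sup>2)"
        using wn R d power_less_one_iff[of "16 * w x\<^sub>0 / (3 * R\<^sup>2)" d] by (auto simp: not_le[symmetric])
      then show ?thesis using R by (simp add: field_simps)
    next
      case False
      then have "(norm (x\<^sub>0 - c))\<^sup>2 \<le> (R / 2)\<^sup>2" by (intro power_mono) auto
      then have "4 * (norm (x\<^sub>0 - c))\<^sup>2 \<le> R\<^sup>2" by (simp add: power_divide)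
      moreover have "3 / 16 * b \<le> b - a" if "4 * a \<le> b" "0 \<le> b" for a b :: real
        using that by simp
      ultimately show ?thesis unfolding w_def by (metis zero_le_power2)
    qed
    define r e where "r = norm (x\<^sub>0 - c) / R" and "e = \<epsilon> / R"
    have rR: "norm (x\<^sub>0 - c) = r * R" "\<epsilon> = e * R" using R by (auto simp: r_def e_def)
    have "r\<^sup>2 * R\<^sup>2 \<le> 13 / 16 * R\<^sup>2" using wx by (simp add: w_def rR power_mult_distrib)
    then have r2: "r\<^sup>2 \<le> 13 / 16" using R by simp
    have r0: "r \<ge> 0" "e \<ge> 0" using R \<epsilon> by (auto simp: r_def e_def)
    have ek: "e * (real d + 1) \<le> 118 / 1000" using \<epsilon>(2) R by (simp add: e_def field_simps)
    have mi: "(3 * (real d + 1 - 1) * e)\<^sup>2 \<le> 3 / 4 * (1 - (r + e)\<^sup>2)" "(r + e)\<^sup>2 < 1"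
      by (rule mesh_inequality; use d r0 ek r2 in simp)+
    obtain y where y: "y \<in> Y" "norm (y - x\<^sub>0) \<le> \<epsilon>" using mesh[OF x\<^sub>0(1)] by blast
    have re: "r + e < 1" using mi(2) r0 by (simp add: abs_square_less_1)
    have out: "norm (x\<^sub>0 - c) + \<epsilon> < R"
      using mult_strict_right_mono[OF re R] by (simp add: rR algebra_simps)
    have small: "(3 * real d * \<epsilon>)\<^sup>2 \<le> 3 / 4 * (R\<^sup>2 - (norm (x\<^sub>0 - c) + \<epsilon>)\<^sup>2)"
    proof -
      have "(3 * real d * e)\<^sup>2 * R\<^sup>2 \<le> 3 / 4 * (1 - (r + e)\<^sup>2) * R\<^sup>2"
        using mi(1) by (intro mult_right_mono) auto
      then show ?thesis by (simp add: rR power_mult_distrib algebra_simps power2_eq_square)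
    qed
    have "P x\<^sub>0 / 8 \<le> P y"
      unfolding P_def w_def
      by (rule weighted_maximum_stable[OF lp R _ _ _ y(2) out small])
        (use x\<^sub>0(2) P0 in \<open>auto simp: P_def w_def\<close>)
    also have "\<dots> \<le> \<eta> * R ^ (2 * d)"
    proof -
      have "norm (y - c) \<le> norm (x\<^sub>0 - c) + norm (y - x\<^sub>0)"
        using norm_triangle_ineq[of "x\<^sub>0 - c" "y - x\<^sub>0"] by simp
      then have "norm (y - c) \<le> R" using y(2) out by linarith
      then have "0 \<le> w y" "w y \<le> R\<^sup>2" by (auto simp: w_def power_mono)
      then have "\<bar>w y ^ d\<bar> \<le> (R\<^sup>2) ^ d" by (auto intro: power_mono)
      then show ?thesis
        unfolding P_def abs_mult using \<eta>[OF y(1)] \<eta>0 by (intro mult_mono) (auto simp: power_mult)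
    qed
    finally show ?thesis by simp
  qed
  then have "B \<le> 8 * \<eta> * (4 / 3) ^ d"
  proof -
    assume "P x\<^sub>0 \<le> 8 * \<eta> * R ^ (2 * d)"
    then have "B \<le> 8 * \<eta> * R ^ (2 * d) / (3 / 4 * R\<^sup>2) ^ d"
      unfolding B_def using R by (intro divide_right_mono) auto
    also have "\<dots> = 8 * \<eta> * (4 / 3) ^ d"
      using R by (simp add: power_mult power_mult_distrib power_divide)
    finally show ?thesis .
  qed
  then have "B * (4 * \<sigma>) ^ d \<le> 8 * \<eta> * (4 / 3) ^ d * (4 * \<sigma>) ^ d"
    using \<sigma> by (intro mult_right_mono) auto
  also have "(8::real) * \<eta> * (4 / 3) ^ d * (4 * \<sigma>) ^ d = 8 * (16 / 3 * \<sigma>) ^ d * \<eta>"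
  proof -
    have "(16 / 3 * \<sigma>) ^ d = (4 / 3 * (4 * \<sigma>)) ^ d" by simp
    also have "\<dots> = (4 / 3) ^ d * (4 * \<sigma>) ^ d" by (rule power_mult_distrib)
    finally show ?thesis by simp
  qed
  finally show ?thesis using all by simp
qed

section \<open>Local polynomial reproduction\<close>

text \<open>Duality in finite dimension: a functional on the span of the \<open>\<phi> i\<close> that is bounded by \<open>\<Lambda>\<close> times the
  square norm on \<open>Y\<close> is the inner product with an element of the span of norm at most \<open>\<Lambda>\<close>. The \<open>\<phi> i\<close> may
  be linearly dependent. The induction adjoins one function at a time and corrects by its component \<open>\<psi>\<close>
  orthogonal to the earlier ones.\<close>

lemma exists_weights_of_square_bound:
  fixes \<phi> :: "'i \<Rightarrow> 'y \<Rightarrow> real" and b :: "'i \<Rightarrow> real"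
  assumes "finite I" and Y: "finite Y"
    and "\<And>a. \<bar>\<Sum>i\<in>I. a i * b i\<bar> \<le> \<Lambda> * sqrt (\<Sum>y\<in>Y. (\<Sum>i\<in>I. a i * \<phi> i y)\<^sup>2)"
  shows "\<exists>s. (\<forall>i\<in>I. (\<Sum>y\<in>Y. (\<Sum>k\<in>I. s k * \<phi> k y) * \<phi> i y) = b i)
    \<and> (\<Sum>y\<in>Y. (\<Sum>k\<in>I. s k * \<phi> k y)\<^sup>2) \<le> \<Lambda>\<^sup>2"
  using assms(1,3)
proof (induction I arbitrary: b \<Lambda> rule: finite_induct)
  case empty
  then show ?case by simp
next
  case (insert j I)
  define ip :: "('y \<Rightarrow> real) \<Rightarrow> ('y \<Rightarrow> real) \<Rightarrow> real" where "ip f g = (\<Sum>y\<in>Y. f y * g y)" for f g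
  define comb where "comb a y = (\<Sum>i\<in>I. a i * \<phi> i y)" for a :: "'i \<Rightarrow> real" and y
  have ip_comb: "ip (comb a) g = (\<Sum>i\<in>I. a i * ip (\<phi> i) g)" for a g
  proof -
    have "ip (comb a) g = (\<Sum>y\<in>Y. \<Sum>i\<in>I. a i * (\<phi> i y * g y))"
      unfolding ip_def comb_def by (simp add: sum_distrib_right mult.assoc)
    also have "\<dots> = (\<Sum>i\<in>I. \<Sum>y\<in>Y. a i * (\<phi> i y * g y))" by (rule sum.swap)
    finally show ?thesis unfolding ip_def by (simp add: sum_distrib_left)
  qed
  have ip_lin: "ip (\<lambda>y. f y + t * g y) k = ip f k + t * ip g k" for f g k t
    unfolding ip_def by (simp add: sum.distrib sum_distrib_left algebra_simps)
  have ip_sym: "ip f g = ip g f" for f g by (simp add: ip_def mult.commute)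
  have cs: "\<bar>ip f g\<bar> \<le> sqrt (ip g g) * sqrt (ip f f)" for f g
  proof -
    have "(ip f g)\<^sup>2 \<le> ip g g * ip f f"
      using Cauchy_Schwarz_ineq_sum[of f g Y] by (simp add: ip_def power2_eq_square mult.commute)
    then have "sqrt ((ip f g)\<^sup>2) \<le> sqrt (ip g g * ip f f)" by (rule real_sqrt_le_mono)
    then show ?thesis by (simp add: real_sqrt_mult)
  qed
  have restrict: "\<bar>\<Sum>i\<in>I. a i * b i\<bar> \<le> \<Lambda> * sqrt (ip (comb a) (comb a))" for a
  proof -
    have "(\<Sum>i\<in>insert j I. (a(j := 0)) i * c i) = (\<Sum>i\<in>I. a i * c i)" for c
      using insert.hyps by (auto intro!: sum.cong)
    then show ?thesis using insert.prems[of "a(j := 0)"]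
      by (simp add: ip_def comb_def power2_eq_square)
  qed
  obtain s\<^sub>0 where s\<^sub>0: "\<And>i. i \<in> I \<Longrightarrow> ip (comb s\<^sub>0) (\<phi> i) = b i"
    using insert.IH[of b \<Lambda>] restrict unfolding ip_def comb_def power2_eq_square by blast
  have "\<bar>\<Sum>i\<in>I. a i * ip (\<phi> i) (\<phi> j)\<bar> \<le> sqrt (ip (\<phi> j) (\<phi> j)) * sqrt (ip (comb a) (comb a))" for a
    using cs[of "comb a" "\<phi> j"] by (simp add: ip_comb[of a "\<phi> j"])
  then obtain r where r: "\<And>i. i \<in> I \<Longrightarrow> ip (comb r) (\<phi> i) = ip (\<phi> i) (\<phi> j)"
    using insert.IH[of "\<lambda>i. ip (\<phi> i) (\<phi> j)" "sqrt (ip (\<phi> j) (\<phi> j))"]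
    unfolding ip_def comb_def power2_eq_square by blast
  define \<psi> where "\<psi> y = \<phi> j y + (- 1) * comb r y" for y
  have \<psi>i: "ip \<psi> (\<phi> i) = 0" if "i \<in> I" for i
    unfolding \<psi>_def ip_lin using r[OF that] by (simp add: ip_sym)
  have \<psi>c: "ip (comb a) \<psi> = 0" for a
    unfolding ip_comb using \<psi>i by (simp add: ip_sym[of _ \<psi>])
  define \<beta> where "\<beta> = b j - (\<Sum>i\<in>I. r i * b i)"
  define N where "N = ip \<psi> \<psi>"
  have \<beta>: "\<bar>\<beta>\<bar> \<le> \<Lambda> * sqrt N"
  proof -
    let ?a = "\<lambda>i. if i = j then 1 else - r i"
    have "(\<Sum>i\<in>insert j I. ?a i * c i) = c j - (\<Sum>i\<in>I. r i * c i)" for c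
    proof -
      have "(\<Sum>i\<in>I. ?a i * c i) = (\<Sum>i\<in>I. - (r i * c i))"
        using insert.hyps by (intro sum.cong) auto
      then show ?thesis using insert.hyps by (simp add: sum_negf)
    qed
    then show ?thesis using insert.prems[of ?a]
      by (simp add: \<beta>_def N_def ip_def \<psi>_def comb_def power2_eq_square)
  qed
  \<comment> \<open>If \<open>N = 0\<close>, then \<open>\<beta> = 0\<close> by the previous bound, and the value \<open>t = 0\<close> of the quotient is the right one.\<close>
  define t where "t = \<beta> / N"
  have tN: "t * N = \<beta>" using \<beta> by (cases "N = 0") (auto simp: t_def)
  define s where "s = (\<lambda>i. s\<^sub>0 i - t * r i)(j := t)"
  define \<sigma> where "\<sigma> y = (\<Sum>k\<in>insert j I. s k * \<phi> k y)" for y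
  have \<sigma>: "\<sigma> = (\<lambda>y. comb s\<^sub>0 y + t * \<psi> y)"
  proof
    fix y
    have "(\<Sum>k\<in>I. s k * \<phi> k y) = (\<Sum>k\<in>I. s\<^sub>0 k * \<phi> k y - t * (r k * \<phi> k y))"
      using insert.hyps by (intro sum.cong) (auto simp: s_def algebra_simps)
    then show "\<sigma> y = comb s\<^sub>0 y + t * \<psi> y"
      using insert.hyps s_def
      by (simp add: \<sigma>_def \<psi>_def comb_def sum_subtractf sum_distrib_left[symmetric] right_diff_distrib)
  qed
  have I: "ip \<sigma> (\<phi> i) = b i" if "i \<in> I" for i
    unfolding \<sigma> ip_lin using s\<^sub>0[OF that] \<psi>i[OF that] by simp
  have "ip \<psi> (\<phi> j) = N"
  proof -
    have "\<phi> j = (\<lambda>y. \<psi> y + 1 * comb r y)" by (simp add: \<psi>_def)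
    then have "ip (\<phi> j) \<psi> = ip \<psi> \<psi> + ip (comb r) \<psi>" using ip_lin[of \<psi> 1 "comb r" \<psi>] by simp
    then show ?thesis using \<psi>c[of r] by (simp add: N_def ip_sym[of "\<phi> j"])
  qed
  moreover have "ip (comb s\<^sub>0) (\<phi> j) = (\<Sum>i\<in>I. r i * b i)"
  proof -
    have "\<phi> j = (\<lambda>y. \<psi> y + 1 * comb r y)" by (simp add: \<psi>_def)
    then have "ip (\<phi> j) (comb s\<^sub>0) = ip \<psi> (comb s\<^sub>0) + ip (comb r) (comb s\<^sub>0)"
      using ip_lin[of \<psi> 1 "comb r" "comb s\<^sub>0"] by simp
    also have "ip \<psi> (comb s\<^sub>0) = 0" using \<psi>c by (simp add: ip_sym[of \<psi>])
    also have "ip (comb r) (comb s\<^sub>0) = (\<Sum>i\<in>I. r i * b i)"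
      unfolding ip_comb using s\<^sub>0 by (intro sum.cong) (auto simp: ip_sym)
    finally show ?thesis by (simp add: ip_sym)
  qed
  ultimately have J: "ip \<sigma> (\<phi> j) = b j"
    unfolding \<sigma> ip_lin using tN by (simp add: \<beta>_def)
  have all: "ip \<sigma> (\<phi> i) = b i" if "i \<in> insert j I" for i using I J that by auto
  have "ip \<sigma> \<sigma> = (\<Sum>k\<in>insert j I. s k * ip \<sigma> (\<phi> k))"
  proof -
    have "ip \<sigma> \<sigma> = (\<Sum>y\<in>Y. \<Sum>k\<in>insert j I. s k * (\<sigma> y * \<phi> k y))"
      unfolding ip_def by (subst (2) \<sigma>_def) (simp only: sum_distrib_left mult.left_commute)
    also have "\<dots> = (\<Sum>k\<in>insert j I. \<Sum>y\<in>Y. s k * (\<sigma> y * \<phi> k y))" by (rule sum.swap)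
    finally show ?thesis unfolding ip_def by (simp only: sum_distrib_left)
  qed
  also have "\<dots> = (\<Sum>k\<in>insert j I. s k * b k)" using all by (intro sum.cong) auto
  also have "\<dots> \<le> \<Lambda> * sqrt (ip \<sigma> \<sigma>)"
    using insert.prems[of s] unfolding ip_def \<sigma>_def power2_eq_square by linarith
  finally have le: "ip \<sigma> \<sigma> \<le> \<Lambda> * sqrt (ip \<sigma> \<sigma>)" .
  have nn: "ip \<sigma> \<sigma> \<ge> 0" by (simp add: ip_def sum_nonneg)
  have "ip \<sigma> \<sigma> \<le> \<Lambda>\<^sup>2"
  proof (cases "ip \<sigma> \<sigma> = 0")
    case False
    then have pos: "sqrt (ip \<sigma> \<sigma>) > 0" using nn by simp
    have "sqrt (ip \<sigma> \<sigma>) * sqrt (ip \<sigma> \<sigma>) \<le> \<Lambda> * sqrt (ip \<sigma> \<sigma>)"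
      unfolding real_sqrt_mult_self abs_of_nonneg[OF nn] by (rule le)
    then have "sqrt (ip \<sigma> \<sigma>) \<le> \<Lambda>" using pos by (rule mult_right_le_imp_le)
    then show ?thesis by (rule sqrt_le_D)
  qed simp
  then show ?case
    using all unfolding ip_def \<sigma>_def power2_eq_square by blast
qed

lemma line_polynomial_monomial:
  fixes \<alpha> :: "'n::finite \<Rightarrow> nat"
  shows "line_polynomial (multi_degree \<alpha>) (monomial \<alpha>)"
  unfolding line_polynomial_def
proof (intro allI)
  fix u v :: "real ^ 'n"
  define g where "g = (\<Prod>i\<in>UNIV. [:u $ i, v $ i:] ^ \<alpha> i)"
  have "degree g \<le> (\<Sum>i\<in>UNIV. degree ([:u $ i, v $ i:] ^ \<alpha> i))"
    unfolding g_def using degree_prod_sum_le[of "UNIV :: 'n set" "\<lambda>i. [:u $ i, v $ i:] ^ \<alpha> i"]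
    by (simp add: o_def)
  also have "\<dots> \<le> multi_degree \<alpha>"
    unfolding multi_degree_def
  proof (rule sum_mono)
    fix i :: 'n
    have "degree ([:u $ i, v $ i:] ^ \<alpha> i) \<le> degree [:u $ i, v $ i:] * \<alpha> i"
      by (rule degree_power_le)
    also have "\<dots> \<le> 1 * \<alpha> i" by (intro mult_right_mono) auto
    finally show "degree ([:u $ i, v $ i:] ^ \<alpha> i) \<le> \<alpha> i" by simp
  qed
  finally have "degree g \<le> multi_degree \<alpha>" .
  moreover have "monomial \<alpha> (u + t *\<^sub>R v) = poly g t" for t
    by (simp add: g_def monomial_def poly_prod)
  ultimately show "\<exists>g. degree g \<le> multi_degree \<alpha> \<and> (\<forall>t. monomial \<alpha> (u + t *\<^sub>R v) = poly g t)"
    by blast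
qed

lemma line_polynomial_mono: "line_polynomial d p \<Longrightarrow> d \<le> e \<Longrightarrow> line_polynomial e p"
  unfolding line_polynomial_def
proof (intro allI)
  fix u v
  assume "\<forall>u v. \<exists>g. degree g \<le> d \<and> (\<forall>t. p (u + t *\<^sub>R v) = poly g t)" and de: "d \<le> e"
  then obtain g where "degree g \<le> d" "\<forall>t. p (u + t *\<^sub>R v) = poly g t" by blast
  with de show "\<exists>g. degree g \<le> e \<and> (\<forall>t. p (u + t *\<^sub>R v) = poly g t)"
    by (intro exI[of _ g]) simp
qed

lemma line_polynomial_sum:
  assumes "\<And>i. i \<in> I \<Longrightarrow> line_polynomial d (p i)"
  shows "line_polynomial d (\<lambda>x. \<Sum>i\<in>I. a i * p i x)"
  unfolding line_polynomial_def
proof (intro allI)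
  fix u v
  obtain g where g: "\<And>i. i \<in> I \<Longrightarrow> degree (g i) \<le> d \<and> (\<forall>t. p i (u + t *\<^sub>R v) = poly (g i) t)"
  proof -
    have "\<forall>i\<in>I. \<exists>g. degree g \<le> d \<and> (\<forall>t. p i (u + t *\<^sub>R v) = poly g t)"
      using assms unfolding line_polynomial_def by blast
    from bchoice[OF this] show thesis using that by blast
  qed
  show "\<exists>G. degree G \<le> d \<and> (\<forall>t. (\<Sum>i\<in>I. a i * p i (u + t *\<^sub>R v)) = poly G t)"
  proof (cases "finite I")
    case True
    have "degree (\<Sum>i\<in>I. smult (a i) (g i)) \<le> d"
      by (rule degree_sum_le[OF True]) (use g degree_smult_le order.trans in blast)
    then show ?thesis
      by (intro exI[of _ "\<Sum>i\<in>I. smult (a i) (g i)"]) (use g in \<open>auto simp: poly_sum\<close>)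
  qed (auto intro: exI[of _ 0])
qed

lemma continuous_on_monomial: "continuous_on S (monomial \<alpha>)"
  unfolding monomial_def by (intro continuous_intros)

lemma norm_vec_le_sqrt_card:
  fixes z :: "real ^ 'n"
  assumes "\<And>i. \<bar>z $ i\<bar> \<le> r" and "r \<ge> 0"
  shows "norm z \<le> sqrt (real CARD('n)) * r"
proof -
  have "(norm z)\<^sup>2 = (\<Sum>i\<in>UNIV. (z $ i)\<^sup>2)"
    by (simp add: norm_vec_def L2_set_def sum_nonneg)
  also have "\<dots> \<le> (\<Sum>i\<in>(UNIV::'n set). r\<^sup>2)"
    using assms by (intro sum_mono) (simp add: abs_le_square_iff[symmetric])
  also have "\<dots> = (sqrt (real CARD('n)) * r)\<^sup>2" by (simp add: power_mult_distrib)
  finally show ?thesis by (rule power2_le_imp_le) (use assms in simp)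
qed

lemma mem_cube_iff: "x \<in> cube U a s \<longleftrightarrow> (\<exists>z. x = a + U z \<and> (\<forall>i. 0 \<le> z $ i \<and> z $ i \<le> s))"
  unfolding cube_def by auto

lemma ball_in_cube:
  fixes U :: "real ^ 'n \<Rightarrow> real ^ 'n" and a :: "real ^ 'n"
  assumes U: "orthogonal_transformation U" and s: "s \<ge> 0"
  defines "c \<equiv> a + U (\<chi> i. s / 2)"
  shows "cball c (s / 2) \<subseteq> cube U a s"
    and "x \<in> cube U a s \<Longrightarrow> norm (x - c) \<le> sqrt (real CARD('n)) * (s / 2)"
proof -
  have lin: "linear U" using U by (rule orthogonal_transformation_linear)
  show "cball c (s / 2) \<subseteq> cube U a s"
  proof
    fix y assume y: "y \<in> cball c (s / 2)"
    obtain z where z: "y - a = U z" using orthogonal_transformation_surj[OF U] by (metis surjD)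
    have "y - c = U (z - (\<chi> i. s / 2))" using z by (simp add: c_def linear_diff[OF lin] algebra_simps)
    then have "norm (z - (\<chi> i. s / 2)) \<le> s / 2"
      using y by (simp add: dist_norm norm_minus_commute[of c] orthogonal_transformation_norm[OF U])
    then have "\<bar>z $ i - s / 2\<bar> \<le> s / 2" for i
      using component_le_norm_cart[of "z - (\<chi> i. s / 2)" i] by simp
    then have "0 \<le> z $ i \<and> z $ i \<le> s" for i by (smt (verit) field_sum_of_halves)
    then show "y \<in> cube U a s" using z by (auto simp: mem_cube_iff algebra_simps intro!: exI[of _ z])
  qed
  assume "x \<in> cube U a s"
  then obtain z where z: "x = a + U z" "\<And>i. 0 \<le> z $ i \<and> z $ i \<le> s" by (auto simp: mem_cube_iff)
  have "x - c = U (z - (\<chi> i. s / 2))" using z by (simp add: c_def linear_diff[OF lin])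
  then have "norm (x - c) = norm (z - (\<chi> i. s / 2))" by (simp add: orthogonal_transformation_norm[OF U])
  also have "\<dots> \<le> sqrt (real CARD('n)) * (s / 2)"
  proof (rule norm_vec_le_sqrt_card)
    fix i show "\<bar>(z - (\<chi> i. s / 2)) $ i\<bar> \<le> s / 2" using z(2)[of i] by (simp add: abs_le_iff field_simps)
  qed (use s in simp)
  finally show "norm (x - c) \<le> sqrt (real CARD('n)) * (s / 2)" .
qed

lemma cube_diameter:
  fixes U :: "real ^ 'n \<Rightarrow> real ^ 'n"
  assumes U: "orthogonal_transformation U" and s: "s \<ge> 0" and "x \<in> cube U a s" "y \<in> cube U a s"
  shows "norm (x - y) \<le> sqrt (real CARD('n)) * s"
proof -
  obtain u v where u: "x = a + U u" "\<And>i. 0 \<le> u $ i \<and> u $ i \<le> s"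
    and v: "y = a + U v" "\<And>i. 0 \<le> v $ i \<and> v $ i \<le> s"
    using assms(3,4) by (auto simp: mem_cube_iff)
  have "x - y = U (u - v)"
    using u v by (simp add: linear_diff[OF orthogonal_transformation_linear[OF U]])
  then have "norm (x - y) = norm (u - v)" by (simp add: orthogonal_transformation_norm[OF U])
  also have "\<dots> \<le> sqrt (real CARD('n)) * s"
  proof (rule norm_vec_le_sqrt_card)
    fix i show "\<bar>(u - v) $ i\<bar> \<le> s" using u(2)[of i] v(2)[of i] by (simp add: abs_le_iff)
  qed (use s in simp)
  finally show ?thesis .
qed

lemma subcube_containing:
  fixes U :: "real ^ 'n \<Rightarrow> real ^ 'n"
  assumes U: "orthogonal_transformation U" and s: "0 \<le> s" "s \<le> b" and x: "x \<in> cube U a b"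
  obtains a' where "cube U a' s \<subseteq> cube U a b" "x \<in> cube U a' s"
proof -
  have lin: "linear U" using U by (rule orthogonal_transformation_linear)
  obtain z where z: "x = a + U z" "\<And>i. 0 \<le> z $ i \<and> z $ i \<le> b" using x by (auto simp: mem_cube_iff)
  \<comment> \<open>The vertex is placed at \<open>x\<close> and pulled back just far enough for the subcube to stay inside.\<close>
  define k :: "real ^ 'n" where "k = (\<chi> i. min (z $ i) (b - s))"
  have k: "0 \<le> k $ i" "k $ i \<le> b - s" "k $ i \<le> z $ i" "z $ i \<le> k $ i + s" for i
    using z(2)[of i] s by (auto simp: k_def min_def)
  show thesis
  proof
    show "cube U (a + U k) s \<subseteq> cube U a b"
    proof
      fix y assume "y \<in> cube U (a + U k) s"
      then obtain v where v: "y = a + U k + U v" "\<And>i. 0 \<le> v $ i \<and> v $ i \<le> s"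
        by (auto simp: mem_cube_iff)
      have "0 \<le> (k + v) $ i \<and> (k + v) $ i \<le> b" for i
        using k(1,2)[of i] v(2)[of i] by auto
      then show "y \<in> cube U a b"
        unfolding mem_cube_iff v(1) by (intro exI[of _ "k + v"]) (auto simp: linear_add[OF lin])
    qed
    show "x \<in> cube U (a + U k) s"
      unfolding mem_cube_iff z(1)
    proof (intro exI[of _ "z - k"] conjI allI)
      fix i show "0 \<le> (z - k) $ i" "(z - k) $ i \<le> s" using k(3,4)[of i] by auto
    qed (simp add: linear_diff[OF lin])
  qed
qed

text \<open>One point of \<open>X\<close> is taken from each of the \<open>q\<^sup>n\<close> cells of the cube.\<close>

lemma grid_selection:
  fixes U :: "real ^ 'n \<Rightarrow> real ^ 'n"
  assumes U: "orthogonal_transformation U" and \<delta>: "\<delta> > 0" and q: "q > 0"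
    and hit: "\<And>a'. cube U a' \<delta> \<subseteq> cube U a (real q * \<delta>) \<Longrightarrow> cube U a' \<delta> \<inter> X \<noteq> {}"
  obtains Y where "Y \<subseteq> X" "Y \<subseteq> cube U a (real q * \<delta>)" "finite Y" "card Y \<le> q ^ CARD('n)"
    "\<And>x. x \<in> cube U a (real q * \<delta>) \<Longrightarrow> \<exists>y\<in>Y. norm (y - x) \<le> sqrt (real CARD('n)) * \<delta>"
proof -
  have lin: "linear U" using U by (rule orthogonal_transformation_linear)
  define v :: "('n \<Rightarrow> nat) \<Rightarrow> real ^ 'n" where "v k = (\<chi> i. \<delta> * real (k i))" for k
  define K where "K = PiE (UNIV :: 'n set) (\<lambda>_. {..<q})"
  have "finite K" unfolding K_def by (intro finite_PiE) auto
  have "card K = q ^ CARD('n)" by (simp add: K_def card_PiE)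
  have sub: "cube U (a + U (v k)) \<delta> \<subseteq> cube U a (real q * \<delta>)" if "k \<in> K" for k
  proof
    fix y assume "y \<in> cube U (a + U (v k)) \<delta>"
    then obtain z where z: "y = a + U (v k) + U z" "\<And>i. 0 \<le> z $ i \<and> z $ i \<le> \<delta>"
      by (auto simp: mem_cube_iff)
    have "0 \<le> (v k + z) $ i \<and> (v k + z) $ i \<le> real q * \<delta>" for i
    proof -
      have "k i < q" using that by (auto simp: K_def PiE_UNIV_domain)
      then have "real (Suc (k i)) \<le> real q" unfolding of_nat_le_iff by simp
      then have "real (k i) + 1 \<le> real q" by simp
      then have "\<delta> * (real (k i) + 1) \<le> \<delta> * real q" using \<delta> by (intro mult_left_mono) auto
      then show ?thesis using z(2)[of i] \<delta> by (auto simp: v_def algebra_simps)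
    qed
    then show "y \<in> cube U a (real q * \<delta>)"
      unfolding mem_cube_iff z(1) by (intro exI[of _ "v k + z"]) (auto simp: linear_add[OF lin])
  qed
  then have "\<forall>k\<in>K. \<exists>y. y \<in> cube U (a + U (v k)) \<delta> \<inter> X" using hit by blast
  then obtain f where f: "\<And>k. k \<in> K \<Longrightarrow> f k \<in> cube U (a + U (v k)) \<delta> \<inter> X" by metis
  show thesis
  proof
    show "f ` K \<subseteq> X" "f ` K \<subseteq> cube U a (real q * \<delta>)" using f sub by auto
    show "finite (f ` K)" using \<open>finite K\<close> by simp
    show "card (f ` K) \<le> q ^ CARD('n)"
      using card_image_le[OF \<open>finite K\<close>] \<open>card K = _\<close> by metis
    fix x assume "x \<in> cube U a (real q * \<delta>)"
    then obtain z where z: "x = a + U z" "\<And>i. 0 \<le> z $ i \<and> z $ i \<le> real q * \<delta>"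
      by (auto simp: mem_cube_iff)
    \<comment> \<open>The cut-off at \<open>q - 1\<close> assigns the points on the far faces to the last cells.\<close>
    define k where "k i = min (nat \<lfloor>z $ i / \<delta>\<rfloor>) (q - 1)" for i
    have kK: "k \<in> K" using q by (auto simp: K_def k_def PiE_UNIV_domain min_less_iff_disj)
    have kz: "\<delta> * real (k i) \<le> z $ i" "z $ i \<le> \<delta> * real (k i) + \<delta>" for i
    proof -
      have zd: "0 \<le> z $ i / \<delta>" "z $ i / \<delta> \<le> real q" using z(2)[of i] \<delta> by (auto simp: field_simps)
      have fl: "real (nat \<lfloor>z $ i / \<delta>\<rfloor>) \<le> z $ i / \<delta>" "z $ i / \<delta> \<le> real (nat \<lfloor>z $ i / \<delta>\<rfloor>) + 1"
        using zd(1) of_int_floor_le[of "z $ i / \<delta>"] real_of_int_floor_add_one_ge[of "z $ i / \<delta>"]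
        by (simp_all only: of_nat_nat zero_le_floor)
      have "real (k i) \<le> z $ i / \<delta>" using fl(1) unfolding k_def by linarith
      then show "\<delta> * real (k i) \<le> z $ i" using \<delta> by (simp add: field_simps)
      have "z $ i / \<delta> \<le> real (k i) + 1" using fl(2) zd(2) q unfolding k_def by (auto simp: min_def)
      then show "z $ i \<le> \<delta> * real (k i) + \<delta>" using \<delta> by (simp add: field_simps)
    qed
    have "x \<in> cube U (a + U (v k)) \<delta>"
      unfolding mem_cube_iff z(1)
    proof (intro exI[of _ "z - v k"] conjI allI)
      fix i show "0 \<le> (z - v k) $ i" "(z - v k) $ i \<le> \<delta>" using kz[of i] by (auto simp: v_def)
    qed (simp add: linear_diff[OF lin])
    then have "norm (f k - x) \<le> sqrt (real CARD('n)) * \<delta>"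
      using f[OF kK] \<delta> by (intro cube_diameter[OF U]) auto
    then show "\<exists>y\<in>f ` K. norm (y - x) \<le> sqrt (real CARD('n)) * \<delta>" using kK by blast
  qed
qed

text \<open>The selected grid points norm the polynomials of degree \<open>d\<close>, so evaluation at \<open>x\<close> is bounded by their
  square norm on these points, and duality supplies the weights. Passing to the sum of absolute values costs
  the square root of the number of points.\<close>

lemma local_polynomial_reproduction:
  fixes U :: "real ^ 'n \<Rightarrow> real ^ 'n"
  assumes U: "orthogonal_transformation U" and \<delta>: "\<delta> > 0" and q: "q > 0" and d: "d \<ge> 1"
    and fine: "sqrt (real CARD('n)) * (real d + 1) \<le> 59 / 1000 * real q"
    and hit: "\<And>a'. cube U a' \<delta> \<subseteq> cube U a (real q * \<delta>) \<Longrightarrow> cube U a' \<delta> \<inter> X \<noteq> {}"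
    and x: "x \<in> cube U a (real q * \<delta>)"
  obtains Y \<sigma> where "Y \<subseteq> X" "finite Y"
    "\<And>\<alpha>. multi_degree \<alpha> \<le> d \<Longrightarrow> (\<Sum>y\<in>Y. \<sigma> y * monomial \<alpha> y) = monomial \<alpha> x"
    "(\<Sum>y\<in>Y. \<bar>\<sigma> y\<bar>) \<le> 8 * (16 / 3 * sqrt (real CARD('n))) ^ d * sqrt (real q ^ CARD('n))"
    "\<And>y. y \<in> Y \<Longrightarrow> norm (y - x) \<le> sqrt (real CARD('n)) * (real q * \<delta>)"
proof -
  obtain Y where Y: "Y \<subseteq> X" "Y \<subseteq> cube U a (real q * \<delta>)" "finite Y" "card Y \<le> q ^ CARD('n)"
    "\<And>x. x \<in> cube U a (real q * \<delta>) \<Longrightarrow> \<exists>y\<in>Y. norm (y - x) \<le> sqrt (real CARD('n)) * \<delta>"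
    using grid_selection[OF U \<delta> q hit] by metis
  define n where "n = CARD('n)"
  define s where "s = real q * \<delta>"
  have s: "s > 0" using q \<delta> by (simp add: s_def)
  define \<Lambda> where "\<Lambda> = 8 * (16 / 3 * sqrt (real n)) ^ d"
  have \<Lambda>: "\<Lambda> \<ge> 0" by (simp add: \<Lambda>_def)
  define I where "I = {\<alpha> :: 'n \<Rightarrow> nat. multi_degree \<alpha> \<le> d}"
  have I: "finite I" unfolding I_def by (rule finite_multi_degree_le)
  define c where "c = a + U (\<chi> i. s / 2)"
  have bound: "\<bar>\<Sum>\<alpha>\<in>I. w \<alpha> * monomial \<alpha> x\<bar>
      \<le> \<Lambda> * sqrt (\<Sum>y\<in>Y. (\<Sum>\<alpha>\<in>I. w \<alpha> * monomial \<alpha> y)\<^sup>2)" for w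
    unfolding \<Lambda>_def
  proof (rule norming_mesh[where R = "s / 2" and c = c and Y = Y and \<epsilon> = "sqrt (real n) * \<delta>"])
    show "continuous_on UNIV (\<lambda>x. \<Sum>\<alpha>\<in>I. w \<alpha> * monomial \<alpha> x)"
      by (intro continuous_intros continuous_on_monomial)
    show "line_polynomial d (\<lambda>x. \<Sum>\<alpha>\<in>I. w \<alpha> * monomial \<alpha> x)"
      by (rule line_polynomial_sum) (auto simp: I_def intro: line_polynomial_mono[OF line_polynomial_monomial])
    show "sqrt (real n) * \<delta> * (real d + 1) \<le> 118 / 1000 * (s / 2)"
      using mult_right_mono[OF fine, of \<delta>] \<delta> by (simp add: n_def s_def mult_ac)
    show "\<exists>y\<in>Y. norm (y - z) \<le> sqrt (real n) * \<delta>" if "z \<in> cball c (s / 2)" for z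
      using ball_in_cube(1)[OF U, of s a] s that Y(5) unfolding c_def n_def s_def by auto
    show "norm (x - c) \<le> sqrt (real n) * (s / 2)"
      unfolding c_def n_def by (rule ball_in_cube(2)[OF U]) (use s x s_def in auto)
    show "\<bar>\<Sum>\<alpha>\<in>I. w \<alpha> * monomial \<alpha> y\<bar> \<le> sqrt (\<Sum>y\<in>Y. (\<Sum>\<alpha>\<in>I. w \<alpha> * monomial \<alpha> y)\<^sup>2)"
      if "y \<in> Y" for y
    proof (rule real_le_rsqrt)
      show "\<bar>\<Sum>\<alpha>\<in>I. w \<alpha> * monomial \<alpha> y\<bar>\<^sup>2 \<le> (\<Sum>y\<in>Y. (\<Sum>\<alpha>\<in>I. w \<alpha> * monomial \<alpha> y)\<^sup>2)"
        using member_le_sum[OF that, of "\<lambda>y. (\<Sum>\<alpha>\<in>I. w \<alpha> * monomial \<alpha> y)\<^sup>2"] Y(3) by simp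
    qed
    have "CARD('n) \<ge> 1" by simp
    then show "1 \<le> sqrt (real n)" by (simp add: n_def)
  qed (use d s \<delta> in auto)
  obtain w where w: "\<And>\<alpha>. \<alpha> \<in> I \<Longrightarrow> (\<Sum>y\<in>Y. (\<Sum>\<beta>\<in>I. w \<beta> * monomial \<beta> y) * monomial \<alpha> y) = monomial \<alpha> x"
    "(\<Sum>y\<in>Y. (\<Sum>\<beta>\<in>I. w \<beta> * monomial \<beta> y)\<^sup>2) \<le> \<Lambda>\<^sup>2"
    using exists_weights_of_square_bound[OF I Y(3), of "\<lambda>\<alpha>. monomial \<alpha> x" \<Lambda> monomial, OF bound] by blast
  define \<sigma> where "\<sigma> y = (\<Sum>\<beta>\<in>I. w \<beta> * monomial \<beta> y)" for y
  show thesis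
  proof
    show "(\<Sum>y\<in>Y. \<sigma> y * monomial \<alpha> y) = monomial \<alpha> x" if "multi_degree \<alpha> \<le> d" for \<alpha>
      using w(1)[of \<alpha>] that by (simp add: I_def \<sigma>_def)
    have "(\<Sum>y\<in>Y. \<bar>\<sigma> y\<bar> * 1)\<^sup>2 \<le> (\<Sum>y\<in>Y. \<bar>\<sigma> y\<bar>\<^sup>2) * (\<Sum>y\<in>Y. 1\<^sup>2)"
      by (rule Cauchy_Schwarz_ineq_sum)
    also have "\<dots> \<le> \<Lambda>\<^sup>2 * real q ^ n"
    proof (intro mult_mono)
      have "real (card Y) \<le> real (q ^ n)" using Y(4) unfolding n_def of_nat_le_iff .
      then show "(\<Sum>y\<in>Y. 1\<^sup>2) \<le> real q ^ n" by simp
    qed (use w(2) in \<open>auto simp: \<sigma>_def\<close>)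
    also have "\<dots> = (\<Lambda> * sqrt (real q ^ n))\<^sup>2" by (simp add: power_mult_distrib)
    finally have "(\<Sum>y\<in>Y. \<bar>\<sigma> y\<bar>)\<^sup>2 \<le> (\<Lambda> * sqrt (real q ^ n))\<^sup>2" by simp
    then have "(\<Sum>y\<in>Y. \<bar>\<sigma> y\<bar>) \<le> \<Lambda> * sqrt (real q ^ n)"
      by (rule power2_le_imp_le) (use \<Lambda> in simp)
    then show "(\<Sum>y\<in>Y. \<bar>\<sigma> y\<bar>) \<le> 8 * (16 / 3 * sqrt (real CARD('n))) ^ d * sqrt (real q ^ CARD('n))"
      by (simp add: \<Lambda>_def n_def)
    show "norm (y - x) \<le> sqrt (real CARD('n)) * (real q * \<delta>)" if "y \<in> Y" for y
      using cube_diameter[OF U _ _ x, of y] Y(2) that s s_def by auto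
  qed (use Y in auto)
qed

section \<open>Gaussian integrals\<close>

lemma lborel_integral_prod_Basis:
  fixes F :: "'a::euclidean_space \<Rightarrow> real \<Rightarrow> complex"
  assumes F: "\<And>b. b \<in> Basis \<Longrightarrow> integrable lborel (F b)"
  shows "integrable lborel (\<lambda>x::'a. \<Prod>b\<in>Basis. F b (x \<bullet> b))"
    and "(LINT x|lborel. (\<Prod>b\<in>Basis. F b ((x::'a) \<bullet> b))) = (\<Prod>b\<in>Basis. integral\<^sup>L lborel (F b))"
proof -
  interpret product_sigma_finite "\<lambda>_::'a. lborel :: real measure" ..
  have lb: "(lborel :: 'a measure) = distr (\<Pi>\<^sub>M b\<in>Basis. lborel) borel (\<lambda>f. \<Sum>b\<in>Basis. f b *\<^sub>R b)"
    by (subst lborel_def) (simp add: lborel_eq_real)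
  have [measurable]: "F b \<in> borel_measurable borel" if "b \<in> Basis" for b
    using borel_measurable_integrable[OF F[OF that]] by simp
  have m: "(\<lambda>f. \<Sum>b\<in>Basis. f b *\<^sub>R b) \<in> measurable (\<Pi>\<^sub>M b\<in>(Basis :: 'a set). lborel) borel"
    by measurable
  have g: "(\<lambda>x::'a. \<Prod>b\<in>Basis. F b (x \<bullet> b)) \<in> borel_measurable borel"
    by measurable
  have eq: "(\<Prod>b\<in>Basis. F b ((\<Sum>b\<in>Basis. f b *\<^sub>R b) \<bullet> b)) = (\<Prod>b\<in>(Basis :: 'a set). F b (f b))" for f
    by (intro prod.cong) auto
  show "integrable lborel (\<lambda>x::'a. \<Prod>b\<in>Basis. F b (x \<bullet> b))"
    unfolding lb integrable_distr_eq[OF m g] eq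
    by (rule product_integrable_prod) (use F in auto)
  show "(LINT x|lborel. (\<Prod>b\<in>Basis. F b ((x::'a) \<bullet> b))) = (\<Prod>b\<in>Basis. integral\<^sup>L lborel (F b))"
    unfolding lb integral_distr[OF m g] eq
    by (rule product_integral_prod) (use F in auto)
qed

text \<open>The characteristic function of the standard normal distribution, rescaled.\<close>

lemma gauss_fourier_real:
  fixes t \<xi> :: real
  assumes t: "t > 0"
  shows "integrable lborel (\<lambda>x. exp (- \<i> * of_real (x * \<xi>)) * complex_of_real (exp (- t * x\<^sup>2)))"
    and "(LINT x|lborel. exp (- \<i> * of_real (x * \<xi>)) * complex_of_real (exp (- t * x\<^sup>2)))
      = of_real (sqrt (pi / t) * exp (- \<xi>\<^sup>2 / (4 * t)))"
proof -
  define c where "c = sqrt (2 * t)"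
  have c: "c > 0" "c\<^sup>2 = 2 * t" using t by (auto simp: c_def)
  define s where "s = - \<xi> / c"
  have sc: "s * (c * x) = - (x * \<xi>)" for x using c by (simp add: s_def)
  let ?g = "\<lambda>x. std_normal_density x *\<^sub>R exp (\<i> * complex_of_real (s * x))"
  have gi: "integrable lborel ?g"
  proof (rule Bochner_Integration.integrable_bound[of _ std_normal_density])
    show "integrable lborel std_normal_density" by (rule integrable_normal_density) simp
    have "(\<lambda>x. exp (\<i> * complex_of_real (s * x))) \<in> borel_measurable borel"
      by (intro borel_measurable_continuous_onI continuous_intros)
    then show "?g \<in> borel_measurable lborel" by measurable
  qed (auto simp: normal_density_nonneg)
  have "(LINT x|lborel. ?g x) = char std_normal_distribution s"
    unfolding char_def by (subst integral_density) (auto simp: normal_density_nonneg)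
  also have "\<dots> = of_real (exp (- s\<^sup>2 / 2))" by (simp add: char_std_normal_distribution)
  finally have gint: "(LINT x|lborel. ?g x) = of_real (exp (- s\<^sup>2 / 2))" .
  have geq: "?g (0 + c * x) = of_real (1 / sqrt (2 * pi)) * (exp (- \<i> * of_real (x * \<xi>)) * of_real (exp (- t * x\<^sup>2)))" for x
  proof -
    have "std_normal_density (c * x) = 1 / sqrt (2 * pi) * exp (- t * x\<^sup>2)"
      using c by (simp add: std_normal_density_def power_mult_distrib)
    moreover have "exp (\<i> * complex_of_real (s * (c * x))) = exp (- \<i> * of_real (x * \<xi>))" unfolding sc by simp
    ultimately show ?thesis by (simp add: scaleR_conv_of_real mult_ac)
  qed
  have "integrable lborel (\<lambda>x. ?g (0 + c * x))"
    by (rule lborel_integrable_real_affine[OF gi]) (use c in simp)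
  then have "integrable lborel (\<lambda>x. of_real (sqrt (2 * pi)) * (of_real (1 / sqrt (2 * pi)) *
      (exp (- \<i> * of_real (x * \<xi>)) * complex_of_real (exp (- t * x\<^sup>2)))))"
    unfolding geq by (rule integrable_mult_right)
  then show "integrable lborel (\<lambda>x. exp (- \<i> * of_real (x * \<xi>)) * complex_of_real (exp (- t * x\<^sup>2)))"
    by (simp add: mult.assoc[symmetric] flip: of_real_mult)
  have "of_real (exp (- s\<^sup>2 / 2)) = \<bar>c\<bar> *\<^sub>R (LINT x|lborel. ?g (0 + c * x))"
    unfolding gint[symmetric] by (rule lborel_integral_real_affine) (use c in simp)
  also have "\<dots> = of_real (c / sqrt (2 * pi)) * (LINT x|lborel. exp (- \<i> * of_real (x * \<xi>)) * complex_of_real (exp (- t * x\<^sup>2)))"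
    unfolding geq using c by (simp add: scaleR_conv_of_real)
  finally have "(LINT x|lborel. exp (- \<i> * of_real (x * \<xi>)) * complex_of_real (exp (- t * x\<^sup>2)))
      = of_real (sqrt (2 * pi) / c * exp (- s\<^sup>2 / 2))"
    using c by (simp add: field_simps)
  also have "sqrt (2 * pi) / c = sqrt (pi / t)"
    by (simp add: c_def real_sqrt_divide[symmetric])
  also have "- s\<^sup>2 / 2 = - \<xi>\<^sup>2 / (4 * t)" using c by (simp add: s_def power_divide)
  finally show "(LINT x|lborel. exp (- \<i> * of_real (x * \<xi>)) * complex_of_real (exp (- t * x\<^sup>2)))
      = of_real (sqrt (pi / t) * exp (- \<xi>\<^sup>2 / (4 * t)))" .
qed

lemma norm_sq_eq_sum_Basis: "(norm (x::'a::euclidean_space))\<^sup>2 = (\<Sum>b\<in>Basis. (x \<bullet> b)\<^sup>2)"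
  unfolding power2_norm_eq_inner by (subst euclidean_inner) (simp add: power2_eq_square)

lemma gauss_fourier:
  fixes \<xi> :: "'a::euclidean_space"
  assumes t: "t > 0"
  shows "integrable lborel (\<lambda>x::'a. exp (- \<i> * of_real (x \<bullet> \<xi>)) * complex_of_real (exp (- t * (norm x)\<^sup>2)))"
    and "fourier (\<lambda>x. of_real (exp (- t * (norm x)\<^sup>2))) \<xi>
      = of_real (sqrt (pi / t) ^ DIM('a) * exp (- (norm \<xi>)\<^sup>2 / (4 * t)))"
proof -
  let ?F = "\<lambda>b x. exp (- \<i> * of_real (x * (\<xi> \<bullet> b))) * complex_of_real (exp (- t * x\<^sup>2))"
  have eq: "exp (- \<i> * of_real (x \<bullet> \<xi>)) * complex_of_real (exp (- t * (norm x)\<^sup>2))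
      = (\<Prod>b\<in>Basis. ?F b (x \<bullet> b))" for x :: 'a
  proof -
    have "exp (- \<i> * of_real (x \<bullet> \<xi>)) = (\<Prod>b\<in>Basis. exp (- \<i> * of_real ((x \<bullet> b) * (\<xi> \<bullet> b))))"
      by (subst exp_sum[symmetric]) (auto simp: euclidean_inner[of x \<xi>] sum_distrib_left sum_negf)
    moreover have "exp (- t * (norm x)\<^sup>2) = (\<Prod>b\<in>Basis. exp (- t * (x \<bullet> b)\<^sup>2))"
      by (subst exp_sum[symmetric]) (auto simp: norm_sq_eq_sum_Basis sum_distrib_left)
    ultimately show ?thesis by (simp only: of_real_prod prod.distrib)
  qed
  show "integrable lborel (\<lambda>x::'a. exp (- \<i> * of_real (x \<bullet> \<xi>)) * complex_of_real (exp (- t * (norm x)\<^sup>2)))"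
    unfolding eq by (rule lborel_integral_prod_Basis(1)) (rule gauss_fourier_real(1)[OF t])
  have "fourier (\<lambda>x. of_real (exp (- t * (norm x)\<^sup>2))) \<xi> = (\<Prod>b\<in>Basis. integral\<^sup>L lborel (?F b))"
    unfolding fourier_def eq by (rule lborel_integral_prod_Basis(2)) (rule gauss_fourier_real(1)[OF t])
  also have "\<dots> = (\<Prod>b\<in>Basis. of_real (sqrt (pi / t) * exp (- (\<xi> \<bullet> b)\<^sup>2 / (4 * t))))"
    by (simp only: gauss_fourier_real(2)[OF t])
  also have "\<dots> = of_real (\<Prod>b\<in>(Basis::'a set). sqrt (pi / t) * exp (- (\<xi> \<bullet> b)\<^sup>2 / (4 * t)))" by simp
  also have "(\<Prod>b\<in>(Basis::'a set). sqrt (pi / t) * exp (- (\<xi> \<bullet> b)\<^sup>2 / (4 * t)))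
      = sqrt (pi / t) ^ DIM('a) * exp (- (norm \<xi>)\<^sup>2 / (4 * t))"
    by (simp add: prod.distrib exp_sum[symmetric] norm_sq_eq_sum_Basis sum_divide_distrib[symmetric] sum_negf)
  finally show "fourier (\<lambda>x. of_real (exp (- t * (norm x)\<^sup>2))) \<xi>
      = of_real (sqrt (pi / t) ^ DIM('a) * exp (- (norm \<xi>)\<^sup>2 / (4 * t)))" .
qed

lemma gauss_integral:
  assumes t: "t > 0"
  shows "integrable lborel (\<lambda>x::'a::euclidean_space. exp (- t * (norm x)\<^sup>2))"
    and "(LINT x|lborel. exp (- t * (norm (x::'a))\<^sup>2)) = sqrt (pi / t) ^ DIM('a)"
proof -
  have "integrable lborel (\<lambda>x::'a. complex_of_real (exp (- t * (norm x)\<^sup>2)))"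
    using gauss_fourier(1)[OF t, of "0::'a"] by simp
  then show "integrable lborel (\<lambda>x::'a. exp (- t * (norm x)\<^sup>2))"
    by (simp only: complex_of_real_integrable_eq)
  have "complex_of_real (LINT x|lborel. exp (- t * (norm (x::'a))\<^sup>2)) = of_real (sqrt (pi / t) ^ DIM('a))"
    using gauss_fourier(2)[OF t, of "0::'a"] unfolding fourier_def
    by (simp add: integral_complex_of_real[symmetric] del: integral_complex_of_real)
  then show "(LINT x|lborel. exp (- t * (norm (x::'a))\<^sup>2)) = sqrt (pi / t) ^ DIM('a)"
    by (simp only: of_real_eq_iff)
qed

lemma lborel_translate:
  fixes f :: "'a::euclidean_space \<Rightarrow> 'b::{banach, second_countable_topology}"
  assumes [measurable]: "f \<in> borel_measurable borel"
  shows "(LINT x|lborel. f (c + x)) = (LINT x|lborel. f x)"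
    and "integrable lborel (\<lambda>x. f (c + x)) \<longleftrightarrow> integrable lborel f"
proof -
  have "(LINT x|distr lborel borel ((+) c). f x) = (LINT x|lborel. f (c + x))"
    by (rule integral_distr) auto
  then show "(LINT x|lborel. f (c + x)) = (LINT x|lborel. f x)" by (simp add: lborel_distr_plus)
  have "integrable (distr lborel borel ((+) c)) f \<longleftrightarrow> integrable lborel (\<lambda>x. f (c + x))"
    by (rule integrable_distr_eq) auto
  then show "integrable lborel (\<lambda>x. f (c + x)) \<longleftrightarrow> integrable lborel f" by (simp add: lborel_distr_plus)
qed

text \<open>Completing the square.\<close>

lemma gauss_exponential_moment:
  fixes v :: "'a::euclidean_space"
  assumes t: "t > 0"
  shows "integrable lborel (\<lambda>x::'a. exp (- t * (norm x)\<^sup>2 + x \<bullet> v))"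
    and "(LINT x|lborel. exp (- t * (norm (x::'a))\<^sup>2 + x \<bullet> v))
      = sqrt (pi / t) ^ DIM('a) * exp ((norm v)\<^sup>2 / (4 * t))"
proof -
  define c where "c = (- (1 / (2 * t))) *\<^sub>R v"
  have eq: "exp (- t * (norm x)\<^sup>2 + x \<bullet> v) = exp ((norm v)\<^sup>2 / (4 * t)) * exp (- t * (norm (c + x))\<^sup>2)" for x :: 'a
  proof -
    have "- t * (norm x)\<^sup>2 + x \<bullet> v = (norm v)\<^sup>2 / (4 * t) + - t * (norm (c + x))\<^sup>2"
      using t unfolding c_def power2_norm_eq_inner
      by (simp add: inner_add inner_diff inner_commute power2_eq_square field_simps)
    then show ?thesis by (simp only: exp_add)
  qed
  have m: "(\<lambda>x::'a. exp (- t * (norm x)\<^sup>2)) \<in> borel_measurable borel" by measurable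
  show "integrable lborel (\<lambda>x::'a. exp (- t * (norm x)\<^sup>2 + x \<bullet> v))"
    unfolding eq using gauss_integral(1)[OF t] lborel_translate(2)[OF m, of c] by simp
  show "(LINT x|lborel. exp (- t * (norm (x::'a))\<^sup>2 + x \<bullet> v))
      = sqrt (pi / t) ^ DIM('a) * exp ((norm v)\<^sup>2 / (4 * t))"
    unfolding eq using gauss_integral(2)[OF t, where 'a='a] lborel_translate(1)[OF m, of c] by simp
qed

lemma power_even_le_exp:
  fixes s :: real
  shows "s ^ (2 * k) \<le> fact (2 * k) * (exp s + exp (- s))"
proof -
  have *: "u ^ m \<le> fact m * exp u" if "u \<ge> 0" for u :: real and m
  proof -
    have "(\<Sum>i\<in>{m}. u ^ i /\<^sub>R fact i) \<le> (\<Sum>i. u ^ i /\<^sub>R fact i)"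
      by (rule sum_le_suminf[OF summable_exp_generic]) (use that in auto)
    then show ?thesis by (simp add: exp_def field_simps)
  qed
  have "s ^ (2 * k) = \<bar>s\<bar> ^ (2 * k)" by (simp add: power_even_abs)
  also have "\<dots> \<le> fact (2 * k) * exp \<bar>s\<bar>" by (rule *) simp
  also have "\<dots> \<le> fact (2 * k) * (exp s + exp (- s))"
    by (intro mult_left_mono) (auto simp: abs_if)
  finally show ?thesis .
qed

text \<open>A product majorant supplies the integrability on the product space that Fubini's theorem asks for.\<close>

lemma Fubini_dominated:
  fixes f :: "'a \<Rightarrow> 'b \<Rightarrow> complex"
  assumes "sigma_finite_measure M" "sigma_finite_measure N"
    and m: "(\<lambda>(x, y). f x y) \<in> borel_measurable (M \<Otimes>\<^sub>M N)"
    and \<Phi>: "integrable M \<Phi>" and \<Theta>: "integrable N \<Theta>"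
    and bound: "\<And>x y. norm (f x y) \<le> \<Phi> x * \<Theta> y"
  shows "(LINT x|M. LINT y|N. f x y) = (LINT y|N. LINT x|M. f x y)"
    and "integrable M (\<lambda>x. LINT y|N. f x y)"
    and "integrable N (\<lambda>y. LINT x|M. f x y)"
proof -
  have P: "pair_sigma_finite M N" using assms(1,2) by (simp add: pair_sigma_finite_def)
  note [measurable] = m borel_measurable_integrable[OF \<Phi>] borel_measurable_integrable[OF \<Theta>]
  have i2: "integrable N (\<lambda>y. f x y)" if "x \<in> space M" for x
  proof (rule Bochner_Integration.integrable_bound[of _ "\<lambda>y. \<Phi> x * \<Theta> y"])
    show "(\<lambda>y. f x y) \<in> borel_measurable N"
      using measurable_Pair2[OF m, of x] that by simp
    show "AE y in N. norm (f x y) \<le> norm (\<Phi> x * \<Theta> y)"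
      using bound order.trans[OF _ abs_ge_self] by (auto intro!: always_eventually)
  qed (use \<Theta> in simp)
  have prod: "integrable (M \<Otimes>\<^sub>M N) (\<lambda>(x, y). f x y)"
  proof (rule pair_sigma_finite.Fubini_integrable[OF P m])
    show "AE x in M. integrable N (\<lambda>y. case (x, y) of (x, y) \<Rightarrow> f x y)"
      using i2 by (auto intro: AE_I2)
    show "integrable M (\<lambda>x. LINT y|N. norm (case (x, y) of (x, y) \<Rightarrow> f x y))"
    proof (rule Bochner_Integration.integrable_bound[of _ "\<lambda>x. \<Phi> x * (LINT y|N. \<Theta> y)"])
      show "AE x in M. norm (LINT y|N. norm (case (x, y) of (x, y) \<Rightarrow> f x y))
          \<le> norm (\<Phi> x * (LINT y|N. \<Theta> y))"
      proof (intro AE_I2)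
        fix x assume x: "x \<in> space M"
        have "(LINT y|N. norm (f x y)) \<le> (LINT y|N. \<Phi> x * \<Theta> y)"
          by (rule integral_mono) (use i2[OF x] \<Theta> bound in auto)
        moreover have "(LINT y|N. norm (f x y)) \<ge> 0" by simp
        ultimately show "norm (LINT y|N. norm (case (x, y) of (x, y) \<Rightarrow> f x y))
          \<le> norm (\<Phi> x * (LINT y|N. \<Theta> y))" by simp
      qed
      show "(\<lambda>x. LINT y|N. norm (case (x, y) of (x, y) \<Rightarrow> f x y)) \<in> borel_measurable M"
        by (rule sigma_finite_measure.borel_measurable_lebesgue_integral[OF assms(2)]) (use m in measurable)
    qed (use \<Phi> in simp_all)
  qed
  show "(LINT x|M. LINT y|N. f x y) = (LINT y|N. LINT x|M. f x y)"
    using pair_sigma_finite.Fubini_integral[OF P prod] by simp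
  show "integrable M (\<lambda>x. LINT y|N. f x y)"
    using pair_sigma_finite.integrable_fst[OF P prod] by simp
  show "integrable N (\<lambda>y. LINT x|M. f x y)"
    using pair_sigma_finite.integrable_snd[OF P prod] by simp
qed

text \<open>An integrable majorant for functions that decay faster than a high power of the norm.\<close>

lemma integrable_cauchy_product:
  "integrable lborel (\<lambda>x::'a::euclidean_space. \<Prod>b\<in>Basis. 1 / (1 + (x \<bullet> b)\<^sup>2))"
proof -
  have "integrable lborel (\<lambda>x::real. 1 / (1 + x\<^sup>2))"
    using integrable_inverse_1_plus_square
    by (simp add: set_integrable_def einterval_def inverse_eq_divide)
  then have "integrable lborel (\<lambda>x::real. complex_of_real (1 / (1 + x\<^sup>2)))"
    by (simp only: complex_of_real_integrable_eq)
  from lborel_integral_prod_Basis(1)[of "\<lambda>_::'a. \<lambda>x. complex_of_real (1 / (1 + x\<^sup>2))", OF this]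
  have "integrable lborel (\<lambda>x::'a. complex_of_real (\<Prod>b\<in>Basis. 1 / (1 + (x \<bullet> b)\<^sup>2)))"
    by (simp only: of_real_prod)
  then show ?thesis by (simp only: complex_of_real_integrable_eq)
qed

section \<open>Smooth functions and mollifiers\<close>

lemma C_k_SucD: "C_k (Suc k) f \<Longrightarrow> C_k k f"
proof (induction k arbitrary: f)
  case 0
  then show ?case
    by (auto simp: continuous_on_eq_continuous_at intro: differentiable_imp_continuous_within)
next
  case (Suc k)
  then show ?case by (simp only: C_k.simps(2)) blast
qed

lemma C_k_SucI:
  assumes "\<And>x. (f has_derivative f' x) (at x)" and "\<And>v. C_k k (\<lambda>x. f' x v)"
  shows "C_k (Suc k) f"
proof -
  have "frechet_derivative f (at x) = f' x" for x
    using frechet_derivative_at[OF assms(1)] by simp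
  then show ?thesis using assms by (auto simp: differentiable_def)
qed

lemma C_k_Suc_has_derivative:
  "C_k (Suc k) f \<Longrightarrow> (f has_derivative frechet_derivative f (at x)) (at x)"
  by (simp add: frechet_derivative_works)

lemma C_k_const: "C_k k (\<lambda>x. c)"
proof (induction k arbitrary: c)
  case (Suc k)
  show ?case by (rule C_k_SucI[where f' = "\<lambda>x v. 0"]) (auto intro: Suc)
qed simp

lemma C_k_add: "C_k k f \<Longrightarrow> C_k k g \<Longrightarrow> C_k k (\<lambda>x. f x + g x)"
proof (induction k arbitrary: f g)
  case 0
  then show ?case by (simp add: continuous_on_add)
next
  case (Suc k)
  have "C_k k (\<lambda>x. frechet_derivative f (at x) v)" "C_k k (\<lambda>x. frechet_derivative g (at x) v)" for v
    using Suc.prems by auto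
  then show ?case
    by (intro C_k_SucI[where f' = "\<lambda>x v. frechet_derivative f (at x) v + frechet_derivative g (at x) v"]
          has_derivative_add Suc.IH)
      (use Suc.prems C_k_Suc_has_derivative in blast)+
qed

lemma C_k_mult: "C_k k f \<Longrightarrow> C_k k g \<Longrightarrow> C_k k (\<lambda>x. f x * g x)"
proof (induction k arbitrary: f g)
  case 0
  then show ?case by (simp add: continuous_on_mult)
next
  case (Suc k)
  have "C_k k f" "C_k k g" using Suc.prems by (auto intro: C_k_SucD simp del: C_k.simps)
  moreover have "C_k k (\<lambda>x. frechet_derivative f (at x) v)" "C_k k (\<lambda>x. frechet_derivative g (at x) v)" for v
    using Suc.prems by auto
  ultimately show ?case
    by (intro C_k_SucI[where f' = "\<lambda>x v. f x * frechet_derivative g (at x) v + frechet_derivative f (at x) v * g x"]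
          has_derivative_mult C_k_add Suc.IH)
      (use Suc.prems C_k_Suc_has_derivative in blast)+
qed

lemma C_k_sum: "(\<And>i. i \<in> I \<Longrightarrow> C_k k (f i)) \<Longrightarrow> C_k k (\<lambda>x. \<Sum>i\<in>I. f i x)"
  by (induction I rule: infinite_finite_induct) (auto intro: C_k_const C_k_add)

lemma C_k_translate: "C_k k f \<Longrightarrow> C_k k (\<lambda>x. f (x - z))"
proof (induction k arbitrary: f)
  case 0
  then show ?case by (auto intro!: continuous_on_compose2[of UNIV f] continuous_intros)
next
  case (Suc k)
  have "((\<lambda>x. f (x - z)) has_derivative (\<lambda>v. frechet_derivative f (at (x - z)) v)) (at x)" for x
    by (rule has_derivative_compose[of "\<lambda>x. x - z" "\<lambda>v. v", OF _ C_k_Suc_has_derivative[OF Suc.prems]])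
      (auto intro!: derivative_eq_intros)
  then show ?case
    by (rule C_k_SucI) (use Suc in auto)
qed

lemma C_k_inner: "C_k k (\<lambda>x. complex_of_real (x \<bullet> v))"
proof (cases k)
  case 0
  then show ?thesis by (simp add: continuous_intros)
next
  case (Suc j)
  show ?thesis unfolding Suc
    by (rule C_k_SucI[where f' = "\<lambda>x w. complex_of_real (w \<bullet> v)"])
      (auto intro!: derivative_eq_intros C_k_const)
qed

text \<open>Up to linear combinations the functions \<open>t\<^sup>-\<^sup>j exp (-1/t)\<close> are closed under differentiation. The standard bump
  function is therefore smooth without any estimate on its higher derivatives.\<close>

definition flat :: "nat \<Rightarrow> real \<Rightarrow> real" where
  "flat j t = (if t > 0 then inverse t ^ j * exp (- inverse t) else 0)"

text \<open>Quadratic decay at the origin gives differentiability there.\<close>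

lemma flat_le_sq: "\<bar>flat j t\<bar> \<le> fact (j + 2) * t\<^sup>2"
proof (cases "t > 0")
  case True
  define u where "u = inverse t"
  have u: "u > 0" using True by (simp add: u_def)
  have "u ^ (j + 2) \<le> fact (j + 2) * exp u"
  proof -
    have "(\<Sum>i\<in>{j + 2}. u ^ i /\<^sub>R fact i) \<le> (\<Sum>i. u ^ i /\<^sub>R fact i)"
      by (rule sum_le_suminf[OF summable_exp_generic]) (use u in auto)
    then show ?thesis by (simp add: exp_def field_simps del: fact_Suc)
  qed
  then have "u ^ j * u\<^sup>2 * exp (- u) \<le> fact (j + 2)"
    by (simp add: exp_minus field_simps power_add power2_eq_square del: fact_Suc)
  then have "u ^ j * exp (- u) * u\<^sup>2 * t\<^sup>2 \<le> fact (j + 2) * t\<^sup>2"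
    by (intro mult_right_mono) (auto simp: mult_ac simp del: fact_Suc)
  moreover have "u\<^sup>2 * t\<^sup>2 = 1" using True by (simp add: u_def power_mult_distrib[symmetric])
  ultimately have "u ^ j * exp (- u) \<le> fact (j + 2) * t\<^sup>2" by (simp only: mult.assoc mult_1_right)
  then show ?thesis using True u by (simp add: flat_def u_def abs_mult del: fact_Suc)
next
  case False
  then show ?thesis by (simp add: flat_def del: fact_Suc)
qed

lemma flat_has_derivative:
  "(flat j has_real_derivative (flat (j + 2) t - real j * flat (j + 1) t)) (at t)"
proof -
  consider "t > 0" | "t < 0" | "t = 0" by linarith
  then show ?thesis
  proof cases
    case 1
    have "((\<lambda>t. inverse t ^ j * exp (- inverse t)) has_real_derivative
        (flat (j + 2) t - real j * flat (j + 1) t)) (at t)"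
    proof -
      define u where "u = inverse t"
      have "((\<lambda>t. inverse t ^ j * exp (- inverse t)) has_real_derivative
          real j * u ^ (j - 1) * - (u * u) * exp (- u) + u ^ j * (exp (- u) * (u * u))) (at t)"
        unfolding u_def using 1 by (auto intro!: derivative_eq_intros simp: power2_eq_square)
      also have "real j * u ^ (j - 1) * - (u * u) * exp (- u) + u ^ j * (exp (- u) * (u * u))
          = flat (j + 2) t - real j * flat (j + 1) t"
        using 1 by (cases j) (auto simp: flat_def u_def[symmetric] algebra_simps)
      finally show ?thesis .
    qed
    then show ?thesis
      by (rule has_field_derivative_transform_within_open[of _ _ _ "{0<..}"]) (use 1 in \<open>auto simp: flat_def\<close>)
  next
    case 2
    have "((\<lambda>t::real. 0) has_real_derivative (flat (j + 2) t - real j * flat (j + 1) t)) (at t)"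
      using 2 by (simp add: flat_def)
    then show ?thesis
      by (rule has_field_derivative_transform_within_open[of _ _ _ "{..<0}"]) (use 2 in \<open>auto simp: flat_def\<close>)
  next
    case 3
    have "((\<lambda>h. flat j h / h) \<longlongrightarrow> 0) (at 0)"
    proof (rule tendsto_rabs_zero_cancel,
        rule tendsto_sandwich[where f = "\<lambda>_. 0" and h = "\<lambda>h. fact (j + 2) * \<bar>h\<bar>"])
      show "((\<lambda>h::real. fact (j + 2) * \<bar>h\<bar>) \<longlongrightarrow> 0) (at 0)"
        by (auto intro!: tendsto_eq_intros)
      show "\<forall>\<^sub>F h in at 0. \<bar>flat j h / h\<bar> \<le> fact (j + 2) * \<bar>h\<bar>"
        unfolding eventually_at_filter
      proof (intro always_eventually allI impI)
        fix h :: real assume "h \<noteq> 0"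
        then show "\<bar>flat j h / h\<bar> \<le> fact (j + 2) * \<bar>h\<bar>"
          using flat_le_sq[of j h] by (simp add: abs_divide field_simps power2_eq_square del: fact_Suc)
      qed
    qed auto
    then show ?thesis using 3 by (simp add: has_field_derivative_iff flat_def)
  qed
qed

lemma C_k_flat_ball:
  "C_k k (\<lambda>x::'a::euclidean_space. complex_of_real (flat j (r\<^sup>2 - (norm x)\<^sup>2)))"
proof (induction k arbitrary: j)
  case 0
  have "continuous_on UNIV (flat j)"
    using flat_has_derivative DERIV_isCont by (metis continuous_at_imp_continuous_on)
  then show ?case
    by (auto intro!: continuous_intros continuous_on_compose2[of UNIV "flat j"])
next
  case (Suc k)
  let ?q = "\<lambda>x::'a. r\<^sup>2 - (norm x)\<^sup>2"
  have q: "(?q has_derivative (\<lambda>v. - (2 * (x \<bullet> v)))) (at x)" for x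
    unfolding power2_norm_eq_inner
    by (auto intro!: derivative_eq_intros simp: inner_commute)
  have d: "((\<lambda>x. complex_of_real (flat j (?q x))) has_derivative
      (\<lambda>v. complex_of_real ((flat (j + 2) (?q x) - real j * flat (j + 1) (?q x)) * - (2 * (x \<bullet> v))))) (at x)" for x
    by (intro has_derivative_of_real
        has_derivative_compose[OF q flat_has_derivative[THEN has_field_derivative_imp_has_derivative]])
  have "C_k k (\<lambda>x. complex_of_real ((flat (j + 2) (?q x) - real j * flat (j + 1) (?q x)) * - (2 * (x \<bullet> v))))" for v
  proof -
    have "C_k k (\<lambda>x. (complex_of_real (flat (j + 2) (?q x)) + of_real (- real j) * complex_of_real (flat (j + 1) (?q x)))
        * (of_real (- 2) * complex_of_real (x \<bullet> v)))"
      by (intro C_k_mult C_k_add Suc.IH C_k_const C_k_inner)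
    then show ?thesis by (simp add: algebra_simps)
  qed
  with d show ?case by (rule C_k_SucI)
qed

lemma test_functions_integrable:
  assumes "\<phi> \<in> test_functions"
  shows "integrable lborel \<phi>" "continuous_on UNIV \<phi>" "bounded {x. \<phi> x \<noteq> 0}"
proof -
  have c: "C_k 0 \<phi>" and k: "compact (closure {x. \<phi> x \<noteq> 0})"
    using assms by (auto simp: test_functions_def)
  show cont: "continuous_on UNIV \<phi>" using c by simp
  show "bounded {x. \<phi> x \<noteq> 0}"
    using k compact_imp_bounded bounded_subset closure_subset by metis
  have "set_integrable lborel (closure {x. \<phi> x \<noteq> 0}) \<phi>"
    unfolding set_integrable_def
    by (rule borel_integrable_compact[OF k]) (use cont continuous_on_subset in blast)
  moreover have "indicator (closure {x. \<phi> x \<noteq> 0}) x *\<^sub>R \<phi> x = \<phi> x" for x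
    using closure_subset[of "{x. \<phi> x \<noteq> 0}"] by (auto simp: indicator_def)
  ultimately show "integrable lborel \<phi>" by (simp add: set_integrable_def)
qed

lemma test_functionsI:
  assumes "\<And>k. C_k k \<phi>" and "bounded {x. \<phi> x \<noteq> 0}"
  shows "\<phi> \<in> test_functions"
  using assms by (auto simp: test_functions_def compact_closure)

lemma integral_pos_of_ball:
  fixes f :: "'a::euclidean_space \<Rightarrow> real"
  assumes int: "integrable lborel f" and nn: "\<And>x. f x \<ge> 0"
    and r: "r > 0" and pos: "\<And>x. x \<in> ball z r \<Longrightarrow> f x > 0"
  shows "(LINT x|lborel. f x) > 0"
proof -
  have "(LINT x|lborel. f x) \<noteq> 0"
  proof
    assume "(LINT x|lborel. f x) = 0"
    then have "AE x in lborel. f x = 0"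
      using integral_nonneg_eq_0_iff_AE[OF int] nn by simp
    then have "AE x in lborel. x \<notin> ball z r"
    proof eventually_elim
      case (elim x)
      then show ?case using pos[of x] by auto
    qed
    then have "ball z r \<in> null_sets lborel"
      using AE_iff_null_sets[of "ball z r" lborel] by simp
    then have "measure lborel (ball z r) = 0" by (rule measure_eq_0_null_sets)
    then show False using r unit_ball_vol_pos[of "real DIM('a)"] by (simp add: content_ball)
  qed
  moreover have "(LINT x|lborel. f x) \<ge> 0" using nn by (simp add: Bochner_Integration.integral_nonneg)
  ultimately show ?thesis by simp
qed

definition mollifier :: "real \<Rightarrow> ('a::euclidean_space \<Rightarrow> real) \<Rightarrow> bool" where
  "mollifier r \<eta> \<longleftrightarrow> r > 0 \<and> (\<lambda>x. complex_of_real (\<eta> x)) \<in> test_functions \<and> (\<forall>x. \<eta> x \<ge> 0)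
     \<and> (\<forall>x. norm x \<ge> r \<longrightarrow> \<eta> x = 0) \<and> (\<forall>x. norm x < r \<longrightarrow> \<eta> x > 0) \<and> (LINT x|lborel. \<eta> x) = 1"

lemma obtain_mollifier:
  assumes r: "r > 0"
  obtains \<eta> :: "'a::euclidean_space \<Rightarrow> real" where "mollifier r \<eta>"
proof -
  define \<beta> where "\<beta> x = flat 0 (r\<^sup>2 - (norm x)\<^sup>2)" for x :: 'a
  have Ck: "C_k k (\<lambda>x. complex_of_real (\<beta> x))" for k unfolding \<beta>_def by (rule C_k_flat_ball)
  have pos: "\<beta> x > 0" if "norm x < r" for x
  proof -
    have "(norm x)\<^sup>2 < r\<^sup>2" using that by (intro power_strict_mono) auto
    then show ?thesis by (simp add: \<beta>_def flat_def)
  qed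
  have zero: "\<beta> x = 0" if "norm x \<ge> r" for x
  proof -
    have "r\<^sup>2 \<le> (norm x)\<^sup>2" using that r by (intro power_mono) auto
    then show ?thesis by (simp add: \<beta>_def flat_def)
  qed
  have nn: "\<beta> x \<ge> 0" for x by (simp add: \<beta>_def flat_def)
  have "{x. \<beta> x \<noteq> 0} \<subseteq> ball 0 r"
  proof
    fix x assume "x \<in> {x. \<beta> x \<noteq> 0}"
    then show "x \<in> ball 0 r" using zero[of x] by (cases "r \<le> norm x") auto
  qed
  then have bdd: "bounded {x. \<beta> x \<noteq> 0}" using bounded_ball bounded_subset by blast
  have "(\<lambda>x. complex_of_real (\<beta> x)) \<in> test_functions"
    by (rule test_functionsI[OF Ck]) (use bdd in simp)
  then have int: "integrable lborel \<beta>"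
    using test_functions_integrable(1) complex_of_real_integrable_eq by blast
  define I where "I = (LINT x|lborel. \<beta> x)"
  have "I > 0"
    unfolding I_def by (rule integral_pos_of_ball[OF int nn r, of 0]) (use pos in simp)
  have "C_k k (\<lambda>x. complex_of_real (\<beta> x / I))" for k
    using C_k_mult[OF C_k_const[of k "complex_of_real (1 / I)"] Ck[of k]] by simp
  then have "(\<lambda>x. complex_of_real (\<beta> x / I)) \<in> test_functions"
    by (rule test_functionsI) (use bdd \<open>I > 0\<close> in simp)
  moreover have "(LINT x|lborel. \<beta> x / I) = 1" using \<open>I > 0\<close> by (simp add: I_def)
  ultimately have "mollifier r (\<lambda>x. \<beta> x / I)"
    unfolding mollifier_def using r nn zero pos \<open>I > 0\<close> by auto
  then show thesis by (rule that)
qed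

section \<open>Decay of the Fourier transform\<close>

text \<open>By translation invariance every difference quotient has integral zero, and dominated convergence
  passes this on to the derivative.\<close>

lemma integral_directional_derivative_eq_0:
  fixes g :: "'a::euclidean_space \<Rightarrow> complex"
  assumes d: "\<And>x. (g has_derivative g' x) (at x)"
    and cont: "continuous_on UNIV (\<lambda>x. g' x v)" and b: "bounded {x. g x \<noteq> 0}"
  shows "(LINT x|lborel. g' x v) = 0"
proof -
  have gc: "continuous_on UNIV g"
    using d has_derivative_continuous continuous_at_imp_continuous_on by blast
  obtain B where B: "B > 0" "\<And>x. g x \<noteq> 0 \<Longrightarrow> norm x \<le> B"
    using b by (auto simp: bounded_pos)
  have g'0: "g' x v = 0" if "norm x > B" for x
  proof -
    have "((\<lambda>x. 0) has_derivative g' x) (at x)"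
      by (rule has_derivative_transform_within_open[OF d, where s = "- cball 0 B"]) (use that B in force)+
    then have "g' x = (\<lambda>v. 0)" using has_derivative_unique[OF _ has_derivative_const] by blast
    then show ?thesis by simp
  qed
  have gm[measurable]: "g \<in> borel_measurable borel" using gc by (rule borel_measurable_continuous_onI)
  have g'm[measurable]: "(\<lambda>x. g' x v) \<in> borel_measurable borel" using cont by (rule borel_measurable_continuous_onI)
  have gi: "integrable lborel g"
  proof -
    have "set_integrable lborel (cball 0 B) g" unfolding set_integrable_def
      by (rule borel_integrable_compact) (use gc continuous_on_subset in auto)
    moreover have "indicator (cball 0 B) x *\<^sub>R g x = g x" for x
      using B(2)[of x] by (auto simp: indicator_def)
    ultimately show ?thesis by (simp add: set_integrable_def)
  qed
  obtain M where M: "\<And>x. norm (g' x v) \<le> M" "M \<ge> 0"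
  proof -
    have "compact ((\<lambda>x. g' x v) ` cball 0 B)"
      by (rule compact_continuous_image) (use cont continuous_on_subset in auto)
    then obtain M where M: "\<forall>y\<in>(\<lambda>x. g' x v) ` cball 0 B. norm y \<le> M" "M > 0"
      using compact_imp_bounded bounded_pos by metis
    have "norm (g' x v) \<le> M" for x
      using M g'0[of x] by (cases "norm x \<le> B") auto
    then show thesis using that M(2) by (metis less_imp_le)
  qed
  have gv: "((\<lambda>s. g (x + s *\<^sub>R v)) has_vector_derivative g' (x + s *\<^sub>R v) v) (at s)" for x s
  proof -
    have "((\<lambda>s. g (x + s *\<^sub>R v)) has_derivative (\<lambda>h. g' (x + s *\<^sub>R v) (h *\<^sub>R v))) (at s)"
      by (rule has_derivative_compose[of "\<lambda>s. x + s *\<^sub>R v", OF _ d]) (auto intro!: derivative_eq_intros)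
    moreover have "(\<lambda>h. g' (x + s *\<^sub>R v) (h *\<^sub>R v)) = (\<lambda>h. h *\<^sub>R g' (x + s *\<^sub>R v) v)"
      using d[of "x + s *\<^sub>R v"] by (simp add: has_derivative_def bounded_linear.linear linear_scale)
    ultimately show ?thesis by (simp add: has_vector_derivative_def)
  qed
  define t :: "nat \<Rightarrow> real" where "t j = 1 / real (Suc j)" for j
  have t: "0 < t j" "t j \<le> 1" for j by (auto simp: t_def)
  have tlim: "t \<longlonglongrightarrow> 0" unfolding t_def using lim_1_over_n[where 'a=real] LIMSEQ_Suc by blast
  define Q where "Q j x = (1 / t j) *\<^sub>R (g (x + t j *\<^sub>R v) - g x)" for j x
  have Q0: "(LINT x|lborel. Q j x) = 0" for j
  proof -
    have "integrable lborel (\<lambda>x. g (t j *\<^sub>R v + x))" using gi lborel_translate(2)[OF gm] by blast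
    then have "(LINT x|lborel. g (x + t j *\<^sub>R v) - g x) = 0"
      using gi lborel_translate(1)[OF gm, of "t j *\<^sub>R v"] by (simp add: add.commute)
    then show ?thesis unfolding Q_def by simp
  qed
  have "(\<lambda>j. LINT x|lborel. Q j x) \<longlonglongrightarrow> (LINT x|lborel. g' x v)"
  proof (rule integral_dominated_convergence)
    show "integrable lborel (\<lambda>x::'a. M * indicator (cball 0 (B + norm v)) x)"
      using emeasure_lborel_cball_finite[of "0::'a" "B + norm v"]
      by (intro integrable_mult_right integrable_real_indicator) (auto simp: infinity_ennreal_def)
    show "AE x in lborel. (\<lambda>j. Q j x) \<longlonglongrightarrow> g' x v"
    proof (intro always_eventually allI)
      fix x
      have vd: "((\<lambda>s. g (x + s *\<^sub>R v)) has_vector_derivative g' x v) (at 0)"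
        using gv[of x 0] by simp
      have "((\<lambda>s. (1 / s) *\<^sub>R (g (x + s *\<^sub>R v) - g x)) \<longlongrightarrow> g' x v) (at 0)"
      proof (rule Lim_transform_eventually)
        have "((\<lambda>s. norm (g (x + s *\<^sub>R v) - g x - s *\<^sub>R g' x v) / norm s) \<longlongrightarrow> 0) (at 0)"
          using vd by (simp add: has_vector_derivative_def has_derivative_iff_norm)
        then have "((\<lambda>s. norm ((1 / s) *\<^sub>R (g (x + s *\<^sub>R v) - g x - s *\<^sub>R g' x v))) \<longlongrightarrow> 0) (at 0)"
          by (simp add: divide_inverse mult.commute)
        then show "((\<lambda>s. (1 / s) *\<^sub>R (g (x + s *\<^sub>R v) - g x - s *\<^sub>R g' x v) + g' x v) \<longlongrightarrow> g' x v) (at 0)"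
          using tendsto_add[OF tendsto_norm_zero_cancel tendsto_const] by fastforce
        show "\<forall>\<^sub>F s in at 0. (1 / s) *\<^sub>R (g (x + s *\<^sub>R v) - g x - s *\<^sub>R g' x v) + g' x v
            = (1 / s) *\<^sub>R (g (x + s *\<^sub>R v) - g x)"
          unfolding eventually_at_filter by (auto simp: scaleR_diff_right intro!: always_eventually)
      qed
      from this[THEN filterlim_compose, of t sequentially]
      show "(\<lambda>j. Q j x) \<longlonglongrightarrow> g' x v"
        unfolding Q_def using tlim t by (auto simp: filterlim_at less_imp_neq[THEN not_sym])
    qed
    show "AE x in lborel. norm (Q j x) \<le> M * indicator (cball 0 (B + norm v)) x" for j
    proof (intro always_eventually allI)
      fix x
      show "norm (Q j x) \<le> M * indicator (cball 0 (B + norm v)) x"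
      proof (cases "norm x \<le> B + norm v")
        case True
        have "norm (g (x + t j *\<^sub>R v) - g (x + 0 *\<^sub>R v)) \<le> M * norm (t j - 0)"
        proof (rule differentiable_bound[where S = UNIV and f = "\<lambda>s. g (x + s *\<^sub>R v)"])
          show "((\<lambda>s. g (x + s *\<^sub>R v)) has_derivative (\<lambda>h. h *\<^sub>R g' (x + s *\<^sub>R v) v)) (at s)" for s
            using gv[of x s] by (simp add: has_vector_derivative_def)
          show "onorm (\<lambda>h. h *\<^sub>R g' (x + s *\<^sub>R v) v) \<le> M" for s
            using M by (intro onorm_le) (metis mult.commute mult_right_mono norm_ge_zero norm_scaleR real_norm_def)
        qed auto
        then show ?thesis using True t[of j] by (simp add: Q_def pos_divide_le_eq)
      next
        case False
        have "norm (x + t j *\<^sub>R v) \<ge> norm x - norm (t j *\<^sub>R v)"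
          using norm_triangle_ineq4[of "x + t j *\<^sub>R v" "t j *\<^sub>R v"] by simp
        moreover have "norm (t j *\<^sub>R v) \<le> norm v" using mult_right_mono[OF t(2), of "norm v" j] t(1)[of j] by simp
        ultimately have "g (x + t j *\<^sub>R v) = 0" "g x = 0" using False B(2) norm_ge_zero[of v] by (smt (verit))+
        then show ?thesis using M by (simp add: Q_def)
      qed
    qed
  qed (auto simp: Q_def)
  then have "(\<lambda>j::nat. 0) \<longlonglongrightarrow> (LINT x|lborel. g' x v)" by (simp only: Q0)
  then show ?thesis using LIMSEQ_unique tendsto_const by blast
qed

lemma test_functions_deriv:
  assumes "\<phi> \<in> test_functions"
  shows "(\<lambda>x. frechet_derivative \<phi> (at x) v) \<in> test_functions"
    and "(\<phi> has_derivative frechet_derivative \<phi> (at x)) (at x)"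
proof -
  have C: "C_k (Suc k) \<phi>" for k using assms by (auto simp: test_functions_def)
  show d: "(\<phi> has_derivative frechet_derivative \<phi> (at x)) (at x)" for x
    using C[of 0] by (rule C_k_Suc_has_derivative)
  have zero: "frechet_derivative \<phi> (at y) v = 0" if "y \<notin> closure {x. \<phi> x \<noteq> 0}" for y
  proof -
    have "((\<lambda>x. 0) has_derivative frechet_derivative \<phi> (at y)) (at y)"
    proof (rule has_derivative_transform_within_open[OF d])
      show "open (- closure {x. \<phi> x \<noteq> 0})" by auto
      show "\<phi> x = 0" if "x \<in> - closure {x. \<phi> x \<noteq> 0}" for x
        using that closure_subset[of "{x. \<phi> x \<noteq> 0}"] by auto
    qed (use that in auto)
    then have "frechet_derivative \<phi> (at y) = (\<lambda>v. 0)" using has_derivative_unique[OF _ has_derivative_const] by blast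
    then show ?thesis by simp
  qed
  show "(\<lambda>x. frechet_derivative \<phi> (at x) v) \<in> test_functions"
  proof (rule test_functionsI)
    show "C_k k (\<lambda>x. frechet_derivative \<phi> (at x) v)" for k using C[of k] by simp
    have "bounded (closure {x. \<phi> x \<noteq> 0})"
      using assms compact_imp_bounded by (auto simp: test_functions_def)
    then show "bounded {x. frechet_derivative \<phi> (at x) v \<noteq> 0}"
      by (rule bounded_subset) (use zero in auto)
  qed
qed

lemma fourier_deriv:
  fixes \<phi> :: "'a::euclidean_space \<Rightarrow> complex"
  assumes \<phi>: "\<phi> \<in> test_functions"
  shows "fourier (\<lambda>x. frechet_derivative \<phi> (at x) v) \<xi> = \<i> * of_real (v \<bullet> \<xi>) * fourier \<phi> \<xi>"
proof -
  define e where "e x = exp (- \<i> * complex_of_real (x \<bullet> \<xi>))" for x :: 'a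
  have ed0: "((\<lambda>x. - \<i> * complex_of_real (x \<bullet> \<xi>)) has_derivative (\<lambda>w. - \<i> * of_real (w \<bullet> \<xi>))) (at x)" for x
    by (auto intro!: derivative_eq_intros)
  have ed: "(e has_derivative (\<lambda>w. - \<i> * of_real (w \<bullet> \<xi>) * e x)) (at x)" for x
    using has_derivative_compose[OF ed0 DERIV_exp[THEN has_field_derivative_imp_has_derivative]]
    unfolding e_def[abs_def] by (simp add: mult.commute)
  have ec: "continuous_on UNIV e" unfolding e_def by (intro continuous_intros)
  let ?d = "\<lambda>x. frechet_derivative \<phi> (at x) v"
  note T = test_functions_deriv[OF \<phi>] test_functions_integrable[OF \<phi>]
    test_functions_integrable[OF test_functions_deriv(1)[OF \<phi>, of v]]
  have e1: "norm (e x) = 1" for x by (simp add: e_def)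
  have em[measurable]: "e \<in> borel_measurable borel" using ec by (rule borel_measurable_continuous_onI)
  have i: "integrable lborel (\<lambda>x. e x * f x)" if "integrable lborel f" for f
    by (rule Bochner_Integration.integrable_bound[OF that]) (use that e1 in \<open>auto simp: norm_mult\<close>)
  have "(LINT x|lborel. e x * ?d x + (- \<i> * of_real (v \<bullet> \<xi>) * e x) * \<phi> x) = 0"
  proof (rule integral_directional_derivative_eq_0[where g = "\<lambda>x. e x * \<phi> x"
        and g' = "\<lambda>x w. e x * frechet_derivative \<phi> (at x) w + (- \<i> * of_real (w \<bullet> \<xi>) * e x) * \<phi> x"])
    show "((\<lambda>x. e x * \<phi> x) has_derivative
        (\<lambda>w. e x * frechet_derivative \<phi> (at x) w + (- \<i> * of_real (w \<bullet> \<xi>) * e x) * \<phi> x)) (at x)" for x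
      by (rule has_derivative_mult[OF ed T(2)])
    show "continuous_on UNIV (\<lambda>x. e x * ?d x + (- \<i> * of_real (v \<bullet> \<xi>) * e x) * \<phi> x)"
      by (intro continuous_intros ec T)
    show "bounded {x. e x * \<phi> x \<noteq> 0}" by (rule bounded_subset[OF T(5)]) auto
  qed
  moreover have "(LINT x|lborel. e x * ?d x + (- \<i> * of_real (v \<bullet> \<xi>) * e x) * \<phi> x)
      = (LINT x|lborel. e x * ?d x) + (LINT x|lborel. (- \<i> * of_real (v \<bullet> \<xi>)) * (e x * \<phi> x))"
    using i[OF T(3)] i[OF T(6)] by (subst Bochner_Integration.integral_add[symmetric]) (auto simp: mult.assoc)
  ultimately have "(LINT x|lborel. e x * ?d x) = \<i> * of_real (v \<bullet> \<xi>) * (LINT x|lborel. e x * \<phi> x)"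
    by (simp add: add_eq_0_iff)
  then show ?thesis by (simp add: fourier_def e_def)
qed

text \<open>The Fourier transform of \<open>\<phi> - \<Delta> \<phi>\<close> is \<open>1 + |\<xi>|\<^sup>2\<close> times that of \<open>\<phi>\<close>, so each application of \<open>1 - \<Delta>\<close> gains a
  factor.\<close>

lemma fourier_decay:
  fixes \<phi> :: "'a::euclidean_space \<Rightarrow> complex"
  assumes "\<phi> \<in> test_functions"
  shows "\<exists>B\<ge>0. \<forall>\<xi>. (1 + (norm \<xi>)\<^sup>2) ^ M * norm (fourier \<phi> \<xi>) \<le> B"
  using assms
proof (induction M arbitrary: \<phi>)
  case 0
  have "norm (fourier \<phi> \<xi>) \<le> (LINT x|lborel. norm (\<phi> x))" for \<xi>
    unfolding fourier_def by (rule order.trans[OF integral_norm_bound]) (simp add: norm_mult)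
  then show ?case by (intro exI[of _ "LINT x|lborel. norm (\<phi> x)"]) auto
next
  case (Suc M)
  let ?D = "\<lambda>v \<phi> x. frechet_derivative \<phi> (at x) v"
  define \<psi> where "\<psi> x = \<phi> x + (\<Sum>b\<in>Basis. (- 1) * ?D b (?D b \<phi>) x)" for x
  have D2: "?D b (?D b \<phi>) \<in> test_functions" for b
    using test_functions_deriv(1) Suc.prems by blast
  have "\<psi> \<in> test_functions"
  proof (rule test_functionsI)
    show "C_k k \<psi>" for k unfolding \<psi>_def
      using Suc.prems D2 by (intro C_k_add C_k_sum C_k_mult C_k_const) (auto simp: test_functions_def)
    have "{x. \<psi> x \<noteq> 0} \<subseteq> {x. \<phi> x \<noteq> 0} \<union> (\<Union>b\<in>Basis. {x. ?D b (?D b \<phi>) x \<noteq> 0})"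
    proof
      fix x assume "x \<in> {x. \<psi> x \<noteq> 0}"
      then show "x \<in> {x. \<phi> x \<noteq> 0} \<union> (\<Union>b\<in>Basis. {x. ?D b (?D b \<phi>) x \<noteq> 0})"
        unfolding \<psi>_def by (rule contrapos_pp) auto
    qed
    then show "bounded {x. \<psi> x \<noteq> 0}"
      by (rule bounded_subset[rotated])
        (use test_functions_integrable(3)[OF Suc.prems] test_functions_integrable(3)[OF D2] in auto)
  qed
  then obtain B where B: "B \<ge> 0" "\<And>\<xi>. (1 + (norm \<xi>)\<^sup>2) ^ M * norm (fourier \<psi> \<xi>) \<le> B"
    using Suc.IH by blast
  have i: "integrable lborel (\<lambda>x. exp (- \<i> * complex_of_real (x \<bullet> \<xi>)) * f x)"
    if "f \<in> test_functions" for f and \<xi> :: 'a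
  proof -
    have m: "(\<lambda>x. exp (- \<i> * complex_of_real (x \<bullet> \<xi>))) \<in> borel_measurable borel"
      by (intro borel_measurable_continuous_onI continuous_intros)
    note fi = test_functions_integrable(1)[OF that]
    show ?thesis
      by (rule Bochner_Integration.integrable_bound[OF fi])
        (use m borel_measurable_integrable[OF fi] in \<open>auto simp: norm_mult\<close>)
  qed
  have "fourier \<psi> \<xi> = of_real (1 + (norm \<xi>)\<^sup>2) * fourier \<phi> \<xi>" for \<xi>
  proof -
    have "fourier \<psi> \<xi> = fourier \<phi> \<xi> + (\<Sum>b\<in>Basis. - fourier (?D b (?D b \<phi>)) \<xi>)"
    proof -
      let ?e = "\<lambda>x. exp (- \<i> * complex_of_real (x \<bullet> \<xi>))"
      have "fourier \<psi> \<xi> = (LINT x|lborel. ?e x * \<phi> x + (\<Sum>b\<in>Basis. - (?e x * ?D b (?D b \<phi>) x)))"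
        unfolding fourier_def \<psi>_def by (simp add: right_diff_distrib sum_distrib_left sum_negf)
      also have "\<dots> = (LINT x|lborel. ?e x * \<phi> x) + (LINT x|lborel. (\<Sum>b\<in>Basis. - (?e x * ?D b (?D b \<phi>) x)))"
        by (rule Bochner_Integration.integral_add)
          (intro i[OF Suc.prems] Bochner_Integration.integrable_sum Bochner_Integration.integrable_minus i[OF D2])+
      also have "(LINT x|lborel. (\<Sum>b\<in>Basis. - (?e x * ?D b (?D b \<phi>) x)))
          = (\<Sum>b\<in>Basis. LINT x|lborel. - (?e x * ?D b (?D b \<phi>) x))"
        by (rule Bochner_Integration.integral_sum)
          (intro Bochner_Integration.integrable_minus i[OF D2])
      finally show ?thesis by (simp only: fourier_def Bochner_Integration.integral_minus)
    qed
    moreover have "fourier (?D b (?D b \<phi>)) \<xi> = - of_real ((\<xi> \<bullet> b)\<^sup>2) * fourier \<phi> \<xi>" for b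
    proof -
      have "\<i> * a * (\<i> * a * f) = (\<i> * \<i>) * (a * a * f)" for a f by (simp only: mult_ac)
      then show "fourier (?D b (?D b \<phi>)) \<xi> = - of_real ((\<xi> \<bullet> b)\<^sup>2) * fourier \<phi> \<xi>"
        unfolding fourier_deriv[OF test_functions_deriv(1)[OF Suc.prems, of b], of b \<xi>]
          fourier_deriv[OF Suc.prems, of b \<xi>]
        by (simp add: power2_eq_square inner_commute)
    qed
    moreover have "(\<Sum>b\<in>Basis. - (- of_real ((\<xi> \<bullet> b)\<^sup>2) * fourier \<phi> \<xi>))
        = of_real ((norm \<xi>)\<^sup>2) * fourier \<phi> \<xi>"
      by (simp add: norm_sq_eq_sum_Basis sum_distrib_right)
    ultimately have "fourier \<psi> \<xi> = fourier \<phi> \<xi> + of_real ((norm \<xi>)\<^sup>2) * fourier \<phi> \<xi>"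
      by (simp only:)
    then show ?thesis by (simp add: algebra_simps)
  qed
  then have "norm (fourier \<psi> \<xi>) = (1 + (norm \<xi>)\<^sup>2) * norm (fourier \<phi> \<xi>)" for \<xi>
    by (simp only: norm_mult norm_of_real) (simp add: abs_of_nonneg)
  then show ?case using B by (intro exI[of _ B]) (auto simp: mult_ac)
qed

section \<open>Logarithms and Bessel functions as mixtures of exponentials\<close>

lemma exp_minus_taylor:
  fixes x :: real
  assumes "x \<ge> 0"
  shows "\<bar>exp (- x) - (\<Sum>j<n. (- x) ^ j / fact j)\<bar> \<le> x ^ n / fact n"
proof (cases "x = 0 \<or> n = 0")
  case True
  then show ?thesis
  proof
    assume "x = 0"
    then show ?thesis
      by (cases n) (simp_all add: sum.lessThan_Suc_shift del: sum.lessThan_Suc)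
  next
    assume "n = 0" then show ?thesis using assms by simp
  qed
next
  case False
  then have "- x < 0" "n > 0" using assms by auto
  then obtain t where t: "- x < t" "t < 0"
    "exp (- x) = (\<Sum>m<n. (exp 0 / fact m) * (- x) ^ m) + exp t / fact n * (- x) ^ n"
    using Maclaurin_minus[of "- x" n "\<lambda>_. exp" exp] by (auto intro: DERIV_exp)
  have "\<bar>exp (- x) - (\<Sum>j<n. (- x) ^ j / fact j)\<bar> = exp t * (x ^ n / fact n)"
    using assms unfolding t(3) by (simp add: abs_mult power_abs)
  also have "\<dots> \<le> 1 * (x ^ n / fact n)" using t assms by (intro mult_right_mono) auto
  finally show ?thesis by simp
qed

lemma power_exp_integral:
  fixes c :: real
  assumes c: "c > 0"
  shows "integrable lborel (\<lambda>t. indicator {0<..} t * (t ^ k * exp (- c * t)))"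
    and "(LINT t|lborel. indicator {0<..} t * (t ^ k * exp (- c * t))) = fact k / c ^ (k + 1)"
proof -
  have "has_bochner_integral lborel (\<lambda>x::real. indicator {0..} x * (x ^ k * exp (- x))) (fact k)"
  proof (intro has_bochner_integral_nn_integral)
    have "(\<integral>\<^sup>+ x. ennreal (indicator {0..} x * (x ^ k * exp (- x))) \<partial>lborel)
        = (\<integral>\<^sup>+ x. ennreal (x ^ k * exp (- x)) * indicator {0..} x \<partial>lborel)"
      by (intro nn_integral_cong) (auto simp: indicator_def)
    also have "\<dots> = ennreal (fact k)" using nn_intergal_power_times_exp_Ici[of k] by simp
    finally show "(\<integral>\<^sup>+ x. ennreal (indicator {0..} x * (x ^ k * exp (- x))) \<partial>lborel) = ennreal (fact k)" .
  qed (auto simp: indicator_def)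
  then have "has_bochner_integral lborel (\<lambda>x. indicator {0..} (0 + c * x) * ((0 + c * x) ^ k * exp (- (0 + c * x)))) (fact k /\<^sub>R \<bar>c\<bar>)"
    by (subst (asm) lborel_has_bochner_integral_real_affine_iff[where c = c and t = 0]) (use c in auto)
  then have "has_bochner_integral lborel (\<lambda>x. (1 / c ^ k) * (indicator {0..} (0 + c * x) * ((0 + c * x) ^ k * exp (- (0 + c * x))))) ((1 / c ^ k) * (fact k /\<^sub>R \<bar>c\<bar>))"
    by (rule has_bochner_integral_mult_right)
  also have "(1 / c ^ k) * (fact k /\<^sub>R \<bar>c\<bar>) = fact k / c ^ (k + 1)" using c by (simp add: field_simps)
  also have "(\<lambda>x. (1 / c ^ k) * (indicator {0..} (0 + c * x) * ((0 + c * x) ^ k * exp (- (0 + c * x)))))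
      = (\<lambda>x. indicator {0..} x * (x ^ k * exp (- c * x)))"
    using c by (auto simp: indicator_def zero_le_mult_iff power_mult_distrib)
  finally have h: "has_bochner_integral lborel (\<lambda>x. indicator {0..} x * (x ^ k * exp (- c * x))) (fact k / c ^ (k + 1))" .
  have ae: "AE x in lborel. indicator {0..} x * (x ^ k * exp (- c * x)) = indicator {0<..} x * (x ^ k * exp (- c * x))"
    using AE_lborel_singleton[of "0::real"] by eventually_elim (auto simp: indicator_def)
  have m: "(\<lambda>x. indicator {0<..} x * (x ^ k * exp (- c * x))) \<in> borel_measurable lborel" by measurable
  have h2: "has_bochner_integral lborel (\<lambda>x. indicator {0<..} x * (x ^ k * exp (- c * x))) (fact k / c ^ (k + 1))"
    using h has_bochner_integral_cong_AE[OF _ m ae] has_bochner_integral_iff[THEN iffD1, OF h]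
    by (metis (no_types, lifting) borel_measurable_integrable)
  then show "integrable lborel (\<lambda>t. indicator {0<..} t * (t ^ k * exp (- c * t)))"
    and "(LINT t|lborel. indicator {0<..} t * (t ^ k * exp (- c * t))) = fact k / c ^ (k + 1)"
    by (auto simp: has_bochner_integral_iff)
qed

text \<open>The integrand is the integral of \<open>exp (- t u)\<close> over \<open>u\<close> between \<open>r\<close> and \<open>s\<close>; exchanging the integrals leaves
  that of \<open>1 / u\<close>.\<close>

lemma frullani_exp_less:
  fixes r s :: real
  assumes r: "0 < r" "r \<le> s"
  shows "integrable lborel (\<lambda>t. indicator {0<..} t * ((exp (- (t * r)) - exp (- (t * s))) / t))"
    and "(LINT t|lborel. indicator {0<..} t * ((exp (- (t * r)) - exp (- (t * s))) / t)) = ln s - ln r"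
proof -
  define f :: "real \<Rightarrow> real \<Rightarrow> complex" where
    "f t u = of_real (indicator {0<..} t * (indicator {r..s} u * exp (- (t * u))))" for t u
  define \<Theta> where "\<Theta> t = indicator {0<..} t * (t ^ 0 * exp (- r * t))" for t :: real
  have inner_u: "(LINT u|lborel. f t u) = of_real (indicator {0<..} t * ((exp (- (t * r)) - exp (- (t * s))) / t))" for t
  proof (cases "t > 0")
    case True
    have "(LINT u|lborel. indicator {r..s} u *\<^sub>R exp (- (t * u))) = - exp (- (t * s)) / t - - exp (- (t * r)) / t"
    proof (rule integral_FTC_atLeastAtMost)
      show "((\<lambda>u. - exp (- (t * u)) / t) has_vector_derivative exp (- (t * u))) (at u within {r..s})" for u
        using True unfolding has_real_derivative_iff_has_vector_derivative[symmetric]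
        by (auto intro!: derivative_eq_intros)
    qed (use r in \<open>auto intro!: continuous_intros\<close>)
    then have "(LINT u|lborel. indicator {r..s} u * exp (- (t * u))) = (exp (- (t * r)) - exp (- (t * s))) / t"
      by (simp add: diff_divide_distrib)
    then show ?thesis using True unfolding f_def integral_complex_of_real by simp
  qed (simp add: f_def)
  have inner_t: "(LINT t|lborel. f t u) = of_real (indicator {r..s} u * (1 / u))" for u
  proof (cases "u \<in> {r..s}")
    case True
    then have u: "u > 0" using r by auto
    have "(LINT t|lborel. indicator {0<..} t * exp (- (t * u))) = 1 / u"
      using power_exp_integral(2)[OF u, of 0] by (simp add: mult.commute)
    then show ?thesis using True unfolding f_def integral_complex_of_real by simp
  qed (simp add: f_def)
  have \<Theta>: "integrable lborel \<Theta>" unfolding \<Theta>_def by (rule power_exp_integral(1)[OF r(1)])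
  have \<Phi>: "integrable lborel (indicat_real {r..s})"
    by (intro integrable_real_indicator) (auto simp: emeasure_lborel_Icc_eq)
  have m: "(\<lambda>(t, u). f t u) \<in> borel_measurable (lborel \<Otimes>\<^sub>M lborel)"
    unfolding f_def by measurable
  have b: "norm (f t u) \<le> \<Theta> t * indicat_real {r..s} u" for t u
    using r by (auto simp: f_def \<Theta>_def indicator_def mult.commute[of r])
  note F = Fubini_dominated[OF lborel.sigma_finite_measure_axioms lborel.sigma_finite_measure_axioms m \<Theta> \<Phi> b]
  from F(2) show "integrable lborel (\<lambda>t. indicator {0<..} t * ((exp (- (t * r)) - exp (- (t * s))) / t))"
    unfolding inner_u by (simp only: complex_of_real_integrable_eq)
  have "(LINT u|lborel. indicator {r..s} u *\<^sub>R (1 / u)) = ln s - ln r"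
  proof (rule integral_FTC_atLeastAtMost)
    show "(ln has_vector_derivative 1 / u) (at u within {r..s})" if "r \<le> u" "u \<le> s" for u
      using that r unfolding has_real_derivative_iff_has_vector_derivative[symmetric]
      by (auto intro!: derivative_eq_intros)
  qed (use r in \<open>auto intro!: continuous_intros\<close>)
  then have "(LINT u|lborel. LINT t|lborel. f t u) = of_real (ln s - ln r)"
    unfolding inner_t integral_complex_of_real by simp
  then show "(LINT t|lborel. indicator {0<..} t * ((exp (- (t * r)) - exp (- (t * s))) / t)) = ln s - ln r"
    using F(1) unfolding inner_u integral_complex_of_real by (simp only: of_real_eq_iff)
qed

lemma frullani_exp:
  fixes s :: real
  assumes s: "0 < s"
  shows "integrable lborel (\<lambda>t. indicator {0<..} t * ((exp (- (t * s)) - exp (- t)) / t))"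
    and "(LINT t|lborel. indicator {0<..} t * ((exp (- (t * s)) - exp (- t)) / t)) = - ln s"
proof -
  have neg: "indicator {0<..} t * ((exp (- (t * s)) - exp (- t)) / t)
      = - (indicator {0<..} t * ((exp (- t) - exp (- (t * s))) / t))" for t :: real
    by (simp add: diff_divide_distrib right_diff_distrib)
  show "integrable lborel (\<lambda>t. indicator {0<..} t * ((exp (- (t * s)) - exp (- t)) / t))"
  proof (cases "s \<le> 1")
    case True
    then show ?thesis using frullani_exp_less(1)[of s 1] s by simp
  next
    case False
    then show ?thesis unfolding neg using frullani_exp_less(1)[of 1 s] by simp
  qed
  show "(LINT t|lborel. indicator {0<..} t * ((exp (- (t * s)) - exp (- t)) / t)) = - ln s"
  proof (cases "s \<le> 1")
    case True
    then show ?thesis using frullani_exp_less(2)[of s 1] s by simp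
  next
    case False
    then show ?thesis unfolding neg using frullani_exp_less(2)[of 1 s] by simp
  qed
qed

text \<open>The exponential with its Taylor polynomial of degree \<open>a\<close> subtracted; the last Taylor term is
  damped to keep the quotient by \<open>t\<^sup>a\<^sup>+\<^sup>1\<close> integrable at infinity as well as at the origin.\<close>

definition exp_remainder :: "nat \<Rightarrow> real \<Rightarrow> real \<Rightarrow> real" where
  "exp_remainder a s t = exp (- (t * s)) - (\<Sum>j<a. (- (t * s)) ^ j / fact j) - (- (t * s)) ^ a / fact a * exp (- t)"

text \<open>Taylor's theorem up to \<open>t = 1\<close>; beyond, the terms of degree below \<open>a\<close> and the damped one are all of order
  \<open>t\<^sup>a\<^sup>-\<^sup>1\<close>.\<close>

lemma exp_remainder_bound:
  assumes t: "t > 0" and s: "s \<ge> 0" and a: "a \<ge> 1"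
  shows "\<bar>exp_remainder a s t\<bar> \<le> (real a + 2) * (1 + s) ^ (a + 1) * (t ^ (a + 1) * (2 / (1 + t\<^sup>2)))"
proof (cases "t \<le> 1")
  case True
  have "exp_remainder a s t = (exp (- (t * s)) - (\<Sum>j<Suc a. (- (t * s)) ^ j / fact j))
      + (- (t * s)) ^ a / fact a * (1 - exp (- t))"
    by (simp add: exp_remainder_def right_diff_distrib)
  moreover have "\<bar>exp (- (t * s)) - (\<Sum>j<Suc a. (- (t * s)) ^ j / fact j)\<bar> \<le> (t * s) ^ Suc a / fact (Suc a)"
    by (rule exp_minus_taylor) (use t s in simp)
  moreover have "\<bar>(- (t * s)) ^ a / fact a * (1 - exp (- t))\<bar> \<le> (t * s) ^ a / fact a * t"
  proof -
    have "\<bar>(- (t * s)) ^ a / fact a * (1 - exp (- t))\<bar> = (t * s) ^ a / fact a * (1 - exp (- t))"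
      using t s by (simp add: abs_mult power_abs)
    also have "\<dots> \<le> (t * s) ^ a / fact a * t"
      using t s exp_ge_add_one_self[of "- t"] by (intro mult_left_mono) auto
    finally show ?thesis .
  qed
  moreover have "(t * s) ^ Suc a / fact (Suc a) \<le> t ^ (a + 1) * (1 + s) ^ (a + 1)"
  proof -
    have "(t * s) ^ Suc a / fact (Suc a) \<le> (t * s) ^ Suc a / 1"
      using t s by (intro divide_left_mono fact_ge_1) auto
    also have "\<dots> \<le> t ^ (a + 1) * (1 + s) ^ (a + 1)"
      unfolding power_mult_distrib using t s power_mono[of s "1 + s" "a + 1"] by (simp only: Suc_eq_plus1 div_by_1) (intro mult_left_mono, auto)
    finally show ?thesis .
  qed
  moreover have "(t * s) ^ a / fact a * t \<le> t ^ (a + 1) * (1 + s) ^ (a + 1)"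
  proof -
    have "(t * s) ^ a / fact a * t \<le> (t * s) ^ a / 1 * t"
      using t s by (intro mult_right_mono divide_left_mono fact_ge_1) auto
    also have "\<dots> = t ^ (a + 1) * s ^ a" by (simp add: power_mult_distrib)
    also have "\<dots> \<le> t ^ (a + 1) * (1 + s) ^ (a + 1)"
    proof (rule mult_left_mono)
      show "s ^ a \<le> (1 + s) ^ (a + 1)"
        using power_mono[of s "1 + s" a] power_increasing[of a "a + 1" "1 + s"] s by linarith
    qed (use t in simp)
    finally show ?thesis .
  qed
  ultimately have "\<bar>exp_remainder a s t\<bar> \<le> 2 * (t ^ (a + 1) * (1 + s) ^ (a + 1))" by linarith
  also have "\<dots> \<le> (real a + 2) * (t ^ (a + 1) * (1 + s) ^ (a + 1)) * 1"
    using t s by (simp add: mult_right_mono)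
  also have "\<dots> \<le> (real a + 2) * (t ^ (a + 1) * (1 + s) ^ (a + 1)) * (2 / (1 + t\<^sup>2))"
  proof (intro mult_left_mono)
    have "t\<^sup>2 \<le> 1" using True t by (simp add: power_le_one)
    then have "1 + t\<^sup>2 \<le> 2" "0 < 1 + t\<^sup>2" using zero_le_power2[of t] by linarith+
    then show "1 \<le> 2 / (1 + t\<^sup>2)" by (simp only: pos_le_divide_eq) simp
  qed (use t s in auto)
  finally show ?thesis by (simp only: mult.assoc mult.left_commute[of "t ^ (a + 1)"])
next
  case False
  then have t1: "t \<ge> 1" by simp
  have p: "\<bar>(- (t * s)) ^ j / fact j\<bar> \<le> t ^ j * (1 + s) ^ a" if "j \<le> a" for j
  proof -
    have "\<bar>(- (t * s)) ^ j / fact j\<bar> = (t * s) ^ j / fact j" using t s by (simp add: power_abs abs_mult)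
    also have "\<dots> \<le> (t * s) ^ j / 1" using t s by (intro divide_left_mono fact_ge_1) auto
    also have "\<dots> = t ^ j * s ^ j" by (simp add: power_mult_distrib)
    also have "t ^ j * s ^ j \<le> t ^ j * (1 + s) ^ a"
    proof (rule mult_left_mono)
      show "s ^ j \<le> (1 + s) ^ a"
        using power_mono[of s "1 + s" j] power_increasing[of j a "1 + s"] s that by linarith
    qed (use t in simp)
    finally show ?thesis .
  qed
  have e1: "\<bar>exp (- (t * s))\<bar> \<le> t ^ (a - 1) * (1 + s) ^ a"
  proof -
    have "exp (- (t * s)) \<le> 1" using t s by simp
    moreover have "1 * 1 \<le> t ^ (a - 1) * (1 + s) ^ a"
      using t1 s by (intro mult_mono one_le_power) auto
    ultimately show ?thesis unfolding abs_exp_cancel by linarith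
  qed
  have "\<bar>\<Sum>j<a. (- (t * s)) ^ j / fact j\<bar> \<le> (\<Sum>j<a. t ^ (a - 1) * (1 + s) ^ a)"
  proof (rule order.trans[OF sum_abs sum_mono])
    fix j assume "j \<in> {..<a}"
    then have j: "j \<le> a - 1" "j \<le> a" by auto
    have "t ^ j * (1 + s) ^ a \<le> t ^ (a - 1) * (1 + s) ^ a"
      by (rule mult_right_mono[OF power_increasing[OF j(1) t1]]) (use s in simp)
    with p[OF j(2)] show "\<bar>(- (t * s)) ^ j / fact j\<bar> \<le> t ^ (a - 1) * (1 + s) ^ a"
      by (rule order.trans)
  qed
  then have e2: "\<bar>\<Sum>j<a. (- (t * s)) ^ j / fact j\<bar> \<le> real a * (t ^ (a - 1) * (1 + s) ^ a)"
    by (simp only: sum_constant card_lessThan)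
  have e3: "\<bar>(- (t * s)) ^ a / fact a * exp (- t)\<bar> \<le> t ^ (a - 1) * (1 + s) ^ a"
  proof -
    have "\<bar>(- (t * s)) ^ a / fact a * exp (- t)\<bar> \<le> t ^ a * (1 + s) ^ a * exp (- t)"
      unfolding abs_mult[of _ "exp (- t)"] abs_exp_cancel
      by (rule mult_right_mono[OF p]) simp_all
    also have "\<dots> = (t ^ (a - 1) * (1 + s) ^ a) * (t * exp (- t))"
    proof -
      have "t ^ a = t ^ (a - 1) * t" using a power_minus_mult[of a t] by simp
      moreover have "(u * t) * v * w = (u * v) * (t * w)" for u v w :: real by simp
      ultimately show ?thesis by (simp only:)
    qed
    also have "\<dots> \<le> (t ^ (a - 1) * (1 + s) ^ a) * 1"
    proof (rule mult_left_mono)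
      have "t \<le> exp t" using exp_ge_add_one_self[of t] by linarith
      then show "t * exp (- t) \<le> 1" by (simp add: exp_minus field_simps)
    qed (use t s in simp)
    finally show ?thesis by (simp only: mult_1_right)
  qed
  have "\<bar>exp_remainder a s t\<bar> \<le> (real a + 2) * (t ^ (a - 1) * (1 + s) ^ a)"
  proof -
    have "(real a + 2) * (t ^ (a - 1) * (1 + s) ^ a)
        = t ^ (a - 1) * (1 + s) ^ a + real a * (t ^ (a - 1) * (1 + s) ^ a) + t ^ (a - 1) * (1 + s) ^ a"
      by (simp add: distrib_right)
    then show ?thesis using e1 e2 e3 unfolding exp_remainder_def by linarith
  qed
  also have "\<dots> \<le> (real a + 2) * (t ^ (a - 1) * (1 + s) ^ (a + 1) * (t\<^sup>2 * (2 / (1 + t\<^sup>2))))"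
  proof (intro mult_left_mono)
    have "1 \<le> t\<^sup>2" using t1 by (simp add: one_le_power)
    then have "1 \<le> t\<^sup>2 * (2 / (1 + t\<^sup>2))"
      by (simp add: field_simps)
    moreover have "(1 + s) ^ a \<le> (1 + s) ^ (a + 1)" using s by (intro power_increasing) auto
    ultimately have "t ^ (a - 1) * (1 + s) ^ a * 1 \<le> t ^ (a - 1) * (1 + s) ^ (a + 1) * (t\<^sup>2 * (2 / (1 + t\<^sup>2)))"
      using t s by (intro mult_mono) auto
    then show "t ^ (a - 1) * (1 + s) ^ a \<le> t ^ (a - 1) * (1 + s) ^ (a + 1) * (t\<^sup>2 * (2 / (1 + t\<^sup>2)))" by (simp only: mult_1_right)
  qed simp
  also have "\<dots> = (real a + 2) * (1 + s) ^ (a + 1) * ((t ^ (a - 1) * t\<^sup>2) * (2 / (1 + t\<^sup>2)))"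
    by (simp only: mult.assoc mult.left_commute[of "t ^ (a - 1)"])
  also have "t ^ (a - 1) * t\<^sup>2 = t ^ (a + 1)"
    using a by (simp only: power_add[symmetric]) simp
  finally show ?thesis .
qed

lemma integrable_two_over: "integrable lborel (\<lambda>t::real. 2 / (1 + t\<^sup>2))"
  using integrable_mult_right[OF integrable_cauchy_product[where 'a=real], of 2] by simp

text \<open>Integration by parts against \<open>t\<^sup>-\<^sup>a\<^sup>-\<^sup>1\<close> lowers \<open>a\<close> by one, because the derivative of the remainder is \<open>- s\<close> times
  the previous remainder up to a damped monomial, whose integral accumulates to the harmonic number. Frullani's
  integral is the case \<open>a = 0\<close>.\<close>

lemma exp_remainder_integral:
  fixes s :: real
  assumes s: "s > 0"
  shows "integrable lborel (\<lambda>t. indicator {0<..} t * (exp_remainder a s t / t ^ (a + 1)))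
    \<and> fact a * (LINT t|lborel. indicator {0<..} t * (exp_remainder a s t / t ^ (a + 1)))
      = (-1) ^ (a + 1) * s ^ a * ln s + (- s) ^ a * harm a"
proof (induction a)
  case 0
  show ?case using frullani_exp[OF s] by (simp add: exp_remainder_def harm_def)
next
  case (Suc b)
  define a where "a = Suc b"
  define B where "B = exp_remainder a s"
  define C where "C = (real a + 2) * (1 + s) ^ (a + 1)"
  have C: "C \<ge> 0" using s by (simp add: C_def)
  have Bb: "\<bar>B t\<bar> \<le> C * (t ^ (a + 1) * (2 / (1 + t\<^sup>2)))" if "t > 0" for t
    unfolding B_def C_def by (rule exp_remainder_bound) (use that s in \<open>auto simp: a_def\<close>)
  \<comment> \<open>The derivative of \<open>B\<close>.\<close>
  define Bd where "Bd t = - s * exp_remainder b s t + (- s) ^ a * t ^ a / fact a * exp (- t)" for t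
  have pw: "((\<lambda>t. (- (t * s)) ^ Suc j / fact (Suc j)) has_real_derivative - s * ((- (t * s)) ^ j / fact j)) (at t)" for j t
  proof -
    have "((\<lambda>t. - (t * s)) has_real_derivative - s) (at t)" by (auto intro!: derivative_eq_intros)
    from DERIV_cdivide[OF DERIV_power_Suc[OF this], of j "fact (Suc j)"]
    show ?thesis by (rule DERIV_cong) (simp add: divide_simps)
  qed
  have deriv: "(B has_real_derivative Bd t) (at t)" for t
  proof -
    have "((\<lambda>t. \<Sum>j<a. (- (t * s)) ^ j / fact j) has_real_derivative (\<Sum>j<b. - s * ((- (t * s)) ^ j / fact j))) (at t)"
    proof -
      have "((\<lambda>t. \<Sum>j<b. (- (t * s)) ^ Suc j / fact (Suc j)) has_real_derivative
          (\<Sum>j<b. - s * ((- (t * s)) ^ j / fact j))) (at t)"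
        by (intro DERIV_sum pw)
      then have "((\<lambda>t. 1 + (\<Sum>j<b. (- (t * s)) ^ Suc j / fact (Suc j))) has_real_derivative
          (\<Sum>j<b. - s * ((- (t * s)) ^ j / fact j))) (at t)"
        using DERIV_add[OF DERIV_const] by fastforce
      then show ?thesis unfolding a_def sum.lessThan_Suc_shift by simp
    qed
    moreover have "((\<lambda>t. (- (t * s)) ^ a / fact a * exp (- t)) has_real_derivative
        - s * ((- (t * s)) ^ b / fact b * exp (- t)) - (- (t * s)) ^ a / fact a * exp (- t)) (at t)"
      using DERIV_mult[OF pw[of b t] DERIV_chain2[OF DERIV_exp DERIV_minus[OF DERIV_ident]], unfolded a_def[symmetric]]
      by (rule DERIV_cong) (simp add: mult.assoc mult.commute[of "exp (- t)"])
    ultimately have "(B has_real_derivative (- s * exp (- (t * s)) - (\<Sum>j<b. - s * ((- (t * s)) ^ j / fact j))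
        - (- s * ((- (t * s)) ^ b / fact b * exp (- t)) - (- (t * s)) ^ a / fact a * exp (- t)))) (at t)"
      unfolding B_def exp_remainder_def[abs_def]
      by (intro DERIV_diff) (auto intro!: derivative_eq_intros)
    moreover have "(- (t * s)) ^ a = (- s) ^ a * t ^ a"
      by (simp add: power_mult_distrib[symmetric] mult.commute)
    ultimately have d: "(B has_real_derivative (- s * exp (- (t * s)) - (\<Sum>j<b. - s * ((- (t * s)) ^ j / fact j))
        - (- s * ((- (t * s)) ^ b / fact b * exp (- t)) - (- s) ^ a * t ^ a / fact a * exp (- t)))) (at t)"
      by (simp only:)
    show ?thesis
      by (rule DERIV_cong[OF d])
        (unfold Bd_def exp_remainder_def sum_distrib_left[symmetric], simp add: right_diff_distrib)
  qed
  have Bcont: "isCont B t" for t using deriv DERIV_isCont by blast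
  have Bdcont: "isCont Bd t" for t
    unfolding Bd_def exp_remainder_def by (intro continuous_intros) auto
  have Bm[measurable]: "B \<in> borel_measurable borel"
    using Bcont continuous_at_imp_continuous_on borel_measurable_continuous_onI by blast
  have i1: "integrable lborel (\<lambda>t. indicator {0<..} t * (B t / t ^ (a + 1)))"
  proof (rule Bochner_Integration.integrable_bound[OF integrable_mult_right[OF integrable_two_over, of C]])
    show "AE t in lborel. norm (indicator {0<..} t * (B t / t ^ (a + 1))) \<le> norm (C * (2 / (1 + t\<^sup>2)))"
    proof (intro always_eventually allI)
      fix t :: real
      show "norm (indicator {0<..} t * (B t / t ^ (a + 1))) \<le> norm (C * (2 / (1 + t\<^sup>2)))"
      proof (cases "t > 0")
        case True
        have "\<bar>B t\<bar> / t ^ (a + 1) \<le> C * (t ^ (a + 1) * (2 / (1 + t\<^sup>2))) / t ^ (a + 1)"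
          by (rule divide_right_mono[OF Bb[OF True]]) (use True in simp)
        also have "\<dots> = C * (2 / (1 + t\<^sup>2))"
        proof -
          have "C * (p * q) / p = C * q" if "p \<noteq> 0" for p q :: real using that by simp
          moreover have "t ^ (a + 1) \<noteq> 0" using True by simp
          ultimately show ?thesis by blast
        qed
        finally have "\<bar>B t\<bar> / t ^ (a + 1) \<le> \<bar>C * (2 / (1 + t\<^sup>2))\<bar>" using abs_ge_self by (rule order.trans)
        moreover have "norm (indicator {0<..} t * (B t / t ^ (a + 1))) = \<bar>B t\<bar> / t ^ (a + 1)"
          using True by (simp only: indicator_simps greaterThan_iff mult_1_left real_norm_def abs_divide abs_of_pos zero_less_power)
        ultimately show ?thesis by (simp only: real_norm_def)
      qed simp
    qed
  qed measurable
  have i2: "integrable lborel (\<lambda>t. indicator {0<..} t * (exp_remainder b s t / t ^ (b + 1)))"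
    and I2: "fact b * (LINT t|lborel. indicator {0<..} t * (exp_remainder b s t / t ^ (b + 1)))
      = (-1) ^ (b + 1) * s ^ b * ln s + (- s) ^ b * harm b"
    by (rule Suc.IH[THEN conjunct1], rule Suc.IH[THEN conjunct2])
  note i3 = power_exp_integral(1)[OF zero_less_one, of 0]
  have I3: "(LINT t|lborel. indicator {0<..} t * (t ^ 0 * exp (- 1 * t))) = (1::real)"
    unfolding power_exp_integral(2)[OF zero_less_one, of 0] by simp
  \<comment> \<open>The derivative of \<open>- B t / (a t\<^sup>a)\<close>, whose integral over the half line is zero.\<close>
  define f where "f t = B t / t ^ (a + 1) - Bd t / (real a * t ^ a)" for t
  define K where "K = (- s) ^ a / (real a * fact a)"
  have f_eq: "indicator {0<..} t *\<^sub>R f t = indicator {0<..} t * (B t / t ^ (a + 1))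
      + (s / real a) * (indicator {0<..} t * (exp_remainder b s t / t ^ (b + 1)))
      - K * (indicator {0<..} t * (t ^ 0 * exp (- 1 * t)))" for t
  proof (cases "t > 0")
    case True
    have *: "(- s * E + S * p / F * X) / (A * p) = - ((s / A) * (E / p)) + S / (A * F) * X"
      if "p \<noteq> 0" for E S p F X A :: real
      using that unfolding add_divide_distrib by simp
    have "t ^ a \<noteq> 0" using True by simp
    from *[OF this] have "Bd t / (real a * t ^ a) = - ((s / real a) * (exp_remainder b s t / t ^ (b + 1))) + K * exp (- t)"
      unfolding Bd_def K_def a_def Suc_eq_plus1 by (simp only:)
    then have "f t = B t / t ^ (a + 1) + (s / real a) * (exp_remainder b s t / t ^ (b + 1)) - K * exp (- t)"
      unfolding f_def by linarith
    then show ?thesis using True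
      by (simp only: indicator_simps greaterThan_iff mult_1_left power_0 real_scaleR_def mult_minus1)
  qed (simp add: indicator_def)
  have j2: "integrable lborel (\<lambda>t. (s / real a) * (indicator {0<..} t * (exp_remainder b s t / t ^ (b + 1))))"
    by (intro integrable_mult_right i2)
  have j3: "integrable lborel (\<lambda>t. K * (indicator {0<..} t * (t ^ 0 * exp (- 1 * t))))"
    by (intro integrable_mult_right i3)
  have int_f: "integrable lborel (\<lambda>t. indicator {0<..} t *\<^sub>R f t)"
    unfolding f_eq by (intro Bochner_Integration.integrable_diff Bochner_Integration.integrable_add i1 j2 j3)
  have "(LBINT t=0..\<infinity>. f t) = 0 - 0"
  proof (rule interval_integral_FTC_integrable[where F = "\<lambda>t. - B t / (real a * t ^ a)"])
    show "((\<lambda>t. - B t / (real a * t ^ a)) has_vector_derivative f t) (at t)" if "0 < ereal t" for t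
    proof -
      have t: "t > 0" using that by simp
      have "((\<lambda>t. - B t / (real a * t ^ a)) has_real_derivative f t) (at t)"
      proof -
        have d: "((\<lambda>t. real a * t ^ a) has_real_derivative real a * (real a * t ^ b)) (at t)"
          using DERIV_cmult[OF DERIV_pow[of a t UNIV], of "real a"] by (simp add: a_def)
        have *: "(- D * (A * (p * t)) - (- Bv) * (A * (A * p))) / ((A * (p * t)) * (A * (p * t)))
            = Bv / (p * t * t) - D / (A * (p * t))" if "A \<noteq> 0" "p \<noteq> 0" for A p D Bv :: real
          using that t by (simp add: field_simps)
        have "t ^ b \<noteq> 0" "real a \<noteq> 0" using t by (auto simp: a_def)
        have ta: "t ^ a = t ^ b * t" "t ^ (a + 1) = t ^ b * t * t" by (simp_all add: a_def)
        have "real a * t ^ a \<noteq> 0" using t by (simp add: a_def)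
        from DERIV_divide[OF DERIV_minus[OF deriv] d this]
        show ?thesis unfolding f_def ta *[OF \<open>real a \<noteq> 0\<close> \<open>t ^ b \<noteq> 0\<close>] .
      qed
      then show ?thesis by (simp only: has_real_derivative_iff_has_vector_derivative)
    qed
    show "isCont f t" if "0 < ereal t" for t
      unfolding f_def using that Bcont Bdcont by (intro continuous_intros) (auto simp: a_def)
    show "set_integrable lborel (einterval 0 \<infinity>) f"
      using int_f by (simp add: set_integrable_def zero_ereal_def einterval_eq)
    have lim: "((\<lambda>t::real. C / real a * (t * (2 / (1 + t\<^sup>2)))) \<longlongrightarrow> 0) F \<Longrightarrow> (\<forall>\<^sub>F t in F. t > 0) \<Longrightarrow>
        ((\<lambda>t. - B t / (real a * t ^ a)) \<longlongrightarrow> 0) F" for F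
    proof (rule Lim_null_comparison)
      assume "\<forall>\<^sub>F t in F. t > (0::real)"
      then show "\<forall>\<^sub>F t in F. norm (- B t / (real a * t ^ a)) \<le> C / real a * (t * (2 / (1 + t\<^sup>2)))"
      proof eventually_elim
        case (elim t)
        have "\<bar>B t\<bar> / (real a * t ^ a) \<le> C * (t ^ (a + 1) * (2 / (1 + t\<^sup>2))) / (real a * t ^ a)"
          by (rule divide_right_mono[OF Bb[OF elim]]) (use elim in simp)
        also have "\<dots> = C / real a * (t * (2 / (1 + t\<^sup>2)))"
        proof -
          have "C * ((p * t) * q) / (r * p) = C / r * (t * q)" if "p \<noteq> 0" for p q r :: real using that by simp
          moreover have "t ^ a \<noteq> 0" using elim by simp
          ultimately show ?thesis by (simp only: power_add power_one_right) blast
        qed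
        also have "\<bar>B t\<bar> / (real a * t ^ a) = norm (- B t / (real a * t ^ a))"
          using elim by (simp only: real_norm_def abs_divide abs_minus_cancel abs_mult abs_of_nat abs_of_pos zero_less_power)
        finally show ?case .
      qed
    qed
    show "(((\<lambda>t. - B t / (real a * t ^ a)) \<circ> real_of_ereal) \<longlongrightarrow> 0) (at_right 0)"
      unfolding zero_ereal_def ereal_tendsto_simps
      by (rule lim, real_asymp) (simp add: eventually_at_right_less)
    show "(((\<lambda>t. - B t / (real a * t ^ a)) \<circ> real_of_ereal) \<longlongrightarrow> 0) (at_left \<infinity>)"
      unfolding ereal_tendsto_simps
      by (rule lim, real_asymp) (simp add: eventually_gt_at_top)
  qed simp
  then have "(LINT t|lborel. indicator {0<..} t *\<^sub>R f t) = 0"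
    by (simp add: interval_lebesgue_integral_def set_lebesgue_integral_def zero_ereal_def einterval_eq)
  moreover have "(LINT t|lborel. indicator {0<..} t *\<^sub>R f t) = (LINT t|lborel. indicator {0<..} t * (B t / t ^ (a + 1)))
      + (s / real a) * (LINT t|lborel. indicator {0<..} t * (exp_remainder b s t / t ^ (b + 1))) - K * 1"
    unfolding f_eq Bochner_Integration.integral_diff[OF Bochner_Integration.integrable_add[OF i1 j2] j3]
      Bochner_Integration.integral_add[OF i1 j2] integral_mult_right_zero I3 ..
  ultimately have *: "(LINT t|lborel. indicator {0<..} t * (B t / t ^ (a + 1)))
      = K - (s / real a) * (LINT t|lborel. indicator {0<..} t * (exp_remainder b s t / t ^ (b + 1)))"
    by linarith
  have "fact a * (LINT t|lborel. indicator {0<..} t * (B t / t ^ (a + 1)))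
      = (- s) ^ a / real a - s * (fact b * (LINT t|lborel. indicator {0<..} t * (exp_remainder b s t / t ^ (b + 1))))"
  proof -
    have "(A * F) * (S / (A * (A * F)) - (s / A) * Y) = S / A - s * (F * Y)"
      if "A \<noteq> 0" "F \<noteq> 0" for A F S Y :: real
      using that by (simp add: field_simps)
    moreover have "fact a = real a * fact b" by (simp add: a_def)
    moreover have "real a \<noteq> 0" "fact b \<noteq> (0::real)" by (simp_all add: a_def)
    ultimately show ?thesis unfolding * K_def by (simp only:)
  qed
  also have "\<dots> = (-1) ^ (a + 1) * s ^ a * ln s + (- s) ^ a * harm a"
  proof -
    have "(- s * r) / A - s * (P * q * L + r * H) = (- 1 * P) * (s * q) * L + (- s * r) * (H + 1 / A)"
      for r A P q L H :: real by (simp add: algebra_simps)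
    moreover have "(- s) ^ a = - s * (- s) ^ b" "s ^ a = s * s ^ b" "(-1::real) ^ (a + 1) = - 1 * (- 1) ^ (b + 1)"
      by (simp_all add: a_def)
    moreover have "harm a = harm b + 1 / real a" by (simp add: a_def harm_Suc inverse_eq_divide)
    ultimately show ?thesis unfolding I2 by (simp only:)
  qed
  finally show ?case using i1 unfolding a_def B_def by blast
qed

lemma inverse_power_exp_bound:
  fixes t \<rho> :: real
  assumes "t > 0" "\<rho> > 0"
  shows "exp (- (\<rho> / t)) / t ^ k \<le> fact k / \<rho> ^ k"
proof -
  define u where "u = \<rho> / t"
  have u: "u > 0" using assms by (simp add: u_def)
  have "(\<Sum>i\<in>{k}. u ^ i /\<^sub>R fact i) \<le> (\<Sum>i. u ^ i /\<^sub>R fact i)"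
    by (rule sum_le_suminf[OF summable_exp_generic]) (use u in auto)
  then have "u ^ k \<le> fact k * exp u" by (simp add: exp_def field_simps)
  then have "u ^ k * exp (- u) \<le> fact k" by (simp add: exp_minus field_simps)
  then have "\<rho> ^ k * (exp (- (\<rho> / t)) / t ^ k) \<le> fact k" by (simp add: u_def power_divide)
  then show ?thesis using assms by (simp add: field_simps)
qed

lemma bessel_integrand_integrable:
  fixes c \<rho> :: real
  assumes c: "c > 0" and \<rho>: "\<rho> > 0"
  shows "integrable lborel (\<lambda>t. indicator {0<..} t * (exp (- (\<rho> / t) - c * t) / t ^ k))"
proof (rule Bochner_Integration.integrable_bound[OF integrable_mult_right[OF power_exp_integral(1)[OF c, of 0], of "fact k / \<rho> ^ k"]])
  show "AE t in lborel. norm (indicator {0<..} t * (exp (- (\<rho> / t) - c * t) / t ^ k))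
      \<le> norm (fact k / \<rho> ^ k * (indicator {0<..} t * (t ^ 0 * exp (- c * t))))"
  proof (intro always_eventually allI)
    fix t :: real
    show "norm (indicator {0<..} t * (exp (- (\<rho> / t) - c * t) / t ^ k))
      \<le> norm (fact k / \<rho> ^ k * (indicator {0<..} t * (t ^ 0 * exp (- c * t))))"
    proof (cases "t > 0")
      case True
      have "exp (- (\<rho> / t)) / t ^ k * exp (- c * t) \<le> fact k / \<rho> ^ k * exp (- c * t)"
        by (rule mult_right_mono[OF inverse_power_exp_bound[OF True \<rho>]]) simp
      moreover have "exp (- (\<rho> / t) - c * t) = exp (- (\<rho> / t)) * exp (- c * t)"
        by (simp add: exp_add[symmetric])
      ultimately show ?thesis using True \<rho> by simp
    qed simp
  qed
qed measurable

text \<open>The substitution \<open>t = r / (2 c) * exp u\<close> turns the exponent into \<open>- c r cosh u\<close>, and folding the line at the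
  origin combines \<open>exp (- \<nu> u)\<close> with \<open>exp (\<nu> u)\<close>.\<close>

lemma Bessel_K_integral:
  fixes c r :: real
  assumes c: "c > 0" and r: "r > 0"
  shows "(LINT t|lborel. indicator {0<..} t * (exp (- (r\<^sup>2 / 4 / t) - c\<^sup>2 * t) / t ^ (\<nu> + 1)))
    = 2 * (2 * c / r) ^ \<nu> * Bessel_K (real \<nu>) (c * r)"
proof -
  define \<tau> where "\<tau> = r / (2 * c)"
  have \<tau>: "\<tau> > 0" using c r by (simp add: \<tau>_def)
  define f where "f u = (1 / \<tau>) ^ \<nu> * (exp (- real \<nu> * u) * exp (- (c * r) * cosh u))" for u
  have f0: "f u \<ge> 0" for u using \<tau> by (simp add: f_def)
  have fcont: "isCont f u" for u
    unfolding f_def cosh_def by (intro continuous_intros) auto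
  have fm[measurable]: "f \<in> borel_measurable borel"
    using fcont continuous_at_imp_continuous_on borel_measurable_continuous_onI by blast
  have fg: "f (ln t - ln \<tau>) * (1 / t) = exp (- (r\<^sup>2 / 4 / t) - c\<^sup>2 * t) / t ^ (\<nu> + 1)" if t: "t > 0" for t
  proof -
    have e: "exp (ln t - ln \<tau>) = t / \<tau>" "exp (- (ln t - ln \<tau>)) = \<tau> / t"
      using t \<tau> by (simp_all add: exp_diff)
    have "exp (- real \<nu> * (ln t - ln \<tau>)) = exp (- (ln t - ln \<tau>)) ^ \<nu>"
      by (simp add: exp_of_nat_mult[symmetric] right_diff_distrib)
    then have 1: "exp (- real \<nu> * (ln t - ln \<tau>)) = (\<tau> / t) ^ \<nu>" unfolding e .
    have 2: "(c * r) * cosh (ln t - ln \<tau>) = r\<^sup>2 / 4 / t + c\<^sup>2 * t"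
      unfolding cosh_def e using t c r by (simp add: \<tau>_def field_simps power2_eq_square)
    have 3: "- (c * r) * cosh (ln t - ln \<tau>) = - (r\<^sup>2 / 4 / t) - c\<^sup>2 * t" using 2 by simp
    have "(1 / \<tau>) ^ \<nu> * (\<tau> / t) ^ \<nu> = (1 / t) ^ \<nu>"
      unfolding power_mult_distrib[symmetric] using \<tau> by simp
    moreover have "P * (Q * X) * (1 / t) = P * Q * X / t" for P Q X :: real by simp
    moreover have "(1 / t) ^ \<nu> * X / t = X / t ^ (\<nu> + 1)" for X
      by (simp add: power_one_over)
    ultimately show ?thesis unfolding f_def 1 3 by (simp only:)
  qed
  have ind: "indicator {0<..} t *\<^sub>R (f (ln t - ln \<tau>) * (1 / t))
      = indicator {0<..} t * (exp (- (r\<^sup>2 / 4 / t) - c\<^sup>2 * t) / t ^ (\<nu> + 1))" for t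
  proof (cases "t > 0")
    case True
    then show ?thesis by (simp only: fg real_scaleR_def)
  qed (simp add: indicator_def)
  let ?g = "\<lambda>t. ln t - ln \<tau>" and ?g' = "\<lambda>t::real. 1 / t"
  have s1: "(0::ereal) < \<infinity>" by simp
  have s2: "DERIV ?g t :> ?g' t" if "0 < ereal t" "ereal t < \<infinity>" for t
    using that by (auto intro!: derivative_eq_intros)
  have s4: "isCont ?g' t" if "0 < ereal t" "ereal t < \<infinity>" for t
    using that by (intro continuous_intros) auto
  have s6: "0 \<le> ?g' t" if "0 \<le> ereal t" "ereal t \<le> \<infinity>" for t using that by simp
  have s7: "((ereal \<circ> ?g \<circ> real_of_ereal) \<longlongrightarrow> - \<infinity>) (at_right 0)"
  proof -
    have "filterlim ?g at_bot (at_right 0)" by real_asymp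
    then show ?thesis unfolding zero_ereal_def ereal_tendsto_simps by simp
  qed
  have s8: "((ereal \<circ> ?g \<circ> real_of_ereal) \<longlongrightarrow> \<infinity>) (at_left \<infinity>)"
  proof -
    have "filterlim ?g at_top at_top" by real_asymp
    then show ?thesis unfolding ereal_tendsto_simps by simp
  qed
  have s9: "set_integrable lborel (einterval 0 \<infinity>) (\<lambda>t. f (?g t) * ?g' t)"
    unfolding set_integrable_def zero_ereal_def einterval_eq ind
    by (rule bessel_integrand_integrable) (use c r in simp_all)
  note S = interval_integral_substitution_nonneg[OF s1 s2 fcont s4 f0 s6 s7 s8 s9]
  have fi: "integrable lborel f"
    using S(1) by (simp add: set_integrable_def einterval_def)
  have "(LBINT u=-\<infinity>..\<infinity>. f u) = (LINT u|lborel. f u)"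
    by (simp add: interval_lebesgue_integral_def set_lebesgue_integral_def einterval_def)
  moreover have "(LBINT t=0..\<infinity>. f (?g t) * ?g' t) = (LINT t|lborel. indicator {0<..} t *\<^sub>R (f (?g t) * ?g' t))"
    by (simp only: interval_lebesgue_integral_def set_lebesgue_integral_def zero_ereal_def einterval_eq) simp
  ultimately have eq: "(LINT t|lborel. indicator {0<..} t *\<^sub>R (f (ln t - ln \<tau>) * (1 / t))) = (LINT u|lborel. f u)"
    using S(2) by simp
  have A: "(LINT t|lborel. indicator {0<..} t * (exp (- (r\<^sup>2 / 4 / t) - c\<^sup>2 * t) / t ^ (\<nu> + 1))) = (LINT u|lborel. f u)"
    unfolding ind[symmetric] by (rule eq)
  have i: "integrable lborel (\<lambda>u. indicator S u * f u)" if "S \<in> sets borel" for S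
    using integrable_mult_indicator[OF _ fi, of S] that by simp
  have "(LINT u|lborel. f u) = (LINT u|lborel. indicator {0..} u * f u + indicator {..<0} u * f u)"
    by (intro Bochner_Integration.integral_cong) (auto simp: indicator_def)
  also have "\<dots> = (LINT u|lborel. indicator {0..} u * f u) + (LINT u|lborel. indicator {..<0} u * f u)"
    by (intro Bochner_Integration.integral_add i) auto
  also have "(LINT u|lborel. indicator {..<0} u * f u) = (LINT u|lborel. indicator {..<0} (0 + (-1) * u) * f (0 + (-1) * u))"
    by (subst lborel_integral_real_affine[where c = "-1" and t = 0]) auto
  also have "\<dots> = (LINT u|lborel. indicator {0..} u * f (- u))"
  proof (rule integral_cong_AE)
    show "AE u in lborel. indicator {..<0} (0 + (-1) * u) * f (0 + (-1) * u) = indicator {0..} u * f (- u)"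
      using AE_lborel_singleton[of "0::real"] by eventually_elim (auto simp: indicator_def)
  qed measurable
  also have "(LINT u|lborel. indicator {0..} u * f u) + (LINT u|lborel. indicator {0..} u * f (- u))
      = (LINT u|lborel. indicator {0..} u * f u + indicator {0..} u * f (- u))"
  proof (rule Bochner_Integration.integral_add[symmetric])
    have "integrable lborel (\<lambda>u. indicator {..0} (0 + (-1) * u) * f (0 + (-1) * u))"
      by (rule lborel_integrable_real_affine[OF i]) auto
    moreover have "indicator {..0} (0 + (-1) * u) * f (0 + (-1) * u) = indicator {0..} u * f (- u)" for u :: real
      by (auto simp: indicator_def)
    ultimately show "integrable lborel (\<lambda>u. indicator {0..} u * f (- u))" by (simp only:)
  qed (intro i, auto)
  also have "\<dots> = (LINT u|lborel. (2 * (1 / \<tau>) ^ \<nu>) * (indicator {0..} u *\<^sub>R (exp (- (c * r) * cosh u) * cosh (real \<nu> * u))))"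
  proof (intro Bochner_Integration.integral_cong refl)
    fix u
    have "f u + f (- u) = (2 * (1 / \<tau>) ^ \<nu>) * (exp (- (c * r) * cosh u) * cosh (real \<nu> * u))"
    proof -
      have "P * (x * E) + P * (y * E) = (2 * P) * (E * ((y + x) / 2))" for P x y E :: real
        by (simp add: algebra_simps)
      moreover have "cosh (real \<nu> * u) = (exp (- real \<nu> * - u) + exp (- real \<nu> * u)) / 2"
        by (simp add: cosh_def)
      ultimately show ?thesis unfolding f_def cosh_minus by (simp only:)
    qed
    then show "indicator {0..} u * f u + indicator {0..} u * f (- u)
        = (2 * (1 / \<tau>) ^ \<nu>) * (indicator {0..} u *\<^sub>R (exp (- (c * r) * cosh u) * cosh (real \<nu> * u)))"
      by (simp add: indicator_def)
  qed
  also have "\<dots> = 2 * (1 / \<tau>) ^ \<nu> * Bessel_K (real \<nu>) (c * r)"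
    unfolding Bessel_K_def set_lebesgue_integral_def by (rule integral_mult_right_zero)
  finally show ?thesis unfolding A by (simp only: \<tau>_def divide_divide_eq_right mult_1_left)
qed

text \<open>By induction on \<open>j\<close>: once the lower coefficients vanish, dividing by \<open>t\<^sup>j\<close> and letting \<open>t\<close> tend to zero
  isolates the next one.\<close>

lemma coeffs_zero_of_small_polynomial:
  fixes b :: "nat \<Rightarrow> complex"
  assumes small: "\<And>t. 0 < t \<Longrightarrow> t \<le> 1 \<Longrightarrow> norm (\<Sum>j\<le>a. b j * of_real t ^ j) \<le> K * t ^ (a + 1)"
    and "j \<le> a"
  shows "b j = 0"
  using assms(2)
proof (induction j rule: less_induct)
  case (less j)
  define C where "C = \<bar>K\<bar> + (\<Sum>i\<le>a. norm (b i))"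
  have le: "norm (b j) \<le> t * C" if t: "0 < t" "t \<le> 1" for t :: real
  proof -
    have "(\<Sum>i\<le>a. b i * of_real t ^ i) = (\<Sum>i\<in>{..a}. if i < j then 0 else b i * of_real t ^ i)"
      using less by (intro sum.cong) auto
    also have "\<dots> = b j * of_real t ^ j + (\<Sum>i\<in>{..a} - {j}. if i < j then 0 else b i * of_real t ^ i)"
      using less.prems by (subst sum.remove[of _ j]) auto
    finally have "b j * of_real t ^ j = (\<Sum>i\<le>a. b i * of_real t ^ i)
        - (\<Sum>i\<in>{..a} - {j}. if i < j then 0 else b i * of_real t ^ i)" by simp
    then have "norm (b j * of_real t ^ j) \<le> norm (\<Sum>i\<le>a. b i * of_real t ^ i)
        + norm (\<Sum>i\<in>{..a} - {j}. if i < j then 0 else b i * of_real t ^ i)"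
      by (simp only: norm_triangle_ineq4)
    also have "norm (\<Sum>i\<le>a. b i * of_real t ^ i) \<le> \<bar>K\<bar> * t ^ (j + 1)"
    proof -
      have "K * t ^ (a + 1) \<le> \<bar>K\<bar> * t ^ (j + 1)"
        using t less.prems by (intro mult_mono power_decreasing) auto
      then show ?thesis using small[OF t] by linarith
    qed
    also have "norm (\<Sum>i\<in>{..a} - {j}. if i < j then 0 else b i * of_real t ^ i)
        \<le> (\<Sum>i\<in>{..a} - {j}. norm (b i) * t ^ (j + 1))"
    proof (rule order.trans[OF norm_sum sum_mono])
      fix i assume i: "i \<in> {..a} - {j}"
      show "norm (if i < j then 0 else b i * of_real t ^ i) \<le> norm (b i) * t ^ (j + 1)"
      proof (cases "i < j")
        case False
        then have "t ^ i \<le> t ^ (j + 1)" using i t by (intro power_decreasing) auto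
        then have "norm (b i) * t ^ i \<le> norm (b i) * t ^ (j + 1)" by (rule mult_left_mono) simp
        then show ?thesis using False t by (simp add: norm_mult norm_power del: power_Suc)
      qed (use t in simp)
    qed
    also have "\<dots> \<le> (\<Sum>i\<le>a. norm (b i) * t ^ (j + 1))"
      using t by (intro sum_mono2) auto
    finally have "norm (b j * of_real t ^ j) \<le> C * t ^ (j + 1)"
      by (simp only: C_def distrib_right sum_distrib_right)
    moreover have "norm (b j * of_real t ^ j) = norm (b j) * t ^ j" using t by (simp add: norm_mult norm_power)
    moreover have "C * t ^ (j + 1) = (t * C) * t ^ j" by simp
    ultimately have "norm (b j) * t ^ j \<le> (t * C) * t ^ j" by (simp only:)
    moreover have "t ^ j > 0" using t by simp
    ultimately show ?thesis by (rule mult_right_le_imp_le)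
  qed
  have "norm (b j) \<le> 0"
  proof (rule tendsto_lowerbound)
    show "((\<lambda>t::real. t * C) \<longlongrightarrow> 0) (at_right 0)" by (auto intro!: tendsto_eq_intros)
    show "\<forall>\<^sub>F t in at_right 0. norm (b j) \<le> t * C"
      unfolding eventually_at_right_field using le by (intro exI[of _ 1]) auto
  qed simp
  then show ?case by simp
qed

text \<open>The logarithmic kernel as a mixture of exponentials. Pointwise the mixture converges only after
  Taylor polynomials have been subtracted. The functional given by \<open>w\<close> does not see them: its
  Laplace transform is small at the origin, which forces the moments of \<open>s\<close> up to order \<open>a\<close> to vanish. For the
  same reason the harmonic term of \<open>exp_remainder_integral\<close> drops out. Point masses and Fourier transforms of
  test functions are both instances.\<close>

lemma log_kernel_representation:
  fixes w :: "'b \<Rightarrow> complex" and s :: "'b \<Rightarrow> real"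
  assumes sf: "sigma_finite_measure M"
    and wm[measurable]: "w \<in> borel_measurable M" and sm[measurable]: "s \<in> borel_measurable M"
    and s: "\<And>x. s x > 0" and a: "a \<ge> 1"
    and int: "integrable M (\<lambda>x. norm (w x) * (1 + s x) ^ (a + 1))"
    and small: "\<And>t. 0 < t \<Longrightarrow> t \<le> 1 \<Longrightarrow> norm (LINT x|M. w x * of_real (exp (- (t * s x)))) \<le> K * t ^ (a + 1)"
  shows "(LINT x|M. w x * of_real ((-1) ^ (a + 1) * s x ^ a * ln (s x)))
    = of_real (fact a) * (LINT t|lborel. of_real (indicator {0<..} t / t ^ (a + 1)) * (LINT x|M. w x * of_real (exp (- (t * s x)))))"
proof -
  define \<Phi> where "\<Phi> x = norm (w x) * (1 + s x) ^ (a + 1)" for x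
  have \<Phi>i: "integrable M \<Phi>" using int by (simp add: \<Phi>_def[abs_def])
  have dom: "integrable M (\<lambda>x. w x * of_real (g x))"
    if [measurable]: "g \<in> borel_measurable M" and g: "\<And>x. \<bar>g x\<bar> \<le> B * (1 + s x) ^ (a + 1)" for g B
  proof (rule Bochner_Integration.integrable_bound[OF integrable_mult_right[OF \<Phi>i, of B]])
    show "AE x in M. norm (w x * of_real (g x)) \<le> norm (B * \<Phi> x)"
    proof (intro always_eventually allI)
      fix x
      have "norm (w x) * \<bar>g x\<bar> \<le> norm (w x) * (B * (1 + s x) ^ (a + 1))"
        by (rule mult_left_mono[OF g]) simp
      also have "\<dots> = B * \<Phi> x" by (simp add: \<Phi>_def)
      finally show "norm (w x * of_real (g x)) \<le> norm (B * \<Phi> x)"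
        by (simp add: norm_mult)
    qed
  qed measurable
  have pw: "s x ^ j \<le> (1 + s x) ^ (a + 1)" if "j \<le> a + 1" for j x
    using power_mono[of "s x" "1 + s x" j] power_increasing[OF that, of "1 + s x"] s[of x] by linarith
  define m where "m j = (LINT x|M. w x * of_real (s x ^ j))" for j
  have mi: "integrable M (\<lambda>x. w x * of_real (s x ^ j))" if "j \<le> a + 1" for j
    by (rule dom[where B = 1]) (use pw[OF that] s in \<open>auto simp: less_imp_le\<close>)
  have one: "1 \<le> (1 + s x) ^ (a + 1)" for x using s[of x] by (intro one_le_power) simp
  have ei: "integrable M (\<lambda>x. w x * of_real (exp (- (t * s x))))" if "t > 0" for t
  proof (rule dom[where B = 1])
    fix x
    have "exp (- (t * s x)) \<le> 1" using that s[of x] by simp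
    then show "\<bar>exp (- (t * s x))\<bar> \<le> 1 * (1 + s x) ^ (a + 1)" using one[of x] by (simp only: abs_exp_cancel mult_1_left)
  qed measurable
  define F where "F t = (LINT x|M. w x * of_real (exp (- (t * s x))))" for t
  have m0: "m j = 0" if "j \<le> a" for j
  proof -
    have "(-1) ^ j / fact j * m j = 0"
    proof (rule coeffs_zero_of_small_polynomial[OF _ that])
      fix t :: real assume t: "0 < t" "t \<le> 1"
      define R where "R x = exp (- (t * s x)) - (\<Sum>j<Suc a. (- (t * s x)) ^ j / fact j)" for x
      have [measurable]: "R \<in> borel_measurable M" unfolding R_def by measurable
      have R: "\<bar>R x\<bar> \<le> t ^ (a + 1) * (1 + s x) ^ (a + 1)" for x
      proof -
        have "\<bar>R x\<bar> \<le> (t * s x) ^ Suc a / fact (Suc a)"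
          unfolding R_def by (rule exp_minus_taylor) (use t s[of x] in simp)
        also have "\<dots> \<le> (t * s x) ^ Suc a / 1"
          using t s[of x] by (intro divide_left_mono fact_ge_1) auto
        also have "\<dots> = t ^ (a + 1) * s x ^ (a + 1)" by (simp only: power_mult_distrib div_by_1 Suc_eq_plus1)
        also have "\<dots> \<le> t ^ (a + 1) * (1 + s x) ^ (a + 1)"
          by (rule mult_left_mono[OF pw]) (use t in simp_all)
        finally show ?thesis .
      qed
      have Ri: "integrable M (\<lambda>x. w x * of_real (R x))" by (rule dom[OF _ R]) measurable
      have eq: "w x * of_real (exp (- (t * s x))) - w x * of_real (R x)
          = (\<Sum>j<Suc a. ((-1) ^ j / fact j * of_real t ^ j) * (w x * of_real (s x ^ j)))" for x
      proof -
        have "of_real (exp (- (t * s x))) - of_real (R x) = (\<Sum>j<Suc a. of_real ((- (t * s x)) ^ j / fact j) :: complex)"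
          by (simp only: of_real_diff[symmetric] R_def) simp
        also have "\<dots> = (\<Sum>j<Suc a. ((-1) ^ j / fact j * of_real t ^ j) * of_real (s x ^ j))"
        proof (intro sum.cong refl)
          fix j
          have "(- (t * s x)) ^ j = (-1) ^ j * t ^ j * s x ^ j"
            by (simp only: power_mult_distrib[symmetric]) simp
          then show "of_real ((- (t * s x)) ^ j / fact j) = ((-1) ^ j / fact j * of_real t ^ j) * (of_real (s x ^ j) :: complex)"
            by (simp only:) simp
        qed
        finally show ?thesis
          by (simp only: right_diff_distrib[symmetric] sum_distrib_left mult.left_commute[of "w x"])
      qed
      have "(LINT x|M. w x * of_real (exp (- (t * s x))) - w x * of_real (R x))
          = (\<Sum>j<Suc a. ((-1) ^ j / fact j * of_real t ^ j) * m j)"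
      proof -
        have "integrable M (\<lambda>x. ((-1) ^ j / fact j * of_real t ^ j) * (w x * of_real (s x ^ j)))"
          if "j \<in> {..<Suc a}" for j by (intro integrable_mult_right mi) (use that in auto)
        then show ?thesis
          unfolding eq m_def by (simp only: Bochner_Integration.integral_sum integral_mult_right_zero)
      qed
      then have "(\<Sum>j\<le>a. ((-1) ^ j / fact j * m j) * of_real t ^ j) = F t - (LINT x|M. w x * of_real (R x))"
        unfolding F_def Bochner_Integration.integral_diff[OF ei[OF t(1)] Ri] lessThan_Suc_atMost
        by (simp only: mult.assoc mult.commute[of _ "of_real t ^ _"])
      then have n1: "norm (\<Sum>j\<le>a. ((-1) ^ j / fact j * m j) * of_real t ^ j) \<le> norm (F t) + norm (LINT x|M. w x * of_real (R x))"
        by (simp only: norm_triangle_ineq4)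
      have n2: "norm (LINT x|M. w x * of_real (R x)) \<le> (LINT x|M. t ^ (a + 1) * \<Phi> x)"
      proof (rule order.trans[OF integral_norm_bound integral_mono])
        show "integrable M (\<lambda>x. norm (w x * of_real (R x)))" using Ri by (rule integrable_norm)
        show "integrable M (\<lambda>x. t ^ (a + 1) * \<Phi> x)" by (intro integrable_mult_right \<Phi>i)
        fix x
        have "norm (w x) * \<bar>R x\<bar> \<le> norm (w x) * (t ^ (a + 1) * (1 + s x) ^ (a + 1))"
          by (rule mult_left_mono[OF R]) simp
        then show "norm (w x * of_real (R x)) \<le> t ^ (a + 1) * \<Phi> x"
          by (simp only: norm_mult norm_of_real \<Phi>_def mult.left_commute)
      qed
      have n3: "(LINT x|M. t ^ (a + 1) * \<Phi> x) = t ^ (a + 1) * (LINT x|M. \<Phi> x)" by (rule integral_mult_right_zero)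
      have n4: "norm (F t) \<le> K * t ^ (a + 1)" using small[OF t] unfolding F_def .
      have "norm (\<Sum>j\<le>a. ((-1) ^ j / fact j * m j) * of_real t ^ j) \<le> K * t ^ (a + 1) + t ^ (a + 1) * (LINT x|M. \<Phi> x)"
        using n1 n2 n4 unfolding n3 by linarith
      then show "norm (\<Sum>j\<le>a. ((-1) ^ j / fact j * m j) * of_real t ^ j) \<le> (K + (LINT x|M. \<Phi> x)) * t ^ (a + 1)"
        by (simp only: distrib_right mult.commute[of "t ^ (a + 1)"])
    qed
    then show ?thesis by simp
  qed
  define f where "f x t = w x * of_real (indicator {0<..} t * (exp_remainder a (s x) t / t ^ (a + 1)))" for x t
  have fm: "(\<lambda>(x, t). f x t) \<in> borel_measurable (M \<Otimes>\<^sub>M lborel)"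
    unfolding f_def exp_remainder_def by measurable
  have \<Theta>i: "integrable lborel (\<lambda>t. (real a + 2) * (2 / (1 + t\<^sup>2)))"
    by (intro integrable_mult_right integrable_two_over)
  have fb: "norm (f x t) \<le> \<Phi> x * ((real a + 2) * (2 / (1 + t\<^sup>2)))" for x t
  proof (cases "t > 0")
    case True
    have "\<bar>exp_remainder a (s x) t\<bar> / t ^ (a + 1)
        \<le> (real a + 2) * (1 + s x) ^ (a + 1) * (t ^ (a + 1) * (2 / (1 + t\<^sup>2))) / t ^ (a + 1)"
      by (rule divide_right_mono[OF exp_remainder_bound[OF True _ a]]) (use s[of x] True in simp_all)
    also have "\<dots> = (1 + s x) ^ (a + 1) * ((real a + 2) * (2 / (1 + t\<^sup>2)))"
    proof -
      have "A * B * (p * q) / p = B * (A * q)" if "p \<noteq> 0" for A B p q :: real using that by simp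
      moreover have "t ^ (a + 1) \<noteq> 0" using True by simp
      ultimately show ?thesis by blast
    qed
    finally have "norm (w x) * (\<bar>exp_remainder a (s x) t\<bar> / t ^ (a + 1))
        \<le> norm (w x) * ((1 + s x) ^ (a + 1) * ((real a + 2) * (2 / (1 + t\<^sup>2))))"
      by (rule mult_left_mono) simp
    moreover have "norm (f x t) = norm (w x) * (\<bar>exp_remainder a (s x) t\<bar> / t ^ (a + 1))"
      unfolding f_def norm_mult norm_of_real using True
      by (simp only: indicator_simps greaterThan_iff mult_1_left abs_divide abs_of_pos zero_less_power)
    ultimately show ?thesis by (simp only: \<Phi>_def mult.assoc)
  next
    case False
    then show ?thesis using s[of x] by (simp add: f_def \<Phi>_def add_nonneg_nonneg)
  qed
  note Fu = Fubini_dominated[OF sf lborel.sigma_finite_measure_axioms fm \<Phi>i \<Theta>i fb]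
  define I where "I x = (LINT t|lborel. indicator {0<..} t * (exp_remainder a (s x) t / t ^ (a + 1)))" for x
  have inner_t: "(LINT t|lborel. f x t) = w x * of_real (I x)" for x
    unfolding f_def I_def by (simp only: integral_mult_right_zero integral_complex_of_real)
  have I: "fact a * I x = (-1) ^ (a + 1) * s x ^ a * ln (s x) + (- s x) ^ a * harm a" for x
    unfolding I_def using exp_remainder_integral[OF s] by blast
  have inner_x: "(LINT x|M. f x t) = of_real (indicator {0<..} t / t ^ (a + 1)) * F t" for t
  proof (cases "t > 0")
    case True
    define c where "c j = (-1) ^ j / fact j * of_real t ^ j * (if j = a then of_real (exp (- t)) else 1 :: complex)" for j
    have rem: "w x * of_real (exp_remainder a (s x) t)
        = w x * of_real (exp (- (t * s x))) - (\<Sum>j<Suc a. c j * (w x * of_real (s x ^ j)))" for x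
    proof -
      have p: "(- (t * s x)) ^ j = (-1) ^ j * t ^ j * s x ^ j" for j
        by (simp only: power_mult_distrib[symmetric]) simp
      have "(\<Sum>j<Suc a. c j * (w x * of_real (s x ^ j)))
          = w x * of_real ((\<Sum>j<a. (- (t * s x)) ^ j / fact j) + (- (t * s x)) ^ a / fact a * exp (- t))"
        unfolding sum.lessThan_Suc of_real_add distrib_left of_real_sum sum_distrib_left
        by (intro arg_cong2[where f = plus] sum.cong) (auto simp: c_def p)
      then show ?thesis unfolding exp_remainder_def by (simp add: algebra_simps)
    qed
    have "(LINT x|M. w x * of_real (exp_remainder a (s x) t)) = F t - (\<Sum>j<Suc a. c j * m j)"
    proof -
      have j: "integrable M (\<lambda>x. c j * (w x * of_real (s x ^ j)))" if "j \<in> {..<Suc a}" for j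
        by (intro integrable_mult_right mi) (use that in auto)
      then have "(LINT x|M. (\<Sum>j<Suc a. c j * (w x * of_real (s x ^ j)))) = (\<Sum>j<Suc a. c j * m j)"
        unfolding m_def by (simp only: Bochner_Integration.integral_sum integral_mult_right_zero)
      then show ?thesis
        unfolding rem F_def
        by (simp only: Bochner_Integration.integral_diff[OF ei[OF True] Bochner_Integration.integrable_sum[OF j]])
    qed
    also have "(\<Sum>j<Suc a. c j * m j) = 0" using m0 by (intro sum.neutral) auto
    finally have "(LINT x|M. w x * of_real (exp_remainder a (s x) t)) = F t" by simp
    moreover have "f x t = of_real (indicator {0<..} t / t ^ (a + 1)) * (w x * of_real (exp_remainder a (s x) t))" for x
      by (simp add: f_def)
    ultimately show ?thesis by simp
  qed (simp add: f_def)
  have Ii: "integrable M (\<lambda>x. w x * of_real (I x))" using Fu(2) unfolding inner_t .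
  have "w x * of_real ((-1) ^ (a + 1) * s x ^ a * ln (s x))
      = of_real (fact a) * (w x * of_real (I x)) - of_real ((-1) ^ a * harm a) * (w x * of_real (s x ^ a))" for x
  proof -
    have "(- s x) ^ a = (-1) ^ a * s x ^ a" by (simp only: power_mult_distrib[symmetric]) simp
    then have "(-1) ^ (a + 1) * s x ^ a * ln (s x) = fact a * I x - (-1) ^ a * harm a * s x ^ a"
      using I[of x] by (simp only:) (simp add: algebra_simps)
    then show ?thesis by (simp only: of_real_diff of_real_mult right_diff_distrib mult.left_commute mult.commute)
  qed
  then have "(LINT x|M. w x * of_real ((-1) ^ (a + 1) * s x ^ a * ln (s x)))
      = (LINT x|M. of_real (fact a) * (w x * of_real (I x)) - of_real ((-1) ^ a * harm a) * (w x * of_real (s x ^ a)))"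
    by (simp only:)
  also have "\<dots> = of_real (fact a) * (LINT x|M. w x * of_real (I x)) - of_real ((-1) ^ a * harm a) * m a"
  proof -
    have k1: "integrable M (\<lambda>x. of_real (fact a) * (w x * of_real (I x)))" by (intro integrable_mult_right Ii)
    have k2: "integrable M (\<lambda>x. of_real ((-1) ^ a * harm a) * (w x * of_real (s x ^ a)))"
      by (intro integrable_mult_right mi) simp
    show ?thesis unfolding m_def Bochner_Integration.integral_diff[OF k1 k2] integral_mult_right_zero ..
  qed
  also have "(LINT x|M. w x * of_real (I x)) = (LINT t|lborel. of_real (indicator {0<..} t / t ^ (a + 1)) * F t)"
    using Fu(1) unfolding inner_t inner_x .
  finally show ?thesis using m0[of a] by (simp add: F_def)
qed

section \<open>The generalized Fourier transform of the shifted surface spline\<close>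

lemma shifted_surface_spline_alt:
  fixes x :: "real ^ 'n"
  assumes "even lam" "c > 0"
  shows "shifted_surface_spline lam c x = 1 / 2 * ((-1) ^ (lam div 2 + 1) * ((norm x)\<^sup>2 + c\<^sup>2) ^ (lam div 2) * ln ((norm x)\<^sup>2 + c\<^sup>2))"
proof -
  have s: "(norm x)\<^sup>2 + c\<^sup>2 > 0" using assms by (simp add: add_nonneg_pos)
  have "real lam / 2 = real (lam div 2)" using assms by (auto elim: evenE)
  then have "((norm x)\<^sup>2 + c\<^sup>2) powr (real lam / 2) = ((norm x)\<^sup>2 + c\<^sup>2) ^ (lam div 2)"
    using s by (simp only: powr_realpow)
  moreover have "ln (sqrt ((norm x)\<^sup>2 + c\<^sup>2)) = ln ((norm x)\<^sup>2 + c\<^sup>2) / 2" using s by (simp add: ln_sqrt)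
  ultimately show ?thesis by (simp add: shifted_surface_spline_def)
qed

lemma fourier_measurable:
  assumes "\<phi> \<in> test_functions"
  shows "fourier \<phi> \<in> borel_measurable borel"
proof -
  note [measurable] = borel_measurable_integrable[OF test_functions_integrable(1)[OF assms]]
  have "(\<lambda>\<xi>. LINT x|lborel. exp (- \<i> * complex_of_real (x \<bullet> \<xi>)) * \<phi> x) \<in> borel_measurable lborel"
  proof (rule lborel.borel_measurable_lebesgue_integral)
    have "(\<lambda>p::'a \<times> 'a. exp (- \<i> * complex_of_real (snd p \<bullet> fst p))) \<in> borel_measurable borel"
      by (intro borel_measurable_continuous_onI continuous_intros)
    then have "(\<lambda>p::'a \<times> 'a. exp (- \<i> * complex_of_real (snd p \<bullet> fst p))) \<in> borel_measurable (lborel \<Otimes>\<^sub>M lborel)"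
      by (simp add: lborel_prod)
    then show "(\<lambda>(\<xi>, x). exp (- \<i> * complex_of_real (x \<bullet> \<xi>)) * \<phi> x) \<in> borel_measurable (lborel \<Otimes>\<^sub>M lborel)"
      unfolding split_beta' by measurable
  qed
  then show ?thesis by (simp add: fourier_def[abs_def])
qed

text \<open>The Fourier transform is moved from the test function to the Gaussian.\<close>

lemma fourier_gauss_pairing:
  fixes \<phi> :: "'a::euclidean_space \<Rightarrow> complex"
  assumes \<phi>: "\<phi> \<in> test_functions" and t: "t > 0"
  shows "(LINT x|lborel. fourier \<phi> x * of_real (exp (- t * (norm x)\<^sup>2)))
    = (LINT \<xi>|lborel. \<phi> \<xi> * of_real (sqrt (pi / t) ^ DIM('a) * exp (- (norm \<xi>)\<^sup>2 / (4 * t))))"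
proof -
  note \<phi>i = test_functions_integrable(1)[OF \<phi>]
  note [measurable] = borel_measurable_integrable[OF \<phi>i]
  define f where "f x \<xi> = of_real (exp (- t * (norm x)\<^sup>2)) * (exp (- \<i> * complex_of_real (\<xi> \<bullet> x)) * \<phi> \<xi>)" for x \<xi> :: 'a
  have m: "(\<lambda>(x, \<xi>). f x \<xi>) \<in> borel_measurable (lborel \<Otimes>\<^sub>M lborel)"
  proof -
    have "(\<lambda>p::'a \<times> 'a. exp (- \<i> * complex_of_real (snd p \<bullet> fst p))) \<in> borel_measurable borel"
      by (intro borel_measurable_continuous_onI continuous_intros)
    then have "(\<lambda>p::'a \<times> 'a. exp (- \<i> * complex_of_real (snd p \<bullet> fst p))) \<in> borel_measurable (lborel \<Otimes>\<^sub>M lborel)"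
      by (simp add: lborel_prod)
    then show ?thesis unfolding split_beta' f_def by measurable
  qed
  have ni: "integrable lborel (\<lambda>\<xi>. norm (\<phi> \<xi>))" using \<phi>i by simp
  have b: "norm (f x \<xi>) \<le> exp (- t * (norm x)\<^sup>2) * norm (\<phi> \<xi>)" for x \<xi>
    unfolding f_def norm_mult by simp
  have A: "(LINT \<xi>|lborel. f x \<xi>) = fourier \<phi> x * of_real (exp (- t * (norm x)\<^sup>2))" for x
    unfolding f_def fourier_def by simp
  have B: "(LINT x|lborel. f x \<xi>) = \<phi> \<xi> * of_real (sqrt (pi / t) ^ DIM('a) * exp (- (norm \<xi>)\<^sup>2 / (4 * t)))" for \<xi>
  proof -
    have "f x \<xi> = \<phi> \<xi> * (exp (- \<i> * complex_of_real (x \<bullet> \<xi>)) * of_real (exp (- t * (norm x)\<^sup>2)))" for x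
      unfolding f_def by (simp add: inner_commute)
    then have "(LINT x|lborel. f x \<xi>) = \<phi> \<xi> * fourier (\<lambda>x. of_real (exp (- t * (norm x)\<^sup>2))) \<xi>"
      unfolding fourier_def by simp
    then show ?thesis by (simp only: gauss_fourier(2)[OF t])
  qed
  show ?thesis
    using Fubini_dominated(1)[OF lborel.sigma_finite_measure_axioms lborel.sigma_finite_measure_axioms
        m gauss_integral(1)[OF t] ni b]
    unfolding A B .
qed

lemma fourier_weighted_integrable:
  fixes \<phi> :: "'a::euclidean_space \<Rightarrow> complex"
  assumes \<phi>: "\<phi> \<in> test_functions"
  shows "integrable lborel (\<lambda>x. norm (fourier \<phi> x) * (1 + ((norm x)\<^sup>2 + c\<^sup>2)) ^ k)"
proof -
  note [measurable] = fourier_measurable[OF \<phi>]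
  obtain B where B: "B \<ge> 0" "\<And>x. (1 + (norm x)\<^sup>2) ^ (DIM('a) + k) * norm (fourier \<phi> x) \<le> B"
    using fourier_decay[OF \<phi>] by blast
  show ?thesis
  proof (rule Bochner_Integration.integrable_bound[OF integrable_mult_right[OF integrable_cauchy_product, of "(1 + c\<^sup>2) ^ k * B"]])
    show "AE x in lborel. norm (norm (fourier \<phi> x) * (1 + ((norm x)\<^sup>2 + c\<^sup>2)) ^ k)
        \<le> norm ((1 + c\<^sup>2) ^ k * B * (\<Prod>b\<in>Basis. 1 / (1 + ((x::'a) \<bullet> b)\<^sup>2)))"
    proof (intro always_eventually allI)
      fix x :: 'a
      define u where "u = 1 + (norm x)\<^sup>2"
      define P where "P = (\<Prod>b\<in>Basis. 1 + (x \<bullet> b)\<^sup>2)"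
      have P0: "P > 0" unfolding P_def by (intro prod_pos) (auto intro: add_pos_nonneg)
      have u1: "u \<ge> 1" by (simp add: u_def)
      have "P \<le> (\<Prod>b\<in>(Basis::'a set). u)"
        unfolding P_def
      proof (rule prod_mono)
        fix b :: 'a assume "b \<in> Basis"
        then have "\<bar>x \<bullet> b\<bar> \<le> norm x" by (rule Basis_le_norm)
        then have "(x \<bullet> b)\<^sup>2 \<le> (norm x)\<^sup>2" by (rule abs_le_square_iff[THEN iffD1, of "x \<bullet> b" "norm x", simplified])
        then show "0 \<le> 1 + (x \<bullet> b)\<^sup>2 \<and> 1 + (x \<bullet> b)\<^sup>2 \<le> u" by (simp add: u_def)
      qed
      then have Pu: "P \<le> u ^ DIM('a)" by simp
      have "1 + ((norm x)\<^sup>2 + c\<^sup>2) \<le> (1 + c\<^sup>2) * u"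
        by (simp add: u_def algebra_simps)
      then have "(1 + ((norm x)\<^sup>2 + c\<^sup>2)) ^ k \<le> ((1 + c\<^sup>2) * u) ^ k" by (intro power_mono) auto
      then have "norm (fourier \<phi> x) * (1 + ((norm x)\<^sup>2 + c\<^sup>2)) ^ k * P
          \<le> norm (fourier \<phi> x) * ((1 + c\<^sup>2) * u) ^ k * u ^ DIM('a)"
        using Pu P0 u1 by (intro mult_mono mult_left_mono) auto
      also have "\<dots> = (1 + c\<^sup>2) ^ k * (u ^ (DIM('a) + k) * norm (fourier \<phi> x))"
        by (simp add: power_mult_distrib power_add)
      also have "\<dots> \<le> (1 + c\<^sup>2) ^ k * B" using B(2)[of x] by (intro mult_left_mono) (auto simp: u_def)
      finally have "norm (fourier \<phi> x) * (1 + ((norm x)\<^sup>2 + c\<^sup>2)) ^ k \<le> (1 + c\<^sup>2) ^ k * B / P"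
        using P0 by (simp only: pos_le_divide_eq)
      moreover have "(\<Prod>b\<in>Basis. 1 / (1 + (x \<bullet> b)\<^sup>2)) = 1 / P" unfolding P_def by (simp add: prod_dividef)
      moreover have "norm (fourier \<phi> x) * (1 + ((norm x)\<^sup>2 + c\<^sup>2)) ^ k \<ge> 0" by simp
      ultimately show "norm (norm (fourier \<phi> x) * (1 + ((norm x)\<^sup>2 + c\<^sup>2)) ^ k)
        \<le> norm ((1 + c\<^sup>2) ^ k * B * (\<Prod>b\<in>Basis. 1 / (1 + (x \<bullet> b)\<^sup>2)))"
        using abs_ge_self[of "(1 + c\<^sup>2) ^ k * B / P"]
        unfolding real_norm_def by (simp only: abs_of_nonneg times_divide_eq_right mult_1_right)
    qed
  qed measurable
qed

lemma sqrt_power_double: "x \<ge> 0 \<Longrightarrow> sqrt x ^ (2 * N) = x ^ N"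
  by (simp add: power_mult)

text \<open>The constant \<open>l(\<lambda>,n)\<close> for \<open>\<lambda> = 2 a\<close> and \<open>n = 2 N\<close>, see \<open>surface_spline_l_eq\<close>.\<close>

definition spline_const :: "nat \<Rightarrow> nat \<Rightarrow> real" where
  "spline_const N a = fact a * pi ^ N * 2 ^ (a + N)"

text \<open>If \<open>\<phi>\<close> vanishes near the origin, its averages against \<open>exp (- |\<xi>|\<^sup>2 / (4 t))\<close> are of the order \<open>exp (- \<rho> / t)\<close>, so
  the Laplace transform required by \<open>log_kernel_representation\<close> is small to every order. The remaining integral over
  \<open>t\<close>, for fixed \<open>\<xi>\<close>, is the Bessel integral.\<close>

lemma spline_fourier_transform:
  fixes \<phi> :: "real ^ 'n::finite \<Rightarrow> complex"
  assumes n: "CARD('n) = 2 * N" and lam: "lam = 2 * a" "a \<ge> 1" and c: "c > 0"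
    and \<phi>: "\<phi> \<in> test_functions" and away: "0 \<notin> closure {x. \<phi> x \<noteq> 0}"
  defines "g \<equiv> (\<lambda>\<theta>::real^'n. norm \<theta> powr (- real lam - real CARD('n))
              * Bessel_K_tilde ((real CARD('n) + real lam) / 2) (c * norm \<theta>))"
  shows "(LINT x|lborel. complex_of_real (shifted_surface_spline lam c x) * fourier \<phi> x)
      = (LINT \<theta>|lborel. complex_of_real (spline_const N a * g \<theta>) * \<phi> \<theta>)"
    and "integrable lborel (\<lambda>\<theta>. complex_of_real (spline_const N a * g \<theta>) * \<phi> \<theta>)"
proof -
  note \<phi>i = test_functions_integrable(1)[OF \<phi>]
  note [measurable] = borel_measurable_integrable[OF \<phi>i] fourier_measurable[OF \<phi>]
  obtain r where r: "r > 0" "\<And>\<xi>. \<phi> \<xi> \<noteq> 0 \<Longrightarrow> norm \<xi> \<ge> r"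
  proof -
    have "open (- closure {x. \<phi> x \<noteq> 0})" by auto
    then obtain r where "r > 0" "ball 0 r \<subseteq> - closure {x. \<phi> x \<noteq> 0}"
      using away open_contains_ball by blast
    then have "norm \<xi> \<ge> r" if "\<phi> \<xi> \<noteq> 0" for \<xi>
      using that closure_subset[of "{x. \<phi> x \<noteq> 0}"] by (force simp: not_le[symmetric])
    then show thesis using that \<open>r > 0\<close> by blast
  qed
  define s where "s x = (norm x)\<^sup>2 + c\<^sup>2" for x :: "real ^ 'n"
  have s0: "s x > 0" for x using c by (simp add: s_def add_nonneg_pos)
  define G where "G t = (LINT \<xi>|lborel. \<phi> \<xi> * of_real (exp (- (norm \<xi>)\<^sup>2 / (4 * t))))" for t :: real
  have laplace: "(LINT x|lborel. fourier \<phi> x * of_real (exp (- (t * s x)))) = of_real (exp (- (c\<^sup>2 * t)) * pi ^ N / t ^ N) * G t"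
    if t: "t > 0" for t
  proof -
    have "fourier \<phi> x * of_real (exp (- (t * s x))) = of_real (exp (- (c\<^sup>2 * t))) * (fourier \<phi> x * of_real (exp (- t * (norm x)\<^sup>2)))" for x
    proof -
      have "exp (- (t * s x)) = exp (- (c\<^sup>2 * t)) * exp (- t * (norm x)\<^sup>2)"
        unfolding exp_add[symmetric] by (simp add: s_def algebra_simps)
      then show ?thesis by simp
    qed
    then have "(LINT x|lborel. fourier \<phi> x * of_real (exp (- (t * s x))))
        = of_real (exp (- (c\<^sup>2 * t))) * (LINT x|lborel. fourier \<phi> x * of_real (exp (- t * (norm x)\<^sup>2)))"
      by (simp only: integral_mult_right_zero)
    also have "(LINT x|lborel. fourier \<phi> x * of_real (exp (- t * (norm x)\<^sup>2)))
        = (LINT \<xi>|lborel. of_real (pi ^ N / t ^ N) * (\<phi> \<xi> * of_real (exp (- (norm \<xi>)\<^sup>2 / (4 * t)))))"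
      unfolding fourier_gauss_pairing[OF \<phi> t]
    proof (intro Bochner_Integration.integral_cong refl)
      fix \<xi> :: "real ^ 'n"
      have "sqrt (pi / t) ^ DIM(real ^ 'n) = pi ^ N / t ^ N"
        using t by (simp add: n sqrt_power_double power_divide)
      then show "\<phi> \<xi> * of_real (sqrt (pi / t) ^ DIM(real ^ 'n) * exp (- (norm \<xi>)\<^sup>2 / (4 * t)))
          = of_real (pi ^ N / t ^ N) * (\<phi> \<xi> * of_real (exp (- (norm \<xi>)\<^sup>2 / (4 * t))))"
        by (simp only: of_real_mult mult.left_commute)
    qed
    also have "\<dots> = of_real (pi ^ N / t ^ N) * G t" unfolding G_def by (rule integral_mult_right_zero)
    finally show ?thesis by (simp only: of_real_mult[symmetric] mult.assoc[symmetric] times_divide_eq_right)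
  qed
  define \<rho> where "\<rho> = r\<^sup>2 / 4"
  have \<rho>: "\<rho> > 0" using r by (simp add: \<rho>_def)
  have gauss_le: "exp (- (norm \<xi>)\<^sup>2 / (4 * t)) \<le> exp (- (\<rho> / t))" if "t > 0" "\<phi> \<xi> \<noteq> 0" for t \<xi>
  proof -
    have "r\<^sup>2 \<le> (norm \<xi>)\<^sup>2" using r that by (intro power_mono) auto
    then have "r\<^sup>2 / (4 * t) \<le> (norm \<xi>)\<^sup>2 / (4 * t)" using that by (intro divide_right_mono) auto
    then show ?thesis by (simp add: \<rho>_def)
  qed
  define I1 where "I1 = (LINT \<xi>|lborel. norm (\<phi> \<xi>))"
  have Gle: "norm (G t) \<le> exp (- (\<rho> / t)) * I1" if t: "t > 0" for t
  proof -
    have p: "norm (\<phi> \<xi> * of_real (exp (- (norm \<xi>)\<^sup>2 / (4 * t)))) \<le> exp (- (\<rho> / t)) * norm (\<phi> \<xi>)" for \<xi>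
      using mult_right_mono[OF gauss_le[OF t, of \<xi>], of "norm (\<phi> \<xi>)"]
      by (cases "\<phi> \<xi> = 0") (simp_all add: norm_mult mult.commute)
    have i: "integrable lborel (\<lambda>\<xi>. exp (- (\<rho> / t)) * norm (\<phi> \<xi>))" using \<phi>i by simp
    have "norm (G t) \<le> (LINT \<xi>|lborel. exp (- (\<rho> / t)) * norm (\<phi> \<xi>))"
      unfolding G_def
    proof (rule Bochner_Integration.integral_norm_bound_integral[OF _ i])
      show "integrable lborel (\<lambda>\<xi>. \<phi> \<xi> * of_real (exp (- (norm \<xi>)\<^sup>2 / (4 * t))))"
        by (rule Bochner_Integration.integrable_bound[OF i])
          (measurable, use p in \<open>auto intro!: always_eventually intro: order.trans[OF _ abs_ge_self]\<close>)
    qed (rule p)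
    then show ?thesis by (simp add: I1_def)
  qed
  have I1: "I1 \<ge> 0" by (simp add: I1_def)
  have small: "norm (LINT x|lborel. fourier \<phi> x * of_real (exp (- (t * s x))))
      \<le> (pi ^ N * I1 * (fact (N + a + 1) / \<rho> ^ (N + a + 1))) * t ^ (a + 1)" if t: "0 < t" "t \<le> 1" for t
  proof -
    have e: "exp (- (\<rho> / t)) \<le> fact (N + a + 1) / \<rho> ^ (N + a + 1) * t ^ (N + a + 1)"
      using inverse_power_exp_bound[OF t(1) \<rho>, of "N + a + 1"] t(1) by (simp only: pos_divide_le_eq zero_less_power)
    have "norm (LINT x|lborel. fourier \<phi> x * of_real (exp (- (t * s x)))) = exp (- (c\<^sup>2 * t)) * pi ^ N / t ^ N * norm (G t)"
      unfolding laplace[OF t(1)] norm_mult norm_of_real using t by simp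
    also have "\<dots> \<le> 1 * pi ^ N / t ^ N * (exp (- (\<rho> / t)) * I1)"
      using t Gle[OF t(1)] I1 by (intro mult_mono divide_right_mono) auto
    also have "\<dots> \<le> 1 * pi ^ N / t ^ N * ((fact (N + a + 1) / \<rho> ^ (N + a + 1) * t ^ (N + a + 1)) * I1)"
      using t I1 e by (intro mult_left_mono mult_right_mono) auto
    also have "\<dots> = (pi ^ N * I1 * (fact (N + a + 1) / \<rho> ^ (N + a + 1))) * t ^ (a + 1)"
    proof -
      have "t ^ (N + a + 1) = t ^ N * t ^ (a + 1)" by (simp add: power_add)
      moreover have "1 * p / q * ((F * (q * w)) * i) = (p * i * F) * w" if "q \<noteq> 0" for p q F w i :: real
        using that by simp
      moreover have "t ^ N \<noteq> 0" using t by simp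
      ultimately show ?thesis by (simp only:)
    qed
    finally show ?thesis .
  qed
  have rep: "(LINT x|lborel. fourier \<phi> x * of_real ((-1) ^ (a + 1) * s x ^ a * ln (s x)))
    = of_real (fact a) * (LINT t|lborel. of_real (indicator {0<..} t / t ^ (a + 1)) * (LINT x|lborel. fourier \<phi> x * of_real (exp (- (t * s x)))))"
  proof (rule log_kernel_representation[OF lborel.sigma_finite_measure_axioms _ _ s0 lam(2) _ small])
    show "integrable lborel (\<lambda>x. norm (fourier \<phi> x) * (1 + s x) ^ (a + 1))"
      unfolding s_def by (rule fourier_weighted_integrable[OF \<phi>])
  qed (unfold s_def, measurable)
  define C where "C = fact a / 2 * pi ^ N"
  define f where "f t \<xi> = \<phi> \<xi> * of_real (C * (indicator {0<..} t * (exp (- ((norm \<xi>)\<^sup>2 / 4 / t) - c\<^sup>2 * t) / t ^ (a + N + 1))))" for t \<xi>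
  have fm: "(\<lambda>(t, \<xi>). f t \<xi>) \<in> borel_measurable (lborel \<Otimes>\<^sub>M lborel)"
    unfolding f_def by measurable
  have \<Theta>i: "integrable lborel (\<lambda>t. C * (indicator {0<..} t * (exp (- (\<rho> / t) - c\<^sup>2 * t) / t ^ (a + N + 1))))"
    by (intro integrable_mult_right bessel_integrand_integrable) (use c \<rho> in auto)
  have ni: "integrable lborel (\<lambda>\<xi>. norm (\<phi> \<xi>))" using \<phi>i by simp
  have C0: "C \<ge> 0" by (simp add: C_def)
  have fb: "norm (f t \<xi>) \<le> (C * (indicator {0<..} t * (exp (- (\<rho> / t) - c\<^sup>2 * t) / t ^ (a + N + 1)))) * norm (\<phi> \<xi>)" for t \<xi>
  proof (cases "t > 0 \<and> \<phi> \<xi> \<noteq> 0")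
    case True
    have "exp (- ((norm \<xi>)\<^sup>2 / 4 / t) - c\<^sup>2 * t) \<le> exp (- (\<rho> / t) - c\<^sup>2 * t)"
      using gauss_le[of t \<xi>] True by simp
    then have "C * (exp (- ((norm \<xi>)\<^sup>2 / 4 / t) - c\<^sup>2 * t) / t ^ (a + N + 1)) \<le> C * (exp (- (\<rho> / t) - c\<^sup>2 * t) / t ^ (a + N + 1))"
      using C0 True by (intro mult_left_mono divide_right_mono) auto
    then have "norm (\<phi> \<xi>) * (C * (exp (- ((norm \<xi>)\<^sup>2 / 4 / t) - c\<^sup>2 * t) / t ^ (a + N + 1)))
        \<le> norm (\<phi> \<xi>) * (C * (exp (- (\<rho> / t) - c\<^sup>2 * t) / t ^ (a + N + 1)))"
      by (rule mult_left_mono) simp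
    moreover have "C * (exp (- ((norm \<xi>)\<^sup>2 / 4 / t) - c\<^sup>2 * t) / t ^ (a + N + 1)) \<ge> 0" using C0 True by simp
    ultimately show ?thesis using True
      by (simp only: f_def norm_mult norm_of_real abs_of_nonneg indicator_simps greaterThan_iff mult_1_left mult.commute)
  qed (auto simp: f_def)
  note Fu = Fubini_dominated[OF lborel.sigma_finite_measure_axioms lborel.sigma_finite_measure_axioms fm \<Theta>i ni fb]
  have inner_\<xi>: "(LINT \<xi>|lborel. f t \<xi>)
      = of_real (fact a / 2) * (of_real (indicator {0<..} t / t ^ (a + 1)) * (LINT x|lborel. fourier \<phi> x * of_real (exp (- (t * s x)))))" for t
  proof (cases "t > 0")
    case True
    have "f t \<xi> = of_real (C * exp (- (c\<^sup>2 * t)) / t ^ (a + N + 1)) * (\<phi> \<xi> * of_real (exp (- (norm \<xi>)\<^sup>2 / (4 * t))))" for \<xi>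
    proof -
      have "exp (- ((norm \<xi>)\<^sup>2 / 4 / t) - c\<^sup>2 * t) = exp (- (c\<^sup>2 * t)) * exp (- (norm \<xi>)\<^sup>2 / (4 * t))"
        unfolding exp_add[symmetric] by simp
      then show ?thesis using True by (simp add: f_def)
    qed
    then have "(LINT \<xi>|lborel. f t \<xi>) = of_real (C * exp (- (c\<^sup>2 * t)) / t ^ (a + N + 1)) * G t"
      unfolding G_def by (simp only: integral_mult_right_zero)
    also have "C * exp (- (c\<^sup>2 * t)) / t ^ (a + N + 1) = (fact a / 2) * (1 / t ^ (a + 1) * (exp (- (c\<^sup>2 * t)) * pi ^ N / t ^ N))"
    proof -
      have "t ^ (a + N + 1) = t ^ (a + 1) * t ^ N" by (simp add: power_add)
      then show ?thesis unfolding C_def by (simp only: times_divide_eq_left times_divide_eq_right divide_divide_eq_left mult_1_left mult.assoc mult.left_commute mult.commute)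
    qed
    finally show ?thesis unfolding laplace[OF True] using True by (simp only: indicator_simps greaterThan_iff of_real_mult mult.assoc)
  qed (simp add: f_def)
  have inner_t: "(LINT t|lborel. f t \<xi>) = of_real (spline_const N a * g \<xi>) * \<phi> \<xi>" for \<xi>
  proof (cases "\<phi> \<xi> = 0")
    case False
    define y where "y = norm \<xi>"
    have y: "y > 0" using r(2)[OF False] r(1) unfolding y_def by linarith
    have "(LINT t|lborel. f t \<xi>) = \<phi> \<xi> * of_real (C * (2 * (2 * c / y) ^ (a + N) * Bessel_K (real (a + N)) (c * y)))"
      unfolding f_def y_def[symmetric]
      by (simp only: integral_mult_right_zero integral_complex_of_real Bessel_K_integral[OF c y, of "a + N"])
    also have "C * (2 * (2 * c / y) ^ (a + N) * Bessel_K (real (a + N)) (c * y)) = spline_const N a * g \<xi>"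
    proof -
      have e: "(real CARD('n) + real lam) / 2 = real (a + N)" "- real lam - real CARD('n) = - real (2 * (a + N))"
        using n lam(1) by auto
      have "g \<xi> = inverse (y ^ (2 * (a + N))) * ((c * y) ^ (a + N) * Bessel_K (real (a + N)) (c * y))"
        unfolding g_def Bessel_K_tilde_def e y_def[symmetric] using y c
        by (simp only: powr_minus powr_realpow mult_pos_pos)
      moreover have "y ^ (2 * (a + N)) = y ^ (a + N) * y ^ (a + N)" by (simp only: mult_2 power_add)
      moreover have "y ^ (a + N) \<noteq> 0" using y by simp
      moreover have "F / 2 * P * (2 * (w * q / p) * K) = F * P * w * (inverse (p * p) * (q * p * K))" if "p \<noteq> 0" for F P w q p K :: real
        using that by (simp add: field_simps)
      ultimately show ?thesis unfolding C_def spline_const_def power_mult_distrib power_divide by (simp only:)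
    qed
    finally show ?thesis by (simp only: mult.commute)
  qed (simp add: f_def)
  show "integrable lborel (\<lambda>\<theta>. complex_of_real (spline_const N a * g \<theta>) * \<phi> \<theta>)"
    using Fu(3) unfolding inner_t .
  have "(LINT x|lborel. complex_of_real (shifted_surface_spline lam c x) * fourier \<phi> x)
      = (LINT x|lborel. of_real (1 / 2) * (fourier \<phi> x * of_real ((-1) ^ (a + 1) * s x ^ a * ln (s x))))"
  proof (intro Bochner_Integration.integral_cong refl)
    fix x :: "real ^ 'n"
    have "even lam" "lam div 2 = a" using lam(1) by auto
    then have "shifted_surface_spline lam c x = 1 / 2 * ((-1) ^ (a + 1) * s x ^ a * ln (s x))"
      using shifted_surface_spline_alt[of lam c x] c by (simp only: s_def)
    then show "complex_of_real (shifted_surface_spline lam c x) * fourier \<phi> x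
        = of_real (1 / 2) * (fourier \<phi> x * of_real ((-1) ^ (a + 1) * s x ^ a * ln (s x)))"
      by (simp only: of_real_mult mult.commute mult.left_commute)
  qed
  also have "\<dots> = of_real (1 / 2) * (LINT x|lborel. fourier \<phi> x * of_real ((-1) ^ (a + 1) * s x ^ a * ln (s x)))"
    by (rule integral_mult_right_zero)
  also have "\<dots> = (LINT t|lborel. LINT \<xi>|lborel. f t \<xi>)"
    unfolding rep inner_\<xi> integral_mult_right_zero by simp
  also have "\<dots> = (LINT \<theta>|lborel. complex_of_real (spline_const N a * g \<theta>) * \<phi> \<theta>)"
    using Fu(1) unfolding inner_t .
  finally show "(LINT x|lborel. complex_of_real (shifted_surface_spline lam c x) * fourier \<phi> x)
      = (LINT \<theta>|lborel. complex_of_real (spline_const N a * g \<theta>) * \<phi> \<theta>)" .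
qed

lemma Bessel_K_pos:
  assumes z: "z > 0"
  shows "Bessel_K (real \<nu>) z > 0"
proof -
  have "(LINT t|lborel. indicator {0<..} t * (exp (- (z\<^sup>2 / 4 / t) - 1\<^sup>2 * t) / t ^ (\<nu> + 1))) > 0"
  proof (rule integral_pos_of_ball[where z = 1 and r = "1 / 2"])
    show "integrable lborel (\<lambda>t. indicator {0<..} t * (exp (- (z\<^sup>2 / 4 / t) - 1\<^sup>2 * t) / t ^ (\<nu> + 1)))"
      by (rule bessel_integrand_integrable) (use z in auto)
    show "indicator {0<..} t * (exp (- (z\<^sup>2 / 4 / t) - 1\<^sup>2 * t) / t ^ (\<nu> + 1)) \<ge> 0" for t :: real
      by (simp add: indicator_def)
    show "indicator {0<..} t * (exp (- (z\<^sup>2 / 4 / t) - 1\<^sup>2 * t) / t ^ (\<nu> + 1)) > 0"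
      if "t \<in> ball 1 (1 / 2)" for t :: real
    proof -
      have "t > 0" using that unfolding mem_ball dist_real_def by linarith
      then show ?thesis by simp
    qed
  qed simp
  then have "0 < 2 * (2 * 1 / z) ^ \<nu> * Bessel_K (real \<nu>) (1 * z)"
    by (simp only: Bessel_K_integral[OF zero_less_one z])
  then have "0 < (2 * (2 / z) ^ \<nu>) * Bessel_K (real \<nu>) z" by simp
  moreover have "2 * (2 / z) ^ \<nu> > 0" using z by simp
  ultimately show ?thesis by (simp only: zero_less_mult_pos)
qed

lemma test_functions_translate:
  assumes \<phi>: "\<phi> \<in> test_functions"
  shows "(\<lambda>x. \<phi> (x - z)) \<in> test_functions"
proof (rule test_functionsI)
  show "C_k k (\<lambda>x. \<phi> (x - z))" for k
    using \<phi> by (intro C_k_translate) (simp add: test_functions_def)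
  have "{x. \<phi> (x - z) \<noteq> 0} \<subseteq> (+) z ` {x. \<phi> x \<noteq> 0}"
  proof
    fix x assume "x \<in> {x. \<phi> (x - z) \<noteq> 0}"
    then have "x - z \<in> {x. \<phi> x \<noteq> 0}" by simp
    then show "x \<in> (+) z ` {x. \<phi> x \<noteq> 0}" by (rule rev_image_eqI) simp
  qed
  then show "bounded {x. \<phi> (x - z) \<noteq> 0}"
    using bounded_translation[OF test_functions_integrable(3)[OF \<phi>]] bounded_subset by blast
qed

text \<open>Uniqueness of the constant follows by testing with a bump around a unit vector, on which the Bessel
  profile is positive.\<close>

lemma surface_spline_l_eq:
  assumes n: "CARD('n::finite) = 2 * N" and lam: "lam = 2 * a" "a \<ge> 1"
  shows "surface_spline_l TYPE('n) lam = spline_const N a"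
proof -
  define g where "g c \<theta> = norm \<theta> powr (- real lam - real CARD('n))
      * Bessel_K_tilde ((real CARD('n) + real lam) / 2) (c * norm \<theta>)" for c and \<theta> :: "real ^ 'n"
  note tr = spline_fourier_transform[where 'n='n, OF n lam, folded g_def]
  have gpos: "g 1 \<theta> > 0" if "\<theta> \<noteq> 0" for \<theta>
  proof -
    have "(real CARD('n) + real lam) / 2 = real (a + N)" using n lam(1) by auto
    then show ?thesis using that Bessel_K_pos[of "norm \<theta>" "a + N"]
      unfolding g_def Bessel_K_tilde_def by (simp only:) simp
  qed
  have g0: "g 1 \<theta> \<ge> 0" for \<theta>
    using gpos[of \<theta>] by (cases "\<theta> = 0") (auto simp: g_def)
  have cpos: "spline_const N a > 0" by (simp add: spline_const_def)
  have "norm (axis undefined 1 :: real ^ 'n) = 1" by simp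
  then obtain e :: "real ^ 'n" where e: "norm e = 1" by blast
  obtain \<eta> :: "real ^ 'n \<Rightarrow> real" where \<eta>: "mollifier (1 / 2) \<eta>" using obtain_mollifier[of "1 / 2"] by auto
  define \<phi> where "\<phi> x = complex_of_real (\<eta> (x - e))" for x
  have \<phi>: "\<phi> \<in> test_functions"
    unfolding \<phi>_def[abs_def]
    by (rule test_functions_translate[where \<phi> = "\<lambda>x. complex_of_real (\<eta> x)"]) (use \<eta> in \<open>simp add: mollifier_def\<close>)
  have "closure {x. \<phi> x \<noteq> 0} \<subseteq> cball e (1 / 2)"
  proof (rule closure_minimal)
    show "{x. \<phi> x \<noteq> 0} \<subseteq> cball e (1 / 2)"
    proof
      fix x assume "x \<in> {x. \<phi> x \<noteq> 0}"
      then have "\<eta> (x - e) \<noteq> 0" by (simp add: \<phi>_def)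
      then have "\<not> 1 / 2 \<le> norm (x - e)" using \<eta> unfolding mollifier_def by blast
      then show "x \<in> cball e (1 / 2)" by (simp add: dist_norm norm_minus_commute)
    qed
  qed simp
  moreover have "0 \<notin> cball e (1 / 2)" using e by (simp add: dist_norm)
  ultimately have away: "0 \<notin> closure {x. \<phi> x \<noteq> 0}" by blast
  define I where "I = (LINT \<theta>|lborel. g 1 \<theta> * \<eta> (\<theta> - e))"
  have "complex_of_real (spline_const N a * g 1 \<theta>) * \<phi> \<theta> = of_real (spline_const N a * (g 1 \<theta> * \<eta> (\<theta> - e)))" for \<theta>
    by (simp add: \<phi>_def)
  then have "integrable lborel (\<lambda>\<theta>. spline_const N a * (g 1 \<theta> * \<eta> (\<theta> - e)))"
    using tr(2)[OF zero_less_one \<phi> away] by (simp only: complex_of_real_integrable_eq)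
  then have int: "integrable lborel (\<lambda>\<theta>. g 1 \<theta> * \<eta> (\<theta> - e))" using cpos by simp
  have "I > 0"
    unfolding I_def
  proof (rule integral_pos_of_ball[OF int, of "1 / 2" e])
    show "0 \<le> g 1 x * \<eta> (x - e)" for x using g0 \<eta> by (simp add: mollifier_def)
    show "0 < g 1 x * \<eta> (x - e)" if "x \<in> ball e (1 / 2)" for x
    proof -
      have "x \<noteq> 0" using that e by (auto simp: dist_norm)
      moreover have "\<eta> (x - e) > 0" using that \<eta> by (simp add: mollifier_def dist_norm norm_minus_commute)
      ultimately show ?thesis using gpos by simp
    qed
  qed simp
  have val: "(LINT \<theta>|lborel. complex_of_real (l * g 1 \<theta>) * \<phi> \<theta>) = of_real (l * I)" for l
  proof -
    have "complex_of_real (l * g 1 \<theta>) * \<phi> \<theta> = of_real (l * (g 1 \<theta> * \<eta> (\<theta> - e)))" for \<theta> by (simp add: \<phi>_def)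
    then show ?thesis unfolding I_def by (simp only: integral_complex_of_real integral_mult_right_zero)
  qed
  have eq: "surface_spline_l TYPE('n) lam = (THE l. l > 0 \<and>
     (\<forall>c>0. fourier_away_from_origin (shifted_surface_spline lam c :: real ^ 'n \<Rightarrow> real) (\<lambda>\<theta>. l * g c \<theta>)))"
    unfolding surface_spline_l_def g_def by (simp only: mult.assoc)
  show ?thesis
    unfolding eq
  proof (rule the_equality)
    show "spline_const N a > 0 \<and> (\<forall>c>0. fourier_away_from_origin (shifted_surface_spline lam c :: real ^ 'n \<Rightarrow> real)
        (\<lambda>\<theta>. spline_const N a * g c \<theta>))"
      using cpos tr(1) unfolding fourier_away_from_origin_def by blast
  next
    fix l assume "l > 0 \<and> (\<forall>c>0. fourier_away_from_origin (shifted_surface_spline lam c :: real ^ 'n \<Rightarrow> real) (\<lambda>\<theta>. l * g c \<theta>))"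
    then have "fourier_away_from_origin (shifted_surface_spline lam 1 :: real ^ 'n \<Rightarrow> real) (\<lambda>\<theta>. l * g 1 \<theta>)" by simp
    then have "(LINT x|lborel. complex_of_real (shifted_surface_spline lam 1 x) * fourier \<phi> x)
        = (LINT \<theta>|lborel. complex_of_real (l * g 1 \<theta>) * \<phi> \<theta>)"
      using \<phi> away unfolding fourier_away_from_origin_def by blast
    then have "complex_of_real (l * I) = of_real (spline_const N a * I)"
      unfolding tr(1)[OF zero_less_one \<phi> away] val by (rule sym)
    then have "l * I = spline_const N a * I" by (simp only: of_real_eq_iff)
    moreover have "I \<noteq> 0" using \<open>I > 0\<close> by simp
    ultimately show "l = spline_const N a" using mult_right_cancel by blast
  qed
qed

section \<open>Functionals annihilating polynomials\<close>

lemma poly_space_scale: "p \<in> poly_space k \<Longrightarrow> (\<lambda>x. c * p x) \<in> poly_space k"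
  unfolding poly_space_def
proof (elim CollectE exE)
  fix a assume "p = (\<lambda>x. \<Sum>\<alpha> | multi_degree \<alpha> \<le> k. a \<alpha> * complex_of_real (monomial \<alpha> x))"
  then show "(\<lambda>x. c * p x) \<in> {p. \<exists>a. p = (\<lambda>x. \<Sum>\<alpha> | multi_degree \<alpha> \<le> k. a \<alpha> * complex_of_real (monomial \<alpha> x))}"
    by (intro CollectI exI[of _ "\<lambda>\<alpha>. c * a \<alpha>"]) (simp add: sum_distrib_left mult.assoc)
qed

lemma poly_space_add: "p \<in> poly_space k \<Longrightarrow> q \<in> poly_space k \<Longrightarrow> (\<lambda>x. p x + q x) \<in> poly_space k"
  unfolding poly_space_def
proof (elim CollectE exE)
  fix a b assume "p = (\<lambda>x. \<Sum>\<alpha> | multi_degree \<alpha> \<le> k. a \<alpha> * complex_of_real (monomial \<alpha> x))"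
    "q = (\<lambda>x. \<Sum>\<alpha> | multi_degree \<alpha> \<le> k. b \<alpha> * complex_of_real (monomial \<alpha> x))"
  then show "(\<lambda>x. p x + q x) \<in> {p. \<exists>a. p = (\<lambda>x. \<Sum>\<alpha> | multi_degree \<alpha> \<le> k. a \<alpha> * complex_of_real (monomial \<alpha> x))}"
    by (intro CollectI exI[of _ "\<lambda>\<alpha>. a \<alpha> + b \<alpha>"]) (simp add: sum.distrib distrib_right)
qed

lemma poly_space_zero: "(\<lambda>x. 0) \<in> poly_space k"
  unfolding poly_space_def by (intro CollectI exI[of _ "\<lambda>\<alpha>. 0"]) simp

lemma poly_space_sum: "(\<And>i. i \<in> I \<Longrightarrow> p i \<in> poly_space k) \<Longrightarrow> (\<lambda>x. \<Sum>i\<in>I. p i x) \<in> poly_space k"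
  by (induction I rule: infinite_finite_induct) (auto intro: poly_space_zero poly_space_add)

lemma poly_space_monomial:
  fixes \<alpha> :: "'n::finite \<Rightarrow> nat"
  assumes "multi_degree \<alpha> \<le> k"
  shows "(\<lambda>x. complex_of_real (monomial \<alpha> x)) \<in> poly_space k"
proof -
  have "(\<Sum>\<beta> | multi_degree \<beta> \<le> k. (if \<beta> = \<alpha> then 1 else 0) * complex_of_real (monomial \<beta> x))
      = complex_of_real (monomial \<alpha> x)" for x
  proof -
    have "(\<Sum>\<beta> | multi_degree \<beta> \<le> k. (if \<beta> = \<alpha> then 1 else 0) * complex_of_real (monomial \<beta> x))
        = (\<Sum>\<beta> | multi_degree \<beta> \<le> k. if \<beta> = \<alpha> then complex_of_real (monomial \<beta> x) else 0)"
      by (intro sum.cong) auto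
    also have "\<dots> = complex_of_real (monomial \<alpha> x)"
      using assms by (simp add: sum.delta[OF finite_multi_degree_le])
    finally show ?thesis .
  qed
  then show ?thesis unfolding poly_space_def by (intro CollectI exI[of _ "\<lambda>\<beta>. if \<beta> = \<alpha> then 1 else 0"]) auto
qed

lemma poly_space_mult:
  assumes "p \<in> poly_space j" "q \<in> poly_space k"
  shows "(\<lambda>x. p x * q x) \<in> poly_space (j + k)"
proof -
  obtain a b where a: "p = (\<lambda>x. \<Sum>\<alpha> | multi_degree \<alpha> \<le> j. a \<alpha> * complex_of_real (monomial \<alpha> x))"
    and b: "q = (\<lambda>x. \<Sum>\<beta> | multi_degree \<beta> \<le> k. b \<beta> * complex_of_real (monomial \<beta> x))"
    using assms by (auto simp: poly_space_def)
  have "(\<lambda>x. \<Sum>\<alpha> | multi_degree \<alpha> \<le> j. \<Sum>\<beta> | multi_degree \<beta> \<le> k.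
      (a \<alpha> * b \<beta>) * complex_of_real (monomial (\<lambda>i. \<alpha> i + \<beta> i) x)) \<in> poly_space (j + k)"
    by (intro poly_space_sum poly_space_scale poly_space_monomial)
      (auto simp: multi_degree_def sum.distrib)
  moreover have "p x * q x = (\<Sum>\<alpha> | multi_degree \<alpha> \<le> j. \<Sum>\<beta> | multi_degree \<beta> \<le> k.
      (a \<alpha> * b \<beta>) * complex_of_real (monomial (\<lambda>i. \<alpha> i + \<beta> i) x))" for x
    unfolding a b sum_product
    by (intro sum.cong refl) (simp add: monomial_def power_add prod.distrib)
  ultimately show ?thesis by simp
qed

lemma poly_space_const: "(\<lambda>x. c) \<in> poly_space k"
  using poly_space_scale[OF poly_space_monomial[of "\<lambda>_. 0" k], of c]
  by (simp add: multi_degree_def monomial_def)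

lemma poly_space_coord: "(\<lambda>x. complex_of_real (x $ i)) \<in> poly_space 1"
proof -
  let ?\<alpha> = "\<lambda>j. if j = i then 1 else 0 :: nat"
  have "monomial ?\<alpha> x = x $ i" for x
    unfolding monomial_def by (subst prod.remove[of _ i]) auto
  moreover have "multi_degree ?\<alpha> = 1" by (simp add: multi_degree_def)
  ultimately show ?thesis using poly_space_monomial[of ?\<alpha> 1] by simp
qed

lemma poly_space_power:
  assumes "p \<in> poly_space 1"
  shows "(\<lambda>x. p x ^ k) \<in> poly_space k"
proof (induction k)
  case (Suc k)
  then show ?case using poly_space_mult[OF assms Suc] by simp
qed (simp add: poly_space_const)

lemma poly_space_prod:
  "finite I \<Longrightarrow> (\<And>i. i \<in> I \<Longrightarrow> p i \<in> poly_space (d i)) \<Longrightarrow> (\<lambda>x. \<Prod>i\<in>I. p i x) \<in> poly_space (\<Sum>i\<in>I. d i)"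
  by (induction I rule: finite_induct) (auto intro: poly_space_const poly_space_mult)

lemma poly_space_mono: "p \<in> poly_space j \<Longrightarrow> j \<le> k \<Longrightarrow> p \<in> poly_space k"
  using poly_space_mult[OF _ poly_space_const[of 1 "k - j"], of p j] by simp

lemma poly_space_translated_monomial:
  "(\<lambda>z. complex_of_real (monomial \<alpha> (z + y))) \<in> poly_space (multi_degree \<alpha>)"
proof -
  have "(\<lambda>z. \<Prod>i\<in>UNIV. (complex_of_real (z $ i) + complex_of_real (y $ i)) ^ \<alpha> i) \<in> poly_space (\<Sum>i\<in>UNIV. \<alpha> i)"
    by (intro poly_space_prod poly_space_power poly_space_add poly_space_coord poly_space_const) simp
  then show ?thesis by (simp add: monomial_def multi_degree_def)
qed

lemma poly_space_inner_power:
  fixes x \<xi> :: "real ^ 'n"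
  shows "(\<lambda>z. complex_of_real ((z - x) \<bullet> \<xi>) ^ k) \<in> poly_space k"
proof (rule poly_space_power)
  have "(\<lambda>z. (\<Sum>i\<in>UNIV. complex_of_real (\<xi> $ i) * (complex_of_real (z $ i) + complex_of_real (- (x $ i))))) \<in> poly_space 1"
    by (intro poly_space_sum poly_space_scale poly_space_add poly_space_coord poly_space_const)
  then show "(\<lambda>z. complex_of_real ((z - x) \<bullet> \<xi>)) \<in> poly_space 1"
    by (simp add: inner_vec_def mult.commute)
qed

definition annihilates :: "(real ^ 'n::finite) set \<Rightarrow> (real ^ 'n \<Rightarrow> complex) \<Rightarrow> nat \<Rightarrow> bool" where
  "annihilates Z u k \<longleftrightarrow> (\<forall>q\<in>poly_space k. (\<Sum>z\<in>Z. u z * q z) = 0)"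

lemma annihilatesI:
  fixes Z :: "(real ^ 'n::finite) set"
  assumes "\<And>\<alpha>. multi_degree \<alpha> \<le> k \<Longrightarrow> (\<Sum>z\<in>Z. u z * complex_of_real (monomial \<alpha> z)) = 0"
  shows "annihilates Z u k"
  unfolding annihilates_def
proof
  fix q :: "real ^ 'n \<Rightarrow> complex" assume "q \<in> poly_space k"
  then obtain a where q: "q = (\<lambda>x. \<Sum>\<alpha> | multi_degree \<alpha> \<le> k. a \<alpha> * complex_of_real (monomial \<alpha> x))"
    by (auto simp: poly_space_def)
  have "(\<Sum>z\<in>Z. u z * q z) = (\<Sum>z\<in>Z. \<Sum>\<alpha> | multi_degree \<alpha> \<le> k. a \<alpha> * (u z * complex_of_real (monomial \<alpha> z)))"
    unfolding q sum_distrib_left by (intro sum.cong refl) simp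
  also have "\<dots> = (\<Sum>\<alpha> | multi_degree \<alpha> \<le> k. \<Sum>z\<in>Z. a \<alpha> * (u z * complex_of_real (monomial \<alpha> z)))"
    by (rule sum.swap)
  also have "\<dots> = 0"
    by (rule sum.neutral) (use assms in \<open>auto simp: sum_distrib_left[symmetric]\<close>)
  finally show "(\<Sum>z\<in>Z. u z * q z) = 0" .
qed

lemma annihilatesD: "annihilates Z u k \<Longrightarrow> q \<in> poly_space k \<Longrightarrow> (\<Sum>z\<in>Z. u z * q z) = 0"
  by (simp add: annihilates_def)

section \<open>From test functions to point evaluations\<close>

lemma mollifier_average:
  fixes g :: "'a::euclidean_space \<Rightarrow> complex"
  assumes \<eta>: "mollifier r \<eta>" and [measurable]: "g \<in> borel_measurable borel"
    and close: "\<And>x. norm (x - z) < r \<Longrightarrow> norm (g x - v) \<le> e"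
  shows "integrable lborel (\<lambda>x. g x * of_real (\<eta> (x - z)))"
    and "norm ((LINT x|lborel. g x * of_real (\<eta> (x - z))) - v) \<le> e"
proof -
  have \<eta>0: "\<eta> x \<ge> 0" "norm x \<ge> r \<Longrightarrow> \<eta> x = 0" for x using \<eta> by (auto simp: mollifier_def)
  have "integrable lborel (\<lambda>x. complex_of_real (\<eta> x))"
    using \<eta> test_functions_integrable(1) by (auto simp: mollifier_def)
  then have i0: "integrable lborel \<eta>" by (simp only: complex_of_real_integrable_eq)
  have [measurable]: "\<eta> \<in> borel_measurable borel" using borel_measurable_integrable[OF i0] by simp
  have i: "integrable lborel (\<lambda>x. \<eta> (x - z))"
    using lborel_translate(2)[of \<eta> "- z"] i0 by simp
  have one: "(LINT x|lborel. \<eta> (x - z)) = 1"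
    using lborel_translate(1)[of \<eta> "- z"] \<eta> by (simp add: mollifier_def)
  have b: "norm ((g x - v) * of_real (\<eta> (x - z))) \<le> e * \<eta> (x - z)" for x
    using close[of x] \<eta>0(1)[of "x - z"] \<eta>0(2)[of "x - z"]
    by (cases "norm (x - z) < r") (auto simp: norm_mult intro: mult_right_mono)
  have i1: "integrable lborel (\<lambda>x. (g x - v) * of_real (\<eta> (x - z)))"
  proof (rule Bochner_Integration.integrable_bound[OF integrable_mult_right[OF i, of e]])
    show "AE x in lborel. norm ((g x - v) * of_real (\<eta> (x - z))) \<le> norm (e * \<eta> (x - z))"
      using order.trans[OF b abs_ge_self] by (auto intro!: always_eventually)
  qed measurable
  have i2: "integrable lborel (\<lambda>x. v * of_real (\<eta> (x - z)))"
    using i by (intro integrable_mult_right) (simp only: complex_of_real_integrable_eq)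
  have eq: "g x * of_real (\<eta> (x - z)) = (g x - v) * of_real (\<eta> (x - z)) + v * of_real (\<eta> (x - z))" for x
    by (simp add: algebra_simps)
  show "integrable lborel (\<lambda>x. g x * of_real (\<eta> (x - z)))"
    unfolding eq by (rule Bochner_Integration.integrable_add[OF i1 i2])
  have "(LINT x|lborel. g x * of_real (\<eta> (x - z))) = (LINT x|lborel. (g x - v) * of_real (\<eta> (x - z))) + v"
    unfolding eq Bochner_Integration.integral_add[OF i1 i2] integral_mult_right_zero integral_complex_of_real one by simp
  then have "norm ((LINT x|lborel. g x * of_real (\<eta> (x - z))) - v) = norm (LINT x|lborel. (g x - v) * of_real (\<eta> (x - z)))"
    by simp
  also have "\<dots> \<le> (LINT x|lborel. e * \<eta> (x - z))"
    by (rule order.trans[OF integral_norm_bound integral_mono])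
      (use i1 i b in auto)
  finally show "norm ((LINT x|lborel. g x * of_real (\<eta> (x - z))) - v) \<le> e" using one by simp
qed

lemma mollifier_integrable_continuous:
  fixes g :: "'a::euclidean_space \<Rightarrow> complex"
  assumes \<eta>: "mollifier r \<eta>" and g: "continuous_on UNIV g"
  shows "integrable lborel (\<lambda>x. g x * of_real (\<eta> (x - z)))"
proof -
  have "compact (g ` cball z r)"
    by (rule compact_continuous_image) (use g continuous_on_subset in auto)
  then obtain B where B: "\<And>y. y \<in> g ` cball z r \<Longrightarrow> norm y \<le> B"
    using compact_imp_bounded bounded_iff by metis
  show ?thesis
  proof (rule mollifier_average(1)[OF \<eta>, where v = 0 and e = B])
    show "g \<in> borel_measurable borel" using g by (rule borel_measurable_continuous_onI)
    show "norm (g x - 0) \<le> B" if "norm (x - z) < r" for x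
      using that by (simp add: B dist_norm norm_minus_commute)
  qed
qed

text \<open>The point masses are smeared with mollifiers of shrinking radius. Translates of a monomial are
  polynomials of the same degree, so the smeared functional still annihilates \<open>P\<^sub>m\<^sub>-\<^sub>1\<close>, and both sides converge by
  continuity.\<close>

lemma native_bound_point_evaluations:
  fixes f :: "real ^ 'n::finite \<Rightarrow> complex" and h :: "real ^ 'n \<Rightarrow> real"
  assumes f: "continuous_on UNIV f" and h: "continuous_on UNIV h"
    and nb: "native_bound h m f K" and m: "m \<ge> 1"
    and Z: "finite Z" and u: "annihilates Z u (m - 1)"
  shows "norm (\<Sum>z\<in>Z. u z * f z)
    \<le> K * sqrt (Re (\<Sum>z\<in>Z. \<Sum>w\<in>Z. u z * cnj (u w) * of_real (h (z - w))))"
proof -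
  define r where "r j = 1 / real (Suc j)" for j
  have r: "r j > 0" for j by (simp add: r_def)
  have rlim: "r \<longlonglongrightarrow> 0" unfolding r_def using lim_1_over_n[where 'a=real] LIMSEQ_Suc by blast
  have "\<forall>j. \<exists>\<eta> :: real ^ 'n \<Rightarrow> real. mollifier (r j) \<eta>" using obtain_mollifier[OF r] by metis
  then obtain \<eta> :: "nat \<Rightarrow> real ^ 'n \<Rightarrow> real" where \<eta>: "\<And>j. mollifier (r j) (\<eta> j)" by metis
  have fm[measurable]: "f \<in> borel_measurable borel" using f by (rule borel_measurable_continuous_onI)
  have hm[measurable]: "h \<in> borel_measurable borel" using h by (rule borel_measurable_continuous_onI)
  have \<eta>m[measurable]: "\<eta> j \<in> borel_measurable borel" for j
  proof -
    have "integrable lborel (\<lambda>x. complex_of_real (\<eta> j x))"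
      using \<eta>[of j] test_functions_integrable(1) by (auto simp: mollifier_def)
    then have "integrable lborel (\<eta> j)" by (simp only: complex_of_real_integrable_eq)
    then show ?thesis using borel_measurable_integrable by auto
  qed
  define \<phi> where "\<phi> j x = (\<Sum>z\<in>Z. u z * complex_of_real (\<eta> j (x - z)))" for j x
  have tr: "(\<lambda>x. complex_of_real (\<eta> j (x - z))) \<in> test_functions" for j z
    using test_functions_translate[of "\<lambda>x. complex_of_real (\<eta> j x)" z] \<eta>[of j] by (simp add: mollifier_def)
  have \<phi>T: "\<phi> j \<in> test_functions" for j
  proof (rule test_functionsI)
    show "C_k k (\<phi> j)" for k
      unfolding \<phi>_def[abs_def] using tr by (intro C_k_sum C_k_mult C_k_const) (simp add: test_functions_def)
    have "{x. \<phi> j x \<noteq> 0} \<subseteq> (\<Union>z\<in>Z. {x. complex_of_real (\<eta> j (x - z)) \<noteq> 0})"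
    proof
      fix x assume "x \<in> {x. \<phi> j x \<noteq> 0}"
      then show "x \<in> (\<Union>z\<in>Z. {x. complex_of_real (\<eta> j (x - z)) \<noteq> 0})"
        unfolding \<phi>_def by (rule contrapos_pp) auto
    qed
    then show "bounded {x. \<phi> j x \<noteq> 0}"
      by (rule bounded_subset[rotated]) (use Z test_functions_integrable(3)[OF tr] in auto)
  qed
  have \<phi>V: "\<phi> j \<in> test_functions_vanishing m" for j
    unfolding test_functions_vanishing_def
  proof (intro CollectI conjI allI impI \<phi>T)
    fix \<alpha> :: "'n \<Rightarrow> nat" assume "multi_degree \<alpha> < m"
    then have \<alpha>: "multi_degree \<alpha> \<le> m - 1" by simp
    have mc: "continuous_on UNIV (\<lambda>x. complex_of_real (monomial \<alpha> x))"
      by (intro continuous_intros continuous_on_monomial)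
    have mm[measurable]: "monomial \<alpha> \<in> borel_measurable borel"
      by (intro borel_measurable_continuous_onI continuous_on_monomial)
    have "(LINT x|lborel. complex_of_real (monomial \<alpha> x) * \<phi> j x)
        = (LINT x|lborel. (\<Sum>z\<in>Z. u z * (complex_of_real (monomial \<alpha> x) * complex_of_real (\<eta> j (x - z)))))"
      unfolding \<phi>_def by (simp add: sum_distrib_left mult.left_commute)
    also have "\<dots> = (\<Sum>z\<in>Z. u z * (LINT x|lborel. complex_of_real (monomial \<alpha> x) * complex_of_real (\<eta> j (x - z))))"
      by (subst Bochner_Integration.integral_sum)
        (auto intro!: integrable_mult_right mollifier_integrable_continuous[OF \<eta> mc])
    also have "\<dots> = (\<Sum>z\<in>Z. u z * (LINT y|lborel. complex_of_real (monomial \<alpha> (z + y)) * complex_of_real (\<eta> j y)))"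
    proof (intro sum.cong refl arg_cong2[where f = times])
      fix z
      show "(LINT x|lborel. complex_of_real (monomial \<alpha> x) * complex_of_real (\<eta> j (x - z)))
          = (LINT y|lborel. complex_of_real (monomial \<alpha> (z + y)) * complex_of_real (\<eta> j y))"
        using lborel_translate(1)[of "\<lambda>x. complex_of_real (monomial \<alpha> x) * complex_of_real (\<eta> j (x - z))" z] by simp
    qed
    also have "\<dots> = (LINT y|lborel. (\<Sum>z\<in>Z. u z * (complex_of_real (monomial \<alpha> (z + y)) * complex_of_real (\<eta> j y))))"
    proof (subst Bochner_Integration.integral_sum)
      fix z
      have "continuous_on UNIV (\<lambda>y. complex_of_real (monomial \<alpha> (z + y)))"
        by (intro continuous_intros continuous_on_compose2[OF continuous_on_monomial[of UNIV \<alpha>]]) auto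
      from mollifier_integrable_continuous[OF \<eta> this, of j 0]
      show "integrable lborel (\<lambda>y. u z * (complex_of_real (monomial \<alpha> (z + y)) * complex_of_real (\<eta> j y)))"
        by (intro integrable_mult_right) simp
    qed simp
    also have "\<dots> = 0"
    proof -
      have "(\<Sum>z\<in>Z. u z * (complex_of_real (monomial \<alpha> (z + y)) * complex_of_real (\<eta> j y))) = 0" for y
      proof -
        have "(\<Sum>z\<in>Z. u z * complex_of_real (monomial \<alpha> (z + y))) = 0"
          by (rule annihilatesD[OF u poly_space_mono[OF poly_space_translated_monomial \<alpha>]])
        then have "(\<Sum>z\<in>Z. u z * complex_of_real (monomial \<alpha> (z + y))) * complex_of_real (\<eta> j y) = 0" by simp
        then show ?thesis by (simp only: sum_distrib_right mult.assoc)
      qed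
      then show ?thesis by (simp only: Bochner_Integration.integral_zero)
    qed
    finally show "(LINT x|lborel. complex_of_real (monomial \<alpha> x) * \<phi> j x) = 0" .
  qed
  have cont_at: "\<exists>d>0. \<forall>x. norm (x - p) < d \<longrightarrow> norm (g x - g p) \<le> e"
    if gc: "continuous_on UNIV g" and e: "e > 0" for g :: "real ^ 'n \<Rightarrow> complex" and p e
  proof -
    have "isCont g p" using gc by (simp add: continuous_on_eq_continuous_at)
    then obtain d where "d > 0" "\<forall>x. dist x p < d \<longrightarrow> dist (g x) (g p) < e"
      using e unfolding continuous_at_eps_delta by blast
    then show ?thesis by (auto simp: dist_norm intro!: exI[of _ d] less_imp_le)
  qed
  have lim1: "(\<lambda>j. LINT x|lborel. f x * \<phi> j x) \<longlonglongrightarrow> (\<Sum>z\<in>Z. u z * f z)"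
  proof -
    have "(LINT x|lborel. f x * \<phi> j x) = (\<Sum>z\<in>Z. u z * (LINT x|lborel. f x * of_real (\<eta> j (x - z))))" for j
    proof -
      have "f x * \<phi> j x = (\<Sum>z\<in>Z. u z * (f x * of_real (\<eta> j (x - z))))" for x
        by (simp add: \<phi>_def sum_distrib_left mult.left_commute)
      then show ?thesis
        by (simp only:) (subst Bochner_Integration.integral_sum,
          auto intro!: integrable_mult_right mollifier_integrable_continuous[OF \<eta> f])
    qed
    moreover have "(\<lambda>j. \<Sum>z\<in>Z. u z * (LINT x|lborel. f x * of_real (\<eta> j (x - z)))) \<longlonglongrightarrow> (\<Sum>z\<in>Z. u z * f z)"
    proof (intro tendsto_sum tendsto_mult tendsto_const LIMSEQ_I)
      fix z :: "real ^ 'n" and e :: real assume e: "e > 0"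
      obtain d where d: "d > 0" "\<forall>x. norm (x - z) < d \<longrightarrow> norm (f x - f z) \<le> e / 2"
        using cont_at[OF f, of "e / 2" z] e by auto
      obtain j0 where j0: "\<And>j. j \<ge> j0 \<Longrightarrow> r j < d"
        using order_tendstoD(2)[OF rlim d(1)] by (auto simp: eventually_sequentially)
      show "\<exists>j0. \<forall>j\<ge>j0. norm ((LINT x|lborel. f x * of_real (\<eta> j (x - z))) - f z) < e"
      proof (intro exI[of _ j0] allI impI)
        fix j assume "j \<ge> j0"
        then have "norm ((LINT x|lborel. f x * of_real (\<eta> j (x - z))) - f z) \<le> e / 2"
          using d(2) j0[of j] by (intro mollifier_average(2)[OF \<eta> fm]) auto
        then show "norm ((LINT x|lborel. f x * of_real (\<eta> j (x - z))) - f z) < e" using e by simp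
      qed
    qed
    ultimately show ?thesis by simp
  qed
  define J where "J j w x = (LINT y|lborel. complex_of_real (h (x - y)) * of_real (\<eta> j (y - w)))" for j w x
  have Jm[measurable]: "J j w \<in> borel_measurable borel" for j w
  proof -
    have "(\<lambda>x. LINT y|lborel. complex_of_real (h (x - y)) * of_real (\<eta> j (y - w))) \<in> borel_measurable lborel"
      by (rule lborel.borel_measurable_lebesgue_integral) measurable
    then show ?thesis by (simp add: J_def[abs_def])
  qed
  have hc: "continuous_on UNIV (\<lambda>y. complex_of_real (h (x - y)))" for x
    by (intro continuous_intros continuous_on_compose2[OF h]) auto
  have hcd: "continuous_on UNIV (\<lambda>y. complex_of_real (h y))" by (intro continuous_intros h)
  have close: "\<exists>j0. \<forall>j\<ge>j0. (\<forall>x. norm (x - z) < r j \<longrightarrow> norm (J j w x - of_real (h (z - w))) \<le> e)"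
    if e: "e > 0" for z w e
  proof -
    obtain d where d: "d > 0" "\<forall>x. norm (x - (z - w)) < d \<longrightarrow> norm (complex_of_real (h x) - of_real (h (z - w))) \<le> e"
      using cont_at[OF hcd e, of "z - w"] by auto
    obtain j0 where j0: "\<And>j. j \<ge> j0 \<Longrightarrow> r j < d / 2"
      using order_tendstoD(2)[OF rlim, of "d / 2"] d(1) by (auto simp: eventually_sequentially)
    have "norm (J j w x - of_real (h (z - w))) \<le> e" if "j \<ge> j0" "norm (x - z) < r j" for j x
      unfolding J_def
    proof (rule mollifier_average(2)[OF \<eta>])
      fix y assume "norm (y - w) < r j"
      then have "norm ((x - z) - (y - w)) < d"
        using norm_triangle_ineq4[of "x - z" "y - w"] that j0[of j] by linarith
      then have "norm ((x - y) - (z - w)) < d" by (simp add: algebra_simps)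
      then show "norm (complex_of_real (h (x - y)) - of_real (h (z - w))) \<le> e" using d(2) by blast
    qed measurable
    then show ?thesis by blast
  qed
  define D where "D j = (LINT x|lborel. LINT y|lborel. complex_of_real (h (x - y)) * \<phi> j x * cnj (\<phi> j y))" for j
  have lim2: "D \<longlonglongrightarrow> (\<Sum>z\<in>Z. \<Sum>w\<in>Z. u z * cnj (u w) * of_real (h (z - w)))"
  proof -
    have inner: "(LINT y|lborel. complex_of_real (h (x - y)) * \<phi> j x * cnj (\<phi> j y))
        = (\<Sum>z\<in>Z. \<Sum>w\<in>Z. (u z * cnj (u w)) * (J j w x * of_real (\<eta> j (x - z))))" for j x
    proof -
      have "complex_of_real (h (x - y)) * \<phi> j x * cnj (\<phi> j y)
          = (\<Sum>w\<in>Z. (\<phi> j x * cnj (u w)) * (complex_of_real (h (x - y)) * of_real (\<eta> j (y - w))))" for y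
        unfolding \<phi>_def[of j y] cnj_sum sum_distrib_left
        by (intro sum.cong refl) simp
      then have "(LINT y|lborel. complex_of_real (h (x - y)) * \<phi> j x * cnj (\<phi> j y))
          = (\<Sum>w\<in>Z. (\<phi> j x * cnj (u w)) * J j w x)"
        unfolding J_def
        by (simp only:) (subst Bochner_Integration.integral_sum,
          auto intro!: integrable_mult_right mollifier_integrable_continuous[OF \<eta> hc])
      also have "\<dots> = (\<Sum>w\<in>Z. \<Sum>z\<in>Z. (u z * cnj (u w)) * (J j w x * of_real (\<eta> j (x - z))))"
        unfolding \<phi>_def sum_distrib_right by (intro sum.cong refl) simp
      also have "\<dots> = (\<Sum>z\<in>Z. \<Sum>w\<in>Z. (u z * cnj (u w)) * (J j w x * of_real (\<eta> j (x - z))))"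
        by (rule sum.swap)
      finally show ?thesis .
    qed
    have "\<exists>j1. \<forall>j\<ge>j1. D j = (\<Sum>z\<in>Z. \<Sum>w\<in>Z. (u z * cnj (u w)) * (LINT x|lborel. J j w x * of_real (\<eta> j (x - z))))"
    proof -
      have "\<forall>p\<in>Z \<times> Z. \<exists>j0. \<forall>j\<ge>j0. integrable lborel (\<lambda>x. J j (snd p) x * of_real (\<eta> j (x - fst p)))"
      proof
        fix p assume "p \<in> Z \<times> Z"
        obtain j0 where "\<forall>j\<ge>j0. \<forall>x. norm (x - fst p) < r j \<longrightarrow> norm (J j (snd p) x - of_real (h (fst p - snd p))) \<le> 1"
          using close[OF zero_less_one] by blast
        then show "\<exists>j0. \<forall>j\<ge>j0. integrable lborel (\<lambda>x. J j (snd p) x * of_real (\<eta> j (x - fst p)))"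
          using mollifier_average(1)[OF \<eta> Jm] by (intro exI[of _ j0]) blast
      qed
      from bchoice[OF this] obtain j0
        where j0: "\<forall>p\<in>Z \<times> Z. \<forall>j\<ge>j0 p. integrable lborel (\<lambda>x. J j (snd p) x * of_real (\<eta> j (x - fst p)))" ..
      define j1 where "j1 = Max (insert 0 (j0 ` (Z \<times> Z)))"
      have int: "integrable lborel (\<lambda>x. J j w x * of_real (\<eta> j (x - z)))" if "z \<in> Z" "w \<in> Z" "j \<ge> j1" for j z w
      proof -
        have "j0 (z, w) \<le> j1" unfolding j1_def using Z that by (intro Max_ge) auto
        then have "j0 (z, w) \<le> j" using that(3) by (rule order.trans)
        moreover have "\<forall>j\<ge>j0 (z, w). integrable lborel (\<lambda>x. J j (snd (z, w)) x * of_real (\<eta> j (x - fst (z, w))))"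
          using j0 that(1,2) by (intro bspec[OF j0]) (rule SigmaI)
        ultimately show ?thesis unfolding fst_conv snd_conv by blast
      qed
      show ?thesis
      proof (intro exI[of _ j1] allI impI)
        fix j assume j: "j \<ge> j1"
        have i: "integrable lborel (\<lambda>x. (u z * cnj (u w)) * (J j w x * of_real (\<eta> j (x - z))))" if "z \<in> Z" "w \<in> Z" for z w
          by (intro integrable_mult_right int that j)
        show "D j = (\<Sum>z\<in>Z. \<Sum>w\<in>Z. (u z * cnj (u w)) * (LINT x|lborel. J j w x * of_real (\<eta> j (x - z))))"
          unfolding D_def inner
          by (simp only: Bochner_Integration.integral_sum Bochner_Integration.integrable_sum i integral_mult_right_zero cong: sum.cong)
      qed
    qed
    then obtain j1 where j1: "\<forall>j\<ge>j1. D j = (\<Sum>z\<in>Z. \<Sum>w\<in>Z. (u z * cnj (u w)) * (LINT x|lborel. J j w x * of_real (\<eta> j (x - z))))" ..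
    have ev: "\<forall>\<^sub>F j in sequentially. (\<Sum>z\<in>Z. \<Sum>w\<in>Z. (u z * cnj (u w)) * (LINT x|lborel. J j w x * of_real (\<eta> j (x - z)))) = D j"
      unfolding eventually_sequentially using j1 by (intro exI[of _ j1] allI impI) (rule sym, blast)
    have "(\<lambda>j. \<Sum>z\<in>Z. \<Sum>w\<in>Z. (u z * cnj (u w)) * (LINT x|lborel. J j w x * of_real (\<eta> j (x - z))))
        \<longlonglongrightarrow> (\<Sum>z\<in>Z. \<Sum>w\<in>Z. u z * cnj (u w) * of_real (h (z - w)))"
    proof (intro tendsto_sum tendsto_mult tendsto_const LIMSEQ_I)
      fix z w :: "real ^ 'n" and e :: real assume e: "e > 0"
      obtain j0 where j0: "\<forall>j\<ge>j0. (\<forall>x. norm (x - z) < r j \<longrightarrow> norm (J j w x - of_real (h (z - w))) \<le> e / 2)"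
        using close[of "e / 2" z w] e by auto
      show "\<exists>j0. \<forall>j\<ge>j0. norm ((LINT x|lborel. J j w x * of_real (\<eta> j (x - z))) - of_real (h (z - w))) < e"
      proof (intro exI[of _ j0] allI impI)
        fix j assume "j \<ge> j0"
        then have "norm ((LINT x|lborel. J j w x * of_real (\<eta> j (x - z))) - of_real (h (z - w))) \<le> e / 2"
          using j0 by (intro mollifier_average(2)[OF \<eta> Jm]) auto
        then show "norm ((LINT x|lborel. J j w x * of_real (\<eta> j (x - z))) - of_real (h (z - w))) < e" using e by simp
      qed
    qed
    then show ?thesis by (rule Lim_transform_eventually[OF _ ev])
  qed
  have "norm (LINT x|lborel. f x * \<phi> j x) \<le> K * sqrt (Re (D j))" for j
    using nb \<phi>V[of j] unfolding native_bound_def D_def by blast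
  then show ?thesis
    by (intro LIMSEQ_le[OF tendsto_norm[OF lim1] tendsto_mult[OF tendsto_const tendsto_real_sqrt[OF tendsto_Re[OF lim2]]]]) auto
qed

section \<open>The quadratic form of the kernel\<close>

text \<open>The Gaussian is the Fourier transform of a Gaussian, which turns the quadratic form into a weighted
  square norm of the exponential sum.\<close>

lemma gauss_quadratic_form:
  fixes Z :: "'a::euclidean_space set" and u :: "'a \<Rightarrow> complex"
  assumes Z: "finite Z" and t: "t > 0"
  shows "integrable lborel (\<lambda>x::'a. exp (- (1 / (4 * t)) * (norm x)\<^sup>2) * (norm (\<Sum>z\<in>Z. u z * exp (- \<i> * of_real (x \<bullet> z))))\<^sup>2)"
    and "(\<Sum>z\<in>Z. \<Sum>w\<in>Z. u z * cnj (u w) * of_real (exp (- t * (norm (z - w))\<^sup>2)))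
      = of_real ((LINT x|lborel. exp (- (1 / (4 * t)) * (norm (x::'a))\<^sup>2) * (norm (\<Sum>z\<in>Z. u z * exp (- \<i> * of_real (x \<bullet> z))))\<^sup>2)
          / sqrt (pi / (1 / (4 * t))) ^ DIM('a))"
proof -
  define \<tau> where "\<tau> = 1 / (4 * t)"
  have \<tau>: "\<tau> > 0" using t by (simp add: \<tau>_def)
  define \<kappa> where "\<kappa> = sqrt (pi / \<tau>) ^ DIM('a)"
  have \<kappa>: "\<kappa> > 0" using \<tau> by (simp add: \<kappa>_def)
  define U where "U x = (\<Sum>z\<in>Z. u z * exp (- \<i> * of_real (x \<bullet> z)))" for x :: 'a
  let ?e = "\<lambda>(v::'a) x. exp (- \<i> * complex_of_real (x \<bullet> v)) * complex_of_real (exp (- \<tau> * (norm x)\<^sup>2))"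
  have eq: "complex_of_real (exp (- \<tau> * (norm x)\<^sup>2) * (norm (U x))\<^sup>2) = (\<Sum>z\<in>Z. \<Sum>w\<in>Z. (u z * cnj (u w)) * ?e (z - w) x)" for x
  proof -
    have "complex_of_real ((norm (U x))\<^sup>2) = U x * cnj (U x)" by (rule complex_norm_square)
    also have "\<dots> = (\<Sum>z\<in>Z. \<Sum>w\<in>Z. (u z * exp (- \<i> * of_real (x \<bullet> z))) * cnj (u w * exp (- \<i> * of_real (x \<bullet> w))))"
      unfolding U_def cnj_sum sum_product ..
    also have "\<dots> = (\<Sum>z\<in>Z. \<Sum>w\<in>Z. (u z * cnj (u w)) * exp (- \<i> * of_real (x \<bullet> (z - w))))"
    proof (intro sum.cong refl)
      fix z w
      have "exp (- \<i> * of_real (x \<bullet> z)) * cnj (exp (- \<i> * of_real (x \<bullet> w))) = exp (- \<i> * of_real (x \<bullet> (z - w)))"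
        unfolding exp_cnj exp_add[symmetric] by (simp add: inner_diff_right algebra_simps)
      then show "(u z * exp (- \<i> * of_real (x \<bullet> z))) * cnj (u w * exp (- \<i> * of_real (x \<bullet> w))) = (u z * cnj (u w)) * exp (- \<i> * of_real (x \<bullet> (z - w)))"
        unfolding complex_cnj_mult by (simp only: mult.assoc mult.left_commute)
    qed
    finally show ?thesis by (simp only: of_real_mult sum_distrib_left mult.commute mult.left_commute)
  qed
  have ei: "integrable lborel (\<lambda>x. (u z * cnj (u w)) * ?e (z - w) x)" for z w
    by (intro integrable_mult_right gauss_fourier(1)[OF \<tau>])
  have "integrable lborel (\<lambda>x. complex_of_real (exp (- \<tau> * (norm x)\<^sup>2) * (norm (U x))\<^sup>2))"
    unfolding eq by (intro Bochner_Integration.integrable_sum ei)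
  then show "integrable lborel (\<lambda>x::'a. exp (- (1 / (4 * t)) * (norm x)\<^sup>2) * (norm (\<Sum>z\<in>Z. u z * exp (- \<i> * of_real (x \<bullet> z))))\<^sup>2)"
    unfolding complex_of_real_integrable_eq U_def \<tau>_def .
  have "complex_of_real (LINT x|lborel. exp (- \<tau> * (norm x)\<^sup>2) * (norm (U x))\<^sup>2)
      = (\<Sum>z\<in>Z. \<Sum>w\<in>Z. (u z * cnj (u w)) * fourier (\<lambda>x. of_real (exp (- \<tau> * (norm x)\<^sup>2))) (z - w))"
    unfolding integral_complex_of_real[symmetric] eq fourier_def
    by (simp only: Bochner_Integration.integral_sum Bochner_Integration.integrable_sum ei integral_mult_right_zero cong: sum.cong)
  also have "\<dots> = (\<Sum>z\<in>Z. \<Sum>w\<in>Z. of_real \<kappa> * (u z * cnj (u w) * of_real (exp (- t * (norm (z - w))\<^sup>2))))"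
  proof (intro sum.cong refl)
    fix z w :: 'a
    have "- (norm (z - w))\<^sup>2 / (4 * \<tau>) = - t * (norm (z - w))\<^sup>2" using t by (simp add: \<tau>_def)
    then show "(u z * cnj (u w)) * fourier (\<lambda>x. of_real (exp (- \<tau> * (norm x)\<^sup>2))) (z - w)
        = of_real \<kappa> * (u z * cnj (u w) * of_real (exp (- t * (norm (z - w))\<^sup>2)))"
      unfolding gauss_fourier(2)[OF \<tau>] \<kappa>_def by (simp only: of_real_mult mult.left_commute)
  qed
  also have "\<dots> = of_real \<kappa> * (\<Sum>z\<in>Z. \<Sum>w\<in>Z. u z * cnj (u w) * of_real (exp (- t * (norm (z - w))\<^sup>2)))"
    by (simp only: sum_distrib_left)
  finally have "of_real \<kappa> * (\<Sum>z\<in>Z. \<Sum>w\<in>Z. u z * cnj (u w) * of_real (exp (- t * (norm (z - w))\<^sup>2)))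
      = of_real \<kappa> * (of_real ((LINT x|lborel. exp (- \<tau> * (norm x)\<^sup>2) * (norm (U x))\<^sup>2) / \<kappa>) :: complex)"
    using \<kappa> by simp
  moreover have "complex_of_real \<kappa> \<noteq> 0" using \<kappa> by simp
  ultimately show "(\<Sum>z\<in>Z. \<Sum>w\<in>Z. u z * cnj (u w) * of_real (exp (- t * (norm (z - w))\<^sup>2)))
      = of_real ((LINT x|lborel. exp (- (1 / (4 * t)) * (norm (x::'a))\<^sup>2) * (norm (\<Sum>z\<in>Z. u z * exp (- \<i> * of_real (x \<bullet> z))))\<^sup>2)
          / sqrt (pi / (1 / (4 * t))) ^ DIM('a))"
    unfolding \<kappa>_def \<tau>_def U_def using mult_left_cancel by blast
qed

text \<open>After a shift by \<open>x\<^sub>0\<close>, the functional kills the Taylor polynomial of degree \<open>k - 1\<close> of the exponential, and the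
  remainder is estimated termwise.\<close>

lemma exponential_sum_bound:
  fixes Z :: "(real ^ 'n::finite) set"
  assumes Z: "finite Z" and u: "annihilates Z u (k - 1)" and k: "k \<ge> 1"
  shows "norm (\<Sum>z\<in>Z. u z * exp (- \<i> * of_real (x \<bullet> z)))
    \<le> (\<Sum>z\<in>Z. norm (u z) * (\<bar>x \<bullet> (z - x\<^sub>0)\<bar> ^ k / fact k))"
proof -
  define y where "y z = - (x \<bullet> (z - x\<^sub>0))" for z
  have "(\<Sum>z\<in>Z. u z * exp (- \<i> * of_real (x \<bullet> z))) = exp (- \<i> * of_real (x \<bullet> x\<^sub>0)) * (\<Sum>z\<in>Z. u z * exp (\<i> * of_real (y z)))"
  proof -
    have "exp (- \<i> * of_real (x \<bullet> z)) = exp (- \<i> * of_real (x \<bullet> x\<^sub>0)) * exp (\<i> * of_real (y z))" for z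
      unfolding exp_add[symmetric] y_def by (simp add: inner_diff_right algebra_simps)
    then have "u z * exp (- \<i> * of_real (x \<bullet> z)) = exp (- \<i> * of_real (x \<bullet> x\<^sub>0)) * (u z * exp (\<i> * of_real (y z)))" for z
      by (metis mult.left_commute)
    then show ?thesis unfolding sum_distrib_left by (rule sum.cong[OF refl])
  qed
  then have "norm (\<Sum>z\<in>Z. u z * exp (- \<i> * of_real (x \<bullet> z))) = norm (\<Sum>z\<in>Z. u z * exp (\<i> * of_real (y z)))"
    by (simp add: norm_mult)
  also have "(\<Sum>z\<in>Z. u z * exp (\<i> * of_real (y z)))
      = (\<Sum>z\<in>Z. u z * (exp (\<i> * of_real (y z)) - (\<Sum>j\<le>k - 1. (\<i> * of_real (y z)) ^ j / fact j)))"
  proof -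
    have "(\<Sum>z\<in>Z. u z * (\<Sum>j\<le>k - 1. (\<i> * of_real (y z)) ^ j / fact j)) = 0"
    proof (rule annihilatesD[OF u])
      have "(\<lambda>z. \<Sum>j\<le>k - 1. ((- \<i>) ^ j / fact j) * of_real ((z - x\<^sub>0) \<bullet> x) ^ j) \<in> poly_space (k - 1)"
        by (intro poly_space_sum poly_space_scale poly_space_mono[OF poly_space_inner_power]) simp
      moreover have "(\<i> * of_real (y z)) ^ j / fact j = ((- \<i>) ^ j / fact j) * of_real ((z - x\<^sub>0) \<bullet> x) ^ j" for z j
      proof -
        have "\<i> * complex_of_real (y z) = - \<i> * of_real ((z - x\<^sub>0) \<bullet> x)" by (simp add: y_def inner_commute)
        then show ?thesis by (simp only: power_mult_distrib times_divide_eq_left)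
      qed
      ultimately show "(\<lambda>z. \<Sum>j\<le>k - 1. (\<i> * of_real (y z)) ^ j / fact j) \<in> poly_space (k - 1)" by (simp only:)
    qed
    then show ?thesis by (simp only: right_diff_distrib sum_subtractf diff_zero)
  qed
  also have "norm \<dots> \<le> (\<Sum>z\<in>Z. norm (u z) * (\<bar>x \<bullet> (z - x\<^sub>0)\<bar> ^ k / fact k))"
  proof (rule order.trans[OF norm_sum sum_mono])
    fix z
    have "norm (exp (\<i> * of_real (y z)) - (\<Sum>j\<le>k - 1. (\<i> * of_real (y z)) ^ j / fact j)) \<le> \<bar>y z\<bar> ^ Suc (k - 1) / fact (Suc (k - 1))"
      by (rule iexp_approx1)
    also have "\<dots> = \<bar>x \<bullet> (z - x\<^sub>0)\<bar> ^ k / fact k" using k by (simp add: y_def del: fact_Suc power_Suc)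
    finally show "norm (u z * (exp (\<i> * of_real (y z)) - (\<Sum>j\<le>k - 1. (\<i> * of_real (y z)) ^ j / fact j)))
        \<le> norm (u z) * (\<bar>x \<bullet> (z - x\<^sub>0)\<bar> ^ k / fact k)"
      unfolding norm_mult by (rule mult_left_mono) simp
  qed
  finally show ?thesis .
qed

text \<open>Exponential moments of a Gaussian are explicit, and they dominate the even powers:
  \<open>(\<mu> y)\<^sup>2\<^sup>k \<le> (2 k)! (exp (\<mu> y) + exp (- \<mu> y))\<close>.\<close>

lemma gauss_even_moment:
  fixes v :: "'a::euclidean_space"
  assumes t: "t > 0" and D: "D > 0" "norm v \<le> D" and k: "k \<ge> 1"
  shows "integrable lborel (\<lambda>x::'a. exp (- (1 / (4 * t)) * (norm x)\<^sup>2) * (x \<bullet> v) ^ (2 * k))"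
    and "(LINT x|lborel. exp (- (1 / (4 * t)) * (norm (x::'a))\<^sup>2) * (x \<bullet> v) ^ (2 * k))
      \<le> sqrt (pi / (1 / (4 * t))) ^ DIM('a) * (2 * fact (2 * k) * exp (real k) * (t * D\<^sup>2) ^ k / real k ^ k)"
proof -
  define \<tau> where "\<tau> = 1 / (4 * t)"
  have \<tau>: "\<tau> > 0" using t by (simp add: \<tau>_def)
  \<comment> \<open>The value that balances the exponential moment \<open>exp (t \<mu>\<^sup>2 D\<^sup>2)\<close> against \<open>\<mu>\<^sup>-\<^sup>2\<^sup>k\<close>.\<close>
  define \<mu> where "\<mu> = sqrt (real k / (t * D\<^sup>2))"
  have kt: "real k / (t * D\<^sup>2) > 0" using k t D by simp
  have \<mu>: "\<mu> > 0" "\<mu>\<^sup>2 = real k / (t * D\<^sup>2)" using kt by (simp_all add: \<mu>_def)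
  define P where "P = real k ^ k / (t * D\<^sup>2) ^ k"
  have P: "P > 0" using k t D by (simp add: P_def)
  have \<mu>P: "\<mu> ^ (2 * k) = P" by (simp add: power_mult \<mu>(2) P_def power_divide)
  let ?E = "\<lambda>w x. exp (- \<tau> * (norm x)\<^sup>2 + x \<bullet> w)"
  define b where "b x = fact (2 * k) / P * (?E (\<mu> *\<^sub>R v) x + ?E (- (\<mu> *\<^sub>R v)) x)" for x :: 'a
  have bi: "integrable lborel b"
    unfolding b_def by (intro integrable_mult_right Bochner_Integration.integrable_add gauss_exponential_moment(1)[OF \<tau>])
  have le: "exp (- \<tau> * (norm x)\<^sup>2) * (x \<bullet> v) ^ (2 * k) \<le> b x" for x :: 'a
  proof -
    have "(\<mu> * (x \<bullet> v)) ^ (2 * k) \<le> fact (2 * k) * (exp (\<mu> * (x \<bullet> v)) + exp (- (\<mu> * (x \<bullet> v))))"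
      by (rule power_even_le_exp)
    then have "P * (x \<bullet> v) ^ (2 * k) \<le> fact (2 * k) * (exp (\<mu> * (x \<bullet> v)) + exp (- (\<mu> * (x \<bullet> v))))"
      by (simp only: power_mult_distrib \<mu>P)
    then have "(x \<bullet> v) ^ (2 * k) \<le> fact (2 * k) * (exp (\<mu> * (x \<bullet> v)) + exp (- (\<mu> * (x \<bullet> v)))) / P"
      using P by (simp only: pos_le_divide_eq mult.commute)
    then have "exp (- \<tau> * (norm x)\<^sup>2) * (x \<bullet> v) ^ (2 * k)
        \<le> exp (- \<tau> * (norm x)\<^sup>2) * (fact (2 * k) * (exp (\<mu> * (x \<bullet> v)) + exp (- (\<mu> * (x \<bullet> v)))) / P)"
      by (rule mult_left_mono) simp
    also have "\<dots> = b x"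
      unfolding b_def exp_add inner_scaleR_right inner_minus_right
    proof -
      have "E * (F * (X + Y) / P) = F / P * (E * X + E * Y)" for E F X Y :: real
        by (simp add: algebra_simps add_divide_distrib)
      then show "exp (- \<tau> * (norm x)\<^sup>2) * (fact (2 * k) * (exp (\<mu> * (x \<bullet> v)) + exp (- (\<mu> * (x \<bullet> v)))) / P)
          = fact (2 * k) / P * (exp (- \<tau> * (norm x)\<^sup>2) * exp (\<mu> * (x \<bullet> v)) + exp (- \<tau> * (norm x)\<^sup>2) * exp (- (\<mu> * (x \<bullet> v))))"
        by blast
    qed
    finally show ?thesis .
  qed
  have nn: "exp (- \<tau> * (norm x)\<^sup>2) * (x \<bullet> v) ^ (2 * k) \<ge> 0" for x :: 'a
    by (simp add: zero_le_even_power)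
  show i: "integrable lborel (\<lambda>x::'a. exp (- (1 / (4 * t)) * (norm x)\<^sup>2) * (x \<bullet> v) ^ (2 * k))"
    unfolding \<tau>_def[symmetric]
  proof (rule Bochner_Integration.integrable_bound[OF bi])
    show "AE x in lborel. norm (exp (- \<tau> * (norm x)\<^sup>2) * (x \<bullet> v) ^ (2 * k)) \<le> norm (b x)"
    proof (intro always_eventually allI)
      fix x :: 'a
      have "norm (exp (- \<tau> * (norm x)\<^sup>2) * (x \<bullet> v) ^ (2 * k)) = exp (- \<tau> * (norm x)\<^sup>2) * (x \<bullet> v) ^ (2 * k)"
        unfolding real_norm_def by (rule abs_of_nonneg[OF nn])
      also have "\<dots> \<le> norm (b x)" using le[of x] unfolding real_norm_def by linarith
      finally show "norm (exp (- \<tau> * (norm x)\<^sup>2) * (x \<bullet> v) ^ (2 * k)) \<le> norm (b x)" .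
    qed
  qed measurable
  have "(LINT x|lborel. exp (- \<tau> * (norm (x::'a))\<^sup>2) * (x \<bullet> v) ^ (2 * k)) \<le> (LINT x|lborel. b x)"
    by (rule integral_mono) (use i bi le in \<open>auto simp: \<tau>_def\<close>)
  also have "(LINT x|lborel. b x) = fact (2 * k) / P * (2 * (sqrt (pi / \<tau>) ^ DIM('a) * exp ((norm (\<mu> *\<^sub>R v))\<^sup>2 / (4 * \<tau>))))"
    unfolding b_def integral_mult_right_zero
      Bochner_Integration.integral_add[OF gauss_exponential_moment(1)[OF \<tau>] gauss_exponential_moment(1)[OF \<tau>]]
      gauss_exponential_moment(2)[OF \<tau>] norm_minus_cancel by simp
  also have "\<dots> \<le> fact (2 * k) / P * (2 * (sqrt (pi / \<tau>) ^ DIM('a) * exp (real k)))"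
  proof -
    have "(norm v)\<^sup>2 \<le> D\<^sup>2" using D by (intro power_mono) auto
    then have "(norm v)\<^sup>2 / D\<^sup>2 \<le> 1" using D by simp
    then have "real k * ((norm v)\<^sup>2 / D\<^sup>2) \<le> real k * 1" by (intro mult_left_mono) auto
    moreover have "(norm (\<mu> *\<^sub>R v))\<^sup>2 / (4 * \<tau>) = real k * ((norm v)\<^sup>2 / D\<^sup>2)"
      using t by (simp add: \<mu>(2) power_mult_distrib \<tau>_def)
    ultimately have "exp ((norm (\<mu> *\<^sub>R v))\<^sup>2 / (4 * \<tau>)) \<le> exp (real k)" by simp
    then show ?thesis using P \<tau> by (intro mult_left_mono) auto
  qed
  also have "\<dots> = sqrt (pi / \<tau>) ^ DIM('a) * (2 * fact (2 * k) * exp (real k) * (t * D\<^sup>2) ^ k / real k ^ k)"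
    by (simp add: P_def)
  finally show "(LINT x|lborel. exp (- (1 / (4 * t)) * (norm (x::'a))\<^sup>2) * (x \<bullet> v) ^ (2 * k))
      \<le> sqrt (pi / (1 / (4 * t))) ^ DIM('a) * (2 * fact (2 * k) * exp (real k) * (t * D\<^sup>2) ^ k / real k ^ k)"
    by (simp only: \<tau>_def)
qed

lemma fact_double_le: "(fact (2 * k) :: real) \<le> 4 ^ k * (fact k)\<^sup>2"
proof -
  have "real (2 * k choose k) \<le> real (2 ^ (2 * k))"
    unfolding of_nat_le_iff by (rule binomial_le_pow2)
  moreover have "real (2 * k choose k) = fact (2 * k) / (fact k * fact k)"
    by (subst binomial_fact) (simp_all add: mult_2)
  ultimately have "fact (2 * k) / (fact k * fact k) \<le> (4::real) ^ k"
    by (simp add: power_mult)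
  then show ?thesis by (simp add: pos_divide_le_eq power2_eq_square)
qed

text \<open>Cauchy-Schwarz with the weights \<open>|u z|\<close> reduces the square of the exponential sum to even Gaussian moments.
  The two factors \<open>k!\<close> of the Taylor remainder compensate \<open>(2 k)!\<close> up to \<open>4\<^sup>k\<close>, so the decay \<open>k\<^sup>-\<^sup>k\<close> survives. The
  point \<open>x\<^sub>0\<close> has displacement zero and does not contribute.\<close>

lemma gauss_form_bound:
  fixes Z :: "(real ^ 'n::finite) set"
  assumes Z: "finite Z" and u: "annihilates Z u (k - 1)" and k: "k \<ge> 1" and t: "t > 0"
    and D: "D > 0" "\<And>z. z \<in> Z \<Longrightarrow> u z \<noteq> 0 \<Longrightarrow> norm (z - x\<^sub>0) \<le> D"
  obtains S where "0 \<le> S" "S \<le> 2 * (\<Sum>z\<in>Z - {x\<^sub>0}. norm (u z))\<^sup>2 * (4 * exp 1) ^ k * (t * D\<^sup>2) ^ k / real k ^ k"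
    "(\<Sum>z\<in>Z. \<Sum>w\<in>Z. u z * cnj (u w) * of_real (exp (- t * (norm (z - w))\<^sup>2))) = of_real S"
proof -
  define \<kappa> where "\<kappa> = sqrt (pi / (1 / (4 * t))) ^ DIM(real ^ 'n)"
  have \<kappa>: "\<kappa> > 0" using t by (simp add: \<kappa>_def)
  define A where "A = (\<Sum>z\<in>Z - {x\<^sub>0}. norm (u z))"
  have A: "A \<ge> 0" by (simp add: A_def sum_nonneg)
  define E where "E x = exp (- (1 / (4 * t)) * (norm x)\<^sup>2)" for x :: "real ^ 'n"
  define U where "U x = (\<Sum>z\<in>Z. u z * exp (- \<i> * of_real (x \<bullet> z)))" for x
  define B where "B = 2 * fact (2 * k) * exp (real k) * (t * D\<^sup>2) ^ k / real k ^ k"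
  have U: "(norm (U x))\<^sup>2 \<le> A / (fact k)\<^sup>2 * (\<Sum>z\<in>Z - {x\<^sub>0}. norm (u z) * (x \<bullet> (z - x\<^sub>0)) ^ (2 * k))" for x
  proof -
    have "norm (U x) \<le> (\<Sum>z\<in>Z. norm (u z) * (\<bar>x \<bullet> (z - x\<^sub>0)\<bar> ^ k / fact k))"
      unfolding U_def by (rule exponential_sum_bound[OF Z u k])
    also have "\<dots> = (\<Sum>z\<in>Z - {x\<^sub>0}. norm (u z) * (\<bar>x \<bullet> (z - x\<^sub>0)\<bar> ^ k / fact k))"
      using Z k by (intro sum.mono_neutral_right) auto
    also have "\<dots> = (\<Sum>z\<in>Z - {x\<^sub>0}. sqrt (norm (u z)) * (sqrt (norm (u z)) * \<bar>x \<bullet> (z - x\<^sub>0)\<bar> ^ k)) / fact k"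
      by (simp add: sum_divide_distrib mult.assoc[symmetric])
    finally have "(norm (U x))\<^sup>2 \<le> ((\<Sum>z\<in>Z - {x\<^sub>0}. sqrt (norm (u z)) * (sqrt (norm (u z)) * \<bar>x \<bullet> (z - x\<^sub>0)\<bar> ^ k)) / fact k)\<^sup>2"
      by (rule power_mono) simp
    also have "\<dots> = (\<Sum>z\<in>Z - {x\<^sub>0}. sqrt (norm (u z)) * (sqrt (norm (u z)) * \<bar>x \<bullet> (z - x\<^sub>0)\<bar> ^ k))\<^sup>2 / (fact k)\<^sup>2"
      by (rule power_divide)
    also have "\<dots> \<le> (\<Sum>z\<in>Z - {x\<^sub>0}. (sqrt (norm (u z)))\<^sup>2) * (\<Sum>z\<in>Z - {x\<^sub>0}. (sqrt (norm (u z)) * \<bar>x \<bullet> (z - x\<^sub>0)\<bar> ^ k)\<^sup>2) / (fact k)\<^sup>2"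
      by (intro divide_right_mono Cauchy_Schwarz_ineq_sum) simp
    also have "(\<Sum>z\<in>Z - {x\<^sub>0}. (sqrt (norm (u z)))\<^sup>2) = A" by (simp add: A_def)
    also have "(\<Sum>z\<in>Z - {x\<^sub>0}. (sqrt (norm (u z)) * \<bar>x \<bullet> (z - x\<^sub>0)\<bar> ^ k)\<^sup>2)
        = (\<Sum>z\<in>Z - {x\<^sub>0}. norm (u z) * (x \<bullet> (z - x\<^sub>0)) ^ (2 * k))"
    proof (intro sum.cong refl)
      fix z
      have "(\<bar>x \<bullet> (z - x\<^sub>0)\<bar> ^ k)\<^sup>2 = (x \<bullet> (z - x\<^sub>0)) ^ (2 * k)"
        by (simp only: power_mult[symmetric] mult.commute[of k 2]) (simp only: power_mult power2_abs)
      then show "(sqrt (norm (u z)) * \<bar>x \<bullet> (z - x\<^sub>0)\<bar> ^ k)\<^sup>2 = norm (u z) * (x \<bullet> (z - x\<^sub>0)) ^ (2 * k)"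
        by (simp only: power_mult_distrib real_sqrt_pow2 norm_ge_zero)
    qed
    finally show ?thesis by simp
  qed
  have mi: "integrable lborel (\<lambda>x. norm (u z) * (E x * (x \<bullet> (z - x\<^sub>0)) ^ (2 * k)))"
    and mb: "norm (u z) * (LINT x|lborel. E x * (x \<bullet> (z - x\<^sub>0)) ^ (2 * k)) \<le> norm (u z) * (\<kappa> * B)" if "z \<in> Z" for z
  proof -
    show "norm (u z) * (LINT x|lborel. E x * (x \<bullet> (z - x\<^sub>0)) ^ (2 * k)) \<le> norm (u z) * (\<kappa> * B)"
    proof (cases "u z = 0")
      case False
      show ?thesis
        using gauss_even_moment(2)[OF t D(1) D(2)[OF that False] k] unfolding E_def \<kappa>_def B_def
        by (rule mult_left_mono) simp
    qed simp
    show "integrable lborel (\<lambda>x. norm (u z) * (E x * (x \<bullet> (z - x\<^sub>0)) ^ (2 * k)))"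
    proof (cases "u z = 0")
      case False
      show ?thesis
        using gauss_even_moment(1)[OF t D(1) D(2)[OF that False] k] unfolding E_def
        by (intro integrable_mult_right)
    qed simp
  qed
  have i: "integrable lborel (\<lambda>x. E x * (norm (U x))\<^sup>2)"
    unfolding E_def U_def by (rule gauss_quadratic_form(1)[OF Z t])
  have i2: "integrable lborel (\<lambda>x. A / (fact k)\<^sup>2 * (\<Sum>z\<in>Z - {x\<^sub>0}. norm (u z) * (E x * (x \<bullet> (z - x\<^sub>0)) ^ (2 * k))))"
    by (intro integrable_mult_right Bochner_Integration.integrable_sum mi) simp
  have "(LINT x|lborel. E x * (norm (U x))\<^sup>2)
      \<le> (LINT x|lborel. A / (fact k)\<^sup>2 * (\<Sum>z\<in>Z - {x\<^sub>0}. norm (u z) * (E x * (x \<bullet> (z - x\<^sub>0)) ^ (2 * k))))"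
  proof (rule integral_mono[OF i i2])
    fix x
    have "E x * (norm (U x))\<^sup>2 \<le> E x * (A / (fact k)\<^sup>2 * (\<Sum>z\<in>Z - {x\<^sub>0}. norm (u z) * (x \<bullet> (z - x\<^sub>0)) ^ (2 * k)))"
      by (rule mult_left_mono[OF U]) (simp add: E_def)
    also have "\<dots> = A / (fact k)\<^sup>2 * (\<Sum>z\<in>Z - {x\<^sub>0}. norm (u z) * (E x * (x \<bullet> (z - x\<^sub>0)) ^ (2 * k)))"
      by (simp only: sum_distrib_left mult.left_commute[of "E x"])
    finally show "E x * (norm (U x))\<^sup>2 \<le> A / (fact k)\<^sup>2 * (\<Sum>z\<in>Z - {x\<^sub>0}. norm (u z) * (E x * (x \<bullet> (z - x\<^sub>0)) ^ (2 * k)))" .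
  qed
  also have "\<dots> = A / (fact k)\<^sup>2 * (\<Sum>z\<in>Z - {x\<^sub>0}. norm (u z) * (LINT x|lborel. E x * (x \<bullet> (z - x\<^sub>0)) ^ (2 * k)))"
    using mi by (simp only: integral_mult_right_zero Bochner_Integration.integral_sum DiffD1 cong: sum.cong)
  also have "\<dots> \<le> A / (fact k)\<^sup>2 * (\<Sum>z\<in>Z - {x\<^sub>0}. norm (u z) * (\<kappa> * B))"
    using A by (intro mult_left_mono sum_mono mb) auto
  also have "(\<Sum>z\<in>Z - {x\<^sub>0}. norm (u z) * (\<kappa> * B)) = A * (\<kappa> * B)" by (simp only: A_def sum_distrib_right)
  also have "A / (fact k)\<^sup>2 * (A * (\<kappa> * B)) = \<kappa> * (A\<^sup>2 * (B / (fact k)\<^sup>2))"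
    unfolding power2_eq_square[of A] by simp
  finally have main: "(LINT x|lborel. E x * (norm (U x))\<^sup>2) \<le> \<kappa> * (A\<^sup>2 * (B / (fact k)\<^sup>2))" .
  define S where "S = (LINT x|lborel. E x * (norm (U x))\<^sup>2) / \<kappa>"
  show thesis
  proof
    show "0 \<le> S" unfolding S_def using \<kappa> by (intro divide_nonneg_pos) (simp_all add: E_def)
    have "S \<le> A\<^sup>2 * (B / (fact k)\<^sup>2)"
      unfolding S_def using main \<kappa> by (simp add: pos_divide_le_eq mult.commute)
    also have "\<dots> \<le> A\<^sup>2 * (2 * (4 * exp 1) ^ k * (t * D\<^sup>2) ^ k / real k ^ k)"
    proof (rule mult_left_mono)
      have "B / (fact k)\<^sup>2 = (fact (2 * k) / (fact k)\<^sup>2) * (2 * exp (real k) * (t * D\<^sup>2) ^ k / real k ^ k)"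
        by (simp add: B_def mult.commute)
      also have "\<dots> \<le> 4 ^ k * (2 * exp (real k) * (t * D\<^sup>2) ^ k / real k ^ k)"
        using fact_double_le[of k] t by (intro mult_right_mono) (simp_all add: pos_divide_le_eq)
      also have "exp (real k) = exp 1 ^ k" by (simp add: exp_of_nat_mult[symmetric])
      also have "4 ^ k * (2 * exp 1 ^ k * (t * D\<^sup>2) ^ k / real k ^ k) = 2 * (4 * exp 1) ^ k * (t * D\<^sup>2) ^ k / real k ^ k"
        unfolding power_mult_distrib[of 4] by simp
      finally show "B / (fact k)\<^sup>2 \<le> 2 * (4 * exp 1) ^ k * (t * D\<^sup>2) ^ k / real k ^ k" .
    qed simp
    also have "A\<^sup>2 * (2 * (4 * exp 1) ^ k * (t * D\<^sup>2) ^ k / real k ^ k) = 2 * A\<^sup>2 * (4 * exp 1) ^ k * (t * D\<^sup>2) ^ k / real k ^ k"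
    proof -
      have "x * (2 * p * q / r) = 2 * x * p * q / r" for x p q r :: real by simp
      then show ?thesis by blast
    qed
    finally show "S \<le> 2 * (\<Sum>z\<in>Z - {x\<^sub>0}. norm (u z))\<^sup>2 * (4 * exp 1) ^ k * (t * D\<^sup>2) ^ k / real k ^ k"
      unfolding A_def .
    show "(\<Sum>z\<in>Z. \<Sum>w\<in>Z. u z * cnj (u w) * of_real (exp (- t * (norm (z - w))\<^sup>2))) = of_real S"
      unfolding S_def E_def U_def \<kappa>_def by (rule gauss_quadratic_form(2)[OF Z t])
  qed
qed

text \<open>The form of the kernel is the mixture of Gaussian forms with density \<open>a!/2 t\<^sup>-\<^sup>a\<^sup>-\<^sup>1 exp (- c\<^sup>2 t)\<close>. Those vanish to order
  \<open>t\<^sup>k\<close> at the origin, which pays for the singular density and leaves a Gamma integral.\<close>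

lemma surface_spline_form:
  fixes Z :: "(real ^ 'n::finite) set"
  assumes Z: "finite Z" and a: "a \<ge> 1" and c: "c > 0" and u: "annihilates Z u (k - 1)" and k: "k \<ge> a + 1"
    and D: "D > 0" "\<And>z. z \<in> Z \<Longrightarrow> u z \<noteq> 0 \<Longrightarrow> norm (z - x\<^sub>0) \<le> D"
  obtains Q where "0 \<le> Q"
    "Q \<le> fact a * (\<Sum>z\<in>Z - {x\<^sub>0}. norm (u z))\<^sup>2 * (4 * exp 1 * D\<^sup>2) ^ k / real k ^ k * (fact (k - a - 1) / (c\<^sup>2) ^ (k - a))"
    "(\<Sum>z\<in>Z. \<Sum>w\<in>Z. u z * cnj (u w) * of_real (shifted_surface_spline (2 * a) c (z - w))) = of_real Q"
proof -
  define A where "A = (\<Sum>z\<in>Z - {x\<^sub>0}. norm (u z))"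
  define B where "B = 2 * A\<^sup>2 * (4 * exp 1) ^ k * (D\<^sup>2) ^ k / real k ^ k"
  have B: "B \<ge> 0" unfolding B_def by simp
  have "\<forall>t\<in>{0<..}. \<exists>S. 0 \<le> S \<and> S \<le> B * t ^ k
      \<and> (\<Sum>z\<in>Z. \<Sum>w\<in>Z. u z * cnj (u w) * of_real (exp (- t * (norm (z - w))\<^sup>2))) = of_real S"
  proof
    fix t :: real assume "t \<in> {0<..}"
    then have t: "t > 0" by simp
    have "k \<ge> 1" using k by simp
    from gauss_form_bound[OF Z u this t D] obtain S where S: "0 \<le> S"
      "S \<le> 2 * A\<^sup>2 * (4 * exp 1) ^ k * (t * D\<^sup>2) ^ k / real k ^ k"
      "(\<Sum>z\<in>Z. \<Sum>w\<in>Z. u z * cnj (u w) * of_real (exp (- t * (norm (z - w))\<^sup>2))) = of_real S"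
      unfolding A_def by blast
    have "2 * A\<^sup>2 * (4 * exp 1) ^ k * (t * D\<^sup>2) ^ k / real k ^ k = B * t ^ k"
      unfolding B_def power_mult_distrib[of t] by simp
    then show "\<exists>S. 0 \<le> S \<and> S \<le> B * t ^ k
      \<and> (\<Sum>z\<in>Z. \<Sum>w\<in>Z. u z * cnj (u w) * of_real (exp (- t * (norm (z - w))\<^sup>2))) = of_real S"
      using S by metis
  qed
  from bchoice[OF this] obtain S where S: "\<forall>t\<in>{0<..}. 0 \<le> S t \<and> S t \<le> B * t ^ k
      \<and> (\<Sum>z\<in>Z. \<Sum>w\<in>Z. u z * cnj (u w) * of_real (exp (- t * (norm (z - w))\<^sup>2))) = of_real (S t)" ..
  define M where "M = count_space (Z \<times> Z)"
  define W where "W p = u (fst p) * cnj (u (snd p))" for p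
  define s where "s p = (norm (fst p - snd p))\<^sup>2 + c\<^sup>2" for p :: "(real ^ 'n) \<times> (real ^ 'n)"
  have sp: "s p > 0" for p using c by (simp add: s_def add_nonneg_pos)
  have fZ: "finite (Z \<times> Z)" using Z by simp
  have M: "(LINT p|M. F p) = (\<Sum>z\<in>Z. \<Sum>w\<in>Z. F (z, w))" for F :: "_ \<Rightarrow> complex"
    unfolding M_def lebesgue_integral_count_space_finite[OF fZ] by (simp add: sum.cartesian_product)
  have form: "(LINT p|M. W p * of_real (exp (- (t * s p)))) = of_real (exp (- c\<^sup>2 * t) * S t)" if t: "t > 0" for t
  proof -
    have "u z * cnj (u w) * of_real (exp (- (t * ((norm (z - w))\<^sup>2 + c\<^sup>2))))
        = of_real (exp (- c\<^sup>2 * t)) * (u z * cnj (u w) * of_real (exp (- t * (norm (z - w))\<^sup>2)))" for z w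
    proof -
      have "- (t * ((norm (z - w))\<^sup>2 + c\<^sup>2)) = - c\<^sup>2 * t + - t * (norm (z - w))\<^sup>2" by (simp add: algebra_simps)
      then show ?thesis by (simp only: exp_add of_real_mult mult.left_commute)
    qed
    then have "(LINT p|M. W p * of_real (exp (- (t * s p))))
        = of_real (exp (- c\<^sup>2 * t)) * (\<Sum>z\<in>Z. \<Sum>w\<in>Z. u z * cnj (u w) * of_real (exp (- t * (norm (z - w))\<^sup>2)))"
      unfolding M W_def s_def fst_conv snd_conv by (simp only: sum_distrib_left)
    then show ?thesis using S t by simp
  qed
  have S0: "0 \<le> S t" and SB: "S t \<le> B * t ^ k" if "t > 0" for t using S that by auto
  have "(LINT p|M. W p * of_real ((-1) ^ (a + 1) * s p ^ a * ln (s p)))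
    = of_real (fact a) * (LINT t|lborel. of_real (indicator {0<..} t / t ^ (a + 1)) * (LINT p|M. W p * of_real (exp (- (t * s p)))))"
  proof (rule log_kernel_representation[OF _ _ _ sp a, where K = B])
    show "sigma_finite_measure M" unfolding M_def using fZ by (rule sigma_finite_measure_count_space_finite)
    show "W \<in> borel_measurable M" "s \<in> borel_measurable M" by (simp_all add: M_def)
    show "integrable M (\<lambda>x. norm (W x) * (1 + s x) ^ (a + 1))" unfolding M_def using fZ by (rule integrable_count_space)
    fix t :: real assume t: "0 < t" "t \<le> 1"
    have "norm (LINT p|M. W p * of_real (exp (- (t * s p)))) = exp (- c\<^sup>2 * t) * S t"
      unfolding form[OF t(1)] norm_of_real using S0[OF t(1)] by simp
    also have "\<dots> \<le> 1 * (B * t ^ k)" using t by (intro mult_mono SB S0) auto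
    also have "\<dots> \<le> B * t ^ (a + 1)" using k B t by (simp only: mult_1) (intro mult_left_mono power_decreasing, auto)
    finally show "norm (LINT p|M. W p * of_real (exp (- (t * s p)))) \<le> B * t ^ (a + 1)" .
  qed
  also have "(LINT t|lborel. of_real (indicator {0<..} t / t ^ (a + 1)) * (LINT p|M. W p * of_real (exp (- (t * s p)))))
      = (LINT t|lborel. complex_of_real (indicator {0<..} t / t ^ (a + 1) * (exp (- c\<^sup>2 * t) * S t)))"
  proof (intro Bochner_Integration.integral_cong refl)
    fix t :: real
    show "complex_of_real (indicator {0<..} t / t ^ (a + 1)) * (LINT p|M. W p * of_real (exp (- (t * s p))))
        = complex_of_real (indicator {0<..} t / t ^ (a + 1) * (exp (- c\<^sup>2 * t) * S t))"
    proof (cases "t > 0")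
      case True
      show ?thesis unfolding form[OF True] by (rule of_real_mult[symmetric])
    qed simp
  qed
  also have "\<dots> = of_real (LINT t|lborel. indicator {0<..} t / t ^ (a + 1) * (exp (- c\<^sup>2 * t) * S t))"
    by (rule integral_complex_of_real)
  finally have rep: "(LINT p|M. W p * of_real ((-1) ^ (a + 1) * s p ^ a * ln (s p)))
      = of_real (fact a) * of_real (LINT t|lborel. indicator {0<..} t / t ^ (a + 1) * (exp (- c\<^sup>2 * t) * S t))" .
  define I where "I = (LINT t|lborel. indicator {0<..} t / t ^ (a + 1) * (exp (- c\<^sup>2 * t) * S t))"
  have I0: "I \<ge> 0" unfolding I_def
  proof (rule Bochner_Integration.integral_nonneg)
    fix t :: real
    show "0 \<le> indicator {0<..} t / t ^ (a + 1) * (exp (- c\<^sup>2 * t) * S t)"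
      using S0[of t] by (cases "t > 0") auto
  qed
  have c2: "c\<^sup>2 > 0" using c by simp
  have "I \<le> (LINT t|lborel. B * (indicator {0<..} t * (t ^ (k - a - 1) * exp (- c\<^sup>2 * t))))"
    unfolding I_def
  proof (rule integral_mono')
    show "integrable lborel (\<lambda>t. B * (indicator {0<..} t * (t ^ (k - a - 1) * exp (- c\<^sup>2 * t))))"
      by (intro integrable_mult_right power_exp_integral(1)[OF c2])
    fix t :: real
    show "0 \<le> B * (indicator {0<..} t * (t ^ (k - a - 1) * exp (- c\<^sup>2 * t)))"
      using B by (cases "t > 0") auto
    show "indicator {0<..} t / t ^ (a + 1) * (exp (- c\<^sup>2 * t) * S t) \<le> B * (indicator {0<..} t * (t ^ (k - a - 1) * exp (- c\<^sup>2 * t)))"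
    proof (cases "t > 0")
      case True
      have "t ^ k = t ^ (a + 1) * t ^ (k - a - 1)" using k by (simp only: power_add[symmetric]) simp
      then have "B * t ^ k / t ^ (a + 1) = B * t ^ (k - a - 1)" using True by simp
      moreover have "S t / t ^ (a + 1) \<le> B * t ^ k / t ^ (a + 1)" using SB[OF True] True by (intro divide_right_mono) auto
      ultimately have "exp (- c\<^sup>2 * t) * (S t / t ^ (a + 1)) \<le> exp (- c\<^sup>2 * t) * (B * t ^ (k - a - 1))"
        by (intro mult_left_mono) auto
      then show ?thesis using True by (simp add: mult.assoc mult.left_commute mult.commute)
    qed simp
  qed
  also have "\<dots> = B * (fact (k - a - 1) / (c\<^sup>2) ^ (k - a - 1 + 1))"
    unfolding integral_mult_right_zero power_exp_integral(2)[OF c2] ..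
  also have "k - a - 1 + 1 = k - a" using k by simp
  finally have IB: "I \<le> B * (fact (k - a - 1) / (c\<^sup>2) ^ (k - a))" .
  show thesis
  proof
    show "0 \<le> fact a / 2 * I" using I0 by simp
    have "fact a / 2 * I \<le> fact a / 2 * (B * (fact (k - a - 1) / (c\<^sup>2) ^ (k - a)))"
      by (rule mult_left_mono[OF IB]) simp
    also have "\<dots> = fact a * A\<^sup>2 * (4 * exp 1 * D\<^sup>2) ^ k / real k ^ k * (fact (k - a - 1) / (c\<^sup>2) ^ (k - a))"
    proof -
      have "F / 2 * (2 * X * Y * Z / P * R) = F * X * (Y * Z) / P * R" for F X Y Z P R :: real by simp
      then show ?thesis unfolding B_def power_mult_distrib[of "4 * exp 1"] by blast
    qed
    finally show "fact a / 2 * I \<le> fact a * (\<Sum>z\<in>Z - {x\<^sub>0}. norm (u z))\<^sup>2 * (4 * exp 1 * D\<^sup>2) ^ k / real k ^ k * (fact (k - a - 1) / (c\<^sup>2) ^ (k - a))"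
      unfolding A_def .
    have "u z * cnj (u w) * of_real (shifted_surface_spline (2 * a) c (z - w))
        = of_real (1 / 2) * (W (z, w) * of_real ((-1) ^ (a + 1) * s (z, w) ^ a * ln (s (z, w))))" for z w
    proof -
      have "shifted_surface_spline (2 * a) c (z - w) = 1 / 2 * ((-1) ^ (a + 1) * s (z, w) ^ a * ln (s (z, w)))"
        using shifted_surface_spline_alt[of "2 * a" c "z - w"] c by (simp add: s_def)
      moreover have "X * of_real (p * q) = of_real p * (X * of_real q)" for X :: complex and p q :: real
        by simp
      ultimately show ?thesis unfolding W_def fst_conv snd_conv by simp
    qed
    then have "(\<Sum>z\<in>Z. \<Sum>w\<in>Z. u z * cnj (u w) * of_real (shifted_surface_spline (2 * a) c (z - w)))
        = of_real (1 / 2) * (LINT p|M. W p * of_real ((-1) ^ (a + 1) * s p ^ a * ln (s p)))"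
      unfolding M by (simp only: sum_distrib_left)
    also have "\<dots> = of_real (fact a / 2 * I)" unfolding rep I_def by simp
    finally show "(\<Sum>z\<in>Z. \<Sum>w\<in>Z. u z * cnj (u w) * of_real (shifted_surface_spline (2 * a) c (z - w))) = of_real (fact a / 2 * I)" .
  qed
qed

text \<open>The conditional positive definiteness of the kernel, of order \<open>a + 1\<close>.\<close>

lemma surface_spline_form_nonneg:
  fixes Z :: "(real ^ 'n::finite) set"
  assumes Z: "finite Z" and a: "a \<ge> 1" and c: "c > 0" and u: "annihilates Z u a"
  obtains Q where "0 \<le> Q"
    "(\<Sum>z\<in>Z. \<Sum>w\<in>Z. u z * cnj (u w) * of_real (shifted_surface_spline (2 * a) c (z - w))) = of_real Q"
proof -
  obtain D where D: "D > 0" "\<forall>z\<in>Z. norm z \<le> D"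
    using finite_imp_bounded[OF Z] unfolding bounded_pos by blast
  have u': "annihilates Z u (a + 1 - 1)" using u by simp
  show thesis
    by (rule surface_spline_form[OF Z a c u' _ D(1), of 0]) (use D(2) that in auto)
qed

section \<open>Optimality of the interpolating spline\<close>

text \<open>The expression is \<open>Q(u - t v)\<close> for a positive semidefinite form with \<open>Q(u) = q\<close>, \<open>Q(u,v) = \<beta>\<close> and \<open>Q(v) = b\<close>; it is
  minimal at \<open>t = \<beta> / b\<close>. If \<open>b = 0\<close>, semidefiniteness forces \<open>\<beta> = 0\<close>.\<close>

lemma nonneg_quadratic_minimizer:
  fixes \<beta> :: complex and q b :: real
  assumes nn: "\<And>t. q - 2 * Re (cnj t * \<beta>) + (norm t)\<^sup>2 * b \<ge> 0" and b: "b \<ge> 0"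
  obtains t where "t * of_real b = \<beta>" "q - 2 * Re (cnj t * \<beta>) + (norm t)\<^sup>2 * b \<le> q"
proof (cases "b = 0")
  case True
  have "\<beta> = 0"
  proof (rule ccontr)
    assume \<beta>: "\<beta> \<noteq> 0"
    \<comment> \<open>At \<open>t = r \<beta>\<close> the expression would be \<open>- 1\<close>.\<close>
    define r where "r = (q + 1) / (2 * (norm \<beta>)\<^sup>2)"
    have "Re (cnj (of_real r * \<beta>) * \<beta>) = r * (norm \<beta>)\<^sup>2"
      unfolding cmod_power2 by (simp add: power2_eq_square algebra_simps)
    then have "2 * Re (cnj (of_real r * \<beta>) * \<beta>) = 2 * (r * (norm \<beta>)\<^sup>2)" by (rule arg_cong)
    also have "\<dots> = q + 1" using \<beta> by (simp add: r_def)
    finally have "2 * Re (cnj (of_real r * \<beta>) * \<beta>) = q + 1" .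
    with nn[of "of_real r * \<beta>"] True show False by simp
  qed
  then show thesis using that[of 0] by simp
next
  case False
  then have b: "b > 0" using b by simp
  have "Re (cnj (\<beta> / of_real b) * \<beta>) = (norm \<beta>)\<^sup>2 / b"
    unfolding cmod_power2 using b by (simp add: power2_eq_square add_divide_distrib)
  moreover have "(norm (\<beta> / of_real b))\<^sup>2 * b = (norm \<beta>)\<^sup>2 / b"
    using b by (simp add: norm_divide power_divide power2_eq_square)
  moreover have "(norm \<beta>)\<^sup>2 / b \<ge> 0" using b by simp
  ultimately show thesis using b by (intro that[of "\<beta> / of_real b"]) simp_all
qed

lemma poly_space_cnj:
  assumes "p \<in> poly_space k"
  shows "(\<lambda>x. cnj (p x)) \<in> poly_space k"
proof -
  from assms obtain a where "p = (\<lambda>x. \<Sum>\<alpha> | multi_degree \<alpha> \<le> k. a \<alpha> * complex_of_real (monomial \<alpha> x))"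
    by (auto simp: poly_space_def)
  then show ?thesis unfolding poly_space_def by (intro CollectI exI[of _ "\<lambda>\<alpha>. cnj (a \<alpha>)"]) simp
qed

text \<open>Let \<open>v\<close> be the conjugate of the coefficients of \<open>s\<close>. Pairing any \<open>w\<close> that annihilates \<open>P\<^sub>m\<^sub>-\<^sub>1\<close> with \<open>v\<close> in the form of
  \<open>h\<close> gives the value of \<open>w\<close> at \<open>s\<close>, the polynomial part of \<open>s\<close> being invisible. The best multiple \<open>t v\<close> to subtract
  from \<open>u\<close> thus has \<open>t Q(v)\<close> equal to the value of \<open>u\<close> at \<open>s\<close>; and \<open>Q(v)\<close> is the value of \<open>v\<close> at \<open>s\<close>, that is at \<open>f\<close>,
  since \<open>v\<close> lives on the interpolation points. So \<open>u - t v\<close> maps \<open>f\<close> to the value of \<open>u\<close> at \<open>f - s\<close>.\<close>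

lemma spline_error_functional_bound:
  fixes h :: "real ^ 'n::finite \<Rightarrow> real"
  assumes f: "continuous_on UNIV f" and h: "continuous_on UNIV h" and heven: "\<And>x. h (- x) = h x"
    and pd: "\<And>Z u. finite Z \<Longrightarrow> annihilates Z u (m - 1) \<Longrightarrow>
      \<exists>Q\<ge>0. (\<Sum>z\<in>Z. \<Sum>w\<in>Z. u z * cnj (u w) * complex_of_real (h (z - w))) = of_real Q"
    and nb: "native_bound h m f K" and K: "K \<ge> 0" and m: "m \<ge> 1"
    and s: "is_h_spline_interpolant h m X f s"
    and Z: "finite Z" "X \<subseteq> Z" and u: "annihilates Z u (m - 1)"
  shows "norm (\<Sum>z\<in>Z. u z * (f z - s z))
    \<le> K * sqrt (Re (\<Sum>z\<in>Z. \<Sum>w\<in>Z. u z * cnj (u w) * of_real (h (z - w))))"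
proof -
  from s obtain p a where p: "p \<in> poly_space (m - 1)"
    and sx: "\<And>x. s x = p x + (\<Sum>y\<in>X. a y * complex_of_real (h (x - y)))"
    and a: "\<And>q. q \<in> poly_space (m - 1) \<Longrightarrow> (\<Sum>y\<in>X. a y * q y) = 0"
    and sf: "\<And>x. x \<in> X \<Longrightarrow> s x = f x"
    unfolding is_h_spline_interpolant_def by blast
  define v where "v z = (if z \<in> X then cnj (a z) else 0)" for z
  have vX: "(\<Sum>z\<in>Z. v z * g z) = (\<Sum>z\<in>X. cnj (a z) * g z)" for g
    using Z by (intro sum.mono_neutral_cong_right) (auto simp: v_def)
  have v: "annihilates Z v (m - 1)"
    unfolding annihilates_def vX
  proof
    fix q :: "real ^ 'n \<Rightarrow> complex" assume "q \<in> poly_space (m - 1)"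
    from a[OF poly_space_cnj[OF this]] have "cnj (\<Sum>y\<in>X. a y * cnj (q y)) = 0" by simp
    then show "(\<Sum>z\<in>X. cnj (a z) * q z) = 0" by simp
  qed
  define B where "B u v = (\<Sum>z\<in>Z. \<Sum>w\<in>Z. u z * cnj (v w) * complex_of_real (h (z - w)))" for u v
  have Bc: "cnj (B u v) = B v u" for u v
  proof -
    have "cnj (B u v) = (\<Sum>z\<in>Z. \<Sum>w\<in>Z. v w * cnj (u z) * complex_of_real (h (w - z)))"
      unfolding B_def cnj_sum
    proof (intro sum.cong refl)
      fix z w
      have "h (z - w) = h (w - z)" using heven[of "w - z"] by simp
      then show "cnj (u z * cnj (v w) * complex_of_real (h (z - w))) = v w * cnj (u z) * complex_of_real (h (w - z))"
        by simp
    qed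
    then show ?thesis unfolding B_def by (subst (asm) sum.swap)
  qed
  have pdB: "\<exists>Q\<ge>0. B w w = of_real Q" if "annihilates Z w (m - 1)" for w
    unfolding B_def by (rule pd[OF Z(1) that])
  from pdB[OF u] obtain q where q: "q \<ge> 0" "B u u = of_real q" by blast
  from pdB[OF v] obtain b where b: "b \<ge> 0" "B v v = of_real b" by blast
  have ann: "annihilates Z (\<lambda>z. u z - t * v z) (m - 1)" for t
    unfolding annihilates_def
  proof
    fix g :: "real ^ 'n \<Rightarrow> complex" assume g: "g \<in> poly_space (m - 1)"
    have "(\<Sum>z\<in>Z. (u z - t * v z) * g z) = (\<Sum>z\<in>Z. u z * g z) - t * (\<Sum>z\<in>Z. v z * g z)"
      by (simp add: left_diff_distrib sum_subtractf sum_distrib_left mult.assoc)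
    then show "(\<Sum>z\<in>Z. (u z - t * v z) * g z) = 0" using annihilatesD[OF u g] annihilatesD[OF v g] by simp
  qed
  have expand: "Re (B (\<lambda>z. u z - t * v z) (\<lambda>z. u z - t * v z)) = q - 2 * Re (cnj t * B u v) + (norm t)\<^sup>2 * b" for t
  proof -
    have "(u z - t * v z) * cnj (u w - t * v w) * H
        = u z * cnj (u w) * H - cnj t * (u z * cnj (v w) * H) - t * (v z * cnj (u w) * H) + t * cnj t * (v z * cnj (v w) * H)" for z w H
      by (simp add: algebra_simps)
    then have "B (\<lambda>z. u z - t * v z) (\<lambda>z. u z - t * v z) = B u u - cnj t * B u v - t * B v u + t * cnj t * B v v"
      unfolding B_def by (simp only: sum.distrib sum_subtractf sum_distrib_left)
    also have "t * B v u = cnj (cnj t * B u v)" unfolding complex_cnj_mult Bc by simp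
    also have "t * cnj t = of_real ((norm t)\<^sup>2)" by (rule complex_norm_square[symmetric])
    finally show ?thesis unfolding q(2) b(2) by simp
  qed
  have "q - 2 * Re (cnj t * B u v) + (norm t)\<^sup>2 * b \<ge> 0" for t
    using pdB[OF ann[of t]] unfolding expand[of t, symmetric] by auto
  from nonneg_quadratic_minimizer[OF this b(1)] obtain t
    where t: "t * of_real b = B u v" "q - 2 * Re (cnj t * B u v) + (norm t)\<^sup>2 * b \<le> q" .
  have Bv: "B w v = (\<Sum>z\<in>Z. w z * s z)" if w: "annihilates Z w (m - 1)" for w
  proof -
    have "(\<Sum>z\<in>Z. w z * s z) = (\<Sum>z\<in>Z. w z * p z) + (\<Sum>z\<in>Z. w z * (\<Sum>y\<in>X. a y * complex_of_real (h (z - y))))"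
      unfolding sx by (simp only: distrib_left sum.distrib)
    also have "(\<Sum>z\<in>Z. w z * p z) = 0" by (rule annihilatesD[OF w p])
    also have "(\<Sum>z\<in>Z. w z * (\<Sum>y\<in>X. a y * complex_of_real (h (z - y)))) = B w v"
      unfolding B_def
    proof (intro sum.cong refl)
      fix z
      have "(\<Sum>y\<in>X. a y * complex_of_real (h (z - y))) = (\<Sum>y\<in>Z. cnj (v y) * complex_of_real (h (z - y)))"
        using Z by (intro sum.mono_neutral_cong_left) (auto simp: v_def)
      then show "w z * (\<Sum>y\<in>X. a y * complex_of_real (h (z - y))) = (\<Sum>y\<in>Z. w z * cnj (v y) * complex_of_real (h (z - y)))"
        by (simp add: sum_distrib_left mult.assoc)
    qed
    finally show ?thesis by simp
  qed
  have "(\<Sum>z\<in>Z. (u z - t * v z) * f z) = (\<Sum>z\<in>Z. u z * f z) - t * (\<Sum>z\<in>Z. v z * f z)"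
    by (simp add: left_diff_distrib sum_subtractf sum_distrib_left mult.assoc)
  also have "(\<Sum>z\<in>Z. v z * f z) = (\<Sum>z\<in>Z. v z * s z)"
    by (intro sum.cong refl) (simp add: v_def sf)
  also have "\<dots> = of_real b" using Bv[OF v] b(2) by simp
  also have "t * of_real b = (\<Sum>z\<in>Z. u z * s z)" unfolding t(1) by (rule Bv[OF u])
  also have "(\<Sum>z\<in>Z. u z * f z) - \<dots> = (\<Sum>z\<in>Z. u z * (f z - s z))"
    by (simp add: right_diff_distrib sum_subtractf)
  finally have "norm (\<Sum>z\<in>Z. u z * (f z - s z)) = norm (\<Sum>z\<in>Z. (u z - t * v z) * f z)" by simp
  also have "\<dots> \<le> K * sqrt (Re (B (\<lambda>z. u z - t * v z) (\<lambda>z. u z - t * v z)))"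
    unfolding B_def by (rule native_bound_point_evaluations[OF f h nb m Z(1) ann])
  also have "\<dots> \<le> K * sqrt (Re (B u u))"
    unfolding expand q(2) Re_complex_of_real using t(2) K by (intro mult_left_mono real_sqrt_le_mono)
  finally show ?thesis unfolding B_def .
qed

lemma native_seminorm_bound:
  fixes h :: "real ^ 'n::finite \<Rightarrow> real"
  assumes f: "f \<in> native_space h m" and B: "B \<ge> 0"
    and le: "\<And>K. K \<ge> 0 \<Longrightarrow> native_bound h m f K \<Longrightarrow> e \<le> K * B"
  shows "e \<le> B * native_seminorm h m f"
proof (cases "B = 0")
  case True
  then show ?thesis using f le by (auto simp: native_space_def)
next
  case False
  with B have B: "B > 0" by simp
  have "e / B \<le> native_seminorm h m f"
    unfolding native_seminorm_def
  proof (rule cInf_greatest)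
    show "{K. 0 \<le> K \<and> native_bound h m f K} \<noteq> {}" using f by (auto simp: native_space_def)
    fix K assume "K \<in> {K. 0 \<le> K \<and> native_bound h m f K}"
    then show "e / B \<le> K" using le[of K] B by (simp add: pos_divide_le_eq)
  qed
  then show ?thesis using B by (simp add: pos_divide_le_eq mult.commute)
qed

section \<open>The numerical constants\<close>

lemma gamma_seq_Nats: "gamma_seq n \<in> \<nat>"
  by (induction n rule: gamma_seq.induct) (auto intro!: Nats_mult Nats_add)

lemma gamma_seq_ge:
  assumes "n \<ge> 2"
  shows "gamma_seq n \<ge> 6 * real n"
proof -
  have ge: "gamma_seq (Suc k) \<ge> 2" for k
  proof (induction k)
    case (Suc k)
    have "2 * 1 \<le> (2 * real (Suc (Suc k))) * (1 + gamma_seq (Suc k))" using Suc by (intro mult_mono) auto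
    then show ?case by simp
  qed simp
  obtain k where n: "n = Suc (Suc k)" using assms by (metis Suc_le_D numeral_2_eq_2 Suc_le_mono)
  have "2 * real n * 3 \<le> 2 * real n * (1 + gamma_seq (Suc k))" using ge[of k] by (intro mult_left_mono) auto
  then show ?thesis unfolding n gamma_seq.simps by simp
qed

lemma spline_rho_ge_1: "spline_rho n lam m \<ge> 1"
  by (auto simp: spline_rho_def spline_s0_def)

text \<open>In the second case of the definition there are at most \<open>a\<close> factors, each at most \<open>2 m + 2 = 2 a + 4\<close>; in the first
  the numerator is at least one.\<close>

lemma spline_Delta0_ge:
  assumes n: "n \<ge> 2"
  shows "spline_Delta0 n (2 * a) (a + 1) \<ge> 1 / (real (2 * a + 4) ^ a * spline_rho n (2 * a) (a + 1) ^ (2 * a + 4))"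
proof -
  let ?\<rho> = "spline_rho n (2 * a) (a + 1)"
  have \<rho>: "?\<rho> ^ (2 * a + 4) \<ge> 1" by (rule one_le_power[OF spline_rho_ge_1])
  have p: "real (2 * a + 4) ^ a \<ge> 1" by (rule one_le_power) simp
  consider "real n - real (2 * a) > 3" | "real n - real (2 * a) \<le> 1" | "real n - real (2 * a) > 1" "real n - real (2 * a) \<le> 3"
    by linarith
  then show ?thesis
  proof cases
    case 1
    have "(\<Prod>i \<in> {2 * int (a + 1) + 3 .. 2 * int (a + 1) + 2 + spline_s0 n (2 * a)}. real_of_int i) \<ge> 1"
      by (rule prod_ge_1) auto
    then have "1 / ?\<rho> ^ (2 * a + 4) \<le> (\<Prod>i \<in> {2 * int (a + 1) + 3 .. 2 * int (a + 1) + 2 + spline_s0 n (2 * a)}. real_of_int i) / ?\<rho> ^ (2 * a + 4)"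
      using \<rho> by (intro divide_right_mono) auto
    moreover have "2 * (a + 1) + 2 = 2 * a + 4" by simp
    ultimately have "1 / ?\<rho> ^ (2 * a + 4) \<le> spline_Delta0 n (2 * a) (a + 1)"
      unfolding spline_Delta0_def if_P[OF 1] by (simp only:)
    moreover have "1 / (real (2 * a + 4) ^ a * ?\<rho> ^ (2 * a + 4)) \<le> 1 / (1 * ?\<rho> ^ (2 * a + 4))"
      using p \<rho> by (intro divide_left_mono mult_right_mono mult_pos_pos) auto
    ultimately show ?thesis by simp
  next
    case 2
    define s where "s = spline_s0 n (2 * a)"
    have "real_of_int s = - real_of_int \<lceil>(real n - real (2 * a) - 3) / 2\<rceil>" using 2 by (simp add: s_def spline_s0_def)
    also have "\<dots> \<le> - ((real n - real (2 * a) - 3) / 2)" by (simp add: le_of_int_ceiling)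
    also have "\<dots> < real a + 1" using n by (simp add: field_simps)
    finally have s: "s \<le> int a" by linarith
    have "(\<Prod>i \<in> {2 * int (a + 1) - s + 3 .. 2 * int (a + 1) + 2}. real_of_int i) \<le> real (2 * a + 4) ^ a"
      using s by (intro prod_le_power) auto
    moreover have "(\<Prod>i \<in> {2 * int (a + 1) - s + 3 .. 2 * int (a + 1) + 2}. real_of_int i) > 0"
      using s by (intro prod_pos) auto
    ultimately have "1 / real (2 * a + 4) ^ a \<le> spline_Delta0 n (2 * a) (a + 1)"
      using 2 by (simp add: spline_Delta0_def s_def divide_left_mono)
    moreover have "?\<rho> = 1" using 2 by (simp add: spline_rho_def)
    ultimately show ?thesis by simp
  next
    case 3
    have "1 \<le> real (2 * a + 4) ^ a * ?\<rho> ^ (2 * a + 4)"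
      using mult_mono[OF p \<rho>] p by simp
    then have "1 / (real (2 * a + 4) ^ a * ?\<rho> ^ (2 * a + 4)) \<le> 1" by (simp only: divide_le_eq_1) auto
    moreover have "spline_Delta0 n (2 * a) (a + 1) = 1" using 3 by (simp add: spline_Delta0_def)
    ultimately show ?thesis by simp
  qed
qed

text \<open>Each of the four factors on the left is at most \<open>exp (n \<gamma> \<kappa>)\<close>, because \<open>\<gamma> \<ge> 6 n\<close>.\<close>

lemma exponential_absorbs_constants:
  fixes \<gamma> :: real
  assumes n: "n \<ge> 2" and N: "N \<le> n" and \<gamma>: "\<gamma> \<ge> 6 * real n" and \<kappa>: "\<kappa> \<ge> 1"
  shows "144 * (171 * real n) ^ \<kappa> * (2 * \<gamma> * real \<kappa>) ^ n * fact N \<le> (exp (2 * real n * \<gamma>))\<^sup>2 ^ \<kappa>"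
proof -
  define G where "G = real n * \<gamma>"
  have nn: "real n * real n \<ge> 2 * real n" using n by (intro mult_right_mono) auto
  have G: "G \<ge> 6 * (real n * real n)" unfolding G_def using mult_left_mono[OF \<gamma>, of "real n"] by simp
  then have Gn: "G \<ge> 12 * real n" using nn by linarith
  have n2: "real n \<ge> 2" using n by simp
  have G\<kappa>: "G \<le> G * real \<kappa>" using Gn \<kappa> by (simp add: mult_le_cancel_left1)
  have e2: "(2::real) ^ j \<le> exp (real j)" for j
  proof -
    have "(2::real) ^ j \<le> exp 1 ^ j" using exp_ge_add_one_self[of 1] by (intro power_mono) auto
    then show ?thesis by (simp add: exp_of_nat_mult[symmetric])
  qed
  have "(144::real) \<le> 2 ^ 8" by simp
  also have "\<dots> \<le> exp (real 8)" by (rule e2)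
  also have "real 8 \<le> G * real \<kappa>" using Gn G\<kappa> n2 by linarith
  finally have 1: "144 \<le> exp (G * real \<kappa>)" by simp
  have en: "real n \<le> exp (real n)" using exp_ge_add_one_self[of "real n"] by linarith
  then have "171 * real n \<le> 2 ^ 8 * exp (real n)" by (intro mult_mono) auto
  also have "\<dots> \<le> exp (real 8) * exp (real n)" by (intro mult_right_mono e2) simp
  also have "\<dots> = exp (8 + real n)" by (simp add: exp_add)
  also have "\<dots> \<le> exp G" using Gn n by simp
  finally have "(171 * real n) ^ \<kappa> \<le> exp G ^ \<kappa>" by (intro power_mono) auto
  also have "\<dots> = exp (G * real \<kappa>)" by (simp add: exp_of_nat_mult[symmetric] mult.commute)
  finally have 2: "(171 * real n) ^ \<kappa> \<le> exp (G * real \<kappa>)" .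
  have \<gamma>0: "\<gamma> \<ge> 0" using \<gamma> n by linarith
  have "2 * \<gamma> * real \<kappa> \<le> exp (\<gamma> * real \<kappa>)"
  proof -
    have "2 * x \<le> exp x" if "x \<ge> 0" for x :: real
      using exp_lower_Taylor_quadratic[OF that] zero_le_power2[of "x - 1"]
      by (simp add: power2_eq_square algebra_simps)
    from this[of "\<gamma> * real \<kappa>"] \<gamma>0 show ?thesis by (simp add: mult.assoc)
  qed
  then have "(2 * \<gamma> * real \<kappa>) ^ n \<le> exp (\<gamma> * real \<kappa>) ^ n" using \<gamma>0 by (intro power_mono) auto
  also have "\<dots> = exp (G * real \<kappa>)" by (simp add: exp_of_nat_mult[symmetric] G_def mult.assoc)
  finally have 3: "(2 * \<gamma> * real \<kappa>) ^ n \<le> exp (G * real \<kappa>)" .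
  have "fact N \<le> (fact n :: real)" using N by (rule fact_mono)
  also have "\<dots> \<le> real n ^ n" using fact_le_power[of n, where 'a = real] by (simp only: of_nat_power)
  also have "\<dots> \<le> exp (real n) ^ n" using en by (intro power_mono) auto
  also have "\<dots> = exp (real n * real n)" by (simp add: exp_of_nat_mult[symmetric])
  also have "\<dots> \<le> exp (G * real \<kappa>)" unfolding exp_le_cancel_iff using G G\<kappa> nn n2 by linarith
  finally have 4: "fact N \<le> exp (G * real \<kappa>)" .
  have "144 * (171 * real n) ^ \<kappa> * (2 * \<gamma> * real \<kappa>) ^ n * fact N
      \<le> exp (G * real \<kappa>) * exp (G * real \<kappa>) * exp (G * real \<kappa>) * exp (G * real \<kappa>)"
    using \<gamma>0 by (intro mult_mono 1 2 3 4) auto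
  also have "\<dots> = exp (4 * (G * real \<kappa>))" by (simp add: exp_add[symmetric])
  also have "\<dots> = (exp (2 * real n * \<gamma>))\<^sup>2 ^ \<kappa>"
    by (simp add: exp_of_nat_mult[symmetric] power_mult[symmetric] G_def)
  finally show ?thesis .
qed

text \<open>The powers of \<open>c\<close> agree on both sides. The power \<open>\<rho>\<^sup>-\<^sup>2\<^sup>\<kappa>\<close> from \<open>D\<close> pays for the power of \<open>\<rho>\<close> in \<open>\<Delta>\<close>, since
  \<open>\<kappa> \<ge> a + 2\<close>, and \<open>(\<kappa> - a - 1)! / \<kappa>\<^sup>\<kappa>\<close> pays for \<open>(2 a + 4)\<^sup>-\<^sup>a\<close>. Everything else is bounded by the factor
  \<open>exp (- 4 n \<gamma> \<kappa>)\<close> contained in \<open>D\<^sup>2\<^sup>\<kappa>\<close>.\<close>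

lemma error_constant_bound:
  fixes \<gamma> \<rho> c A D V \<Delta> T :: real
  assumes n: "n \<ge> 2" and N: "N \<le> n" and c: "c > 0" and \<kappa>: "\<kappa> \<ge> a + 2"
    and \<gamma>: "\<gamma> \<ge> 6 * real n" and \<rho>: "\<rho> \<ge> 1"
    and A: "0 \<le> A" "A \<le> 8 * (16 / 3 * sqrt (real n)) ^ (\<kappa> - 1) * sqrt ((2 * \<gamma> * real \<kappa>) ^ n)"
    and D: "0 \<le> D" "D \<le> c / (3 * \<rho> * exp (2 * real n * \<gamma>))"
    and \<Delta>: "\<Delta> \<ge> 1 / (real (2 * a + 4) ^ a * \<rho> ^ (2 * a + 4))"
    and V: "V \<ge> fact a / fact N" and T: "T \<le> real \<kappa> + 1"
  shows "fact a * A\<^sup>2 * (4 * exp 1 * D\<^sup>2) ^ \<kappa> / real \<kappa> ^ \<kappa> * (fact (\<kappa> - a - 1) / (c\<^sup>2) ^ (\<kappa> - a))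
    \<le> V * c ^ (2 * a) * \<Delta> * ((2 / 3) powr T)\<^sup>2"
proof -
  define E where "E = (exp (2 * real n * \<gamma>))\<^sup>2"
  have E: "E > 0" by (simp add: E_def)
  define q where "q = 2 * \<gamma> * real \<kappa>"
  have q: "q \<ge> 0" using \<gamma> n by (simp add: q_def)
  have A2: "A\<^sup>2 \<le> 64 * (256 / 9 * real n) ^ \<kappa> * q ^ n"
  proof -
    have "A\<^sup>2 \<le> (8 * (16 / 3 * sqrt (real n)) ^ (\<kappa> - 1) * sqrt (q ^ n))\<^sup>2"
      using A unfolding q_def by (intro power_mono)
    also have "\<dots> = 64 * ((16 / 3 * sqrt (real n))\<^sup>2) ^ (\<kappa> - 1) * q ^ n"
      using q unfolding power_mult_distrib[of 8] power_mult_distrib[of "8 * _"]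
      by (simp add: power_mult[symmetric] mult.commute)
    also have "(16 / 3 * sqrt (real n))\<^sup>2 = 256 / 9 * real n" by (simp add: power2_eq_square)
    also have "64 * (256 / 9 * real n) ^ (\<kappa> - 1) * q ^ n \<le> 64 * (256 / 9 * real n) ^ \<kappa> * q ^ n"
      using n q by (intro mult_right_mono mult_left_mono power_increasing) auto
    finally show ?thesis .
  qed
  have D2: "(4 * exp 1 * D\<^sup>2) ^ \<kappa> / (c\<^sup>2) ^ (\<kappa> - a) \<le> (4 / 3) ^ \<kappa> * (1 / \<rho> ^ (2 * a + 4)) / E ^ \<kappa> * c ^ (2 * a)"
  proof -
    have "D\<^sup>2 \<le> (c / (3 * \<rho> * exp (2 * real n * \<gamma>)))\<^sup>2" using D by (intro power_mono)
    also have "\<dots> = c\<^sup>2 / (9 * \<rho>\<^sup>2 * E)" by (simp add: power_divide power_mult_distrib E_def)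
    finally have "4 * exp 1 * D\<^sup>2 \<le> (4 * 3) * (c\<^sup>2 / (9 * \<rho>\<^sup>2 * E))" using exp_le by (intro mult_mono) auto
    also have "\<dots> = (4 / 3) * (1 / \<rho>\<^sup>2) / E * c\<^sup>2" by simp
    finally have "(4 * exp 1 * D\<^sup>2) ^ \<kappa> \<le> ((4 / 3) * (1 / \<rho>\<^sup>2) / E * c\<^sup>2) ^ \<kappa>" by (rule power_mono) simp
    also have "\<dots> = (4 / 3) ^ \<kappa> * (1 / \<rho>\<^sup>2) ^ \<kappa> / E ^ \<kappa> * (c\<^sup>2) ^ \<kappa>"
      unfolding power_mult_distrib power_divide ..
    also have "(c\<^sup>2) ^ \<kappa> = c ^ (2 * a) * (c\<^sup>2) ^ (\<kappa> - a)"
      unfolding power_mult power_add[symmetric] using \<kappa> by simp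
    finally have "(4 * exp 1 * D\<^sup>2) ^ \<kappa> / (c\<^sup>2) ^ (\<kappa> - a) \<le> (4 / 3) ^ \<kappa> * (1 / \<rho>\<^sup>2) ^ \<kappa> / E ^ \<kappa> * c ^ (2 * a)"
      using c by (simp add: pos_divide_le_eq)
    also have "\<dots> \<le> (4 / 3) ^ \<kappa> * (1 / \<rho> ^ (2 * a + 4)) / E ^ \<kappa> * c ^ (2 * a)"
    proof -
      have "\<rho> ^ (2 * a + 4) \<le> \<rho> ^ (2 * \<kappa>)" using \<rho> \<kappa> by (intro power_increasing) auto
      then have "1 / \<rho> ^ (2 * \<kappa>) \<le> 1 / \<rho> ^ (2 * a + 4)" using \<rho> by (intro divide_left_mono mult_pos_pos zero_less_power) auto
      moreover have "(1 / \<rho>\<^sup>2) ^ \<kappa> = 1 / \<rho> ^ (2 * \<kappa>)" by (simp add: power_divide power_mult)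
      ultimately show ?thesis using E c by (intro mult_right_mono divide_right_mono mult_left_mono) auto
    qed
    finally show ?thesis .
  qed
  have F: "fact (\<kappa> - a - 1) / real \<kappa> ^ \<kappa> \<le> 2 ^ \<kappa> / real (2 * a + 4) ^ a"
  proof -
    have \<kappa>0: "real \<kappa> \<ge> 1" using \<kappa> by simp
    have "(fact (\<kappa> - a - 1) :: real) \<le> real ((\<kappa> - a - 1) ^ (\<kappa> - a - 1))" by (rule fact_le_power)
    also have "\<dots> = real (\<kappa> - a - 1) ^ (\<kappa> - a - 1)" by (rule of_nat_power)
    also have "\<dots> \<le> real \<kappa> ^ (\<kappa> - a - 1)" by (rule power_mono) simp_all
    also have "\<dots> \<le> real \<kappa> ^ (\<kappa> - a)" using \<kappa>0 by (intro power_increasing) auto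
    finally have "fact (\<kappa> - a - 1) * real \<kappa> ^ a \<le> real \<kappa> ^ (\<kappa> - a) * real \<kappa> ^ a" by (rule mult_right_mono) simp
    also have "\<dots> = real \<kappa> ^ \<kappa>" unfolding power_add[symmetric] using \<kappa> by simp
    finally have "fact (\<kappa> - a - 1) / real \<kappa> ^ \<kappa> \<le> 1 / real \<kappa> ^ a" using \<kappa>0 by (simp add: field_simps)
    also have "\<dots> \<le> 1 / (real (2 * a + 4) / 2) ^ a"
      using \<kappa> by (intro divide_left_mono power_mono mult_pos_pos zero_less_power) auto
    also have "\<dots> = 2 ^ a / real (2 * a + 4) ^ a" by (simp only: power_divide divide_divide_eq_right mult_1)
    also have "\<dots> \<le> 2 ^ \<kappa> / real (2 * a + 4) ^ a" using \<kappa> by (intro divide_right_mono power_increasing) auto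
    finally show ?thesis .
  qed
  have core: "64 * ((4 / 9) ^ \<kappa> * (512 / 3 * real n) ^ \<kappa>) * q ^ n / E ^ \<kappa> \<le> (1 / fact N) * (4 / 9) ^ (\<kappa> + 1)"
  proof -
    have "(512 / 3 * real n) ^ \<kappa> \<le> (171 * real n) ^ \<kappa>" by (intro power_mono mult_right_mono) auto
    then have "144 * (512 / 3 * real n) ^ \<kappa> * q ^ n * fact N \<le> 144 * (171 * real n) ^ \<kappa> * q ^ n * fact N"
      using q by (intro mult_right_mono mult_left_mono) auto
    also have "\<dots> \<le> E ^ \<kappa>" unfolding E_def q_def using exponential_absorbs_constants[OF n N \<gamma>] \<kappa> by simp
    finally have "144 * (512 / 3 * real n) ^ \<kappa> * q ^ n * fact N / (fact N * E ^ \<kappa>) \<le> E ^ \<kappa> / (fact N * E ^ \<kappa>)"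
      using E by (intro divide_right_mono) auto
    then have "144 * (512 / 3 * real n) ^ \<kappa> * q ^ n / E ^ \<kappa> \<le> 1 / fact N" using E by simp
    then have "144 * (512 / 3 * real n) ^ \<kappa> * q ^ n / E ^ \<kappa> * (4 / 9) ^ (\<kappa> + 1) \<le> (1 / fact N) * (4 / 9) ^ (\<kappa> + 1)"
      by (rule mult_right_mono) simp
    then show ?thesis by (simp add: mult.commute mult.left_commute)
  qed
  have "fact a * A\<^sup>2 * (4 * exp 1 * D\<^sup>2) ^ \<kappa> / real \<kappa> ^ \<kappa> * (fact (\<kappa> - a - 1) / (c\<^sup>2) ^ (\<kappa> - a))
      = fact a * A\<^sup>2 * ((4 * exp 1 * D\<^sup>2) ^ \<kappa> / (c\<^sup>2) ^ (\<kappa> - a)) * (fact (\<kappa> - a - 1) / real \<kappa> ^ \<kappa>)"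
    by simp
  also have "\<dots> \<le> fact a * (64 * (256 / 9 * real n) ^ \<kappa> * q ^ n) * ((4 / 3) ^ \<kappa> * (1 / \<rho> ^ (2 * a + 4)) / E ^ \<kappa> * c ^ (2 * a)) * (2 ^ \<kappa> / real (2 * a + 4) ^ a)"
    using c q E \<rho> by (intro mult_mono A2 D2 F) auto
  also have "\<dots> = fact a * c ^ (2 * a) * (1 / (real (2 * a + 4) ^ a * \<rho> ^ (2 * a + 4)))
      * (64 * ((256 / 9 * real n) ^ \<kappa> * (4 / 3) ^ \<kappa> * 2 ^ \<kappa>) * q ^ n / E ^ \<kappa>)"
    by (simp add: mult.commute mult.left_commute)
  also have "(256 / 9 * real n) ^ \<kappa> * (4 / 3) ^ \<kappa> * 2 ^ \<kappa> = (4 / 9) ^ \<kappa> * (512 / 3 * real n) ^ \<kappa>"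
    unfolding power_mult_distrib[symmetric] by simp
  also have "fact a * c ^ (2 * a) * (1 / (real (2 * a + 4) ^ a * \<rho> ^ (2 * a + 4))) * (64 * ((4 / 9) ^ \<kappa> * (512 / 3 * real n) ^ \<kappa>) * q ^ n / E ^ \<kappa>)
      \<le> fact a * c ^ (2 * a) * (1 / (real (2 * a + 4) ^ a * \<rho> ^ (2 * a + 4))) * ((1 / fact N) * (4 / 9) ^ (\<kappa> + 1))"
    using c \<rho> by (intro mult_left_mono core) auto
  also have "fact a * c ^ (2 * a) * (1 / (real (2 * a + 4) ^ a * \<rho> ^ (2 * a + 4))) * ((1 / fact N) * (4 / 9) ^ (\<kappa> + 1))
      = (fact a / fact N) * c ^ (2 * a) * (1 / (real (2 * a + 4) ^ a * \<rho> ^ (2 * a + 4))) * (4 / 9) ^ (\<kappa> + 1)"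
    by simp
  also have "\<dots> \<le> V * c ^ (2 * a) * \<Delta> * ((2 / 3) powr T)\<^sup>2"
  proof -
    have "(2 / 3 :: real) ^ (\<kappa> + 1) = (2 / 3) powr (real \<kappa> + 1)" by (subst powr_realpow[symmetric]) (simp_all add: add.commute)
    also have "\<dots> \<le> (2 / 3) powr T" using T by (intro powr_mono') auto
    finally have "((2 / 3 :: real) ^ (\<kappa> + 1))\<^sup>2 \<le> ((2 / 3) powr T)\<^sup>2" by (rule power_mono) simp
    also have "((2 / 3 :: real) ^ (\<kappa> + 1))\<^sup>2 = ((2 / 3)\<^sup>2) ^ (\<kappa> + 1)" by (simp only: power_mult[symmetric] mult.commute)
    finally have T2: "(4 / 9) ^ (\<kappa> + 1) \<le> ((2 / 3) powr T)\<^sup>2" by (simp add: power2_eq_square)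
    have "(0::real) \<le> fact a / fact N" by simp
    then have V0: "0 \<le> V" using V by linarith
    have R0: "0 \<le> 1 / (real (2 * a + 4) ^ a * \<rho> ^ (2 * a + 4))" using \<rho> by simp
    then have \<Delta>0: "0 \<le> \<Delta>" using \<Delta> by linarith
    show ?thesis using V0 R0 \<Delta>0 c by (intro mult_mono V \<Delta> T2 order_refl mult_nonneg_nonneg) auto
  qed
  finally show ?thesis .
qed

section \<open>The error estimate\<close>

lemma shifted_surface_spline_continuous:
  assumes "c > 0"
  shows "continuous_on UNIV (shifted_surface_spline lam c :: real ^ 'n::finite \<Rightarrow> real)"
proof -
  have p: "(norm x)\<^sup>2 + c\<^sup>2 > 0" for x :: "real ^ 'n" using assms by (simp add: add_nonneg_pos)
  then have ne: "(norm x)\<^sup>2 + c\<^sup>2 \<noteq> 0" for x :: "real ^ 'n" by (metis less_irrefl)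
  show ?thesis
    unfolding shifted_surface_spline_def[abs_def]
    by (intro continuous_intros) (use p ne in auto)
qed

text \<open>The optimality of the spline, applied to evaluation at \<open>x\<close> minus the reproducing functional.\<close>

lemma spline_error_of_reproduction:
  fixes f s :: "real ^ 'n::finite \<Rightarrow> complex" and \<sigma> :: "real ^ 'n \<Rightarrow> real" and h :: "real ^ 'n \<Rightarrow> real"
  assumes h_def: "h = shifted_surface_spline (2 * a) c" and a: "a \<ge> 1" and c: "c > 0" and f: "continuous_on UNIV f"
    and nb: "native_bound h (a + 1) f K" and K: "K \<ge> 0"
    and s: "is_h_spline_interpolant h (a + 1) X f s"
    and \<kappa>: "\<kappa> \<ge> a + 1" and Y: "Y \<subseteq> X"
    and repr: "\<And>\<alpha>. multi_degree \<alpha> \<le> \<kappa> - 1 \<Longrightarrow> (\<Sum>y\<in>Y. \<sigma> y * monomial \<alpha> y) = monomial \<alpha> x"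
    and A: "(\<Sum>y\<in>Y. \<bar>\<sigma> y\<bar>) \<le> A" and D: "D > 0" "\<And>y. y \<in> Y \<Longrightarrow> norm (y - x) \<le> D"
  shows "norm (f x - s x)
    \<le> K * sqrt (fact a * A\<^sup>2 * (4 * exp 1 * D\<^sup>2) ^ \<kappa> / real \<kappa> ^ \<kappa> * (fact (\<kappa> - a - 1) / (c\<^sup>2) ^ (\<kappa> - a)))"
proof -
  have X: "finite X" and sf: "\<And>y. y \<in> X \<Longrightarrow> s y = f y" using s by (auto simp: is_h_spline_interpolant_def)
  define Z where "Z = insert x X"
  have Z: "finite Z" "X \<subseteq> Z" "Y \<subseteq> Z" "x \<in> Z" using X Y by (auto simp: Z_def)
  define u where "u z = (if z = x then 1 else 0) - complex_of_real (if z \<in> Y then \<sigma> z else 0)" for z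
  have sum_u: "(\<Sum>z\<in>Z. u z * g z) = g x - (\<Sum>y\<in>Y. of_real (\<sigma> y) * g y)" for g
  proof -
    have "(\<Sum>z\<in>Z. u z * g z) = (\<Sum>z\<in>Z. (if z = x then g z else 0)) - (\<Sum>z\<in>Z. (if z \<in> Y then of_real (\<sigma> z) * g z else 0))"
      unfolding sum_subtractf[symmetric] by (intro sum.cong refl) (simp add: u_def left_diff_distrib)
    also have "(\<Sum>z\<in>Z. (if z = x then g z else 0)) = g x" using Z by simp
    also have "(\<Sum>z\<in>Z. (if z \<in> Y then of_real (\<sigma> z) * g z else 0)) = (\<Sum>y\<in>Y. of_real (\<sigma> y) * g y)"
      using Z by (intro sum.mono_neutral_cong_right) auto
    finally show ?thesis .
  qed
  have u: "annihilates Z u (\<kappa> - 1)"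
  proof (rule annihilatesI)
    fix \<alpha> :: "'n \<Rightarrow> nat" assume "multi_degree \<alpha> \<le> \<kappa> - 1"
    from repr[OF this] have "(\<Sum>y\<in>Y. complex_of_real (\<sigma> y) * of_real (monomial \<alpha> y)) = of_real (monomial \<alpha> x)"
      unfolding of_real_mult[symmetric] of_real_sum[symmetric] by simp
    then show "(\<Sum>z\<in>Z. u z * complex_of_real (monomial \<alpha> z)) = 0" unfolding sum_u by simp
  qed
  have u': "annihilates Z u (a + 1 - 1)"
    unfolding annihilates_def
  proof
    fix q :: "real ^ 'n \<Rightarrow> complex" assume "q \<in> poly_space (a + 1 - 1)"
    then have "q \<in> poly_space (\<kappa> - 1)" by (rule poly_space_mono) (use \<kappa> in simp)
    then show "(\<Sum>z\<in>Z. u z * q z) = 0" by (rule annihilatesD[OF u])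
  qed
  have Du: "norm (z - x) \<le> D" if "z \<in> Z" "u z \<noteq> 0" for z
    using that D by (cases "z = x"; cases "z \<in> Y") (auto simp: u_def)
  obtain Q where Q: "0 \<le> Q"
    "Q \<le> fact a * (\<Sum>z\<in>Z - {x}. norm (u z))\<^sup>2 * (4 * exp 1 * D\<^sup>2) ^ \<kappa> / real \<kappa> ^ \<kappa> * (fact (\<kappa> - a - 1) / (c\<^sup>2) ^ (\<kappa> - a))"
    "(\<Sum>z\<in>Z. \<Sum>w\<in>Z. u z * cnj (u w) * of_real (h (z - w))) = of_real Q"
    using surface_spline_form[OF Z(1) a c u \<kappa> D(1), of x] Du unfolding h_def by blast
  have "(\<Sum>z\<in>Z - {x}. norm (u z)) = (\<Sum>z\<in>Z - {x}. (if z \<in> Y then \<bar>\<sigma> z\<bar> else 0))"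
    by (intro sum.cong refl) (simp add: u_def)
  also have "\<dots> \<le> (\<Sum>z\<in>Z. (if z \<in> Y then \<bar>\<sigma> z\<bar> else 0))"
    using Z by (intro sum_mono2) auto
  also have "\<dots> = (\<Sum>y\<in>Y. \<bar>\<sigma> y\<bar>)" using Z by (intro sum.mono_neutral_cong_right) auto
  finally have "(\<Sum>z\<in>Z - {x}. norm (u z)) \<le> A" using A by simp
  then have "(\<Sum>z\<in>Z - {x}. norm (u z))\<^sup>2 \<le> A\<^sup>2" by (intro power_mono sum_nonneg) auto
  then have "fact a * (\<Sum>z\<in>Z - {x}. norm (u z))\<^sup>2 * (4 * exp 1 * D\<^sup>2) ^ \<kappa> / real \<kappa> ^ \<kappa> * (fact (\<kappa> - a - 1) / (c\<^sup>2) ^ (\<kappa> - a))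
      \<le> fact a * A\<^sup>2 * (4 * exp 1 * D\<^sup>2) ^ \<kappa> / real \<kappa> ^ \<kappa> * (fact (\<kappa> - a - 1) / (c\<^sup>2) ^ (\<kappa> - a))"
    by (intro mult_right_mono divide_right_mono mult_left_mono) auto
  with Q(2) have QA: "Q \<le> fact a * A\<^sup>2 * (4 * exp 1 * D\<^sup>2) ^ \<kappa> / real \<kappa> ^ \<kappa> * (fact (\<kappa> - a - 1) / (c\<^sup>2) ^ (\<kappa> - a))"
    by (rule order.trans)
  have "f x - s x = (\<Sum>z\<in>Z. u z * (f z - s z))"
    unfolding sum_u using Y sf by (simp add: subset_iff)
  also have "norm \<dots> \<le> K * sqrt (Re (\<Sum>z\<in>Z. \<Sum>w\<in>Z. u z * cnj (u w) * of_real (h (z - w))))"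
  proof (rule spline_error_functional_bound[OF f _ _ _ nb K _ s Z(1,2) u'])
    show "continuous_on UNIV h" unfolding h_def using c by (rule shifted_surface_spline_continuous)
    show "h (- x) = h x" for x by (simp add: h_def shifted_surface_spline_def)
    show "\<exists>Q\<ge>0. (\<Sum>z\<in>Z. \<Sum>w\<in>Z. v z * cnj (v w) * complex_of_real (h (z - w))) = of_real Q"
      if "finite Z" "annihilates Z v (a + 1 - 1)" for Z v
      using surface_spline_form_nonneg[OF that(1) a c, of v] that(2) unfolding h_def by auto
  qed simp
  also have "\<dots> \<le> K * sqrt (fact a * A\<^sup>2 * (4 * exp 1 * D\<^sup>2) ^ \<kappa> / real \<kappa> ^ \<kappa> * (fact (\<kappa> - a - 1) / (c\<^sup>2) ^ (\<kappa> - a)))"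
    unfolding Q(3) Re_complex_of_real using K QA by (intro mult_left_mono real_sqrt_le_mono)
  finally show ?thesis .
qed

lemma spline_const_ge:
  assumes "N \<ge> 1" and n: "CARD('n) = 2 * N"
  shows "fact a / fact N \<le> spline_const N a * (real (2 * N) * measure lborel (ball (0 :: real ^ 'n::finite) 1))"
proof -
  have pi: "1 \<le> pi" using pi_ge_two by simp
  then have pi1: "1 \<le> pi ^ N" by (rule one_le_power)
  have "measure lborel (ball (0 :: real ^ 'n) 1) = pi ^ N / fact N"
    using unit_ball_vol_even[of N] by (simp add: content_ball n)
  moreover have "fact a * 1 * 1 * (1 * (1 / fact N)) \<le> fact a * pi ^ N * 2 ^ (a + N) * (real (2 * N) * (pi ^ N / fact N))"
    using assms pi pi1 by (intro mult_mono divide_right_mono one_le_power order_refl) auto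
  ultimately show ?thesis by (simp add: spline_const_def)
qed

theorem theorem2p4:
  fixes h :: "real ^ 'n::finite \<Rightarrow> real"
    and n m lam :: nat
    and c b\<^sub>0 \<rho>' C \<delta>\<^sub>0 \<omega> \<alpha>\<^sub>n \<gamma>\<^sub>n :: real
  assumes n_def: "n = CARD('n)"
    and "n \<ge> 2" and "even n"
    and "lam > 0" and "even lam"
    and "c > 0"
    and m_def: "m = 1 + lam div 2"
    and h_def: "h = shifted_surface_spline lam c"
    and \<alpha>_def: "\<alpha>\<^sub>n = measure lborel (ball (0 :: real ^ 'n) 1)"
    and \<gamma>_def: "\<gamma>\<^sub>n = gamma_seq n"
    and "b\<^sub>0 > 0"
    and \<rho>'_def: "\<rho>' = spline_rho n lam m / c"
    and C_def: "C = max (2 * \<rho>' * sqrt (real n) * exp (2 * real n * \<gamma>\<^sub>n)) (2 / (3 * b\<^sub>0))"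
    and \<delta>\<^sub>0_def: "\<delta>\<^sub>0 = 1 / (3 * C * \<gamma>\<^sub>n * (real m + 1))"
    and \<omega>_def: "\<omega> = (2 / 3) powr (1 / (3 * C * \<gamma>\<^sub>n))"
  shows "\<delta>\<^sub>0 > 0 \<and> 0 < \<omega> \<and> \<omega> < 1 \<and>
    (\<forall>f s X U a b \<delta> E.
       f \<in> native_space h m \<and>
       is_h_spline_interpolant h m X f s \<and>
       orthogonal_transformation U \<and> E = cube U a b \<and> b \<ge> b\<^sub>0 \<and>
       0 < \<delta> \<and> \<delta> \<le> \<delta>\<^sub>0 \<and>
       (\<forall>a'. cube U a' \<delta> \<subseteq> E \<longrightarrow> cube U a' \<delta> \<inter> X \<noteq> {})
       \<longrightarrow> (\<forall>x\<in>E. norm (f x - s x) \<le>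
              sqrt (surface_spline_l TYPE('n) lam) * (pi / 2) powr (1 / 4) * sqrt (real n * \<alpha>\<^sub>n)
              * c powr (real lam / 2) * sqrt (spline_Delta0 n lam m)
              * \<omega> powr (1 / \<delta>) * native_seminorm h m f))"
proof -
  obtain N where N: "n = 2 * N" using \<open>even n\<close> by blast
  obtain l where lam: "lam = 2 * l" using \<open>even lam\<close> by blast
  have N1: "N \<ge> 1" using \<open>n \<ge> 2\<close> N by simp
  have l1: "l \<ge> 1" using \<open>lam > 0\<close> lam by simp
  have m: "m = l + 1" using m_def lam by simp
  have c: "c > 0" by fact
  have \<gamma>6: "\<gamma>\<^sub>n \<ge> 6 * real n" unfolding \<gamma>_def using \<open>n \<ge> 2\<close> by (rule gamma_seq_ge)
  then have \<gamma>0: "\<gamma>\<^sub>n > 0" using \<open>n \<ge> 2\<close> by linarith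
  obtain g where g: "\<gamma>\<^sub>n = real g" using gamma_seq_Nats[of n] unfolding \<gamma>_def by (auto elim: Nats_cases)
  define \<rho> where "\<rho> = spline_rho n lam m"
  have \<rho>: "\<rho> \<ge> 1" unfolding \<rho>_def by (rule spline_rho_ge_1)
  have C1: "2 * (\<rho> / c) * sqrt (real n) * exp (2 * real n * \<gamma>\<^sub>n) \<le> C" and C2: "2 / (3 * b\<^sub>0) \<le> C"
    by (simp_all add: C_def \<rho>'_def \<rho>_def)
  have "2 / (3 * b\<^sub>0) > 0" using \<open>b\<^sub>0 > 0\<close> by simp
  then have C: "C > 0" using C2 by linarith
  have \<delta>\<^sub>0: "\<delta>\<^sub>0 > 0" using C \<gamma>0 by (simp add: \<delta>\<^sub>0_def)
  have "1 / (3 * C * \<gamma>\<^sub>n) > 0" using C \<gamma>0 by simp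
  then have "(2 / 3 :: real) powr (1 / (3 * C * \<gamma>\<^sub>n)) < 1"
    using powr_less_mono'[of "2 / 3" 0 "1 / (3 * C * \<gamma>\<^sub>n)"] by simp
  then have \<omega>: "0 < \<omega>" "\<omega> < 1" by (simp_all add: \<omega>_def)
  have main: "norm (f x - s x) \<le>
      sqrt (surface_spline_l TYPE('n) lam) * (pi / 2) powr (1 / 4) * sqrt (real n * \<alpha>\<^sub>n)
      * c powr (real lam / 2) * sqrt (spline_Delta0 n lam m) * \<omega> powr (1 / \<delta>) * native_seminorm h m f"
    if f: "f \<in> native_space h m" and s: "is_h_spline_interpolant h m X f s"
      and U: "orthogonal_transformation U" and b: "b \<ge> b\<^sub>0" and \<delta>: "0 < \<delta>" "\<delta> \<le> \<delta>\<^sub>0"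
      and hit: "\<And>a'. cube U a' \<delta> \<subseteq> cube U a b \<Longrightarrow> cube U a' \<delta> \<inter> X \<noteq> {}" and x: "x \<in> cube U a b"
    for f s :: "real ^ 'n \<Rightarrow> complex" and X U a b \<delta> x
  proof -
    \<comment> \<open>With this exponent \<open>\<omega>\<close> to the power \<open>1 / \<delta>\<close> is \<open>(2/3)\<close> to the power \<open>T\<close>, and \<open>\<delta> \<le> \<delta>\<^sub>0\<close> means \<open>T \<ge> m + 1\<close>.\<close>
    define T where "T = 1 / (3 * C * \<gamma>\<^sub>n * \<delta>)"
    have "3 * C * \<gamma>\<^sub>n * \<delta> \<le> 3 * C * \<gamma>\<^sub>n * \<delta>\<^sub>0" using \<delta> C \<gamma>0 by (intro mult_left_mono) auto
    also have "\<dots> = 1 / (real m + 1)" using C \<gamma>0 by (simp add: \<delta>\<^sub>0_def)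
    finally have "1 / (1 / (real m + 1)) \<le> T" unfolding T_def using C \<gamma>0 \<delta> by (intro divide_left_mono) auto
    then have T: "real m + 1 \<le> T" by simp
    define \<kappa> where "\<kappa> = nat \<lfloor>T\<rfloor>"
    have \<kappa>T: "real \<kappa> \<le> T" "T \<le> real \<kappa> + 1" using T by (simp_all add: \<kappa>_def)
    have \<kappa>: "\<kappa> \<ge> l + 2" using T m unfolding \<kappa>_def by linarith
    \<comment> \<open>The number of cells along an edge of the local cube; its side \<open>q \<delta>\<close> is at most \<open>2 / (3 C) \<le> b\<^sub>0\<close>, so it fits into
       the given cube.\<close>
    define q where "q = 2 * g * \<kappa>"
    have q: "real q = 2 * \<gamma>\<^sub>n * real \<kappa>" by (simp add: q_def g)
    have "real q > 0" unfolding q using \<gamma>0 \<kappa> by simp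
    then have q0: "q > 0" by simp
    have "real q * \<delta> \<le> 2 * \<gamma>\<^sub>n * T * \<delta>" unfolding q using \<kappa>T \<gamma>0 \<delta> by (intro mult_right_mono mult_left_mono) auto
    also have "\<dots> = 2 / (3 * C)" using C \<gamma>0 \<delta> by (simp add: T_def)
    finally have side: "real q * \<delta> \<le> 2 / (3 * C)" .
    also have "2 / (3 * C) \<le> b\<^sub>0" using C2 C \<open>b\<^sub>0 > 0\<close> by (simp add: field_simps)
    finally have "real q * \<delta> \<le> b" using b by simp
    with \<delta> obtain a' where a': "cube U a' (real q * \<delta>) \<subseteq> cube U a b" "x \<in> cube U a' (real q * \<delta>)"
      using subcube_containing[OF U _ _ x, of "real q * \<delta>"] by auto
    have fine: "sqrt (real CARD('n)) * (real (\<kappa> - 1) + 1) \<le> 59 / 1000 * real q"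
    proof -
      \<comment> \<open>The claim amounts to \<open>sqrt n \<le> 0.118 \<gamma>\<^sub>n\<close>, which follows from \<open>\<gamma>\<^sub>n \<ge> 6 n\<close> and \<open>sqrt n \<ge> 1.413\<close>.\<close>
      have "sqrt 2 \<le> sqrt (real n)" using \<open>n \<ge> 2\<close> by simp
      moreover have "1413 / 1000 \<le> sqrt 2" by (rule real_le_rsqrt) (simp add: power2_eq_square)
      ultimately have "1413 / 1000 \<le> sqrt (real n)" by linarith
      then have "1413 / 1000 * sqrt (real n) \<le> sqrt (real n) * sqrt (real n)" by (intro mult_right_mono) auto
      then have "sqrt (real n) \<le> 59 / 500 * \<gamma>\<^sub>n" using \<gamma>6 by simp
      then have "sqrt (real n) * real \<kappa> \<le> 59 / 500 * \<gamma>\<^sub>n * real \<kappa>" by (rule mult_right_mono) simp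
      moreover have "real (\<kappa> - 1) + 1 = real \<kappa>" using \<kappa> by simp
      ultimately show ?thesis unfolding q n_def[symmetric] by simp
    qed
    have \<kappa>1: "\<kappa> - 1 \<ge> 1" using \<kappa> by simp
    have "\<exists>Y \<sigma>. Y \<subseteq> X \<and> (\<forall>\<alpha>. multi_degree \<alpha> \<le> \<kappa> - 1 \<longrightarrow> (\<Sum>y\<in>Y. \<sigma> y * monomial \<alpha> y) = monomial \<alpha> x)
      \<and> (\<Sum>y\<in>Y. \<bar>\<sigma> y\<bar>) \<le> 8 * (16 / 3 * sqrt (real CARD('n))) ^ (\<kappa> - 1) * sqrt (real q ^ CARD('n))
      \<and> (\<forall>y\<in>Y. norm (y - x) \<le> sqrt (real CARD('n)) * (real q * \<delta>))"
    proof (rule local_polynomial_reproduction[OF U \<delta>(1) q0 \<kappa>1 fine _ a'(2)])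
      show "cube U v \<delta> \<inter> X \<noteq> {}" if "cube U v \<delta> \<subseteq> cube U a' (real q * \<delta>)" for v
        by (rule hit[OF order.trans[OF that a'(1)]])
    qed blast
    then obtain Y \<sigma> where Y: "Y \<subseteq> X"
      "\<And>\<alpha>. multi_degree \<alpha> \<le> \<kappa> - 1 \<Longrightarrow> (\<Sum>y\<in>Y. \<sigma> y * monomial \<alpha> y) = monomial \<alpha> x"
      "(\<Sum>y\<in>Y. \<bar>\<sigma> y\<bar>) \<le> 8 * (16 / 3 * sqrt (real CARD('n))) ^ (\<kappa> - 1) * sqrt (real q ^ CARD('n))"
      "\<And>y. y \<in> Y \<Longrightarrow> norm (y - x) \<le> sqrt (real CARD('n)) * (real q * \<delta>)"
      by blast
    define A where "A = 8 * (16 / 3 * sqrt (real n)) ^ (\<kappa> - 1) * sqrt (real q ^ n)"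
    define D where "D = sqrt (real n) * (real q * \<delta>)"
    have A: "0 \<le> A" by (simp add: A_def)
    have D: "D > 0" using \<open>n \<ge> 2\<close> \<open>real q > 0\<close> \<delta> by (simp add: D_def)
    \<comment> \<open>Here the first argument of the maximum defining \<open>C\<close> is used.\<close>
    have D2: "D \<le> c / (3 * \<rho> * exp (2 * real n * \<gamma>\<^sub>n))"
    proof -
      have "D \<le> sqrt (real n) * (2 / (3 * C))" unfolding D_def by (intro mult_left_mono side) simp
      also have "\<dots> \<le> sqrt (real n) * (2 / (3 * (2 * (\<rho> / c) * sqrt (real n) * exp (2 * real n * \<gamma>\<^sub>n))))"
        using C C1 \<rho> c \<open>n \<ge> 2\<close> by (intro mult_left_mono divide_left_mono mult_pos_pos) auto
      also have "\<dots> = c / (3 * \<rho> * exp (2 * real n * \<gamma>\<^sub>n))"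
        using \<rho> c \<open>n \<ge> 2\<close> by simp
      finally show ?thesis .
    qed
    define V where "V = surface_spline_l TYPE('n) lam * (real n * \<alpha>\<^sub>n)"
    have sl: "surface_spline_l TYPE('n) lam = spline_const N l"
      using surface_spline_l_eq[where 'n = 'n, of N lam l] N lam l1 n_def by simp
    have V: "V \<ge> fact l / fact N"
      unfolding V_def sl \<alpha>_def N using spline_const_ge[where 'n = 'n, OF N1] N n_def by simp
    define W where "W = (2 / 3 :: real) powr T"
    have W: "W = \<omega> powr (1 / \<delta>)" by (simp add: W_def \<omega>_def T_def powr_powr)
    have \<Delta>: "spline_Delta0 n lam m \<ge> 1 / (real (2 * l + 4) ^ l * \<rho> ^ (2 * l + 4))"
      unfolding \<rho>_def lam m using \<open>n \<ge> 2\<close> by (rule spline_Delta0_ge)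
    have "0 \<le> 1 / (real (2 * l + 4) ^ l * \<rho> ^ (2 * l + 4))" using \<rho> by simp
    then have \<Delta>0: "0 \<le> spline_Delta0 n lam m" using \<Delta> by linarith
    define B where "B = sqrt (surface_spline_l TYPE('n) lam) * (pi / 2) powr (1 / 4) * sqrt (real n * \<alpha>\<^sub>n)
      * c powr (real lam / 2) * sqrt (spline_Delta0 n lam m) * \<omega> powr (1 / \<delta>)"
    have cl: "c powr (real lam / 2) = c ^ l" using c lam by (simp add: powr_realpow)
    have B: "sqrt (V * c ^ (2 * l) * spline_Delta0 n lam m * W\<^sup>2) \<le> B"
    proof -
      have "sqrt (c ^ (2 * l)) = c ^ l" using c by (simp add: real_sqrt_power power_mult real_sqrt_abs)
      then have "sqrt (V * c ^ (2 * l) * spline_Delta0 n lam m * W\<^sup>2)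
          = sqrt (surface_spline_l TYPE('n) lam) * 1 * sqrt (real n * \<alpha>\<^sub>n) * c ^ l * sqrt (spline_Delta0 n lam m) * W"
        unfolding V_def real_sqrt_mult by (simp add: W_def)
      also have "\<dots> \<le> B"
        unfolding B_def cl W
      proof (intro mult_right_mono mult_left_mono)
        show "1 \<le> (pi / 2) powr (1 / 4)" using pi_ge_two by (intro ge_one_powr_ge_zero) auto
        show "0 \<le> sqrt (spline_Delta0 n lam m)" using \<Delta>0 by simp
        show "0 \<le> sqrt (surface_spline_l TYPE('n) lam)" unfolding sl by (simp add: spline_const_def)
      qed (use c in \<open>simp_all add: \<alpha>_def\<close>)
      finally show ?thesis .
    qed
    have "norm (f x - s x) \<le> K * B" if K: "K \<ge> 0" "native_bound h m f K" for K
    proof -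
      have "norm (f x - s x)
          \<le> K * sqrt (fact l * A\<^sup>2 * (4 * exp 1 * D\<^sup>2) ^ \<kappa> / real \<kappa> ^ \<kappa> * (fact (\<kappa> - l - 1) / (c\<^sup>2) ^ (\<kappa> - l)))"
      proof (rule spline_error_of_reproduction[OF refl l1 c, where X = X and Y = Y and \<sigma> = \<sigma>])
        show "continuous_on UNIV f" using f by (simp add: native_space_def)
        show "native_bound (shifted_surface_spline (2 * l) c) (l + 1) f K" using K(2) unfolding h_def lam m .
        show "is_h_spline_interpolant (shifted_surface_spline (2 * l) c) (l + 1) X f s" using s unfolding h_def lam m .
        show "(\<Sum>y\<in>Y. \<bar>\<sigma> y\<bar>) \<le> A" using Y(3) unfolding A_def n_def .
        show "norm (y - x) \<le> D" if "y \<in> Y" for y using Y(4)[OF that] unfolding D_def n_def .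
      qed (use K \<kappa> Y(1,2) D in auto)
      also have "\<dots> \<le> K * sqrt (V * c ^ (2 * l) * spline_Delta0 n lam m * W\<^sup>2)"
        unfolding W_def
        by (intro mult_left_mono real_sqrt_le_mono error_constant_bound[OF \<open>n \<ge> 2\<close> _ c \<kappa> \<gamma>6 \<rho> A _ _ D2 \<Delta> V \<kappa>T(2)] K)
          (use N D in \<open>auto simp: A_def q\<close>)
      also have "\<dots> \<le> K * B" by (intro mult_left_mono B K)
      finally show ?thesis .
    qed
    moreover have "0 \<le> sqrt (V * c ^ (2 * l) * spline_Delta0 n lam m * W\<^sup>2)"
    proof -
      have "0 \<le> (fact l / fact N :: real)" by simp
      then have "0 \<le> V" using V by linarith
      then show ?thesis using c \<Delta>0 by simp
    qed
    then have "B \<ge> 0" using B by linarith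
    ultimately show ?thesis
      using native_seminorm_bound[OF f, of B "norm (f x - s x)"] unfolding B_def by blast
  qed
  show ?thesis using \<delta>\<^sub>0 \<omega> main by blast
qed

end
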